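(* Let $(S,D)$ be a stable decorated surface of genus $g(S)\ge 3$ and let $\gamma$ be a curve system on $(S,D)$. Let $M^\gamma_\bullet$ be the relative weight filtration of $\mathfrak{g}_{S,D}$ associated to $\gamma$. Then the normalizer of $M^\gamma_0\mathfrak{g}_{S,D}$ in $\mathfrak{g}_{S,D}$ is $M^\gamma_0\mathfrak{g}_{S,D}$; that is, $\{X\in\mathfrak{g}_{S,D} : [X,M^\gamma_0\mathfrak{g}_{S,D}]\subseteq M^\gamma_0\mathfrak{g}_{S,D}\}=M^\gamma_0\mathfrak{g}_{S,D}$.
   Context: Decorated surfaces. $S$ is a compact connected oriented surface (without boundary) and $D=P\cup V$, where $P$ is a finite set of points of $S$ and $V$ is a finite set of non-zero tangent vectors of $S$; the points of $P$ and the anchor points of the elements of $V$ are all distinct. $S'_D$ is $S$ with all points of $P$ and all anchor points of elements of $V$ removed. $(S,D)$ is stable if $\chi(S'_D)<0$. $\Gamma_{S,D}=\pi_0\mathrm{Diff}^+(S,D)$ is the group of connected components of the group of orientation preserving diffeomorphisms of $S$ fixing each element of $D$. Put $H=H_1(S;\mathbb{Q})$ and let $\mathrm{Sp}(H)$ be the algebraic group over $\mathbb{Q}$ of automorphisms of $H$ preserving the intersection form. Relative completion. $\mathcal{G}_{S,D}$ is the completion over $\mathbb{Q}$ of $\Gamma_{S,D}$ relative to the natural Zariski dense homomorphism $\rho:\Gamma_{S,D}\to\mathrm{Sp}(H)$: a proalgebraic $\mathbb{Q}$-group that is an extension $1\to\mathcal{U}_{S,D}\to\mathcal{G}_{S,D}\to\mathrm{Sp}(H)\to1$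 with $\mathcal{U}_{S,D}$ prounipotent, with a homomorphism $\widehat\rho:\Gamma_{S,D}\to\mathcal{G}_{S,D}$ lifting $\rho$, universal among homomorphisms lifting $\rho$ from $\Gamma_{S,D}$ to proalgebraic extensions of $\mathrm{Sp}(H)$ by prounipotent groups. $\mathfrak{g}_{S,D}$, $\mathfrak{u}_{S,D}$ are the Lie algebras of $\mathcal{G}_{S,D}$, $\mathcal{U}_{S,D}$. Weight filtration. $\mathfrak{g}_{S,D}$ has a natural weight filtration $W_\bullet$ (Hain) with $W_0\mathfrak{g}_{S,D}=\mathfrak{g}_{S,D}$, $W_{-1}\mathfrak{g}_{S,D}=\mathfrak{u}_{S,D}$ and, when $g(S)\ge3$, $W_{-m}\mathfrak{g}_{S,D}=L^m\mathfrak{u}_{S,D}$ for $m\ge1$, the $m$th term of the (closed) lower central series ($L^1\mathfrak{u}=\mathfrak{u}$). Curve systems. A curve system on $(S,D)$ is a finite set $\gamma=\{c_0,\dots,c_r\}$ of disjoint simple closed curves in $S'_D$ such that no two $c_j$ are isotopic in $S'_D$ and no $c_j$ bounds a disk or once-punctured disk in $S'_D$. Let $\tau_j$ be the Dehn twist about $c_j$. Then $\widehat\rho(\tau_j)$ lies in a prounipotent subgroup and $N_j\in\mathfrak{g}_{S,D}$ denotes its canonical logarithm. Let $C^o(\gamma)=\{\sum_j r_jN_j: r_j\in\mathbb{Q},\ r_j>0\}$. Relative weight filtration. If $N$ is a nilpotent endomorphism of a vector space $V$ with an increasing filtration $W_\bullet$ preserved by $N$, a relative weight filtration of $N$ is an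 increasing filtration $M_\bullet$ of $V$ such that $NM_k\subseteq M_{k-2}$ for all $k$ and, for each $m$, the filtration induced by $M_\bullet$ on $\mathrm{Gr}^W_mV$ satisfies: $N^k:\mathrm{Gr}^M_{m+k}\mathrm{Gr}^W_mV\to\mathrm{Gr}^M_{m-k}\mathrm{Gr}^W_mV$ is an isomorphism for all $k\ge0$. It is unique if it exists; the notion extends to inverse limits. It is a known theorem (Hain–Matsumoto, Hain–Pearlstein) that for each $N\in C^o(\gamma)$ the relative weight filtration of $\mathrm{ad}(N)$ on $(\mathfrak{g}_{S,D},W_\bullet)$ exists, is compatible with the bracket, and depends only on $\gamma$; it is denoted $M^\gamma_\bullet$. *)

theory Defs
  imports
    "HOL-Analysis.Analysis"
    "HOL-Homology.Homology"
    "HOL-Combinatorics.Permutations"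
    "HOL-Library.Function_Algebras"
    "Jordan_Normal_Form.Matrix"
begin

section \<open>Smooth maps between open subsets of Euclidean spaces\<close>

primrec iter_deriv ::
  "'e::euclidean_space list \<Rightarrow> ('e \<Rightarrow> 'f::real_normed_vector) \<Rightarrow> 'e \<Rightarrow> 'f" where
  "iter_deriv [] h = h"
| "iter_deriv (b # bs) h = (\<lambda>x. frechet_derivative (iter_deriv bs h) (at x) b)"

text \<open>Meant for open \<open>\<Omega>\<close>: all iterated partial derivatives exist and are differentiable.\<close>

definition smooth_on :: "'e::euclidean_space set \<Rightarrow> ('e \<Rightarrow> 'f::real_normed_vector) \<Rightarrow> bool" where
  "smooth_on \<Omega> h \<longleftrightarrow>
     (\<forall>bs \<in> lists Basis. \<forall>x \<in> \<Omega>. iter_deriv bs h differentiable (at x))"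

text \<open>The plane is modelled by the type \<^typ>\<open>complex\<close>, with its standard orientation.\<close>

definition det2 :: "complex \<Rightarrow> complex \<Rightarrow> real" where
  "det2 v w = Re v * Im w - Im v * Re w"

definition jacobian_det :: "(complex \<Rightarrow> complex) \<Rightarrow> complex \<Rightarrow> real" where
  "jacobian_det h z =
     det2 (frechet_derivative h (at z) 1) (frechet_derivative h (at z) \<i>)"


section \<open>Compact connected oriented smooth surfaces\<close>

text \<open>A chart is a pair of its domain and its coordinate map. Coordinate maps are total functions;
  their values outside the domain are irrelevant. The atlas need not be maximal, and it determines
  both the smooth structure and the orientation.\<close>

type_synonym 'a chart = "'a set \<times> ('a \<Rightarrow> complex)"

record 'a surface =
  stop :: "'a topology"
  charts :: "'a chart set"

abbreviation points :: "'a surface \<Rightarrow> 'a set" where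
  "points S \<equiv> topspace (stop S)"

definition is_chart :: "'a topology \<Rightarrow> 'a chart \<Rightarrow> bool" where
  "is_chart X c \<longleftrightarrow> openin X (fst c) \<and> open (snd c ` fst c) \<and>
     homeomorphic_map (subtopology X (fst c)) (top_of_set (snd c ` fst c)) (snd c)"

definition local_rep :: "'a chart \<Rightarrow> 'a chart \<Rightarrow> ('a \<Rightarrow> 'a) \<Rightarrow> complex \<Rightarrow> complex" where
  "local_rep c d f = snd d \<circ> f \<circ> inv_into (fst c) (snd c)"

definition oriented_surface :: "'a surface \<Rightarrow> bool" where
  "oriented_surface S \<longleftrightarrow>
     points S \<noteq> {} \<and> connected_space (stop S) \<and> compact_space (stop S) \<and> Hausdorff_space (stop S) \<and>
     (\<forall>c \<in> charts S. is_chart (stop S) c) \<and> (\<Union>c \<in> charts S. fst c) = points S \<and>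
     (\<forall>c \<in> charts S. \<forall>d \<in> charts S.
        smooth_on (snd c ` (fst c \<inter> fst d)) (local_rep c d id) \<and>
        (\<forall>z \<in> snd c ` (fst c \<inter> fst d). jacobian_det (local_rep c d id) z > 0))"

definition smooth_self_map :: "'a surface \<Rightarrow> ('a \<Rightarrow> 'a) \<Rightarrow> bool" where
  "smooth_self_map S f \<longleftrightarrow> continuous_map (stop S) (stop S) f \<and>
     (\<forall>c \<in> charts S. \<forall>d \<in> charts S.
        smooth_on (snd c ` (fst c \<inter> f -` fst d)) (local_rep c d f))"

definition smooth_into :: "'a surface \<Rightarrow> 'e::euclidean_space set \<Rightarrow> ('e \<Rightarrow> 'a) \<Rightarrow> bool" where
  "smooth_into S \<Omega> F \<longleftrightarrow> continuous_map (top_of_set \<Omega>) (stop S) F \<and>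
     (\<forall>c \<in> charts S. smooth_on (\<Omega> \<inter> F -` fst c) (snd c \<circ> F))"

text \<open>A tangent vector is an anchor point together with a coordinate vector for each chart around
  it, subject to the usual transformation rule; charts not containing the anchor get \<open>0\<close>.\<close>

type_synonym 'a tangent = "'a \<times> ('a chart \<Rightarrow> complex)"

definition tangent_vector :: "'a surface \<Rightarrow> 'a tangent \<Rightarrow> bool" where
  "tangent_vector S v \<longleftrightarrow> fst v \<in> points S \<and>
     (\<forall>c. \<not> (c \<in> charts S \<and> fst v \<in> fst c) \<longrightarrow> snd v c = 0) \<and>
     (\<forall>c \<in> charts S. \<forall>d \<in> charts S. fst v \<in> fst c \<inter> fst d \<longrightarrow>
        snd v d = frechet_derivative (local_rep c d id) (at (snd c (fst v))) (snd v c))"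

definition nonzero_tangent :: "'a surface \<Rightarrow> 'a tangent \<Rightarrow> bool" where
  "nonzero_tangent S v \<longleftrightarrow> tangent_vector S v \<and> (\<exists>c \<in> charts S. snd v c \<noteq> 0)"

definition decorated_surface :: "'a surface \<Rightarrow> 'a set \<Rightarrow> 'a tangent set \<Rightarrow> bool" where
  "decorated_surface S P V \<longleftrightarrow> oriented_surface S \<and>
     finite P \<and> P \<subseteq> points S \<and> finite V \<and> (\<forall>v \<in> V. nonzero_tangent S v) \<and>
     inj_on fst V \<and> P \<inter> fst ` V = {}"

definition punctured :: "'a surface \<Rightarrow> 'a set \<Rightarrow> 'a tangent set \<Rightarrow> 'a set" where
  "punctured S P V = points S - (P \<union> fst ` V)"


section \<open>Rational homology, genus and Euler characteristic\<close>

text \<open>\<open>rationalization A n \<kappa>\<close>: the homomorphism \<open>\<kappa>\<close> from the abelian group \<open>A\<close> to the rational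
  vectors of length \<open>n\<close> induces an isomorphism after tensoring \<open>A\<close> with the rationals. Thus such a
  \<open>\<kappa>\<close> for \<open>H\<^sub>1(S)\<close> is a choice of basis of \<open>H\<^sub>1(S; Q)\<close>.\<close>

definition rationalization :: "('b, 'm) monoid_scheme \<Rightarrow> nat \<Rightarrow> ('b \<Rightarrow> rat vec) \<Rightarrow> bool" where
  "rationalization A n \<kappa> \<longleftrightarrow>
     (\<forall>x \<in> carrier A. \<kappa> x \<in> carrier_vec n) \<and>
     (\<forall>x \<in> carrier A. \<forall>y \<in> carrier A. \<kappa> (x \<otimes>\<^bsub>A\<^esub> y) = \<kappa> x + \<kappa> y) \<and>
     (\<forall>x \<in> carrier A. \<kappa> x = 0\<^sub>v n \<longleftrightarrow> (\<exists>k::nat. 0 < k \<and> x [^]\<^bsub>A\<^esub> k = \<one>\<^bsub>A\<^esub>)) \<and>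
     (\<forall>v \<in> carrier_vec n. \<exists>x \<in> carrier A. \<exists>k::nat. 0 < k \<and> of_nat k \<cdot>\<^sub>v v = \<kappa> x)"

definition betti :: "nat \<Rightarrow> 'a topology \<Rightarrow> nat" where
  "betti p X = (THE n. \<exists>\<kappa>. rationalization (homology_group (int p) X) n \<kappa>)"

text \<open>Only used for surfaces, whose homology vanishes above degree 2.\<close>

definition euler_char :: "'a topology \<Rightarrow> int" where
  "euler_char X = (\<Sum>p\<le>2. (- 1) ^ p * int (betti p X))"

definition genus :: "'a surface \<Rightarrow> nat" where
  "genus S = betti 1 (stop S) div 2"

definition stable_decoration :: "'a surface \<Rightarrow> 'a set \<Rightarrow> 'a tangent set \<Rightarrow> bool" where
  "stable_decoration S P V \<longleftrightarrow> euler_char (subtopology (stop S) (punctured S P V)) < 0"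


section \<open>Loops and the intersection form\<close>

definition smooth_loop :: "'a surface \<Rightarrow> (real \<Rightarrow> 'a) \<Rightarrow> bool" where
  "smooth_loop S a \<longleftrightarrow> smooth_into S UNIV a \<and> (\<forall>s. a (s + 1) = a s)"

definition embedded_loop :: "'a surface \<Rightarrow> (real \<Rightarrow> 'a) \<Rightarrow> bool" where
  "embedded_loop S a \<longleftrightarrow> smooth_loop S a \<and> inj_on a {0..<1} \<and>
     (\<forall>s. \<forall>c \<in> charts S. a s \<in> fst c \<longrightarrow> vector_derivative (snd c \<circ> a) (at s) \<noteq> 0)"

definition loop_class :: "'a surface \<Rightarrow> (real \<Rightarrow> 'a) \<Rightarrow> 'a chain set" where
  "loop_class S a = homologous_rel_set 1 (stop S) {}
     (frag_of (restrict (\<lambda>x. a (x 1)) (standard_simplex 1)))"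

text \<open>The determinant of the two velocities at a crossing \<open>a s = b t\<close>. Its sign does not depend on
  the chart chosen, since the atlas is oriented.\<close>

definition crossing_det :: "'a surface \<Rightarrow> (real \<Rightarrow> 'a) \<Rightarrow> (real \<Rightarrow> 'a) \<Rightarrow> real \<Rightarrow> real \<Rightarrow> real" where
  "crossing_det S a b s t =
     (let c = (SOME c. c \<in> charts S \<and> a s \<in> fst c) in
        det2 (vector_derivative (snd c \<circ> a) (at s)) (vector_derivative (snd c \<circ> b) (at t)))"

definition crossings :: "(real \<Rightarrow> 'a) \<Rightarrow> (real \<Rightarrow> 'a) \<Rightarrow> (real \<times> real) set" where
  "crossings a b = {(s, t). s \<in> {0..<1} \<and> t \<in> {0..<1} \<and> a s = b t}"

definition transverse :: "'a surface \<Rightarrow> (real \<Rightarrow> 'a) \<Rightarrow> (real \<Rightarrow> 'a) \<Rightarrow> bool" where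
  "transverse S a b \<longleftrightarrow> (\<forall>(s, t) \<in> crossings a b. crossing_det S a b s t \<noteq> 0)"

definition intersection_number :: "'a surface \<Rightarrow> (real \<Rightarrow> 'a) \<Rightarrow> (real \<Rightarrow> 'a) \<Rightarrow> int" where
  "intersection_number S a b =
     (\<Sum>(s, t) \<in> crossings a b. if crossing_det S a b s t > 0 then 1 else - 1)"

text \<open>\<open>J\<close> is the Gram matrix, in the basis \<open>\<kappa>\<close>, of the intersection form: the symplectic (that is,
  skew-symmetric and, by Poincare duality, nondegenerate) form on \<open>H\<^sub>1(S; Q)\<close> whose value on the
  classes of two transverse loops is their signed number of crossings. Every class in \<open>H\<^sub>1(S)\<close> is
  represented by a loop, and any two loops can be made transverse, so \<open>J\<close> is determined by \<open>\<kappa>\<close>.\<close>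

definition intersection_matrix ::
  "'a surface \<Rightarrow> nat \<Rightarrow> ('a chain set \<Rightarrow> rat vec) \<Rightarrow> rat mat \<Rightarrow> bool" where
  "intersection_matrix S n \<kappa> J \<longleftrightarrow> J \<in> carrier_mat n n \<and>
     transpose_mat J = - J \<and> invertible_mat J \<and>
     (\<forall>a b. smooth_loop S a \<and> smooth_loop S b \<and> transverse S a b \<longrightarrow>
        scalar_prod (\<kappa> (loop_class S a)) (mult_mat_vec J (\<kappa> (loop_class S b)))
          = of_int (intersection_number S a b))"

definition homology_basis ::
  "'a surface \<Rightarrow> nat \<Rightarrow> ('a chain set \<Rightarrow> rat vec) \<Rightarrow> rat mat \<Rightarrow> bool" where
  "homology_basis S n \<kappa> J \<longleftrightarrow>
     rationalization (homology_group 1 (stop S)) n \<kappa> \<and> intersection_matrix S n \<kappa> J"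


section \<open>Mapping class groups\<close>

text \<open>Diffeomorphisms are extended by the identity to all of the ambient type.\<close>

definition diffeos :: "'a surface \<Rightarrow> 'a set \<Rightarrow> 'a tangent set \<Rightarrow> ('a \<Rightarrow> 'a) set" where
  "diffeos S P V = {f. f permutes points S \<and> smooth_self_map S f \<and> smooth_self_map S (inv_into UNIV f) \<and>
     (\<forall>c \<in> charts S. \<forall>d \<in> charts S. \<forall>z \<in> snd c ` (fst c \<inter> f -` fst d).
        jacobian_det (local_rep c d f) z > 0) \<and>
     (\<forall>p \<in> P. f p = p) \<and>
     (\<forall>v \<in> V. f (fst v) = fst v \<and>
        (\<forall>c \<in> charts S. fst v \<in> fst c \<longrightarrow>
           frechet_derivative (local_rep c c f) (at (snd c (fst v))) (snd v c) = snd v c))}"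

text \<open>The subbasic neighbourhoods of \<open>f\<close> in the \<open>C\<^sup>\<infinity>\<close> topology: maps whose partial derivatives of
  order at most \<open>r\<close> in the charts \<open>c\<close>, \<open>d\<close> are \<open>\<epsilon>\<close>-close to those of \<open>f\<close> on the compact set \<open>K\<close>.\<close>

definition smooth_nbhd ::
  "'a chart \<Rightarrow> 'a chart \<Rightarrow> 'a set \<Rightarrow> nat \<Rightarrow> real \<Rightarrow> ('a \<Rightarrow> 'a) \<Rightarrow> ('a \<Rightarrow> 'a) set" where
  "smooth_nbhd c d K r \<epsilon> f = {g. g ` K \<subseteq> fst d \<and>
     (\<forall>bs \<in> lists Basis. length bs \<le> r \<longrightarrow> (\<forall>z \<in> snd c ` K.
        norm (iter_deriv bs (local_rep c d g) z - iter_deriv bs (local_rep c d f) z) < \<epsilon>))}"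

definition diffeo_topology ::
  "'a surface \<Rightarrow> 'a set \<Rightarrow> 'a tangent set \<Rightarrow> ('a \<Rightarrow> 'a) topology" where
  "diffeo_topology S P V = topology_generated_by
     {smooth_nbhd c d K r \<epsilon> f \<inter> diffeos S P V | c d K r \<epsilon> f.
        c \<in> charts S \<and> d \<in> charts S \<and> compactin (stop S) K \<and> K \<subseteq> fst c \<and>
        f \<in> diffeos S P V \<and> f ` K \<subseteq> fst d \<and> \<epsilon> > 0}"

text \<open>The product of two components is their elementwise product, as for cosets of the identity
  component.\<close>

definition mapping_class_group ::
  "'a surface \<Rightarrow> 'a set \<Rightarrow> 'a tangent set \<Rightarrow> ('a \<Rightarrow> 'a) set monoid" where
  "mapping_class_group S P V =
     \<lparr>carrier = connected_components_of (diffeo_topology S P V),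
      monoid.mult = (\<lambda>A B. {f \<circ> g | f g. f \<in> A \<and> g \<in> B}),
      one = connected_component_of_set (diffeo_topology S P V) id\<rparr>"

text \<open>The matrix of the action of a mapping class on \<open>H\<^sub>1(S; Q)\<close> in the basis \<open>\<kappa>\<close>.\<close>

definition homology_rep ::
  "'a surface \<Rightarrow> nat \<Rightarrow> ('a chain set \<Rightarrow> rat vec) \<Rightarrow> ('a \<Rightarrow> 'a) set \<Rightarrow> rat mat" where
  "homology_rep S n \<kappa> A = (THE R. R \<in> carrier_mat n n \<and>
     (\<forall>f \<in> A. \<forall>x \<in> carrier (homology_group 1 (stop S)).
        \<kappa> (hom_induced 1 (stop S) {} (stop S) {} f x) = mult_mat_vec R (\<kappa> x)))"


section \<open>Curve systems and Dehn twists\<close>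

definition simple_closed_curve ::
  "'a surface \<Rightarrow> 'a set \<Rightarrow> 'a tangent set \<Rightarrow> 'a set \<Rightarrow> bool" where
  "simple_closed_curve S P V c \<longleftrightarrow> c \<subseteq> punctured S P V \<and> (\<exists>a. embedded_loop S a \<and> range a = c)"

definition isotopic_curves ::
  "'a surface \<Rightarrow> 'a set \<Rightarrow> 'a tangent set \<Rightarrow> 'a set \<Rightarrow> 'a set \<Rightarrow> bool" where
  "isotopic_curves S P V c d \<longleftrightarrow> (\<exists>F :: real \<times> real \<Rightarrow> 'a.
     smooth_into S UNIV F \<and>
     (\<forall>t \<in> {0..1}. embedded_loop S (\<lambda>s. F (s, t)) \<and> range (\<lambda>s. F (s, t)) \<subseteq> punctured S P V) \<and>
     range (\<lambda>s. F (s, 0)) = c \<and> range (\<lambda>s. F (s, 1)) = d)"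

definition bounds_disk_or_punctured_disk ::
  "'a surface \<Rightarrow> 'a set \<Rightarrow> 'a tangent set \<Rightarrow> 'a set \<Rightarrow> bool" where
  "bounds_disk_or_punctured_disk S P V c \<longleftrightarrow> (\<exists>e :: complex \<Rightarrow> 'a.
     embedding_map (top_of_set (cball 0 1)) (stop S) e \<and> e ` sphere 0 1 = c \<and>
     card (e ` cball 0 1 \<inter> (P \<union> fst ` V)) \<le> 1)"

definition curve_system ::
  "'a surface \<Rightarrow> 'a set \<Rightarrow> 'a tangent set \<Rightarrow> 'a set set \<Rightarrow> bool" where
  "curve_system S P V \<gamma> \<longleftrightarrow> finite \<gamma> \<and> \<gamma> \<noteq> {} \<and>
     (\<forall>c \<in> \<gamma>. simple_closed_curve S P V c \<and> \<not> bounds_disk_or_punctured_disk S P V c) \<and>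
     (\<forall>c \<in> \<gamma>. \<forall>d \<in> \<gamma>. c \<noteq> d \<longrightarrow> c \<inter> d = {} \<and> \<not> isotopic_curves S P V c d)"

text \<open>A Dehn twist about \<open>c\<close>: supported in an annulus around \<open>c\<close> parametrised, preserving
  orientation, by \<open>{z. 1 < cmod z < 2}\<close>, it rotates the circle of radius \<open>r\<close> by the angle
  \<open>2 \<pi> \<beta>(r)\<close>, where \<open>\<beta>\<close> is 0 near the inner boundary and 1 near the outer one.\<close>

definition open_annulus :: "complex set" where
  "open_annulus = {z. 1 < cmod z \<and> cmod z < 2}"

definition dehn_twist ::
  "'a surface \<Rightarrow> 'a set \<Rightarrow> 'a tangent set \<Rightarrow> 'a set \<Rightarrow> ('a \<Rightarrow> 'a) \<Rightarrow> bool" where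
  "dehn_twist S P V c f \<longleftrightarrow> (\<exists>e (\<beta> :: real \<Rightarrow> real) \<delta>.
     smooth_into S open_annulus e \<and> inj_on e open_annulus \<and>
     (\<forall>d \<in> charts S. \<forall>z \<in> open_annulus \<inter> e -` fst d. jacobian_det (snd d \<circ> e) z > 0) \<and>
     e ` open_annulus \<subseteq> punctured S P V \<and> e ` sphere 0 (3/2) = c \<and>
     0 < \<delta> \<and> \<delta> < 1/2 \<and> smooth_on UNIV \<beta> \<and>
     (\<forall>r \<le> 1 + \<delta>. \<beta> r = 0) \<and> (\<forall>r \<ge> 2 - \<delta>. \<beta> r = 1) \<and>
     (\<forall>z \<in> open_annulus. f (e z) = e (z * cis (2 * pi * \<beta> (cmod z)))) \<and>
     (\<forall>x. x \<notin> e ` open_annulus \<longrightarrow> f x = x))"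

definition dehn_twist_class ::
  "'a surface \<Rightarrow> 'a set \<Rightarrow> 'a tangent set \<Rightarrow> 'a set \<Rightarrow> ('a \<Rightarrow> 'a) set \<Rightarrow> bool" where
  "dehn_twist_class S P V c \<tau> \<longleftrightarrow>
     \<tau> \<in> carrier (mapping_class_group S P V) \<and> (\<exists>f \<in> \<tau>. dehn_twist S P V c f)"


section \<open>Proalgebraic groups over the rationals\<close>

text \<open>A proalgebraic group over the rationals is given by its group of complex points together with
  its coordinate ring, a ring of complex valued functions on the group which is an algebra over the
  rationals (not over the complex numbers) and a Hopf algebra under the dual of the group structure.
  The points are recovered from the coordinate ring as its ring homomorphisms to the complex
  numbers. As commutative Hopf algebras in characteristic 0 are reduced, and are unions of finitely
  generated Hopf subalgebras, every proalgebraic group over the rationals arises in this way.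
  Coordinate functions are normalised to be 0 outside the group.\<close>

record 'g qgroup = "'g monoid" +
  regular :: "('g \<Rightarrow> complex) set"

definition zero_outside :: "'b set \<Rightarrow> ('b \<Rightarrow> 'c::zero) \<Rightarrow> 'b \<Rightarrow> 'c" where
  "zero_outside C f = (\<lambda>x. if x \<in> C then f x else 0)"

text \<open>The first \<open>n\<close> members of \<open>u\<close> and \<open>v\<close> give the tensor \<open>\<Sum>i<n. u i \<otimes> v i\<close> that is the
  coproduct of \<open>f\<close>.\<close>

definition coproduct ::
  "'g qgroup \<Rightarrow> ('g \<Rightarrow> complex) \<Rightarrow> nat \<Rightarrow> (nat \<Rightarrow> 'g \<Rightarrow> complex) \<Rightarrow> (nat \<Rightarrow> 'g \<Rightarrow> complex) \<Rightarrow> bool" where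
  "coproduct G f n u v \<longleftrightarrow> (\<forall>i<n. u i \<in> regular G \<and> v i \<in> regular G) \<and>
     (\<forall>x \<in> carrier G. \<forall>y \<in> carrier G. f (x \<otimes>\<^bsub>G\<^esub> y) = (\<Sum>i<n. u i x * v i y))"

definition proalgebraic :: "'g qgroup \<Rightarrow> bool" where
  "proalgebraic G \<longleftrightarrow> group G \<and>
     (\<forall>f \<in> regular G. zero_outside (carrier G) f = f) \<and>
     (\<forall>q :: rat. zero_outside (carrier G) (\<lambda>x. of_rat q) \<in> regular G) \<and>
     (\<forall>f \<in> regular G. \<forall>g \<in> regular G. f + g \<in> regular G \<and> f * g \<in> regular G) \<and>
     (\<forall>f \<in> regular G. f \<one>\<^bsub>G\<^esub> \<in> \<rat>) \<and>
     (\<forall>f \<in> regular G. zero_outside (carrier G) (\<lambda>x. f (inv\<^bsub>G\<^esub> x)) \<in> regular G) \<and>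
     (\<forall>f \<in> regular G. \<exists>n u v. coproduct G f n u v) \<and>
     (\<forall>e :: ('g \<Rightarrow> complex) \<Rightarrow> complex.
        e (zero_outside (carrier G) (\<lambda>x. 1)) = 1 \<and>
        (\<forall>f \<in> regular G. \<forall>g \<in> regular G. e (f + g) = e f + e g \<and> e (f * g) = e f * e g)
        \<longrightarrow> (\<exists>!x. x \<in> carrier G \<and> (\<forall>f \<in> regular G. e f = f x)))"

definition rational_points :: "'g qgroup \<Rightarrow> 'g set" where
  "rational_points G = {x \<in> carrier G. \<forall>f \<in> regular G. f x \<in> \<rat>}"

definition proalgebraic_hom :: "'g qgroup \<Rightarrow> 'h qgroup \<Rightarrow> ('g \<Rightarrow> 'h) set" where
  "proalgebraic_hom G H =
     {\<phi> \<in> hom G H. \<forall>f \<in> regular H. zero_outside (carrier G) (f \<circ> \<phi>) \<in> regular G}"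

definition closed_subgroup :: "'g qgroup \<Rightarrow> 'g set \<Rightarrow> 'g qgroup" where
  "closed_subgroup G U = G\<lparr>carrier := U, regular := zero_outside U ` regular G\<rparr>"

text \<open>\<open>x\<close> is unipotent if right translation by \<open>x\<close> on the coordinate ring is locally unipotent;
  the sum is \<open>(R\<^sub>x - 1)\<^sup>k f\<close> evaluated at \<open>y\<close>.\<close>

definition unipotent_element :: "'g qgroup \<Rightarrow> 'g \<Rightarrow> bool" where
  "unipotent_element G x \<longleftrightarrow> x \<in> carrier G \<and> (\<forall>f \<in> regular G. \<exists>k. \<forall>y \<in> carrier G.
     (\<Sum>j\<le>k. (- 1) ^ (k - j) * of_nat (k choose j) * f (y \<otimes>\<^bsub>G\<^esub> x [^]\<^bsub>G\<^esub> j)) = 0)"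

definition prounipotent :: "'g qgroup \<Rightarrow> bool" where
  "prounipotent U \<longleftrightarrow> proalgebraic U \<and> (\<forall>x \<in> carrier U. unipotent_element U x)"


subsection \<open>The symplectic group\<close>

inductive_set matrix_polynomials :: "nat \<Rightarrow> (complex mat \<Rightarrow> complex) set" for n :: nat where
  const: "(\<lambda>A. of_rat q) \<in> matrix_polynomials n"
| entry: "i < n \<Longrightarrow> j < n \<Longrightarrow> (\<lambda>A. A $$ (i, j)) \<in> matrix_polynomials n"
| add: "f \<in> matrix_polynomials n \<Longrightarrow> g \<in> matrix_polynomials n \<Longrightarrow>
    (\<lambda>A. f A + g A) \<in> matrix_polynomials n"
| mult: "f \<in> matrix_polynomials n \<Longrightarrow> g \<in> matrix_polynomials n \<Longrightarrow>
    (\<lambda>A. f A * g A) \<in> matrix_polynomials n"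

definition Sp_carrier :: "nat \<Rightarrow> rat mat \<Rightarrow> complex mat set" where
  "Sp_carrier n J = {A \<in> carrier_mat n n.
     transpose_mat A * map_mat of_rat J * A = map_mat of_rat J}"

text \<open>The inverse of the determinant is not needed as a generator of the coordinate ring:
  symplectic matrices have determinant 1.\<close>

definition Sp :: "nat \<Rightarrow> rat mat \<Rightarrow> complex mat qgroup" where
  "Sp n J = \<lparr>carrier = Sp_carrier n J, monoid.mult = (*), one = 1\<^sub>m n,
     regular = zero_outside (Sp_carrier n J) ` matrix_polynomials n\<rparr>"


section \<open>Relative completion\<close>

definition prounipotent_extension :: "'g qgroup \<Rightarrow> 'h qgroup \<Rightarrow> ('g \<Rightarrow> 'h) \<Rightarrow> bool" where
  "prounipotent_extension G R \<pi> \<longleftrightarrow> proalgebraic G \<and> \<pi> \<in> proalgebraic_hom G R \<and>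
     \<pi> ` carrier G = carrier R \<and> prounipotent (closed_subgroup G (kernel G R \<pi>))"

text \<open>Extensions of \<open>Sp(H)\<close> by a prounipotent group, with a homomorphism from the mapping class
  group to the rational points which lifts its action on homology.\<close>

definition lifting ::
  "'a surface \<Rightarrow> 'a set \<Rightarrow> 'a tangent set \<Rightarrow> nat \<Rightarrow> ('a chain set \<Rightarrow> rat vec) \<Rightarrow> rat mat \<Rightarrow>
   'g qgroup \<Rightarrow> ('g \<Rightarrow> complex mat) \<Rightarrow> (('a \<Rightarrow> 'a) set \<Rightarrow> 'g) \<Rightarrow> bool" where
  "lifting S P V n \<kappa> J G \<pi> \<rho> \<longleftrightarrow> prounipotent_extension G (Sp n J) \<pi> \<and>
     \<rho> \<in> hom (mapping_class_group S P V) G \<and>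
     (\<forall>\<tau> \<in> carrier (mapping_class_group S P V). \<rho> \<tau> \<in> rational_points G \<and>
        \<pi> (\<rho> \<tau>) = map_mat of_rat (homology_rep S n \<kappa> \<tau>))"

text \<open>The universal property is tested on groups whose points lie in the type \<open>'g\<close> of the points of
  the completion. This is no restriction: \<open>'g\<close> has at least the cardinality of the continuum because
  \<open>G\<close> maps onto the complex points of \<open>Sp(H)\<close>; so, up to isomorphism, all extensions that are of
  finite type are included, and every prounipotent extension is an inverse limit of such.\<close>

definition relative_completion ::
  "'a surface \<Rightarrow> 'a set \<Rightarrow> 'a tangent set \<Rightarrow> nat \<Rightarrow> ('a chain set \<Rightarrow> rat vec) \<Rightarrow> rat mat \<Rightarrow>
   'g qgroup \<Rightarrow> ('g \<Rightarrow> complex mat) \<Rightarrow> (('a \<Rightarrow> 'a) set \<Rightarrow> 'g) \<Rightarrow> bool" where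
  "relative_completion S P V n \<kappa> J G \<pi> \<rho> \<longleftrightarrow> lifting S P V n \<kappa> J G \<pi> \<rho> \<and>
     (\<forall>(G' :: 'g qgroup) \<pi>' \<rho>'. lifting S P V n \<kappa> J G' \<pi>' \<rho>' \<longrightarrow>
        (\<exists>!\<Phi>. \<Phi> \<in> proalgebraic_hom G G' \<and> \<Phi> \<in> extensional (carrier G) \<and>
           (\<forall>x \<in> carrier G. \<pi>' (\<Phi> x) = \<pi> x) \<and>
           (\<forall>\<tau> \<in> carrier (mapping_class_group S P V). \<Phi> (\<rho> \<tau>) = \<rho>' \<tau>)))"


section \<open>Lie algebras of proalgebraic groups\<close>

text \<open>Elements of the Lie algebra are the rational valued point derivations of the coordinate ring
  at the identity (additivity and the Leibniz rule imply linearity over the rationals), normalised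
  to be 0 outside the coordinate ring. The vector space operations are pointwise.\<close>

type_synonym 'g lie = "('g \<Rightarrow> complex) \<Rightarrow> rat"

definition lie_algebra :: "'g qgroup \<Rightarrow> 'g lie set" where
  "lie_algebra G = {X. zero_outside (regular G) X = X \<and>
     (\<forall>f \<in> regular G. \<forall>g \<in> regular G. X (f + g) = X f + X g \<and>
        of_rat (X (f * g)) = of_rat (X f) * g \<one>\<^bsub>G\<^esub> + f \<one>\<^bsub>G\<^esub> * of_rat (X g))}"

text \<open>The convolution product; it does not depend on the chosen presentation of the coproduct.\<close>

definition convolution :: "'g qgroup \<Rightarrow> 'g lie \<Rightarrow> 'g lie \<Rightarrow> 'g lie" where
  "convolution G X Y = zero_outside (regular G) (\<lambda>f.
     case (SOME (n, u, v). coproduct G f n u v) of (n, u, v) \<Rightarrow> \<Sum>i<n. X (u i) * Y (v i))"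

definition bracket :: "'g qgroup \<Rightarrow> 'g lie \<Rightarrow> 'g lie \<Rightarrow> 'g lie" where
  "bracket G X Y = convolution G X Y - convolution G Y X"

definition lie_differential ::
  "'g qgroup \<Rightarrow> 'h qgroup \<Rightarrow> ('g \<Rightarrow> 'h) \<Rightarrow> 'g lie \<Rightarrow> 'h lie" where
  "lie_differential G H \<phi> X = zero_outside (regular H) (\<lambda>f. X (zero_outside (carrier G) (f \<circ> \<phi>)))"

text \<open>The Lie algebra of a closed subgroup, as a subspace of the Lie algebra of the group.\<close>

definition lie_subalgebra :: "'g qgroup \<Rightarrow> 'g set \<Rightarrow> 'g lie set" where
  "lie_subalgebra G U =
     lie_differential (closed_subgroup G U) G id ` lie_algebra (closed_subgroup G U)"

definition rscale :: "rat \<Rightarrow> ('b \<Rightarrow> rat) \<Rightarrow> 'b \<Rightarrow> rat" where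
  "rscale q X = (\<lambda>f. q * X f)"

text \<open>Closure in the topology of pointwise convergence, the rationals being discrete. It is the
  inverse limit topology of the Lie algebra.\<close>

definition lie_closure :: "'g qgroup \<Rightarrow> 'g lie set \<Rightarrow> 'g lie set" where
  "lie_closure G A = {X \<in> lie_algebra G.
     \<forall>F. finite F \<and> F \<subseteq> regular G \<longrightarrow> (\<exists>Y \<in> A. \<forall>f \<in> F. X f = Y f)}"

text \<open>\<open>lower_central G u m\<close> is \<open>L\<^sup>m\<^sup>+\<^sup>1 u\<close>.\<close>

primrec lower_central :: "'g qgroup \<Rightarrow> 'g lie set \<Rightarrow> nat \<Rightarrow> 'g lie set" where
  "lower_central G u 0 = u"
| "lower_central G u (Suc m) = lie_closure G
     (module.span rscale {bracket G X Y | X Y. X \<in> u \<and> Y \<in> lower_central G u m})"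

text \<open>\<open>W\<^sub>-\<^sub>m = L\<^sup>m u\<close> for \<open>m \<ge> 1\<close>: the weight filtration in genus at least 3.\<close>

definition weight_filtration ::
  "'g qgroup \<Rightarrow> ('g \<Rightarrow> 'h) \<Rightarrow> 'h qgroup \<Rightarrow> int \<Rightarrow> 'g lie set" where
  "weight_filtration G \<pi> R m =
     (if m \<ge> 0 then lie_algebra G
      else lower_central G (lie_subalgebra G (kernel G R \<pi>)) (nat (- m - 1)))"

text \<open>The canonical logarithm \<open>\<Sum>k\<ge>1. (-1)\<^sup>k\<^sup>+\<^sup>1 (x - 1)\<^sup>k / k\<close> of a unipotent element, where points
  are viewed as functionals on the coordinate ring. The series is finite on each function.\<close>

definition canonical_log :: "'g qgroup \<Rightarrow> 'g \<Rightarrow> 'g lie \<Rightarrow> bool" where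
  "canonical_log G x X \<longleftrightarrow> unipotent_element G x \<and> X \<in> lie_algebra G \<and>
     (\<forall>f \<in> regular G. \<forall>\<^sub>F K in sequentially. of_rat (X f) =
        (\<Sum>k=1..K. (- 1) ^ (k + 1) / of_nat k *
           (\<Sum>j\<le>k. (- 1) ^ (k - j) * of_nat (k choose j) * f (x [^]\<^bsub>G\<^esub> j))))"

text \<open>The cone \<open>C\<^sup>o(\<gamma>)\<close>.\<close>

definition open_cone ::
  "'a surface \<Rightarrow> 'a set \<Rightarrow> 'a tangent set \<Rightarrow> 'g qgroup \<Rightarrow> (('a \<Rightarrow> 'a) set \<Rightarrow> 'g) \<Rightarrow>
   'a set set \<Rightarrow> 'g lie set" where
  "open_cone S P V G \<rho> \<gamma> = {\<Sum>c\<in>\<gamma>. rscale (r c) (N c) | r N. \<forall>c \<in> \<gamma>. r c > 0 \<and>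
     (\<exists>\<tau>. dehn_twist_class S P V c \<tau> \<and> canonical_log G (\<rho> \<tau>) (N c))}"


section \<open>Relative weight filtrations\<close>

text \<open>\<open>gr_filtration W M m k\<close> is the preimage in \<open>W m\<close> of the \<open>k\<close>-th term of the filtration induced
  by \<open>M\<close> on \<open>Gr\<^sup>W\<^sub>m = W m / W (m - 1)\<close>.\<close>

definition gr_filtration ::
  "(int \<Rightarrow> ('b \<Rightarrow> rat) set) \<Rightarrow> (int \<Rightarrow> ('b \<Rightarrow> rat) set) \<Rightarrow> int \<Rightarrow> int \<Rightarrow> ('b \<Rightarrow> rat) set" where
  "gr_filtration W M m k = {x + y | x y. x \<in> M k \<inter> W m \<and> y \<in> W (m - 1)}"

text \<open>The first two conditions on \<open>m\<close> say that the filtration induced on \<open>Gr\<^sup>W\<^sub>m\<close> is finite (without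
  this there is no uniqueness), the last two that \<open>N\<^sup>k\<close> is injective and surjective from
  \<open>Gr\<^sup>M\<^sub>m\<^sub>+\<^sub>k Gr\<^sup>W\<^sub>m\<close> to \<open>Gr\<^sup>M\<^sub>m\<^sub>-\<^sub>k Gr\<^sup>W\<^sub>m\<close>.\<close>

definition relative_weight_filtration ::
  "('b \<Rightarrow> rat) set \<Rightarrow> (int \<Rightarrow> ('b \<Rightarrow> rat) set) \<Rightarrow> (('b \<Rightarrow> rat) \<Rightarrow> ('b \<Rightarrow> rat)) \<Rightarrow>
   (int \<Rightarrow> ('b \<Rightarrow> rat) set) \<Rightarrow> bool" where
  "relative_weight_filtration E W N M \<longleftrightarrow>
     (\<forall>k. module.subspace rscale (M k) \<and> M k \<subseteq> E) \<and> mono M \<and> (\<forall>k. N ` M k \<subseteq> M (k - 2)) \<and>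
     (\<forall>m::int. let F = gr_filtration W M m in
        (\<exists>k. F k = W (m - 1)) \<and>
        (\<exists>k. F k = W m) \<and>
        (\<forall>k::nat.
           (\<forall>x \<in> F (m + int k). (N ^^ k) x \<in> F (m - int k - 1) \<longrightarrow> x \<in> F (m + int k - 1)) \<and>
           (\<forall>y \<in> F (m - int k). \<exists>x \<in> F (m + int k). y - (N ^^ k) x \<in> F (m - int k - 1))))"

text \<open>The version for the inverse limit of the quotients by the terms of the weight filtration:
  the terms of the relative weight filtration are required to be closed, which makes them the
  inverse limits of their images in these quotients.\<close>

definition pro_relative_weight_filtration ::
  "'g qgroup \<Rightarrow> (int \<Rightarrow> 'g lie set) \<Rightarrow> ('g lie \<Rightarrow> 'g lie) \<Rightarrow> (int \<Rightarrow> 'g lie set) \<Rightarrow> bool" where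
  "pro_relative_weight_filtration G W N M \<longleftrightarrow>
     relative_weight_filtration (lie_algebra G) W N M \<and> (\<forall>k. lie_closure G (M k) = M k)"

end

theory Submission
  imports Defs "HOL-Complex_Analysis.Complex_Analysis" "Jordan_Normal_Form.Jordan_Normal_Form_Existence"
begin

text \<open>Let \<open>\<g>\<close> be the Lie algebra of the completion and \<open>\<uu>\<close> that of its prounipotent radical, so that
  \<open>\<g> / \<uu>\<close> is the symplectic Lie algebra. The relative weight filtration of \<open>ad N\<close> induces a finite
  filtration on \<open>\<g> / \<uu>\<close>, so the image of \<open>N\<close> is nilpotent, and there is \<open>e\<close> with
  \<open>[N, [N, e]] = 2 N\<close> modulo \<open>\<uu>\<close>. The element \<open>h = [N, e]\<close> lies in \<open>M\<^sub>0 + \<uu>\<close> and acts on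
  \<open>Gr\<^sup>M\<^sub>m\<^sub>+\<^sub>k Gr\<^sup>W\<^sub>m\<close> as multiplication by \<open>k\<close>. If \<open>X\<close> normalizes \<open>M\<^sub>0\<close>, then \<open>[h', X]\<close> is in \<open>M\<^sub>0\<close> for
  some \<open>h'\<close> in \<open>M\<^sub>0\<close> congruent to \<open>h\<close>; as \<open>k > - m \<ge> 0\<close> on the part of \<open>Gr\<^sup>W\<^sub>m\<close> outside \<open>M\<^sub>0\<close>, descending
  induction on \<open>m\<close> gives \<open>X \<in> M\<^sub>0 + W\<^sub>m\<close> for all \<open>m\<close>. Since \<open>M\<^sub>0\<close> is closed and, by Engel's theorem, the
  lower central series of \<open>\<uu>\<close> tends to 0 in the inverse limit topology, \<open>X \<in> M\<^sub>0\<close>.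

  Points of the group have complex coordinates whereas elements of the Lie algebra are rational. They
  are related by field automorphisms and derivations of the complex numbers, and by the one-parameter
  subgroups \<open>exp (t X)\<close>.\<close>

text \<open>A relative weight filtration is not assumed to respect the bracket, so even the
  inclusion of \<open>M 0\<close> in its normalizer has to be proved. Modulo smaller weights
  \<open>M\<close> is spanned by strings \<open>x, [N, x], [N, [N, x]], ...\<close>. Since
  \<open>ad N\<close> is a derivation, the brackets of two strings form an image of the tensor
  product of two strings, and the Clebsch-Gordan decomposition of the latter puts
  \<open>[M a, M b]\<close> into \<open>M (a + b) + W l\<close> for every \<open>l\<close>.
  Closedness removes \<open>W l\<close> only at the end. No full sl2-triple is constructed:
  \<open>e\<close> comes from a linear equation, which can be solved over the complex numbers, where
  Jordan forms exist, and is then made rational by a Q-linear functional. Each bridge between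
  complex points and rational derivations has its own task. Automorphisms of the complex numbers
  make the convolution independent of the presentation of the coproduct; a derivation shows that the
  Lie algebra maps onto the symplectic one; one-parameter subgroups identify \<open>\<uu>\<close>
  with the kernel of this map and turn unipotency of points into local nilpotency of
  operators.\<close>

hide_const (open) up_ring.coeff up_ring.monom module.smult


section \<open>Monodromy filtrations\<close>

lemma int_descent:
  fixes P :: "int \<Rightarrow> bool"
  assumes "P a" and "\<And>t. t > b \<Longrightarrow> P t \<Longrightarrow> P (t - 1)" and "a \<ge> b"
  shows "P b"
proof -
  have "P (a - int n)" if "int n \<le> a - b" for n
    using that
  proof (induction n)
    case (Suc n)
    then have "P (a - int n - 1)" using assms(2)[of "a - int n"] by simp
    then show ?case by (simp add: algebra_simps)
  qed (use assms in auto)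
  from this[of "nat (a - b)"] show ?thesis using assms(3) by simp
qed

lemma int_descent_mono:
  fixes P :: "int \<Rightarrow> bool"
  assumes "P a" and "\<And>t. t > b \<Longrightarrow> P t \<Longrightarrow> P (t - 1)" and "\<And>s t. s \<le> t \<Longrightarrow> P s \<Longrightarrow> P t"
  shows "P b"
  using int_descent[of P "max a b" b] assms by (metis max.cobounded1 max.cobounded2)

text \<open>\<open>F\<close> is the preimage in \<open>A\<close> of the monodromy weight filtration, centred at 0, of the nilpotent
  endomorphism of \<open>A / B\<close> induced by \<open>N\<close>.\<close>

locale monodromy_filtration = vector_space scale
  for scale :: "'f::field_char_0 \<Rightarrow> 'v::ab_group_add \<Rightarrow> 'v" +
  fixes N :: "'v \<Rightarrow> 'v" and A B :: "'v set" and F :: "int \<Rightarrow> 'v set"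
  assumes lin: "Vector_Spaces.linear scale scale N"
    and subA: "subspace A" and subB: "subspace B" and subF: "\<And>k. subspace (F k)"
    and BF: "\<And>k. B \<subseteq> F k" and FA: "\<And>k. F k \<subseteq> A" and mono: "\<And>i j. i \<le> j \<Longrightarrow> F i \<subseteq> F j"
    and NF: "\<And>k x. x \<in> F k \<Longrightarrow> N x \<in> F (k - 2)"
    and NB: "\<And>x. x \<in> B \<Longrightarrow> N x \<in> B" and NA: "\<And>x. x \<in> A \<Longrightarrow> N x \<in> A"
    and bot: "\<exists>k. F k = B" and top: "\<exists>k. F k = A"
    and inj: "\<And>k x. x \<in> F (int k) \<Longrightarrow> (N ^^ k) x \<in> F (- int k - 1) \<Longrightarrow> x \<in> F (int k - 1)"
    and surj: "\<And>k y. y \<in> F (- int k) \<Longrightarrow> \<exists>x \<in> F (int k). y - (N ^^ k) x \<in> F (- int k - 1)"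
begin

lemma N_add: "N (x + y) = N x + N y" and N_scale: "N (scale c x) = scale c (N x)"
  and N_diff: "N (x - y) = N x - N y"
  using lin by (simp_all add: Vector_Spaces.linear.axioms module_hom.add module_hom.scale module_hom.diff
      Vector_Spaces.linear_iff_module_hom)

lemma Npow_diff: "(N ^^ k) (x - y) = (N ^^ k) x - (N ^^ k) y"
  by (induction k) (auto simp: N_diff)

lemma Npow_add: "(N ^^ k) (x + y) = (N ^^ k) x + (N ^^ k) y"
  by (induction k) (auto simp: N_add)

lemma Npow_B: "x \<in> B \<Longrightarrow> (N ^^ k) x \<in> B"
  by (induction k) (auto simp: NB)

lemma Npow_A: "x \<in> A \<Longrightarrow> (N ^^ k) x \<in> A"
  by (induction k) (auto simp: NA)

lemma Npow_F: "x \<in> F k \<Longrightarrow> (N ^^ s) x \<in> F (k - 2 * int s)"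
proof (induction s)
  case (Suc s)
  then show ?case using NF[of "(N ^^ s) x" "k - 2 * int s"] by (simp add: algebra_simps)
qed auto

text \<open>As long as \<open>w\<close> lies in \<open>F t\<close> with \<open>t > k\<close>, the
  hypothesis puts the \<open>t\<close>-th image of \<open>w\<close> into \<open>F (- t - 1)\<close>,
  and injectivity of \<open>N^t\<close> on the graded piece lowers \<open>t\<close> by one. The
  bound on \<open>s\<close> ensures \<open>s \<le> t\<close> at each of these steps, so that the
  \<open>t\<close>-th image factors through the \<open>s\<close>-th.\<close>

lemma F_reflect:
  assumes "w \<in> A" and "(N ^^ s) w \<in> F (k - 2 * int s)" and "int s \<le> k + 1"
  shows "w \<in> F k"
proof -
  obtain t0 where t0: "F t0 = A" using top by blast
  show ?thesis
  proof (rule int_descent_mono[where P = "\<lambda>t. w \<in> F t" and a = t0])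
    show "w \<in> F t0" using assms t0 by simp
  next
    fix t assume t: "k < t" and w: "w \<in> F t"
    define n where "n = nat t"
    have n: "int n = t" "s \<le> n" using t assms(3) unfolding n_def by auto
    have "(N ^^ s) w \<in> F (t - 1 - 2 * int s)"
      using assms(2) mono[of "k - 2 * int s" "t - 1 - 2 * int s"] t by auto
    then have "(N ^^ (n - s)) ((N ^^ s) w) \<in> F (t - 1 - 2 * int s - 2 * int (n - s))"
      by (rule Npow_F)
    moreover have "(N ^^ (n - s)) ((N ^^ s) w) = (N ^^ n) w"
      using n by (metis comp_apply funpow_add le_add_diff_inverse2)
    moreover have "t - 1 - 2 * int s - 2 * int (n - s) = - int n - 1" using n by simp
    ultimately have "(N ^^ n) w \<in> F (- int n - 1)" by simp
    then show "w \<in> F (t - 1)" using inj[of w n] w n by simp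
  qed (use mono in blast)
qed

lemma F_kernel: "x \<in> A \<Longrightarrow> (N ^^ Suc j) x \<in> B \<Longrightarrow> x \<in> F (int j)"
  using F_reflect[of x "Suc j" "int j"] BF by auto

text \<open>Surjectivity leaves an error in \<open>F (- (j + 1))\<close>, which is itself an image
  of some \<open>z\<close> under \<open>N^(j + 1)\<close>. As
  \<open>N^(j + 1) z = N^j (N z)\<close>, the correction \<open>N z\<close> can be added to the
  first preimage. Finiteness of the filtration ends the process with an error in
  \<open>B\<close>.\<close>

lemma F_negative_image:
  assumes "y \<in> F (- int j)"
  shows "\<exists>x \<in> F (int j). y - (N ^^ j) x \<in> B"
proof -
  obtain b where b: "F b = B" using bot by blast
  have "\<forall>j. nat (- b) - j = d \<longrightarrow> (\<forall>y \<in> F (- int j). \<exists>x \<in> F (int j). y - (N ^^ j) x \<in> B)" for d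
  proof (induction d)
    case 0
    show ?case
    proof (intro allI impI ballI)
      fix j y assume "nat (- b) - j = 0" and y: "y \<in> F (- int j)"
      then have "F (- int j) \<subseteq> B" using mono[of "- int j" b] b by simp
      then have "y - (N ^^ j) 0 \<in> B" using y Npow_B[of 0 j] subB
        by (metis subsetD subspace_0 subspace_diff)
      then show "\<exists>x \<in> F (int j). y - (N ^^ j) x \<in> B" using subF subspace_0 by blast
    qed
  next
    case (Suc d)
    show ?case
    proof (intro allI impI ballI)
      fix j y assume d: "nat (- b) - j = Suc d" and y: "y \<in> F (- int j)"
      obtain x where x: "x \<in> F (int j)" "y - (N ^^ j) x \<in> F (- int (Suc j))"
        using surj[OF y] by (metis diff_minus_eq_add minus_add_distrib of_nat_Suc uminus_add_conv_diff)
      have d': "nat (- b) - Suc j = d" using d by arith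
      obtain z where z: "z \<in> F (int (Suc j))" "y - (N ^^ j) x - (N ^^ Suc j) z \<in> B"
        using Suc.IH[rule_format, OF d', OF x(2)] by blast
      have "N z \<in> F (int j)" using NF[OF z(1)] mono[of "int (Suc j) - 2" "int j"] by auto
      then have "x + N z \<in> F (int j)" using x subF subspace_add by blast
      moreover have "y - (N ^^ j) (x + N z) = y - (N ^^ j) x - (N ^^ Suc j) z"
        by (simp add: Npow_add funpow_swap1)
      ultimately show "\<exists>x \<in> F (int j). y - (N ^^ j) x \<in> B" using z by metis
    qed
  qed
  then show ?thesis using assms by blast
qed

text \<open>Lefschetz decomposition without a choice of primitive complements:
  \<open>N^(k + 1) x\<close> equals \<open>N^(k + 2) z\<close> modulo \<open>B\<close> for some
  \<open>z\<close> in \<open>F (k + 2)\<close>, so \<open>x - N z\<close> is the head of a string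
  that ends after \<open>k + 1\<close> steps, and \<open>z\<close> is treated in the same way at
  level \<open>k + 2\<close>. The number of such steps is \<open>p\<close>.\<close>

lemma F_nonneg_strings:
  assumes "subspace S" and "B \<subseteq> S"
    and "\<And>p x. x \<in> A \<Longrightarrow> (N ^^ Suc (k + 2 * p)) x \<in> B \<Longrightarrow> (N ^^ (j + p)) x \<in> S"
    and x: "x \<in> F (int k)"
  shows "(N ^^ j) x \<in> S"
proof -
  obtain b where b: "F b = B" using bot by blast
  have "\<forall>p x. nat (- b) - (k + 2 * p) \<le> d \<longrightarrow> x \<in> F (int (k + 2 * p)) \<longrightarrow> (N ^^ (j + p)) x \<in> S" for d
  proof (induction d)
    case 0
    show ?case
    proof (intro allI impI)
      fix p x assume d: "nat (- b) - (k + 2 * p) \<le> 0" and x: "x \<in> F (int (k + 2 * p))"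
      have "(N ^^ Suc (k + 2 * p)) x \<in> F (int (k + 2 * p) - 2 * int (Suc (k + 2 * p)))"
        by (rule Npow_F[OF x])
      moreover have "F (int (k + 2 * p) - 2 * int (Suc (k + 2 * p))) \<subseteq> F b"
        using d by (intro mono) (simp add: nat_le_iff)
      ultimately have "(N ^^ Suc (k + 2 * p)) x \<in> B" using b by blast
      then show "(N ^^ (j + p)) x \<in> S" using assms(3) FA x by blast
    qed
  next
    case (Suc d)
    show ?case
    proof (intro allI impI)
      fix p x assume d: "nat (- b) - (k + 2 * p) \<le> Suc d" and x: "x \<in> F (int (k + 2 * p))"
      let ?k = "k + 2 * p"
      have "(N ^^ Suc ?k) x \<in> F (int ?k - 2 * int (Suc ?k))"
        by (rule Npow_F[OF x])
      then have "(N ^^ Suc ?k) x \<in> F (- int (Suc (Suc ?k)))" by (simp add: algebra_simps)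
      then obtain z where z: "z \<in> F (int (Suc (Suc ?k)))" "(N ^^ Suc ?k) x - (N ^^ Suc (Suc ?k)) z \<in> B"
        using F_negative_image by blast
      have "N z \<in> F (int ?k)" using NF[OF z(1)] by (simp add: algebra_simps)
      then have x0: "x - N z \<in> A" using x FA subA subspace_diff by blast
      have "(N ^^ Suc ?k) (x - N z) \<in> B" using z(2) by (simp add: Npow_diff N_diff funpow_swap1)
      then have "(N ^^ (j + p)) (x - N z) \<in> S" using assms(3) x0 by blast
      moreover have "(N ^^ (j + Suc p)) z \<in> S"
        using Suc.IH[rule_format, of "Suc p" z] d z(1) by simp
      moreover have "(N ^^ (j + p)) x = (N ^^ (j + p)) (x - N z) + (N ^^ (j + Suc p)) z"
        by (simp add: Npow_diff funpow_swap1)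
      ultimately show "(N ^^ (j + p)) x \<in> S" using assms(1) subspace_add by metis
    qed
  qed
  from this[of "nat (-b)", rule_format, of 0 x] x show ?thesis by simp
qed

text \<open>The vector \<open>x\<close> is the head of a string of weight \<open>a\<close>, and
  \<open>N^p x\<close> has weight \<open>a - 2 p\<close>. Negative \<open>k\<close> reduces to
  \<open>- k\<close>, because modulo \<open>B\<close> every element of \<open>F k\<close> is then an
  image of one of \<open>F (- k)\<close>.\<close>

lemma F_strings:
  assumes S: "subspace S" "B \<subseteq> S"
    and str: "\<And>a p x. x \<in> A \<Longrightarrow> (N ^^ Suc a) x \<in> B \<Longrightarrow> int a - 2 * int p = k \<Longrightarrow> (N ^^ p) x \<in> S"
  shows "F k \<subseteq> S"
proof
  fix x assume x: "x \<in> F k"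
  show "x \<in> S"
  proof (cases "k \<ge> 0")
    case True
    then obtain n where n: "k = int n" using nonneg_int_cases by blast
    have "(N ^^ 0) x \<in> S"
      by (rule F_nonneg_strings[OF S, of n]) (use str x n in auto)
    then show ?thesis by simp
  next
    case False
    then obtain n where n: "k = - int n" using nonpos_int_cases by (metis linear)
    obtain z where z: "z \<in> F (int n)" "x - (N ^^ n) z \<in> B"
      using F_negative_image x n by blast
    have "(N ^^ n) z \<in> S"
      by (rule F_nonneg_strings[OF S, of n]) (use str z n in auto)
    then have "x - (N ^^ n) z + (N ^^ n) z \<in> S" using z S subspace_add by blast
    then show ?thesis by simp
  qed
qed

text \<open>The relations between \<open>N\<close>, \<open>H\<close> and \<open>E\<close> already force \<open>H\<close> to act as an element of an
  \<open>sl\<^sub>2\<close>-triple would, although nothing is assumed on the commutator of \<open>H\<close> and \<open>E\<close>.\<close>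

lemma F_eigen:
  assumes H: "Vector_Spaces.linear scale scale H" and HA: "\<And>x. x \<in> A \<Longrightarrow> H x \<in> A"
    and HB: "\<And>x. x \<in> B \<Longrightarrow> H x \<in> B" and EA: "\<And>x. x \<in> A \<Longrightarrow> E x \<in> A"
    and EB: "\<And>x. x \<in> B \<Longrightarrow> E x \<in> B"
    and NE: "\<And>x. x \<in> A \<Longrightarrow> N (E x) - E (N x) - H x \<in> B"
    and NH: "\<And>x. x \<in> A \<Longrightarrow> N (H x) - H (N x) - scale 2 (N x) \<in> B"
    and x: "x \<in> F k"
  shows "H x - scale (of_int k) x \<in> F (k - 1)"
proof -
  have H_add: "H (x + y) = H x + H y" and H_scale: "H (scale c x) = scale c (H x)"
    and H_diff: "H (x - y) = H x - H y" for x y c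
    using H by (simp_all add: module_hom.add module_hom.scale module_hom.diff
      Vector_Spaces.linear_iff_module_hom)
  note sB = subspace_add[OF subB] subspace_diff[OF subB] subspace_scale[OF subB]
  have NpH: "(N ^^ p) (H x) - H ((N ^^ p) x) - scale (2 * of_nat p) ((N ^^ p) x) \<in> B"
    if "x \<in> A" for p x
  proof (induction p)
    case 0
    then show ?case using subB by (simp add: subspace_0)
  next
    case (Suc p)
    define y where "y = (N ^^ p) x"
    have y: "y \<in> A" unfolding y_def using that Npow_A by blast
    have "N ((N ^^ p) (H x) - H y - scale (2 * of_nat p) y) + (N (H y) - H (N y) - scale 2 (N y)) \<in> B"
      using Suc NB NH[OF y] sB unfolding y_def by blast
    then show ?case
      by (simp add: y_def N_diff N_add N_scale algebra_simps scale_left_distrib)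
  qed
  \<comment> \<open>The sl2-identity \<open>[N^(p + 1), E] = (p + 1) N^p (H - p)\<close> modulo
    \<open>B\<close>, by induction from \<open>NE\<close> and \<open>NpH\<close>.\<close>
  have NpE: "(N ^^ Suc p) (E x) - E ((N ^^ Suc p) x)
      - scale (of_nat (Suc p)) ((N ^^ p) (H x - scale (of_nat p) x)) \<in> B"
    if x: "x \<in> A" for p x
  proof (induction p)
    case 0
    then show ?case using NE[OF that] by simp
  next
    case (Suc p)
    define y where "y = (N ^^ Suc p) x"
    have y: "y \<in> A" unfolding y_def using that Npow_A by blast
    let ?u = "(N ^^ Suc p) (E x) - E ((N ^^ Suc p) x)
      - scale (of_nat (Suc p)) ((N ^^ p) (H x - scale (of_nat p) x))"
    have "N ?u + (N (E y) - E (N y) - H y)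
      - ((N ^^ Suc p) (H x) - H ((N ^^ Suc p) x) - scale (2 * of_nat (Suc p)) ((N ^^ Suc p) x)) \<in> B"
      using Suc NB NE[OF y] NpH[OF x, of "Suc p"] sB by blast
    moreover have Nps: "(N ^^ j) (scale c z) = scale c ((N ^^ j) z)" for j c z
      by (induction j) (auto simp: N_scale)
    moreover have "scale 2 z = z + z" for z using scale_left_distrib[of 1 1 z] by simp
    ultimately show ?case
      by (simp add: y_def N_diff N_add N_scale Npow_diff Npow_add Nps algebra_simps scale_left_distrib)
  qed
  let ?S = "{x \<in> A. H x - scale (of_int k) x \<in> F (k - 1)}"
  have "F k \<subseteq> ?S"
  proof (rule F_strings)
    show "subspace ?S"
    proof (rule subspaceI)
      show "0 \<in> ?S" using subA subF H_scale[of 0 0] by (simp add: subspace_0)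
    next
      fix x y assume "x \<in> ?S" "y \<in> ?S"
      then have "x + y \<in> A" "(H x - scale (of_int k) x) + (H y - scale (of_int k) y) \<in> F (k - 1)"
        using subA subF subspace_add by blast+
      then show "x + y \<in> ?S" by (simp add: H_add algebra_simps)
    next
      fix c x assume "x \<in> ?S"
      then have "scale c x \<in> A" "scale c (H x - scale (of_int k) x) \<in> F (k - 1)"
        using subA subF subspace_scale by blast+
      then show "scale c x \<in> ?S" by (simp add: H_scale algebra_simps)
    qed
  next
    show "B \<subseteq> ?S"
    proof
      fix x assume x: "x \<in> B"
      then have "H x - scale (of_int k) x \<in> B" using HB sB by simp
      then show "x \<in> ?S" using x BF FA by blast
    qed
  next
    fix a p x
    assume x: "x \<in> A" "(N ^^ Suc a) x \<in> B" and k: "int a - 2 * int p = k"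
    \<comment> \<open>\<open>y\<close> measures how far the head \<open>x\<close> is from an
      eigenvector for \<open>a\<close>. It is enough to place \<open>N^a y\<close> in
      \<open>F (- a - 1)\<close>, since injectivity then lowers \<open>y\<close> from
      \<open>F a\<close> to \<open>F (a - 1)\<close>.\<close>
    define y where "y = H x - scale (of_nat a) x"
    have yA: "y \<in> A" unfolding y_def using x HA subA by (simp add: subspace_diff subspace_scale)
    let ?c = "of_nat (Suc a) :: 'f"
    have c: "?c \<noteq> 0" using of_nat_neq_0 by blast
    have "E ((N ^^ Suc a) x) \<in> B" using x EB by blast
    then have e1: "(N ^^ Suc a) (E x) - scale ?c ((N ^^ a) y) \<in> B"
      using NpE[OF x(1), of a] sB(1)[of "(N ^^ Suc a) (E x) - E ((N ^^ Suc a) x)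
      - scale (of_nat (Suc a)) ((N ^^ a) (H x - scale (of_nat a) x))" "E ((N ^^ Suc a) x)"]
      unfolding y_def by (simp add: algebra_simps)
    have "(N ^^ Suc a) (H x) - H ((N ^^ Suc a) x) - scale (2 * of_nat (Suc a)) ((N ^^ Suc a) x) \<in> B"
      using NpH[OF x(1)] by blast
    moreover have "H ((N ^^ Suc a) x) \<in> B" "scale (2 * of_nat (Suc a)) ((N ^^ Suc a) x) \<in> B"
      using x HB sB(3) by auto
    ultimately have "(N ^^ Suc a) (H x) - H ((N ^^ Suc a) x) - scale (2 * of_nat (Suc a)) ((N ^^ Suc a) x)
      + H ((N ^^ Suc a) x) + scale (2 * of_nat (Suc a)) ((N ^^ Suc a) x) \<in> B" by (intro sB(1))
    then have NHx: "(N ^^ Suc a) (H x) \<in> B" by simp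
    have Nps: "(N ^^ j) (scale c z) = scale c ((N ^^ j) z)" for j c z
      by (induction j) (auto simp: N_scale)
    have Ny: "(N ^^ Suc a) y \<in> B" unfolding y_def Npow_diff Nps using NHx x by (intro sB)
    \<comment> \<open>Applying \<open>N\<close> once more removes the term in \<open>y\<close>, so
      \<open>E x\<close> lies in \<open>F (a + 1)\<close> and its image under
      \<open>N^(a + 1)\<close> in \<open>F (- a - 1)\<close>. Comparison with \<open>e1\<close> then
      locates \<open>N^a y\<close>.\<close>
    have "N ((N ^^ Suc a) (E x) - scale ?c ((N ^^ a) y)) \<in> B" using e1 NB by blast
    then have "(N ^^ Suc (Suc a)) (E x) - scale ?c ((N ^^ Suc a) y) \<in> B" by (simp add: N_diff N_scale)
    then have "(N ^^ Suc (Suc a)) (E x) - scale ?c ((N ^^ Suc a) y) + scale ?c ((N ^^ Suc a) y) \<in> B"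
      by (rule sB(1)) (rule sB(3)[OF Ny])
    then have "(N ^^ Suc (Suc a)) (E x) \<in> B" by simp
    then have "E x \<in> F (int (Suc a))" using F_kernel EA x by blast
    then have "(N ^^ Suc a) (E x) \<in> F (int (Suc a) - 2 * int (Suc a))" by (rule Npow_F)
    moreover have "int (Suc a) - 2 * int (Suc a) = - int a - 1" by simp
    ultimately have "(N ^^ Suc a) (E x) \<in> F (- int a - 1)" by (simp only:)
    then have "(N ^^ Suc a) (E x) - ((N ^^ Suc a) (E x) - scale ?c ((N ^^ a) y)) \<in> F (- int a - 1)"
      by (rule subspace_diff[OF subF]) (use e1 BF in blast)
    then have "scale ?c ((N ^^ a) y) \<in> F (- int a - 1)" by simp
    then have "scale (inverse ?c) (scale ?c ((N ^^ a) y)) \<in> F (- int a - 1)"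
      by (rule subspace_scale[OF subF])
    moreover have "scale (inverse ?c) (scale ?c ((N ^^ a) y)) = (N ^^ a) y"
      using c by (simp del: of_nat_Suc)
    ultimately have "(N ^^ a) y \<in> F (- int a - 1)" by simp
    moreover have "y \<in> F (int a)" using F_kernel Ny yA by blast
    ultimately have "y \<in> F (int a - 1)" using inj by blast
    then have "(N ^^ p) y \<in> F (int a - 1 - 2 * int p)" by (rule Npow_F)
    then have e2: "(N ^^ p) y \<in> F (k - 1)" using k by (simp add: algebra_simps)
    have "(N ^^ p) y - ((N ^^ p) (H x) - H ((N ^^ p) x) - scale (2 * of_nat p) ((N ^^ p) x)) \<in> F (k - 1)"
      by (rule subspace_diff[OF subF e2]) (use NpH[OF x(1), of p] BF in blast)
    moreover have "of_nat a = (of_int k + of_nat p * 2 :: 'f)"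
      using arg_cong[OF k, of "of_int :: int \<Rightarrow> 'f"] by (simp add: algebra_simps)
    ultimately have "H ((N ^^ p) x) - scale (of_int k) ((N ^^ p) x) \<in> F (k - 1)"
      unfolding y_def by (simp add: Npow_diff Npow_add Nps algebra_simps scale_left_distrib)
    then show "(N ^^ p) x \<in> ?S" using Npow_A x by blast
  qed
  then show ?thesis using x by blast
qed

end

section \<open>Tensor products of two strings\<close>

context vector_space
begin

text \<open>The tensor product of two strings, of lengths \<open>a\<close> and \<open>b\<close>, is the space of polynomials in
  \<open>s\<^sub>1, t\<^sub>1, s\<^sub>2, t\<^sub>2\<close> of bidegree \<open>(a, b)\<close> on which \<open>N\<close> is the derivation
  \<open>s\<^sub>1 \<partial>/\<partial>t\<^sub>1 + s\<^sub>2 \<partial>/\<partial>t\<^sub>2\<close>. The function \<open>G c p q\<close> is the image of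
  \<open>(s\<^sub>1 t\<^sub>2 - s\<^sub>2 t\<^sub>1)\<^sup>c s\<^sub>1\<^sup>p t\<^sub>1\<^sup>a\<^sup>-\<^sup>c\<^sup>-\<^sup>p s\<^sub>2\<^sup>q t\<^sub>2\<^sup>b\<^sup>-\<^sup>c\<^sup>-\<^sup>q\<close>, so that \<open>G c 0 0\<close> is the image of a
  primitive vector.\<close>

lemma tensor_strings:
  fixes f :: "nat \<Rightarrow> nat \<Rightarrow> 'b" and S T :: "nat \<Rightarrow> 'b set" and a b :: nat
  assumes char0: "\<And>n. of_nat (Suc n) \<noteq> (0 :: 'a)"
    and lin: "Vector_Spaces.linear scale scale N"
    and sub: "\<And>c. subspace (S c)" and NS: "\<And>c x. x \<in> S c \<Longrightarrow> N x \<in> S (Suc c)"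
    and fT: "\<And>p q. f p q \<in> T (p + q)"
    and Nf: "\<And>p q. N (f p q) = f (Suc p) q + f p (Suc q)"
    and f_end: "\<And>p q. p > a \<or> q > b \<Longrightarrow> f p q \<in> S (p + q)"
    and inj: "\<And>c s z. z \<in> T c \<Longrightarrow> (N ^^ s) z \<in> S (c + s) \<Longrightarrow> s + 2 * c \<le> a + b + 1 \<Longrightarrow> z \<in> S c"
  shows "f p q \<in> S (p + q)"
proof -
  have N_add: "N (x + y) = N x + N y" and N_scale: "N (scale c x) = scale c (N x)"
    and N_diff: "N (x - y) = N x - N y" for x y c
    using lin by (simp_all add: module_hom.add module_hom.scale module_hom.diff
      Vector_Spaces.linear_iff_module_hom)
  have Np_add: "(N ^^ k) (x + y) = (N ^^ k) x + (N ^^ k) y" for k x y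
    by (induction k) (auto simp: N_add)
  have Np_scale: "(N ^^ k) (scale c x) = scale c ((N ^^ k) x)" for k x c
    by (induction k) (auto simp: N_scale)
  have Np_S: "(N ^^ k) x \<in> S (c + k)" if "x \<in> S c" for k x c
    by (induction k) (use that NS in auto)
  note S_add = subspace_add[OF sub] and S_diff = subspace_diff[OF sub] and S_scale = subspace_scale[OF sub]
  \<comment> \<open>If \<open>t^a\<close> is sent to \<open>a!\<close> times the head of a string,
    then \<open>s^p t^(a - p)\<close> is sent to \<open>(a - p)!\<close> times its
    \<open>p\<close>-th image. This normalisation turns \<open>N\<close> into the derivation with
    coefficients \<open>a - p\<close> and \<open>b - q\<close>.\<close>
  define F where "F p q = scale (of_nat (fact (a - p) * fact (b - q))) (f p q)" for p q
  \<comment> \<open>The recursion multiplies by one more factor \<open>s1 t2 - s2 t1\<close>,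
    expanded in the functions of the previous level.\<close>
  define G where "G c = rec_nat F (\<lambda>_ g p q. g (Suc p) q - g p (Suc q)) c" for c
  have G0: "G 0 p q = F p q" and GS: "G (Suc c) p q = G c (Suc p) q - G c p (Suc q)" for c p q
    by (simp_all add: G_def)
  \<comment> \<open>\<open>N\<close> annihilates \<open>s1 t2 - s2 t1\<close>, so only the exponents
    \<open>a - c - p\<close> and \<open>b - c - q\<close> of \<open>t1\<close> and \<open>t2\<close>
    contribute. The identity holds modulo \<open>S\<close> because the strings end only modulo
    \<open>S\<close>.\<close>
  have NG: "N (G c p q) - scale (of_nat (a - c - p)) (G c (Suc p) q) - scale (of_nat (b - c - q)) (G c p (Suc q))
      \<in> S (Suc (p + q + c))" if "p + c \<le> a" "q + c \<le> b" for c p q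
    using that
  proof (induction c arbitrary: p q)
    case 0
    define k where "k = (of_nat (fact (a - p) * fact (b - q)) :: 'a)"
    have p: "scale (of_nat (a - p)) (F (Suc p) q) = (if p = a then 0 else scale k (f (Suc p) q))"
    proof (cases "p = a")
      case False
      then have "a - p = Suc (a - Suc p)" using 0 by simp
      then have e: "(a - p) * (fact (a - Suc p) * fact (b - q)) = fact (a - p) * (fact (b - q) :: nat)"
        by (metis fact_Suc mult.assoc of_nat_id)
      show ?thesis unfolding F_def k_def scale_scale of_nat_mult[symmetric] e using False by simp
    qed simp
    have q: "scale (of_nat (b - q)) (F p (Suc q)) = (if q = b then 0 else scale k (f p (Suc q)))"
    proof (cases "q = b")
      case False
      then have "b - q = Suc (b - Suc q)" using 0 by simp
      then have e: "(b - q) * (fact (a - p) * fact (b - Suc q)) = fact (a - p) * (fact (b - q) :: nat)"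
        by (metis fact_Suc mult.assoc mult.commute of_nat_id)
      show ?thesis unfolding F_def k_def scale_scale of_nat_mult[symmetric] e using False by simp
    qed simp
    have "f (Suc a) q \<in> S (Suc (a + q))" "f p (Suc b) \<in> S (Suc (p + b))" for p q
      using f_end[of "Suc a" q] f_end[of p "Suc b"] by simp_all
    moreover have "0 \<in> S c" for c using sub subspace_0 by blast
    moreover have "N (G 0 p q) = scale k (f (Suc p) q) + scale k (f p (Suc q))"
      unfolding G0 F_def k_def by (simp only: N_scale Nf scale_right_distrib)
    ultimately show ?case using S_scale S_add
      by (simp add: G0 p q)
  next
    case (Suc c)
    define x where "x = a - Suc c - p"
    define y where "y = b - Suc c - q"
    have *: "a - c - Suc p = x" "a - c - p = Suc x" "b - c - Suc q = y" "b - c - q = Suc y"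
      using Suc.prems unfolding x_def y_def by auto
    have "N (G c (Suc p) q) - scale (of_nat x) (G c (Suc (Suc p)) q) - scale (of_nat (Suc y)) (G c (Suc p) (Suc q))
        \<in> S (Suc (Suc (p + q + c)))"
      using Suc.IH[of "Suc p" q, unfolded *] Suc.prems by simp
    moreover have "N (G c p (Suc q)) - scale (of_nat (Suc x)) (G c (Suc p) (Suc q)) - scale (of_nat y) (G c p (Suc (Suc q)))
        \<in> S (Suc (Suc (p + q + c)))"
      using Suc.IH[of p "Suc q", unfolded *] Suc.prems by simp
    ultimately have "N (G c (Suc p) q) - scale (of_nat x) (G c (Suc (Suc p)) q) - scale (of_nat (Suc y)) (G c (Suc p) (Suc q))
      - (N (G c p (Suc q)) - scale (of_nat (Suc x)) (G c (Suc p) (Suc q)) - scale (of_nat y) (G c p (Suc (Suc q))))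
      \<in> S (Suc (Suc (p + q + c)))"
      by (rule S_diff)
    then show ?case unfolding x_def[symmetric] y_def[symmetric]
      by (simp add: GS N_diff algebra_simps scale_left_distrib)
  qed
  \<comment> \<open>Each application of \<open>N\<close> lowers the total degree in
    \<open>t1\<close> and \<open>t2\<close>, which is \<open>m\<close> at the start, by one.\<close>
  have NpG: "(N ^^ Suc m) (G c p q) \<in> S (Suc m + (p + q + c))"
    if "p + c \<le> a" "q + c \<le> b" "m = (a - c - p) + (b - c - q)" for m c p q
    using that
  proof (induction m arbitrary: p q)
    case 0
    then show ?case using NG[of p c q] by simp
  next
    case (Suc m)
    let ?s = "N (G c p q) - scale (of_nat (a - c - p)) (G c (Suc p) q) - scale (of_nat (b - c - q)) (G c p (Suc q))"
    have s: "(N ^^ Suc m) ?s \<in> S (Suc (Suc m) + (p + q + c))"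
      using Np_S[OF NG[OF Suc.prems(1,2)], of "Suc m"] by (simp add: ac_simps)
    have x: "scale (of_nat (a - c - p)) ((N ^^ Suc m) (G c (Suc p) q)) \<in> S (Suc (Suc m) + (p + q + c))"
    proof (cases "a - c - p = 0")
      case True
      then show ?thesis using sub subspace_0 by (simp del: funpow.simps)
    next
      case False
      then have "(N ^^ Suc m) (G c (Suc p) q) \<in> S (Suc m + (Suc p + q + c))"
        using Suc.prems by (intro Suc.IH) linarith+
      then show ?thesis by (intro S_scale) (simp del: funpow.simps)
    qed
    have y: "scale (of_nat (b - c - q)) ((N ^^ Suc m) (G c p (Suc q))) \<in> S (Suc (Suc m) + (p + q + c))"
    proof (cases "b - c - q = 0")
      case True
      then show ?thesis using sub subspace_0 by (simp del: funpow.simps)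
    next
      case False
      then have "(N ^^ Suc m) (G c p (Suc q)) \<in> S (Suc m + (p + Suc q + c))"
        using Suc.prems by (intro Suc.IH) linarith+
      then show ?thesis by (intro S_scale) (simp del: funpow.simps)
    qed
    have "N (G c p q) = ?s + scale (of_nat (a - c - p)) (G c (Suc p) q) + scale (of_nat (b - c - q)) (G c p (Suc q))"
      by simp
    then have "(N ^^ Suc (Suc m)) (G c p q) = (N ^^ Suc m) ?s
      + scale (of_nat (a - c - p)) ((N ^^ Suc m) (G c (Suc p) q))
      + scale (of_nat (b - c - q)) ((N ^^ Suc m) (G c p (Suc q)))"
      by (metis Np_add Np_scale funpow_Suc_right comp_apply)
    then show ?case using s x y S_add by metis
  qed
  have "\<forall>p q. p + q = c \<longrightarrow> f p q \<in> S c" for c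
  proof (induction c rule: less_induct)
    case (less c)
    define g where "g = f 0 c"
    \<comment> \<open>In degree \<open>c - 1\<close> everything lies in \<open>S\<close> by
      induction, so \<open>N f = f (Suc p) q + f p (Suc q)\<close> forces the functions of degree
      \<open>c\<close> to alternate in sign: modulo \<open>S\<close> they are all \<open>g\<close>
      or \<open>- g\<close>.\<close>
    have alt: "f p q - scale ((- 1) ^ p) g \<in> S c" if "p + q = c" for p q
      using that
    proof (induction p arbitrary: q)
      case 0
      then show ?case unfolding g_def using sub subspace_0 by simp
    next
      case (Suc p)
      have "f p q \<in> S (p + q)" using less[of "p + q"] Suc.prems by simp
      then have "N (f p q) \<in> S c" using NS[of "f p q" "p + q"] Suc.prems by simp
      then have "f (Suc p) q + f p (Suc q) \<in> S c" using Nf by simp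
      moreover have "f p (Suc q) - scale ((- 1) ^ p) g \<in> S c" using Suc by simp
      ultimately have "f (Suc p) q + f p (Suc q) - (f p (Suc q) - scale ((- 1) ^ p) g) \<in> S c"
        by (rule S_diff)
      then show ?case by simp
    qed
    have "g \<in> S c"
    proof (cases "c \<le> a \<and> c \<le> b")
      case False
      then consider "c > b" | "c > a" by linarith
      then show ?thesis
      proof cases
        case 1
        then show ?thesis using f_end[of 0 c] unfolding g_def by simp
      next
        case 2
        have "f c 0 \<in> S c" using f_end[of c 0] 2 by simp
        then have "f c 0 - (f c 0 - scale ((- 1) ^ c) g) \<in> S c" by (rule S_diff) (rule alt, simp)
        then have "scale ((- 1) ^ c) g \<in> S c" by simp
        then have "scale ((- 1) ^ c) (scale ((- 1) ^ c) g) \<in> S c" by (rule S_scale)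
        moreover have "(- 1) ^ c * (- 1) ^ c = (1 :: 'a)" by (simp flip: power_add)
        ultimately show ?thesis by simp
      qed
    next
      case True
      \<comment> \<open>The signs of \<open>alt\<close> and those of the expansion of
        \<open>(s1 t2 - s2 t1)^k\<close> agree, so nothing cancels: the multiple of \<open>g\<close>
        is a positive integer up to sign, hence invertible.\<close>
      have Gw: "\<exists>w. G k p q - scale ((- 1) ^ (p + k) * of_nat (Suc w)) g \<in> S c" if "p + q + k = c" for k p q
        using that
      proof (induction k arbitrary: p q)
        case 0
        define k where "k = (fact (a - p) * fact (b - q) :: nat)"
        have "scale (of_nat k) (f p q - scale ((- 1) ^ p) g) \<in> S c"
          using alt 0 S_scale by simp
        moreover have "k = Suc (k - 1)" unfolding k_def by simp
        ultimately show ?case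
          unfolding G0 F_def k_def[symmetric]
          by (intro exI[of _ "k - 1"]) (metis add_0_right mult.commute scale_right_diff_distrib scale_scale)
      next
        case (Suc k)
        obtain w1 where w1: "G k (Suc p) q - scale ((- 1) ^ (Suc p + k) * of_nat (Suc w1)) g \<in> S c"
          using Suc.IH[of "Suc p" q] Suc.prems by auto
        obtain w2 where w2: "G k p (Suc q) - scale ((- 1) ^ (p + k) * of_nat (Suc w2)) g \<in> S c"
          using Suc.IH[of p "Suc q"] Suc.prems by auto
        have e: "of_nat (Suc (w1 + Suc w2)) = of_nat (Suc w1) + (of_nat (Suc w2) :: 'a)" by simp
        have "G (Suc k) p q - scale ((- 1) ^ (p + Suc k) * of_nat (Suc (w1 + Suc w2))) g \<in> S c"
          using S_diff[OF w1 w2] unfolding e by (simp add: GS algebra_simps scale_left_distrib del: of_nat_Suc)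
        then show ?case by blast
      qed
      obtain w where w: "G c 0 0 - scale ((- 1) ^ c * of_nat (Suc w)) g \<in> S c"
        using Gw[of 0 0 c] by auto
      \<comment> \<open>This is the first power of \<open>N\<close> that kills the primitive vector
        \<open>G c 0 0\<close> modulo \<open>S\<close>. It meets the bound
        \<open>s + 2 c \<le> a + b + 1\<close> of \<open>inj\<close> with equality.\<close>
      define s where "s = Suc ((a - c) + (b - c))"
      define k where "k = ((- 1) ^ c * of_nat (Suc w) :: 'a)"
      have k: "k \<noteq> 0" unfolding k_def using char0[of w] by (metis mult_eq_0_iff power_eq_0_iff neg_equal_0_iff_equal one_neq_zero)
      have "(N ^^ s) (G c 0 0) \<in> S (c + s)"
        using NpG[of 0 c 0 "(a - c) + (b - c)"] True unfolding s_def by (simp add: ac_simps del: funpow.simps)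
      moreover have "(N ^^ s) (G c 0 0 - scale k g) \<in> S (c + s)" using Np_S w unfolding k_def by blast
      ultimately have "(N ^^ s) (G c 0 0) - (N ^^ s) (G c 0 0 - scale k g) \<in> S (c + s)" by (rule S_diff)
      moreover have "(N ^^ s) (G c 0 0) = (N ^^ s) (G c 0 0 - scale k g) + scale k ((N ^^ s) g)"
        by (simp flip: Np_scale Np_add)
      ultimately have "scale k ((N ^^ s) g) \<in> S (c + s)" by simp
      then have "scale (inverse k) (scale k ((N ^^ s) g)) \<in> S (c + s)" by (rule S_scale)
      then have "(N ^^ s) g \<in> S (c + s)" using k by simp
      moreover have "g \<in> T c" unfolding g_def using fT[of 0 c] by simp
      ultimately show ?thesis using inj[of g c s] True unfolding s_def by simp
    qed
    show ?case
    proof (intro allI impI)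
      fix p q assume "p + q = c"
      then have "f p q - scale ((- 1) ^ p) g + scale ((- 1) ^ p) g \<in> S c"
        using alt S_add S_scale \<open>g \<in> S c\<close> by blast
      then show "f p q \<in> S c" by simp
    qed
  qed
  then show ?thesis by blast
qed

end

section \<open>Relative weight filtrations of filtered Lie algebras\<close>

text \<open>The Jacobi identity is demanded on \<open>g\<close> only: in the application the ambient
  space consists of all functions on the coordinate ring, and those in the Lie algebra are the
  derivations. No topology appears here; it enters \<open>normalizer_M0\<close> as a hypothesis on
  \<open>M 0\<close>.\<close>

locale filtered_lie = vector_space scale
  for scale :: "'f::field_char_0 \<Rightarrow> 'v::ab_group_add \<Rightarrow> 'v" +
  fixes g :: "'v set" and br :: "'v \<Rightarrow> 'v \<Rightarrow> 'v" and W :: "int \<Rightarrow> 'v set" and N :: 'v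
    and M :: "int \<Rightarrow> 'v set"
  assumes br_lin: "\<And>x. Vector_Spaces.linear scale scale (br x)"
    and br_skew: "\<And>x y. br x y = - br y x"
    and jacobi: "\<And>x y z. x \<in> g \<Longrightarrow> y \<in> g \<Longrightarrow> z \<in> g \<Longrightarrow> br x (br y z) = br (br x y) z + br y (br x z)"
    and subW: "\<And>i. subspace (W i)" and W_nonneg: "\<And>i. i \<ge> 0 \<Longrightarrow> W i = g"
    and W_mono: "\<And>i j. i \<le> j \<Longrightarrow> W i \<subseteq> W j"
    and br_W: "\<And>i j x y. x \<in> W i \<Longrightarrow> y \<in> W j \<Longrightarrow> br x y \<in> W (i + j)"
    and N: "N \<in> g"
    and subM: "\<And>k. subspace (M k)" and M_g: "\<And>k. M k \<subseteq> g" and M_mono: "\<And>i j. i \<le> j \<Longrightarrow> M i \<subseteq> M j"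
    and N_M: "\<And>k x. x \<in> M k \<Longrightarrow> br N x \<in> M (k - 2)"
    and gr: "\<And>m. monodromy_filtration scale (br N) (W m) (W (m - 1))
      (\<lambda>k. {x + y | x y. x \<in> M (m + k) \<inter> W m \<and> y \<in> W (m - 1)})"
begin

definition MW :: "int \<Rightarrow> int \<Rightarrow> 'v set" where
  "MW k l = {x + y | x y. x \<in> M k \<and> y \<in> W l}"

text \<open>The index is shifted by \<open>m\<close>, which centres the filtration at 0 as in
  \<open>monodromy_filtration\<close>.\<close>

definition Gr :: "int \<Rightarrow> int \<Rightarrow> 'v set" where
  "Gr m k = {x + y | x y. x \<in> M (m + k) \<inter> W m \<and> y \<in> W (m - 1)}"

lemma gr': "monodromy_filtration scale (br N) (W m) (W (m - 1)) (Gr m)"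
  using gr unfolding Gr_def[abs_def] by simp

lemma br_add_right: "br x (y + z) = br x y + br x z"
  and br_scale_right: "br x (scale c y) = scale c (br x y)"
  and br_diff_right: "br x (y - z) = br x y - br x z"
  using module_hom.add module_hom.scale module_hom.diff br_lin[of x, unfolded Vector_Spaces.linear_iff_module_hom]
  by blast+

lemma br_add_left: "br (x + y) z = br x z + br y z"
  and br_scale_left: "br (scale c x) z = scale c (br x z)"
  and br_diff_left: "br (x - y) z = br x z - br y z"
  by (simp_all add: br_skew[of _ z] br_add_right br_scale_right br_diff_right)

lemma br_self: "br x x = 0"
proof -
  have "br x x + br x x = 0" using br_skew[of x x] by (metis add.right_inverse)
  then have "scale 2 (br x x) = 0" using scale_left_distrib[of 1 1 "br x x"] by simp
  then show ?thesis by simp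
qed

lemma W_g: "W i \<subseteq> g"
  using W_mono[of i 0] W_mono[of 0 i] W_nonneg[of 0] W_nonneg[of i] by (cases "i \<ge> 0") auto

lemma br_g: "x \<in> g \<Longrightarrow> y \<in> g \<Longrightarrow> br x y \<in> g"
  using br_W[of x 0 y 0] W_nonneg[of 0] by simp

lemma br_W_g: "x \<in> g \<Longrightarrow> y \<in> W i \<Longrightarrow> br x y \<in> W i"
  using br_W[of x 0 y i] W_nonneg[of 0] by simp

lemma sub_MW: "subspace (MW k l)"
  unfolding MW_def by (rule subspace_sums[OF subM subW])

lemma M_MW: "M k \<subseteq> MW k l" and W_MW: "W l \<subseteq> MW k l"
proof -
  have "x + 0 \<in> MW k l" if "x \<in> M k" for x
    unfolding MW_def using that subW subspace_0 by blast
  then show "M k \<subseteq> MW k l" by auto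
  have "0 + x \<in> MW k l" if "x \<in> W l" for x
    unfolding MW_def using that subM subspace_0 by blast
  then show "W l \<subseteq> MW k l" by auto
qed

lemma Npow_M: "x \<in> M k \<Longrightarrow> (br N ^^ p) x \<in> M (k - 2 * int p)"
proof (induction p)
  case (Suc p)
  then show ?case using N_M[of "(br N ^^ p) x" "k - 2 * int p"] by (simp add: algebra_simps)
qed simp

lemma Npow_W: "x \<in> W k \<Longrightarrow> (br N ^^ p) x \<in> W k"
  by (induction p) (auto intro: br_W_g N)

lemma Gr_subset: "Gr l (k - l) \<subseteq> MW k (l - 1)"
  unfolding Gr_def MW_def by auto

text \<open>\<open>F_strings\<close> speaks of \<open>W i\<close> modulo \<open>W (i - 1)\<close>.
  By \<open>F_kernel\<close> a string head is congruent to some \<open>u\<close> in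
  \<open>M (i + n)\<close>, so its images lie in \<open>M a\<close> itself. What remains after
  subtracting them lies both in \<open>M a\<close> and in \<open>W (i - 1)\<close> and is left to
  \<open>low\<close>.\<close>

lemma M_string_induct:
  assumes x: "x \<in> M a" "x \<in> W i"
    and add: "\<And>x y. x \<in> M a \<inter> W i \<Longrightarrow> y \<in> M a \<inter> W i \<Longrightarrow> Q x \<Longrightarrow> Q y \<Longrightarrow> Q (x + y)"
    and sc: "\<And>c x. x \<in> M a \<inter> W i \<Longrightarrow> Q x \<Longrightarrow> Q (scale c x)"
    and low: "\<And>x. x \<in> M a \<Longrightarrow> x \<in> W (i - 1) \<Longrightarrow> Q x"
    and str: "\<And>x n p. x \<in> M (i + int n) \<Longrightarrow> x \<in> W i \<Longrightarrow> (br N ^^ Suc n) x \<in> W (i - 1) \<Longrightarrow>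
      i + int n - 2 * int p = a \<Longrightarrow> Q ((br N ^^ p) x)"
  shows "Q x"
proof -
  interpret F: monodromy_filtration scale "br N" "W i" "W (i - 1)" "Gr i" by (rule gr')
  let ?S = "{u + w | u w. u \<in> {u \<in> M a \<inter> W i. Q u} \<and> w \<in> W (i - 1)}"
  have Q0: "Q 0" using low subM subW subspace_0 by blast
  have sub: "subspace {u \<in> M a \<inter> W i. Q u}"
    by (rule subspaceI) (use Q0 add sc subM subW subspace_0 subspace_add subspace_scale in auto)
  have "Gr i (a - i) \<subseteq> ?S"
  proof (rule F.F_strings)
    show "subspace ?S" by (rule subspace_sums[OF sub subW])
  next
    show "W (i - 1) \<subseteq> ?S"
    proof
      fix w assume "w \<in> W (i - 1)"
      then have "0 + w \<in> ?S" using subspace_0[OF sub] by blast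
      then show "w \<in> ?S" by simp
    qed
  next
    fix n p x assume x: "x \<in> W i" "(br N ^^ Suc n) x \<in> W (i - 1)" and p: "int n - 2 * int p = a - i"
    have "x \<in> Gr i (int n)" using F.F_kernel x by blast
    then obtain u w where u: "x = u + w" "u \<in> M (i + int n)" "u \<in> W i" "w \<in> W (i - 1)"
      unfolding Gr_def by blast
    have "(br N ^^ Suc n) u = (br N ^^ Suc n) x - (br N ^^ Suc n) w" unfolding u(1) F.Npow_add by simp
    then have "(br N ^^ Suc n) u \<in> W (i - 1)" using x(2) Npow_W[OF u(4)] subW subspace_diff by metis
    then have "Q ((br N ^^ p) u)" using str[OF u(2,3)] p by simp
    moreover have "(br N ^^ p) u \<in> M a" using Npow_M[OF u(2), of p] p by (simp add: algebra_simps)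
    moreover have "(br N ^^ p) u \<in> W i" using Npow_W u by blast
    moreover have "(br N ^^ p) w \<in> W (i - 1)" using Npow_W u by blast
    ultimately show "(br N ^^ p) x \<in> ?S" unfolding u(1) F.Npow_add by blast
  qed
  moreover have "x + 0 \<in> Gr i (a - i)"
    unfolding Gr_def using x subspace_0[OF subW[of "i - 1"]]
    by (intro CollectI exI[of _ x] exI[of _ 0]) auto
  ultimately obtain u w where u: "x = u + w" "u \<in> M a" "u \<in> W i" "Q u" "w \<in> W (i - 1)" by auto
  have "w = x - u" using u by simp
  then have "w \<in> M a" using u x subM subspace_diff by blast
  moreover have "w \<in> W i" using u W_mono[of "i - 1" i] by auto
  ultimately show ?thesis using u add low by blast
qed

text \<open>Modulo smaller weights the terms of \<open>M\<close> are spanned by strings of \<open>br N\<close>, and the brackets of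
  two strings are located by the decomposition of a tensor product of strings.\<close>

lemma br_M_MW:
  assumes "x \<in> M a" and "y \<in> M b"
  shows "br x y \<in> MW (a + b) l"
proof -
  have "\<forall>a b. \<forall>x \<in> M a. \<forall>y \<in> M b. br x y \<in> MW (a + b) l"
  proof (rule int_descent_mono[where a = 0])
    show "\<forall>a b. \<forall>x \<in> M a. \<forall>y \<in> M b. br x y \<in> MW (a + b) 0"
      using W_MW[of 0] W_nonneg[of 0] br_g M_g by blast
  next
    fix s t :: int assume "s \<le> t" and "\<forall>a b. \<forall>x \<in> M a. \<forall>y \<in> M b. br x y \<in> MW (a + b) s"
    moreover have "MW k s \<subseteq> MW k t" for k
      unfolding MW_def using W_mono[OF \<open>s \<le> t\<close>] by blast
    ultimately show "\<forall>a b. \<forall>x \<in> M a. \<forall>y \<in> M b. br x y \<in> MW (a + b) t" by blast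
  next
    fix l :: int
    assume l: "\<forall>a b. \<forall>x \<in> M a. \<forall>y \<in> M b. br x y \<in> MW (a + b) l"
    interpret L: monodromy_filtration scale "br N" "W l" "W (l - 1)" "Gr l" by (rule gr')
    define S where "S k = MW k (l - 1)" for k
    have subS: "subspace (S k)" for k unfolding S_def by (rule sub_MW)
    have NS: "br N x \<in> S (k - 2)" if x: "x \<in> S k" for x k
    proof -
      obtain u w where "x = u + w" "u \<in> M k" "w \<in> W (l - 1)" using x unfolding S_def MW_def by blast
      then show ?thesis unfolding S_def MW_def using N_M br_W_g[OF N] br_add_right by blast
    qed
    \<comment> \<open>The part of \<open>z\<close> in \<open>M k\<close> does no harm, so only its
      part \<open>w\<close> in \<open>W l\<close> matters, and \<open>F_reflect\<close> in weight
      \<open>l\<close> applies to that.\<close>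
    have inj: "z \<in> S k" if z: "z \<in> MW k l" "(br N ^^ s) z \<in> S (k - 2 * int s)" and s: "int s \<le> k - l + 1" for z k s
    proof -
      obtain u w where u: "z = u + w" "u \<in> M k" "w \<in> W l" using z unfolding MW_def by blast
      obtain u' w' where u': "(br N ^^ s) z = u' + w'" "u' \<in> M (k - 2 * int s)" "w' \<in> W (l - 1)"
        using z unfolding S_def MW_def by blast
      have eq: "(br N ^^ s) w - w' = u' - (br N ^^ s) u" using u' unfolding u L.Npow_add by (simp add: algebra_simps)
      have "u' - (br N ^^ s) u \<in> M (k - 2 * int s)" using u' Npow_M[OF u(2)] subM subspace_diff by blast
      moreover have "u' - (br N ^^ s) u \<in> W l"
        unfolding eq[symmetric] using Npow_W[OF u(3), of s] u'(3) W_mono[of "l - 1" l] subW subspace_diff by auto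
      moreover have "(br N ^^ s) w = (u' - (br N ^^ s) u) + w'" using eq by (simp add: algebra_simps)
      moreover have "l + (k - l - 2 * int s) = k - 2 * int s" by simp
      ultimately have "(br N ^^ s) w \<in> Gr l (k - l - 2 * int s)"
        unfolding Gr_def using u'(3) by auto
      then have "w \<in> Gr l (k - l)" using L.F_reflect u(3) s by blast
      then have "w \<in> S k" unfolding S_def using Gr_subset by blast
      then show ?thesis unfolding u using u(2) M_MW S_def subS subspace_add by blast
    qed
    \<comment> \<open>Induction on \<open>i + j\<close>. If \<open>i + j < l\<close>, the bracket
      lies in \<open>W (l - 1)\<close> already. Otherwise the cases of smaller \<open>i\<close> or
      \<open>j\<close> are known, and \<open>M_string_induct\<close> reduces both factors to members
      of strings.\<close>
    have main: "\<forall>a b x y. x \<in> M a \<inter> W i \<longrightarrow> y \<in> M b \<inter> W j \<longrightarrow> br x y \<in> S (a + b)"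
      if "nat (i + j - l + 1) = n" for i j n
      using that
    proof (induction n arbitrary: i j rule: less_induct)
      case (less n)
      show ?case
      proof (cases "i + j < l")
        case True
        then show ?thesis unfolding S_def using br_W W_mono[of "i + j" "l - 1"] W_MW by fastforce
      next
        case False
        have IH1: "br x y \<in> S (a + b)" if "x \<in> M a" "x \<in> W (i - 1)" "y \<in> M b" "y \<in> W j" for x y a b
          using less.IH[of "nat (i - 1 + j - l + 1)" "i - 1" j] that less.prems False by auto
        have IH2: "br x y \<in> S (a + b)" if "x \<in> M a" "x \<in> W i" "y \<in> M b" "y \<in> W (j - 1)" for x y a b
          using less.IH[of "nat (i + (j - 1) - l + 1)" i "j - 1"] that less.prems False by auto
        have str: "br ((br N ^^ p) x) ((br N ^^ q) y) \<in> S (i + int n + (j + int m) - 2 * int (p + q))"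
          if x: "x \<in> M (i + int n)" "x \<in> W i" "(br N ^^ Suc n) x \<in> W (i - 1)"
            and y: "y \<in> M (j + int m)" "y \<in> W j" "(br N ^^ Suc m) y \<in> W (j - 1)" for x y n m p q
        proof -
          define k where "k c = i + int n + (j + int m) - 2 * int c" for c :: nat
          have kS: "k (Suc c) = k c - 2" for c unfolding k_def by simp
          have k2: "k (c + s) = k c - 2 * int s" for c s unfolding k_def by simp
          have mx: "(br N ^^ p) x \<in> M (i + int n - 2 * int p)" for p using Npow_M x by blast
          have my: "(br N ^^ q) y \<in> M (j + int m - 2 * int q)" for q using Npow_M y by blast
          have kpq: "i + int n - 2 * int p + (j + int m - 2 * int q) = k (p + q)" for p q
            unfolding k_def by simp
          have "br ((br N ^^ p) x) ((br N ^^ q) y) \<in> S (k (p + q))"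
          \<comment> \<open>\<open>T\<close> is what the hypothesis on \<open>l\<close> provides,
            and \<open>S\<close> is what is wanted for \<open>l - 1\<close>. Past its end a string
            drops to smaller weight, where \<open>IH1\<close> or \<open>IH2\<close> applies.\<close>
          proof (rule tensor_strings[where T = "\<lambda>c. MW (k c) l" and N = "br N" and a = n and b = m
                and S = "\<lambda>c. S (k c)" and f = "\<lambda>p q. br ((br N ^^ p) x) ((br N ^^ q) y)"])
            show "br ((br N ^^ p) x) ((br N ^^ q) y) \<in> MW (k (p + q)) l" for p q
              using l mx my kpq by metis
            show "br N (br ((br N ^^ p) x) ((br N ^^ q) y)) =
              br ((br N ^^ Suc p) x) ((br N ^^ q) y) + br ((br N ^^ p) x) ((br N ^^ Suc q) y)" for p q
              using jacobi[OF N, of "(br N ^^ p) x" "(br N ^^ q) y"] mx my M_g by auto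
            show "br ((br N ^^ p) x) ((br N ^^ q) y) \<in> S (k (p + q))" if pq: "p > n \<or> q > m" for p q
            proof (cases "p > n")
              case True
              have "(br N ^^ p) x = (br N ^^ (p - Suc n)) ((br N ^^ Suc n) x)"
                using True by (metis Suc_leI comp_apply funpow_add le_add_diff_inverse2)
              then have "(br N ^^ p) x \<in> W (i - 1)" using Npow_W[OF x(3)] by metis
              then show ?thesis using IH1[OF mx _ my] Npow_W[OF y(2)] kpq by metis
            next
              case False
              then have "(br N ^^ q) y = (br N ^^ (q - Suc m)) ((br N ^^ Suc m) y)"
                using pq by (metis Suc_leI comp_apply funpow_add le_add_diff_inverse2)
              then have "(br N ^^ q) y \<in> W (j - 1)" using Npow_W[OF y(3)] by metis
              then show ?thesis using IH2[OF mx _ my] Npow_W[OF x(2)] kpq by metis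
            qed
            show "z \<in> S (k c)" if "z \<in> MW (k c) l" "(br N ^^ s) z \<in> S (k (c + s))" "s + 2 * c \<le> n + m + 1" for c s z
            proof (rule inj[OF that(1)])
              show "(br N ^^ s) z \<in> S (k c - 2 * int s)" using that(2) k2 by simp
              \<comment> \<open>Here \<open>l \<le> i + j\<close> enters: the tensor product is
                centred at \<open>i + j\<close>, the monodromy filtration of weight \<open>l\<close>
                at \<open>l\<close>.\<close>
              show "int s \<le> k c - l + 1" using that(3) False unfolding k_def by linarith
            qed
          qed (rule of_nat_neq_0 br_lin subS | use NS kS in simp)+
          then show ?thesis unfolding k_def by simp
        qed
        show ?thesis
        proof (intro allI impI)
          fix a b x y assume x: "x \<in> M a \<inter> W i" and y: "y \<in> M b \<inter> W j"
          have yb: "br x' y \<in> S (i + int n - 2 * int p + b)"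
            if x': "x' = (br N ^^ p) x0" "x0 \<in> M (i + int n)" "x0 \<in> W i" "(br N ^^ Suc n) x0 \<in> W (i - 1)"
            for x' x0 n p
          proof (rule M_string_induct[where x = y and a = b and i = j])
            have x'M: "x' \<in> M (i + int n - 2 * int p)" "x' \<in> W i" using Npow_M Npow_W x' by auto
            show "br x' (u + v) \<in> S (i + int n - 2 * int p + b)"
              if "br x' u \<in> S (i + int n - 2 * int p + b)" "br x' v \<in> S (i + int n - 2 * int p + b)" for u v
              using that br_add_right subS subspace_add by metis
            show "br x' (scale c u) \<in> S (i + int n - 2 * int p + b)"
              if "br x' u \<in> S (i + int n - 2 * int p + b)" for c u
              using that br_scale_right subS subspace_scale by metis
            show "br x' u \<in> S (i + int n - 2 * int p + b)" if "u \<in> M b" "u \<in> W (j - 1)" for u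
              using IH2 x'M that by blast
            show "br x' ((br N ^^ q) u) \<in> S (i + int n - 2 * int p + b)"
              if "u \<in> M (j + int m)" "u \<in> W j" "(br N ^^ Suc m) u \<in> W (j - 1)" "j + int m - 2 * int q = b" for u m q
            proof -
              have "i + int n + (j + int m) - 2 * int (p + q) = i + int n - 2 * int p + b" using that by simp
              then show ?thesis using str[OF x'(2-4) that(1-3), of p q] x'(1) by metis
            qed
          qed (use y in auto)
          show "br x y \<in> S (a + b)"
          proof (rule M_string_induct[where x = x and a = a and i = i])
            show "br (u + v) y \<in> S (a + b)" if "br u y \<in> S (a + b)" "br v y \<in> S (a + b)" for u v
              using that br_add_left subS subspace_add by metis
            show "br (scale c u) y \<in> S (a + b)" if "br u y \<in> S (a + b)" for c u
              using that br_scale_left subS subspace_scale by metis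
            show "br u y \<in> S (a + b)" if "u \<in> M a" "u \<in> W (i - 1)" for u
              using IH1 y that by blast
            show "br ((br N ^^ p) u) y \<in> S (a + b)"
              if "u \<in> M (i + int n)" "u \<in> W i" "(br N ^^ Suc n) u \<in> W (i - 1)" "i + int n - 2 * int p = a" for u n p
              using yb[OF refl that(1-3), of p] that(4) by simp
          qed (use x in auto)
        qed
      qed
    qed
    have "M a \<subseteq> W 0" for a using M_g W_nonneg by auto
    then show "\<forall>a b. \<forall>x \<in> M a. \<forall>y \<in> M b. br x y \<in> MW (a + b) (l - 1)"
      using main[OF refl, of 0 0] unfolding S_def by blast
  qed
  then show ?thesis using assms by blast
qed

theorem normalizer_M0:
  assumes e: "e \<in> g" and h: "br N (br N e) - scale 2 N \<in> W (- 1)"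
    and closed: "\<And>x. x \<in> g \<Longrightarrow> (\<And>l. x \<in> MW 0 l) \<Longrightarrow> x \<in> M 0"
  shows "{x \<in> g. \<forall>y \<in> M 0. br x y \<in> M 0} = M 0"
proof
  have br00: "br x y \<in> M 0" if "x \<in> M 0" "y \<in> M 0" for x y
  proof (rule closed)
    show "br x y \<in> g" using that br_g M_g by blast
    show "br x y \<in> MW 0 l" for l using br_M_MW[OF that] by simp
  qed
  then show "M 0 \<subseteq> {x \<in> g. \<forall>y \<in> M 0. br x y \<in> M 0}" using M_g by blast
  interpret F0: monodromy_filtration scale "br N" "W 0" "W (-1)" "Gr 0" using gr'[of 0] by simp
  \<comment> \<open>One more bracket with \<open>N\<close> kills \<open>2 N\<close>, so the third
    power of \<open>ad N\<close> annihilates \<open>e\<close> modulo \<open>W (- 1)\<close>. Hence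
    \<open>e\<close> has weight at most 2 and \<open>[N, e]\<close> weight at most 0.\<close>
  have "br N (br N (br N e) - scale 2 N) \<in> W (-1)" using br_W_g[OF N h] .
  then have "(br N ^^ Suc 2) e \<in> W (-1)" by (simp add: br_diff_right br_scale_right br_self numeral_2_eq_2)
  then have "e \<in> Gr 0 (int 2)" using F0.F_kernel[of e 2] e W_nonneg by simp
  then have "br N e \<in> Gr 0 0" using F0.NF by fastforce
  then obtain h' w where h': "br N e = h' + w" "h' \<in> M 0" "w \<in> W (-1)" unfolding Gr_def by auto
  have h'g: "h' \<in> g" using h' M_g by blast
  have Nh': "br N h' - scale 2 N \<in> W (-1)"
  proof -
    have "br N h' - scale 2 N = (br N (br N e) - scale 2 N) - br N w" unfolding h' by (simp add: br_add_right)
    then show ?thesis using h br_W_g[OF N h'(3)] subW subspace_diff by metis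
  qed
  show "{x \<in> g. \<forall>y \<in> M 0. br x y \<in> M 0} \<subseteq> M 0"
  proof
    fix x assume "x \<in> {x \<in> g. \<forall>y \<in> M 0. br x y \<in> M 0}"
    then have x: "x \<in> g" "br h' x \<in> M 0" using h' br_skew[of h' x] subM subspace_neg by auto
    have "x \<in> MW 0 l" for l
    proof (rule int_descent_mono[where a = 0])
      show "x \<in> MW 0 0" using W_MW W_nonneg[of 0] x by blast
    next
      show "x \<in> MW 0 t" if "s \<le> t" "x \<in> MW 0 s" for s t
        using that W_mono[of s t] unfolding MW_def by blast
    next
      fix m assume "x \<in> MW 0 m"
      show "x \<in> MW 0 (m - 1)"
      proof (cases "m \<le> 0")
        case False
        then show ?thesis using W_nonneg[of "m - 1"] x W_MW by auto
      next
        case m: True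
        obtain u v where u: "x = u + v" "u \<in> M 0" "v \<in> W m" using \<open>x \<in> MW 0 m\<close> unfolding MW_def by blast
        have vg: "v \<in> g" using u W_g by blast
        \<comment> \<open>Replacing \<open>x\<close> by \<open>v\<close> changes the bracket by
          \<open>[h', u]\<close>, which lies in \<open>M 0\<close> because \<open>M 0\<close> is a
          subalgebra.\<close>
        have hv: "br h' v \<in> M 0"
          using x(2) br00[OF h'(2) u(2)] subspace_diff[OF subM] unfolding u(1) br_add_right
          by (metis add_diff_cancel_left')
        interpret F: monodromy_filtration scale "br N" "W m" "W (m - 1)" "Gr m" by (rule gr')
        \<comment> \<open>\<open>h'\<close> differs from \<open>[N, e]\<close> by \<open>w\<close>
          in \<open>W (- 1)\<close>, and \<open>ad w\<close> acts as 0 on the quotient of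
          \<open>W m\<close> by \<open>W (m - 1)\<close>.\<close>
        have eigen: "br h' z - scale (of_int k) z \<in> Gr m (k - 1)" if "z \<in> Gr m k" for z k
        proof (rule F.F_eigen[where E = "br e"])
          show "br N (br e z) - br e (br N z) - br h' z \<in> W (m - 1)" if "z \<in> W m" for z
          proof -
            have "br N (br e z) - br e (br N z) - br h' z = br w z"
              using jacobi[OF N e subsetD[OF W_g that]] h'(1) by (simp add: br_add_left)
            then show ?thesis using br_W[OF h'(3) that] by simp
          qed
          show "br N (br h' z) - br h' (br N z) - scale 2 (br N z) \<in> W (m - 1)" if "z \<in> W m" for z
          proof -
            have "br N (br h' z) - br h' (br N z) - scale 2 (br N z) = br (br N h' - scale 2 N) z"
              using jacobi[OF N h'g subsetD[OF W_g that]] by (simp add: br_diff_left br_scale_left)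
            then show ?thesis using br_W[OF Nh' that] by simp
          qed
        qed (use that br_lin br_W_g h'g e in auto)
        \<comment> \<open>In the filtration of weight \<open>m\<close>, recentred at 0, the index of
          \<open>M 0\<close> is \<open>- m\<close>.\<close>
        have hv0: "br h' v \<in> Gr m (- m)"
        proof -
          have "br h' v + 0 \<in> Gr m (- m)"
            unfolding Gr_def using hv br_W_g[OF h'g u(3)] subspace_0[OF subW[of "m - 1"]]
            by (intro CollectI exI[of _ "br h' v"] exI[of _ 0]) auto
          then show ?thesis by simp
        qed
        obtain t0 where t0: "Gr m t0 = W m" using F.top by blast
        have "v \<in> Gr m (- m)"
        proof (rule int_descent_mono[where a = t0])
          show "v \<in> Gr m t0" using t0 u by simp
        next
          fix t assume t: "t > - m" and v: "v \<in> Gr m t"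
          have "br h' v \<in> Gr m (t - 1)" using hv0 F.mono[of "- m" "t - 1"] t by auto
          then have "br h' v - (br h' v - scale (of_int t) v) \<in> Gr m (t - 1)"
            by (rule subspace_diff[OF F.subF _ eigen[OF v]])
          then have "scale (of_int t) v \<in> Gr m (t - 1)" by simp
          then have "scale (inverse (of_int t)) (scale (of_int t) v) \<in> Gr m (t - 1)"
            by (rule subspace_scale[OF F.subF])
          \<comment> \<open>Since \<open>m \<le> 0\<close>, every \<open>t > - m\<close> is
            positive, so the eigenvalue can be divided out.\<close>
          moreover have "(of_int t :: 'f) \<noteq> 0" using t m by simp
          ultimately show "v \<in> Gr m (t - 1)" by simp
        next
          show "v \<in> Gr m t" if "s \<le> t" "v \<in> Gr m s" for s t using that F.mono by blast
        qed
        then have "v \<in> MW 0 (m - 1)" using Gr_subset[of m 0] by auto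
        then show ?thesis unfolding u(1) using u(2) M_MW sub_MW subspace_add by blast
      qed
    qed
    then show "x \<in> M 0" using closed x by blast
  qed
qed

end

section \<open>Automorphisms and derivations of the complex numbers\<close>

text \<open>A subring of a product ring, to be extended until it is the graph of a homomorphism.\<close>

definition graph_ring :: "('a::comm_ring_1 \<times> 'b::comm_ring_1) set \<Rightarrow> bool" where
  "graph_ring \<Gamma> \<longleftrightarrow> (1, 1) \<in> \<Gamma> \<and> (\<forall>a b. (a, b) \<in> \<Gamma> \<longrightarrow> (- a, - b) \<in> \<Gamma>) \<and>
     (\<forall>a b c d. (a, b) \<in> \<Gamma> \<and> (c, d) \<in> \<Gamma> \<longrightarrow> (a + c, b + d) \<in> \<Gamma> \<and> (a * c, b * d) \<in> \<Gamma>)"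

text \<open>For an additive relation a trivial fibre over 0 is single-valuedness.\<close>

definition functional :: "('a::zero \<times> 'b::zero) set \<Rightarrow> bool" where
  "functional \<Gamma> \<longleftrightarrow> (\<forall>b. (0, b) \<in> \<Gamma> \<longrightarrow> b = 0)"

definition gpoly :: "('a::zero \<times> 'b::zero) set \<Rightarrow> 'a poly \<Rightarrow> 'b poly \<Rightarrow> bool" where
  "gpoly \<Gamma> p r \<longleftrightarrow> (\<forall>i. (coeff p i, coeff r i) \<in> \<Gamma>)"

text \<open>The subring generated by the subring \<open>\<Gamma>\<close> and the pair
  \<open>(a, b)\<close>: polynomials over the product ring, separated into their two
  components.\<close>

definition adjoin :: "('a::comm_ring_1 \<times> 'b::comm_ring_1) set \<Rightarrow> 'a \<Rightarrow> 'b \<Rightarrow> ('a \<times> 'b) set" where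
  "adjoin \<Gamma> a b = {(poly p a, poly r b) | p r. gpoly \<Gamma> p r}"

lemma adjoinI: "gpoly \<Gamma> p r \<Longrightarrow> x = poly p a \<Longrightarrow> y = poly r b \<Longrightarrow> (x, y) \<in> adjoin \<Gamma> a b"
  unfolding adjoin_def by blast

lemma gpoly_pCons: "gpoly \<Gamma> (pCons a p) (pCons b r) \<longleftrightarrow> (a, b) \<in> \<Gamma> \<and> gpoly \<Gamma> p r"
  unfolding gpoly_def by (auto simp: coeff_pCons split: nat.splits)

lemma gpoly_converse: "gpoly (\<Gamma>\<inverse>) r p \<longleftrightarrow> gpoly \<Gamma> p r"
  unfolding gpoly_def by simp

lemma adjoin_converse: "adjoin (\<Gamma>\<inverse>) b a = (adjoin \<Gamma> a b)\<inverse>"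
  unfolding adjoin_def by (auto simp: gpoly_converse)

lemma graph_ring_converse: "graph_ring \<Gamma> \<Longrightarrow> graph_ring (\<Gamma>\<inverse>)"
  unfolding graph_ring_def by auto

lemma gpoly_0_left: "functional \<Gamma> \<Longrightarrow> gpoly \<Gamma> 0 r \<Longrightarrow> r = 0"
  unfolding functional_def gpoly_def by (auto intro: poly_eqI)

context
  fixes \<Gamma> :: "('a::comm_ring_1 \<times> 'b::comm_ring_1) set"
  assumes ring: "graph_ring \<Gamma>"
begin

lemma graph_ring_closed:
  "(1, 1) \<in> \<Gamma>" "(a, b) \<in> \<Gamma> \<Longrightarrow> (- a, - b) \<in> \<Gamma>"
  "(a, b) \<in> \<Gamma> \<Longrightarrow> (c, d) \<in> \<Gamma> \<Longrightarrow> (a + c, b + d) \<in> \<Gamma>"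
  "(a, b) \<in> \<Gamma> \<Longrightarrow> (c, d) \<in> \<Gamma> \<Longrightarrow> (a * c, b * d) \<in> \<Gamma>"
  using ring unfolding graph_ring_def by blast+

lemma graph_ring_0: "(0, 0) \<in> \<Gamma>"
  using graph_ring_closed(3)[OF graph_ring_closed(1) graph_ring_closed(2)[OF graph_ring_closed(1)]] by simp

lemma graph_ring_diff: "(a, b) \<in> \<Gamma> \<Longrightarrow> (c, d) \<in> \<Gamma> \<Longrightarrow> (a - c, b - d) \<in> \<Gamma>"
  using graph_ring_closed(3)[OF _ graph_ring_closed(2)] by fastforce

lemma graph_ring_of_nat: "(of_nat n, of_nat n) \<in> \<Gamma>"
  by (induction n) (auto intro: graph_ring_0 graph_ring_closed)

lemma gpoly_0: "gpoly \<Gamma> 0 0"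
  unfolding gpoly_def using graph_ring_0 by simp

lemma gpoly_add: "gpoly \<Gamma> p r \<Longrightarrow> gpoly \<Gamma> q s \<Longrightarrow> gpoly \<Gamma> (p + q) (r + s)"
  unfolding gpoly_def using graph_ring_closed by simp

lemma gpoly_minus: "gpoly \<Gamma> p r \<Longrightarrow> gpoly \<Gamma> (- p) (- r)"
  unfolding gpoly_def using graph_ring_closed by simp

lemma gpoly_diff: "gpoly \<Gamma> p r \<Longrightarrow> gpoly \<Gamma> q s \<Longrightarrow> gpoly \<Gamma> (p - q) (r - s)"
  unfolding gpoly_def using graph_ring_diff by simp

lemma gpoly_smult: "(a, b) \<in> \<Gamma> \<Longrightarrow> gpoly \<Gamma> p r \<Longrightarrow> gpoly \<Gamma> (smult a p) (smult b r)"
  unfolding gpoly_def using graph_ring_closed by simp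

lemma gpoly_monom: "(a, b) \<in> \<Gamma> \<Longrightarrow> gpoly \<Gamma> (monom a n) (monom b n)"
  unfolding gpoly_def using graph_ring_0 by simp

lemma gpoly_mult: "gpoly \<Gamma> p r \<Longrightarrow> gpoly \<Gamma> q s \<Longrightarrow> gpoly \<Gamma> (p * q) (r * s)"
proof -
  assume pr: "gpoly \<Gamma> p r" and qs: "gpoly \<Gamma> q s"
  have "(\<Sum>i\<in>I. coeff p i * coeff q (n - i), \<Sum>i\<in>I. coeff r i * coeff s (n - i)) \<in> \<Gamma>"
    if "finite I" for n and I :: "nat set"
    using that
    by induction (use pr qs graph_ring_0 graph_ring_closed in \<open>auto simp: gpoly_def\<close>)
  then show ?thesis unfolding gpoly_def coeff_mult by blast
qed

lemma gpoly_exists: "\<forall>i. coeff p i \<in> Domain \<Gamma> \<Longrightarrow> \<exists>r. gpoly \<Gamma> p r"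
proof (induction p)
  case 0
  then show ?case using gpoly_0 by blast
next
  case (pCons a p)
  have "\<forall>i. coeff p i \<in> Domain \<Gamma>" using pCons.prems by (metis coeff_pCons_Suc)
  moreover have "a \<in> Domain \<Gamma>" using pCons.prems by (metis coeff_pCons_0)
  ultimately show ?case using pCons gpoly_pCons by blast
qed

lemma graph_ring_adjoin: "graph_ring (adjoin \<Gamma> a b)"
proof -
  have "gpoly \<Gamma> [:1:] [:1:]"
    using graph_ring_closed gpoly_0 by (auto simp: gpoly_pCons)
  then have "(1, 1) \<in> adjoin \<Gamma> a b" by (rule adjoinI) auto
  moreover have "(- x, - y) \<in> adjoin \<Gamma> a b" if xy: "(x, y) \<in> adjoin \<Gamma> a b" for x y
  proof -
    obtain p r where *: "gpoly \<Gamma> p r" "x = poly p a" "y = poly r b" using xy unfolding adjoin_def by blast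
    show ?thesis using adjoinI[OF gpoly_minus[OF *(1)]] *(2,3) by simp
  qed
  moreover have "(x + x', y + y') \<in> adjoin \<Gamma> a b \<and> (x * x', y * y') \<in> adjoin \<Gamma> a b"
    if xy: "(x, y) \<in> adjoin \<Gamma> a b" "(x', y') \<in> adjoin \<Gamma> a b" for x y x' y'
  proof -
    obtain p r p' r' where *: "gpoly \<Gamma> p r" "gpoly \<Gamma> p' r'" "x = poly p a" "y = poly r b"
      "x' = poly p' a" "y' = poly r' b" using xy unfolding adjoin_def by blast
    show ?thesis using adjoinI[OF gpoly_add[OF *(1,2)]] adjoinI[OF gpoly_mult[OF *(1,2)]] *(3-6) by simp
  qed
  ultimately show ?thesis unfolding graph_ring_def by blast
qed

lemma adjoin_superset: "\<Gamma> \<subseteq> adjoin \<Gamma> a b"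
proof
  fix z assume "z \<in> \<Gamma>"
  obtain x y where z: "z = (x, y)" by fastforce
  then have "gpoly \<Gamma> [:x:] [:y:]" using \<open>z \<in> \<Gamma>\<close> gpoly_0 by (simp add: gpoly_pCons)
  moreover have "z = (poly [:x:] a, poly [:y:] b)" using z by simp
  ultimately show "z \<in> adjoin \<Gamma> a b" unfolding adjoin_def by blast
qed

lemma adjoin_new: "(a, b) \<in> adjoin \<Gamma> a b"
proof -
  have "gpoly \<Gamma> [:0, 1:] [:0, 1:]"
    using gpoly_0 graph_ring_0 graph_ring_closed by (simp add: gpoly_pCons)
  moreover have "(a, b) = (poly [:0, 1:] a, poly [:0, 1:] b)" by simp
  ultimately show ?thesis unfolding adjoin_def by blast
qed

end

lemma functional_adjoin:
  assumes "graph_ring \<Gamma>" and "\<And>p r. gpoly \<Gamma> p r \<Longrightarrow> poly p a = 0 \<Longrightarrow> poly r b = 0"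
  shows "functional (adjoin \<Gamma> a b)"
  unfolding functional_def adjoin_def using assms by fastforce

text \<open>The domain of \<open>\<Gamma>\<close> is only a ring, over which a polynomial cannot be
  made monic; so minimal polynomials are minimal in degree and determined at best up to
  scalars.\<close>

definition min_gpoly :: "('a::comm_ring_1 \<times> 'b::comm_ring_1) set \<Rightarrow> 'a \<Rightarrow> 'a poly \<Rightarrow> 'b poly \<Rightarrow> bool" where
  "min_gpoly \<Gamma> a p0 r0 \<longleftrightarrow> gpoly \<Gamma> p0 r0 \<and> p0 \<noteq> 0 \<and> poly p0 a = 0 \<and>
     (\<forall>p r. gpoly \<Gamma> p r \<and> p \<noteq> 0 \<and> poly p a = 0 \<longrightarrow> degree p0 \<le> degree p)"

lemma min_gpoly_exists:
  assumes "gpoly \<Gamma> p r" and "p \<noteq> 0" and "poly p a = 0"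
  shows "\<exists>p0 r0. min_gpoly \<Gamma> a p0 r0 \<and> degree p0 \<le> degree p"
proof -
  let ?P = "\<lambda>q. gpoly \<Gamma> (fst q) (snd q) \<and> fst q \<noteq> 0 \<and> poly (fst q) a = 0"
  obtain q where q: "?P q" "\<And>q'. ?P q' \<Longrightarrow> degree (fst q) \<le> degree (fst q')"
    using exists_least_iff[of "\<lambda>n. \<exists>q. ?P q \<and> degree (fst q) = n"] assms
    by (metis fst_conv linorder_not_le snd_conv)
  have "min_gpoly \<Gamma> a (fst q) (snd q)"
    unfolding min_gpoly_def using q(1) q(2)[of "(x, y)" for x y] by (metis fst_conv snd_conv)
  moreover have "degree (fst q) \<le> degree p" using q(2)[of "(p, r)"] assms by simp
  ultimately show ?thesis by blast
qed

lemma min_gpoly_degree: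
  fixes a :: "'a::idom"
  assumes "min_gpoly \<Gamma> a p0 r0"
  shows "degree p0 > 0"
  using assms unfolding min_gpoly_def
  by (metis degree_eq_zeroE gr0I mult_zero_right add.right_neutral pCons_0_0 poly_0 poly_pCons)

lemma pseudo_division:
  fixes a :: "'a::idom"
  assumes ring: "graph_ring \<Gamma>" and min: "min_gpoly \<Gamma> a p0 r0"
    and f: "functional \<Gamma>" and pr: "gpoly \<Gamma> p r" "poly p a = 0"
  shows "\<exists>l l' s t. (l, l') \<in> \<Gamma> \<and> l \<noteq> 0 \<and> gpoly \<Gamma> s t \<and> smult l p = s * p0 \<and> smult l' r = t * r0"
proof -
  define Q where "Q p r \<longleftrightarrow> (\<exists>l l' s t. (l, l') \<in> \<Gamma> \<and> l \<noteq> 0 \<and> gpoly \<Gamma> s t \<and> smult l p = s * p0 \<and> smult l' r = t * r0)" for p r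
  have "\<forall>p r. gpoly \<Gamma> p r \<and> poly p a = 0 \<and> (p = 0 \<or> degree p < n) \<longrightarrow>
    Q p r" for n
  proof (induction n)
    case 0
    show ?case
    proof (intro allI impI)
      fix p r assume "gpoly \<Gamma> p r \<and> poly p a = 0 \<and> (p = 0 \<or> degree p < 0)"
      then have "p = 0" "r = 0" using gpoly_0_left[OF f] by auto
      then show "Q p r"
        unfolding Q_def using graph_ring_closed(1)[OF ring] gpoly_0[OF ring]
        by (intro exI[of _ 1] exI[of _ 1] exI[of _ 0] exI[of _ 0]) auto
    qed
  next
    case (Suc n)
    show ?case
    proof (intro allI impI)
      fix p r assume p: "gpoly \<Gamma> p r \<and> poly p a = 0 \<and> (p = 0 \<or> degree p < Suc n)"
      show "Q p r"
      proof (cases "p = 0 \<or> degree p < n")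
        case True
        then show ?thesis using Suc[rule_format, of p r] p by blast
      next
        case False
        then have n: "degree p = n" "p \<noteq> 0" using p by auto
        have deg: "degree p0 \<le> n" "degree p0 > 0"
          using min p n min_gpoly_degree[OF min] unfolding min_gpoly_def by blast+
        have p0r0: "gpoly \<Gamma> p0 r0" "p0 \<noteq> 0" "poly p0 a = 0" using min unfolding min_gpoly_def by auto
        define l where "l = coeff p0 (degree p0)"
        define l' where "l' = coeff r0 (degree p0)"
        define m where "m = coeff p n"
        define m' where "m' = coeff r n"
        define d where "d = n - degree p0"
        have l: "(l, l') \<in> \<Gamma>" "l \<noteq> 0" unfolding l_def l'_def using p0r0 by (auto simp: gpoly_def)
        have m: "(m, m') \<in> \<Gamma>" unfolding m_def m'_def using p by (simp add: gpoly_def)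
        define p1 where "p1 = smult l p - monom m d * p0"
        define r1 where "r1 = smult l' r - monom m' d * r0"
        have g1: "gpoly \<Gamma> p1 r1" unfolding p1_def r1_def
          by (intro gpoly_diff gpoly_smult gpoly_mult gpoly_monom ring l m p0r0) (use p in simp)
        have a1: "poly p1 a = 0" unfolding p1_def using p p0r0 by simp
        have "degree (monom m d * p0) \<le> n"
          using degree_mult_le[of "monom m d" p0] degree_monom_le[of m d] deg unfolding d_def by linarith
        then have "degree p1 \<le> n" unfolding p1_def using n by (intro degree_diff_le) auto
        moreover have "coeff p1 n = 0"
          unfolding p1_def using deg n by (simp add: coeff_monom_mult d_def l_def m_def)
        ultimately have "p1 = 0 \<or> degree p1 < n" using eq_zero_or_degree_less by blast
        then obtain k k' s t where k: "(k, k') \<in> \<Gamma>" "k \<noteq> 0" "gpoly \<Gamma> s t" "smult k p1 = s * p0" "smult k' r1 = t * r0"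
          using Suc[rule_format, of p1 r1] g1 a1 unfolding Q_def by blast
        have "smult (k * l) p = (s + smult k (monom m d)) * p0"
          using k(4) unfolding p1_def by (simp add: algebra_simps smult_diff_right)
        moreover have "smult (k' * l') r = (t + smult k' (monom m' d)) * r0"
          using k(5) unfolding r1_def by (simp add: algebra_simps smult_diff_right)
        moreover have "gpoly \<Gamma> (s + smult k (monom m d)) (t + smult k' (monom m' d))"
          by (intro gpoly_add gpoly_smult gpoly_monom ring k m)
        moreover have "(k * l, k' * l') \<in> \<Gamma>" "k * l \<noteq> 0" using k l graph_ring_closed[OF ring] by auto
        ultimately show ?thesis unfolding Q_def by blast
      qed
    qed
  qed
  from this[of "Suc (degree p)"] have "Q p r" using pr by simp
  then show ?thesis unfolding Q_def .
qed

text \<open>Up to a factor \<open>l\<close>, every relation at \<open>a\<close> is a multiple of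
  \<open>p0\<close>, and its partner the same multiple of \<open>r0\<close>, so a root of
  \<open>r0\<close> satisfies it. The codomain may have zero divisors, as the dual numbers do; hence
  the condition \<open>nz\<close>.\<close>

lemma functional_adjoin_algebraic:
  fixes a :: "'a::idom"
  assumes ring: "graph_ring \<Gamma>" and f: "functional \<Gamma>" and min: "min_gpoly \<Gamma> a p0 r0"
    and b: "poly r0 b = 0" and nz: "\<And>l l' z. (l, l') \<in> \<Gamma> \<Longrightarrow> l \<noteq> 0 \<Longrightarrow> l' * z = 0 \<Longrightarrow> z = 0"
  shows "functional (adjoin \<Gamma> a b)"
proof (rule functional_adjoin[OF ring])
  fix p r assume "gpoly \<Gamma> p r" "poly p a = 0"
  then obtain l l' s t where l: "(l, l') \<in> \<Gamma>" "l \<noteq> 0" "smult l' r = t * r0"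
    using pseudo_division[OF ring min f] by blast
  have "l' * poly r b = poly (smult l' r) b" by simp
  also have "\<dots> = 0" unfolding l(3) using b by simp
  finally show "poly r b = 0" using nz l by blast
qed

subsection \<open>Automorphisms\<close>

text \<open>Describes algebraically closed subfields; negatives and inverses arise as roots of
  linear polynomials.\<close>

definition root_closed :: "complex set \<Rightarrow> bool" where
  "root_closed S \<longleftrightarrow> (\<forall>x \<in> S. \<forall>y \<in> S. x + y \<in> S \<and> x * y \<in> S) \<and>
     (\<forall>p a. p \<noteq> 0 \<and> (\<forall>i. coeff p i \<in> S) \<and> poly p a = 0 \<longrightarrow> a \<in> S)"

definition root_closure :: "complex set \<Rightarrow> complex set" where
  "root_closure R = \<Inter> {S. R \<subseteq> S \<and> root_closed S}"

lemma root_closed_poly: "root_closed S \<Longrightarrow> a \<in> S \<Longrightarrow> \<forall>i. coeff p i \<in> S \<Longrightarrow> poly p a \<in> S"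
proof (induction p)
  case 0
  then show ?case by (metis coeff_0 poly_0)
next
  case (pCons x p)
  have "\<forall>i. coeff p i \<in> S" using pCons.prems by (metis coeff_pCons_Suc)
  moreover have "x \<in> S" using pCons.prems by (metis coeff_pCons_0)
  ultimately show ?case using pCons unfolding root_closed_def by simp
qed

lemma root_closed_root_closure: "root_closed (root_closure R)"
  unfolding root_closed_def
proof (intro conjI ballI allI impI)
  show "x + y \<in> root_closure R" "x * y \<in> root_closure R" if "x \<in> root_closure R" "y \<in> root_closure R" for x y
    using that unfolding root_closure_def root_closed_def by auto
  fix p a assume p: "p \<noteq> 0 \<and> (\<forall>i. coeff p i \<in> root_closure R) \<and> poly p a = 0"
  have "a \<in> S" if S: "R \<subseteq> S" "root_closed S" for S
  proof -
    have "\<forall>i. coeff p i \<in> S" using p S unfolding root_closure_def by blast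
    then show ?thesis using p S(2) unfolding root_closed_def by metis
  qed
  then show "a \<in> root_closure R" unfolding root_closure_def by blast
qed

lemma root_closure_superset: "R \<subseteq> root_closure R"
  unfolding root_closure_def by blast

lemma root_closure_least: "R \<subseteq> root_closure S \<Longrightarrow> root_closure R \<subseteq> root_closure S"
  using root_closed_root_closure[of S] unfolding root_closure_def[of R] by blast

lemma root_closure_mono: "R \<subseteq> S \<Longrightarrow> root_closure R \<subseteq> root_closure S"
  using root_closure_least root_closure_superset by blast

text \<open>The last two conditions ensure that a maximal partial isomorphism is defined and surjective
  everywhere.\<close>

definition partial_iso :: "(complex \<times> complex) set \<Rightarrow> bool" where
  "partial_iso \<Gamma> \<longleftrightarrow> graph_ring \<Gamma> \<and> functional \<Gamma> \<and> functional (\<Gamma>\<inverse>) \<and>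
     Domain \<Gamma> \<subseteq> root_closure (Range \<Gamma>) \<and> Range \<Gamma> \<subseteq> root_closure (Domain \<Gamma>)"

lemma partial_iso_converse: "partial_iso \<Gamma> \<Longrightarrow> partial_iso (\<Gamma>\<inverse>)"
  unfolding partial_iso_def using graph_ring_converse by auto

lemma gpoly_degree:
  assumes "functional \<Gamma>" "functional (\<Gamma>\<inverse>)" "gpoly \<Gamma> p r"
  shows "degree r = degree p" and "r = 0 \<longleftrightarrow> p = 0"
proof -
  have c: "coeff p i = 0 \<longleftrightarrow> coeff r i = 0" for i
  proof -
    have "(coeff p i, coeff r i) \<in> \<Gamma>" using assms(3) unfolding gpoly_def by blast
    then show ?thesis using assms(1,2) unfolding functional_def by (metis converse.intros)
  qed
  then show "r = 0 \<longleftrightarrow> p = 0" by (simp add: poly_eq_iff)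
  have "degree r \<le> degree p" by (rule degree_le) (use c coeff_eq_0 in blast)
  moreover have "degree p \<le> degree r" by (rule degree_le) (use c coeff_eq_0 in blast)
  ultimately show "degree r = degree p" by simp
qed

text \<open>For the converse relation \<open>r0\<close> has to be minimal at \<open>b\<close>. A
  minimal \<open>r\<close> with partner \<open>p\<close> divides \<open>r0\<close> up to a scalar,
  so \<open>p\<close> divides \<open>p0\<close> up to a scalar. The cofactor has smaller degree than
  \<open>p0\<close> and cannot vanish at \<open>a\<close>; so \<open>p\<close> does, and the degrees
  agree.\<close>

lemma functional_adjoin_iso:
  assumes iso: "partial_iso \<Gamma>" and min: "min_gpoly \<Gamma> a p0 r0" and b: "poly r0 b = 0"
  shows "functional (adjoin \<Gamma> a b)" and "functional ((adjoin \<Gamma> a b)\<inverse>)"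
proof -
  have ring: "graph_ring \<Gamma>" and f: "functional \<Gamma>" and f': "functional (\<Gamma>\<inverse>)"
    using iso unfolding partial_iso_def by auto
  have p0r0: "gpoly \<Gamma> p0 r0" "p0 \<noteq> 0" "poly p0 a = 0" using min unfolding min_gpoly_def by auto
  have nz: "z = 0" if "(l, l') \<in> \<Gamma>" "l \<noteq> 0" "l' * z = 0" for l l' z
    using that f' unfolding functional_def by auto
  have nz': "z = 0" if "(l, l') \<in> \<Gamma>\<inverse>" "l \<noteq> 0" "l' * z = 0" for l l' z
    using that f unfolding functional_def by auto
  show "functional (adjoin \<Gamma> a b)"
    by (rule functional_adjoin_algebraic[OF ring f min b nz])
  have r0: "r0 \<noteq> 0" "degree r0 = degree p0" using gpoly_degree[OF f f' p0r0(1)] p0r0 by auto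
  obtain r p where rp: "min_gpoly (\<Gamma>\<inverse>) b r p" "degree r \<le> degree r0"
    using min_gpoly_exists[of "\<Gamma>\<inverse>" r0 p0 b] p0r0 r0 b gpoly_converse by blast
  have pr: "gpoly \<Gamma> p r" "r \<noteq> 0" "poly r b = 0" using rp gpoly_converse unfolding min_gpoly_def by blast+
  have deg: "degree r = degree p" "p \<noteq> 0" using gpoly_degree[OF f f' pr(1)] pr by auto
  have "degree r0 \<le> degree r"
  proof -
    obtain l' l t s where l: "(l', l) \<in> \<Gamma>\<inverse>" "l' \<noteq> 0" "gpoly (\<Gamma>\<inverse>) t s" "smult l' r0 = t * r" "smult l p0 = s * p"
      using pseudo_division[OF graph_ring_converse[OF ring] rp(1) f', of r0 p0] p0r0 b gpoly_converse by blast
    have lnz: "l \<noteq> 0" using l f unfolding functional_def by auto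
    have "poly (smult l p0) a = 0" using p0r0 by simp
    then have "poly s a = 0 \<or> poly p a = 0" unfolding l(5) by simp
    moreover have s: "s \<noteq> 0" using l(5) lnz p0r0 by auto
    have "gpoly \<Gamma> s t" using l gpoly_converse by blast
    have d: "degree p0 = degree s + degree p"
      using arg_cong[OF l(5), of degree] lnz s deg by (simp add: degree_mult_eq)
    have "degree p > 0" using min_gpoly_degree[OF rp(1)] deg by simp
    then have "poly s a \<noteq> 0"
      using min s \<open>gpoly \<Gamma> s t\<close> d unfolding min_gpoly_def by fastforce
    ultimately have "poly p a = 0" by blast
    then have "degree p0 \<le> degree p" using min pr(1) deg unfolding min_gpoly_def by blast
    then show ?thesis using r0 deg by simp
  qed
  then have "min_gpoly (\<Gamma>\<inverse>) b r0 p0"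
    using rp p0r0 r0 b gpoly_converse unfolding min_gpoly_def by (metis le_antisym)
  then show "functional ((adjoin \<Gamma> a b)\<inverse>)"
    unfolding adjoin_converse[symmetric]
    by (rule functional_adjoin_algebraic[OF graph_ring_converse[OF ring] f' _ p0r0(3) nz'])
qed

lemma Domain_adjoin: "x \<in> Domain (adjoin \<Gamma> a b) \<Longrightarrow> \<exists>p. (\<forall>i. coeff p i \<in> Domain \<Gamma>) \<and> x = poly p a"
  unfolding adjoin_def gpoly_def by blast

lemma Range_adjoin: "x \<in> Range (adjoin \<Gamma> a b) \<Longrightarrow> \<exists>p. (\<forall>i. coeff p i \<in> Range \<Gamma>) \<and> x = poly p b"
  unfolding adjoin_def gpoly_def by blast

lemma partial_iso_adjoin:
  assumes iso: "partial_iso \<Gamma>" and f: "functional (adjoin \<Gamma> a b)" "functional ((adjoin \<Gamma> a b)\<inverse>)"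
    and a: "a \<in> root_closure (Range (adjoin \<Gamma> a b))" and b: "b \<in> root_closure (Domain (adjoin \<Gamma> a b))"
  shows "partial_iso (adjoin \<Gamma> a b)"
proof -
  have ring: "graph_ring \<Gamma>" using iso unfolding partial_iso_def by simp
  have sup: "\<Gamma> \<subseteq> adjoin \<Gamma> a b" by (rule adjoin_superset[OF ring])
  have "Domain \<Gamma> \<subseteq> root_closure (Range (adjoin \<Gamma> a b))"
    using iso root_closure_mono[of "Range \<Gamma>" "Range (adjoin \<Gamma> a b)"] sup unfolding partial_iso_def by blast
  then have "Domain (adjoin \<Gamma> a b) \<subseteq> root_closure (Range (adjoin \<Gamma> a b))"
    using Domain_adjoin root_closed_poly[OF root_closed_root_closure a] by blast
  moreover have "Range \<Gamma> \<subseteq> root_closure (Domain (adjoin \<Gamma> a b))"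
    using iso root_closure_mono[of "Domain \<Gamma>" "Domain (adjoin \<Gamma> a b)"] sup unfolding partial_iso_def by blast
  then have "Range (adjoin \<Gamma> a b) \<subseteq> root_closure (Domain (adjoin \<Gamma> a b))"
    using Range_adjoin root_closed_poly[OF root_closed_root_closure b] by blast
  ultimately show ?thesis unfolding partial_iso_def using f graph_ring_adjoin[OF ring] by blast
qed

lemma partial_iso_adjoin_algebraic:
  assumes iso: "partial_iso \<Gamma>" and min: "min_gpoly \<Gamma> a p0 r0" and b: "poly r0 b = 0"
  shows "partial_iso (adjoin \<Gamma> a b)"
proof (rule partial_iso_adjoin[OF iso functional_adjoin_iso[OF assms]])
  have ring: "graph_ring \<Gamma>" using iso unfolding partial_iso_def by simp
  have sup: "\<Gamma> \<subseteq> adjoin \<Gamma> a b" by (rule adjoin_superset[OF ring])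
  have p0r0: "gpoly \<Gamma> p0 r0" "p0 \<noteq> 0" "poly p0 a = 0" using min unfolding min_gpoly_def by auto
  have r0: "r0 \<noteq> 0" using gpoly_degree p0r0 iso unfolding partial_iso_def by blast
  have "Domain \<Gamma> \<subseteq> root_closure (Range (adjoin \<Gamma> a b))"
    using iso root_closure_mono[of "Range \<Gamma>" "Range (adjoin \<Gamma> a b)"] sup unfolding partial_iso_def by blast
  then have "\<forall>i. coeff p0 i \<in> root_closure (Range (adjoin \<Gamma> a b))" using p0r0 unfolding gpoly_def by blast
  then show "a \<in> root_closure (Range (adjoin \<Gamma> a b))"
    using root_closed_root_closure p0r0 unfolding root_closed_def by blast
  have "Range \<Gamma> \<subseteq> root_closure (Domain (adjoin \<Gamma> a b))"
    using iso root_closure_mono[of "Domain \<Gamma>" "Domain (adjoin \<Gamma> a b)"] sup unfolding partial_iso_def by blast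
  then have "\<forall>i. coeff r0 i \<in> root_closure (Domain (adjoin \<Gamma> a b))" using p0r0 unfolding gpoly_def by blast
  then show "b \<in> root_closure (Domain (adjoin \<Gamma> a b))"
    using root_closed_root_closure r0 b unfolding root_closed_def by blast
qed

lemma partial_iso_maximal_root_closed:
  assumes iso: "partial_iso \<Gamma>" and max: "\<And>a b. partial_iso (adjoin \<Gamma> a b) \<Longrightarrow> (a, b) \<in> \<Gamma>"
  shows "root_closed (Domain \<Gamma>)"
  unfolding root_closed_def
proof (intro conjI allI impI ballI)
  have ring: "graph_ring \<Gamma>" using iso unfolding partial_iso_def by simp
  show "x + y \<in> Domain \<Gamma>" "x * y \<in> Domain \<Gamma>" if "x \<in> Domain \<Gamma>" "y \<in> Domain \<Gamma>" for x y
    using that graph_ring_closed[OF ring] by blast+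
  fix p a assume p: "p \<noteq> 0 \<and> (\<forall>i. coeff p i \<in> Domain \<Gamma>) \<and> poly p a = 0"
  then obtain r where "gpoly \<Gamma> p r" using gpoly_exists[OF ring] by blast
  then obtain p0 r0 where min: "min_gpoly \<Gamma> a p0 r0" using min_gpoly_exists p by blast
  then have "degree r0 > 0"
    using min_gpoly_degree[OF min] gpoly_degree[of \<Gamma> p0 r0] iso unfolding partial_iso_def min_gpoly_def by simp
  then have "\<not> constant (poly r0)" by (simp add: constant_degree)
  then obtain b where "poly r0 b = 0" using Fundamental_Theorem_Algebra.fundamental_theorem_of_algebra by blast
  then have "partial_iso (adjoin \<Gamma> a b)" using partial_iso_adjoin_algebraic iso min by blast
  then show "a \<in> Domain \<Gamma>" using max by blast
qed

text \<open>Domain and range are both closed under roots by maximality, hence equal by the last two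
  conditions of \<open>partial_iso\<close>. An element outside is transcendental over both, so it
  could be adjoined as a fixed point.\<close>

lemma partial_iso_maximal_total:
  assumes iso: "partial_iso \<Gamma>" and max: "\<And>a b. partial_iso (adjoin \<Gamma> a b) \<Longrightarrow> (a, b) \<in> \<Gamma>"
  shows "Domain \<Gamma> = UNIV" and "Range \<Gamma> = UNIV"
proof -
  have ring: "graph_ring \<Gamma>" and f: "functional \<Gamma>" "functional (\<Gamma>\<inverse>)"
    using iso unfolding partial_iso_def by auto
  have d: "root_closed (Domain \<Gamma>)" by (rule partial_iso_maximal_root_closed[OF assms])
  have "root_closed (Domain (\<Gamma>\<inverse>))"
  proof (rule partial_iso_maximal_root_closed)
    show "partial_iso (\<Gamma>\<inverse>)" by (rule partial_iso_converse[OF iso])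
    show "(a, b) \<in> \<Gamma>\<inverse>" if "partial_iso (adjoin (\<Gamma>\<inverse>) a b)" for a b
      using partial_iso_converse[OF that] max[of b a] unfolding adjoin_converse by simp
  qed
  then have r: "root_closed (Range \<Gamma>)" by simp
  have DR: "Domain \<Gamma> = Range \<Gamma>"
    using iso d r unfolding partial_iso_def root_closure_def by blast
  show D: "Domain \<Gamma> = UNIV"
  proof (rule ccontr)
    assume "Domain \<Gamma> \<noteq> UNIV"
    then obtain a where a: "a \<notin> Domain \<Gamma>" by blast
    have p0: "p = 0" if "\<forall>i. coeff p i \<in> Domain \<Gamma>" "poly p a = 0" for p
      using that a d unfolding root_closed_def by blast
    have "functional (adjoin \<Gamma> a a)"
    proof (rule functional_adjoin[OF ring])
      fix p r assume "gpoly \<Gamma> p r" "poly p a = 0"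
      then have "p = 0" using p0 unfolding gpoly_def by blast
      then have "r = 0" using gpoly_0_left[OF f(1)] \<open>gpoly \<Gamma> p r\<close> by blast
      then show "poly r a = 0" by simp
    qed
    moreover have "functional (adjoin (\<Gamma>\<inverse>) a a)"
    proof (rule functional_adjoin[OF graph_ring_converse[OF ring]])
      fix p r assume "gpoly (\<Gamma>\<inverse>) p r" "poly p a = 0"
      then have "p = 0" using p0 unfolding gpoly_def DR by blast
      then have "r = 0" using gpoly_0_left[OF f(2)] \<open>gpoly (\<Gamma>\<inverse>) p r\<close> by blast
      then show "poly r a = 0" by simp
    qed
    moreover have "a \<in> Range (adjoin \<Gamma> a a)" "a \<in> Domain (adjoin \<Gamma> a a)"
      using adjoin_new[OF ring, of a a] by blast+
    then have "a \<in> root_closure (Range (adjoin \<Gamma> a a))" "a \<in> root_closure (Domain (adjoin \<Gamma> a a))"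
      using root_closure_superset by blast+
    ultimately have "partial_iso (adjoin \<Gamma> a a)"
      unfolding adjoin_converse by (intro partial_iso_adjoin[OF iso])
    then show False using max a by blast
  qed
  show "Range \<Gamma> = UNIV" using D DR by simp
qed

lemma partial_iso_extends:
  assumes iso: "partial_iso \<Gamma>0"
  shows "\<exists>\<Gamma>. \<Gamma>0 \<subseteq> \<Gamma> \<and> partial_iso \<Gamma> \<and> Domain \<Gamma> = UNIV \<and> Range \<Gamma> = UNIV"
proof -
  let ?A = "{\<Gamma>. \<Gamma>0 \<subseteq> \<Gamma> \<and> partial_iso \<Gamma>}"
  have "\<exists>\<Gamma>\<in>?A. \<forall>X\<in>?A. \<Gamma> \<subseteq> X \<longrightarrow> X = \<Gamma>"
  proof (rule subset_Zorn_nonempty)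
    show "?A \<noteq> {}" using iso by blast
    fix C assume C: "C \<noteq> {}" "subset.chain ?A C"
    then have CA: "\<And>\<Gamma>. \<Gamma> \<in> C \<Longrightarrow> \<Gamma>0 \<subseteq> \<Gamma> \<and> partial_iso \<Gamma>" and ch: "\<And>X Y. X \<in> C \<Longrightarrow> Y \<in> C \<Longrightarrow> X \<subseteq> Y \<or> Y \<subseteq> X"
      unfolding subset_chain_def by auto
    have rg: "graph_ring X" if "X \<in> C" for X using CA that unfolding partial_iso_def by simp
    have "graph_ring (\<Union>C)"
      unfolding graph_ring_def
    proof (intro conjI allI impI)
      show "(1, 1) \<in> \<Union>C" using C rg graph_ring_closed(1) by blast
      show "(- a, - b) \<in> \<Union>C" if "(a, b) \<in> \<Union>C" for a b
        using that rg graph_ring_closed(2) by blast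
      fix a b c d assume "(a, b) \<in> \<Union>C \<and> (c, d) \<in> \<Union>C"
      then obtain X Y where "X \<in> C" "Y \<in> C" "(a, b) \<in> X" "(c, d) \<in> Y" by blast
      then obtain Z where Z: "Z \<in> C" "(a, b) \<in> Z" "(c, d) \<in> Z" using ch by blast
      then show "(a + c, b + d) \<in> \<Union>C" "(a * c, b * d) \<in> \<Union>C" using graph_ring_closed(3,4)[OF rg[OF Z(1)] Z(2,3)] by blast+
    qed
    moreover have "functional X" "functional (X\<inverse>)" if "X \<in> C" for X
      using CA that unfolding partial_iso_def by auto
    then have "functional (\<Union>C)" "functional ((\<Union>C)\<inverse>)"
      unfolding functional_def by blast+
    moreover have "Domain (\<Union>C) \<subseteq> root_closure (Range (\<Union>C))"
    proof
      fix x assume "x \<in> Domain (\<Union>C)"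
      then obtain X where X: "X \<in> C" "x \<in> Domain X" by blast
      then have "x \<in> root_closure (Range X)" using CA unfolding partial_iso_def by blast
      then show "x \<in> root_closure (Range (\<Union>C))" using root_closure_mono[of "Range X" "Range (\<Union>C)"] X by blast
    qed
    moreover have "Range (\<Union>C) \<subseteq> root_closure (Domain (\<Union>C))"
    proof
      fix x assume "x \<in> Range (\<Union>C)"
      then obtain X where X: "X \<in> C" "x \<in> Range X" by blast
      then have "x \<in> root_closure (Domain X)" using CA unfolding partial_iso_def by blast
      then show "x \<in> root_closure (Domain (\<Union>C))" using root_closure_mono[of "Domain X" "Domain (\<Union>C)"] X by blast
    qed
    moreover have "\<Gamma>0 \<subseteq> \<Union>C" using C CA by blast
    ultimately show "\<Union>C \<in> ?A" unfolding partial_iso_def mem_Collect_eq by (intro conjI)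
  qed
  then obtain \<Gamma> where A: "\<Gamma> \<in> ?A" and max: "\<forall>X\<in>?A. \<Gamma> \<subseteq> X \<longrightarrow> X = \<Gamma>" by (rule bexE)
  have \<Gamma>: "\<Gamma>0 \<subseteq> \<Gamma>" "partial_iso \<Gamma>" using A by auto
  have ring: "graph_ring \<Gamma>" using \<Gamma> unfolding partial_iso_def by simp
  have new: "(a, b) \<in> \<Gamma>" if "partial_iso (adjoin \<Gamma> a b)" for a b
  proof -
    have sup: "\<Gamma> \<subseteq> adjoin \<Gamma> a b" by (rule adjoin_superset[OF ring])
    then have "adjoin \<Gamma> a b \<in> ?A" using \<Gamma> that by simp
    then have "adjoin \<Gamma> a b = \<Gamma>" using max sup by simp
    then show ?thesis using adjoin_new[OF ring, of a b] by simp
  qed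
  have "Domain \<Gamma> = UNIV" "Range \<Gamma> = UNIV" by (rule partial_iso_maximal_total[OF \<Gamma>(2) new], assumption)+
  then show ?thesis using \<Gamma> by (intro exI[of _ \<Gamma>] conjI)
qed

definition rat_graph :: "(complex \<times> complex) set" where
  "rat_graph = {(q, q) | q. q \<in> \<rat>}"

lemma partial_iso_rat_graph: "partial_iso rat_graph"
proof -
  have "Domain rat_graph = \<rat>" "Range rat_graph = \<rat>" unfolding rat_graph_def by auto
  then show ?thesis unfolding partial_iso_def
    using root_closure_superset[of \<rat>] by (auto simp: graph_ring_def functional_def rat_graph_def)
qed

lemma gpoly_rat_graph: "gpoly rat_graph p r \<longleftrightarrow> r = p \<and> (\<forall>i. coeff p i \<in> \<rat>)"
  unfolding gpoly_def rat_graph_def poly_eq_iff by auto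

text \<open>An algebraic irrational number has a minimal polynomial of degree at least 2, of which
  it is a simple root because the derivative has smaller degree; it can be sent to another root. A
  transcendental \<open>c\<close> can be sent to \<open>2 c\<close>.\<close>

lemma partial_iso_moves:
  assumes c: "c \<notin> \<rat>"
  shows "\<exists>\<Gamma> c'. partial_iso \<Gamma> \<and> (c, c') \<in> \<Gamma> \<and> c' \<noteq> c"
proof (cases "\<exists>p. p \<noteq> 0 \<and> (\<forall>i. coeff p i \<in> \<rat>) \<and> poly p c = 0")
  case True
  then obtain p0 r0 where min: "min_gpoly rat_graph c p0 r0"
    using min_gpoly_exists gpoly_rat_graph by blast
  have p0: "r0 = p0" "\<forall>i. coeff p0 i \<in> \<rat>" "p0 \<noteq> 0" "poly p0 c = 0"
    using min gpoly_rat_graph unfolding min_gpoly_def by auto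
  obtain q where q: "p0 = [:- c, 1:] * q" using p0 by (metis dvdE poly_eq_0_iff_dvd)
  have "q \<noteq> 0" using p0 q by auto
  then have dq: "degree p0 = Suc (degree q)" unfolding q by (subst degree_mult_eq) auto
  have "degree q > 0"
  proof (rule ccontr)
    assume "\<not> degree q > 0"
    then have "degree p0 = 1" using dq by simp
    then have "poly p0 c = coeff p0 0 + coeff p0 1 * c" by (simp add: poly_altdef)
    then have "c = - coeff p0 0 / coeff p0 1"
      using p0 \<open>degree p0 = 1\<close> by (metis add_eq_0_iff leading_coeff_0_iff minus_equation_iff nonzero_mult_div_cancel_left)
    moreover have "coeff p0 0 \<in> \<rat>" "coeff p0 1 \<in> \<rat>" using p0 by auto
    ultimately have "c \<in> \<rat>" by (simp add: Rats_divide Rats_minus_iff)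
    then show False using c by simp
  qed
  then have "\<not> constant (poly q)" by (simp add: constant_degree)
  then obtain c' where c': "poly q c' = 0" using Fundamental_Theorem_Algebra.fundamental_theorem_of_algebra by blast
  have "c' \<noteq> c"
  proof
    assume "c' = c"
    moreover have "pderiv p0 = [:- c, 1:] * pderiv q + q * pderiv [:- c, 1:]"
      unfolding q by (rule pderiv_mult)
    ultimately have "poly (pderiv p0) c = 0" using c' by simp
    moreover have "gpoly rat_graph (pderiv p0) (pderiv p0)"
      using p0 gpoly_rat_graph by (simp add: coeff_pderiv)
    moreover have "pderiv p0 \<noteq> 0" using dq pderiv_eq_0_iff[of p0] by simp
    ultimately have "degree p0 \<le> degree (pderiv p0)" using min unfolding min_gpoly_def by blast
    then show False using dq degree_pderiv[of p0] by simp
  qed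
  moreover have "poly r0 c' = 0" using p0 q c' by simp
  ultimately show ?thesis
    using partial_iso_adjoin_algebraic[OF partial_iso_rat_graph min] adjoin_new partial_iso_rat_graph
    unfolding partial_iso_def by blast
next
  case False
  have ring: "graph_ring rat_graph" using partial_iso_rat_graph unfolding partial_iso_def by simp
  let ?\<Gamma> = "adjoin rat_graph c (2 * c)"
  have "functional ?\<Gamma>"
  proof (rule functional_adjoin[OF ring])
    fix p r assume "gpoly rat_graph p r" "poly p c = 0"
    then have "r = p" "p = 0" using False unfolding gpoly_rat_graph by auto
    then show "poly r (2 * c) = 0" by simp
  qed
  moreover have "functional (?\<Gamma>\<inverse>)"
    unfolding adjoin_converse[symmetric]
  proof (rule functional_adjoin[OF graph_ring_converse[OF ring]])
    fix p r assume p: "gpoly (rat_graph\<inverse>) p r" "poly p (2 * c) = 0"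
    then have pr: "r = p" "\<forall>i. coeff p i \<in> \<rat>" unfolding gpoly_converse gpoly_rat_graph by auto
    have "poly (pcompose p [:0, 2:]) c = 0" using p(2) by (simp add: poly_pcompose mult.commute)
    moreover have "\<forall>i. coeff (pcompose p [:0, 2:]) i \<in> \<rat>" using pr by (simp add: coeff_pcompose_linear)
    ultimately have "pcompose p [:0, 2:] = 0" using False by blast
    then have "p = 0" by (simp add: pcompose_eq_0)
    then show "poly r c = 0" using pr by simp
  qed
  moreover have "c \<in> root_closure (Range ?\<Gamma>)"
  proof -
    have "graph_ring ?\<Gamma>" by (rule graph_ring_adjoin[OF ring])
    then have "(2, 2) \<in> ?\<Gamma>" "(0, 0) \<in> ?\<Gamma>" using graph_ring_of_nat[of ?\<Gamma> 2] graph_ring_0 by auto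
    moreover have "(- c, - (2 * c)) \<in> ?\<Gamma>"
      using adjoin_new[OF ring] graph_ring_closed(2)[OF \<open>graph_ring ?\<Gamma>\<close>] by blast
    ultimately have "\<forall>i. coeff [:- (2 * c), 2:] i \<in> root_closure (Range ?\<Gamma>)"
      using root_closure_superset[of "Range ?\<Gamma>"] by (auto simp: coeff_pCons split: nat.splits)
    moreover have "poly [:- (2 * c), 2:] c = 0" "[:- (2 * c), 2:] \<noteq> 0" by auto
    ultimately show ?thesis using root_closed_root_closure unfolding root_closed_def by blast
  qed
  moreover have "2 * c \<in> root_closure (Domain ?\<Gamma>)"
  proof -
    have "c \<in> root_closure (Domain ?\<Gamma>)" using adjoin_new[OF ring] root_closure_superset by blast
    then have "c + c \<in> root_closure (Domain ?\<Gamma>)" using root_closed_root_closure unfolding root_closed_def by blast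
    then show ?thesis by simp
  qed
  ultimately have "partial_iso ?\<Gamma>" by (intro partial_iso_adjoin partial_iso_rat_graph)
  moreover have "2 * c \<noteq> c" using c by auto
  ultimately show ?thesis using adjoin_new[OF ring] by blast
qed

theorem complex_automorphism_moves:
  fixes c :: complex
  assumes "c \<notin> \<rat>"
  shows "\<exists>\<sigma> :: complex \<Rightarrow> complex. bij \<sigma> \<and> (\<forall>x y. \<sigma> (x + y) = \<sigma> x + \<sigma> y) \<and>
    (\<forall>x y. \<sigma> (x * y) = \<sigma> x * \<sigma> y) \<and> \<sigma> 1 = 1 \<and> \<sigma> c \<noteq> c"
proof -
  obtain \<Gamma>0 c' where \<Gamma>0: "partial_iso \<Gamma>0" "(c, c') \<in> \<Gamma>0" "c' \<noteq> c"
    using partial_iso_moves[OF assms] by metis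
  obtain \<Gamma> where \<Gamma>: "\<Gamma>0 \<subseteq> \<Gamma>" "partial_iso \<Gamma>" "Domain \<Gamma> = UNIV" "Range \<Gamma> = UNIV"
    using partial_iso_extends[OF \<Gamma>0(1)] by metis
  have ring: "graph_ring \<Gamma>" and f: "functional \<Gamma>" "functional (\<Gamma>\<inverse>)"
    using \<Gamma> unfolding partial_iso_def by auto
  have "\<forall>x. \<exists>y. (x, y) \<in> \<Gamma>" using \<Gamma>(3) by blast
  then obtain \<sigma> where \<sigma>: "\<And>x. (x, \<sigma> x) \<in> \<Gamma>" by metis
  have u: "y = y'" if "(x, y) \<in> \<Gamma>" "(x, y') \<in> \<Gamma>" for x y y'
    using graph_ring_diff[OF ring that] f(1) unfolding functional_def by (metis diff_self eq_iff_diff_eq_0)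
  have u': "x = x'" if "(x, y) \<in> \<Gamma>" "(x', y) \<in> \<Gamma>" for x x' y
    using graph_ring_diff[OF ring that] f(2) unfolding functional_def
    by (metis converse_iff diff_self eq_iff_diff_eq_0)
  have "inj \<sigma>" using \<sigma> u' by (metis injI)
  moreover have "surj \<sigma>"
  proof (rule surjI)
    fix y
    have "\<exists>x. (x, y) \<in> \<Gamma>" using \<Gamma>(4) by blast
    then show "\<sigma> (SOME x. (x, y) \<in> \<Gamma>) = y" using u[OF \<sigma>] someI_ex[of "\<lambda>x. (x, y) \<in> \<Gamma>"] by metis
  qed
  ultimately have "bij \<sigma>" by (rule bijI)
  moreover have "\<sigma> (x + y) = \<sigma> x + \<sigma> y" "\<sigma> (x * y) = \<sigma> x * \<sigma> y" for x y
    using u[OF \<sigma>] graph_ring_closed(3,4)[OF ring \<sigma> \<sigma>] by metis+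
  moreover have "\<sigma> 1 = 1" using u[OF \<sigma> graph_ring_closed(1)[OF ring]] .
  moreover have "\<sigma> c = c'" using u[OF \<sigma>] \<Gamma>0(2) \<Gamma>(1) by (metis subsetD)
  ultimately show ?thesis using \<Gamma>0(3) by metis
qed

subsection \<open>Derivations\<close>

text \<open>The dual numbers \<open>a + b \<epsilon>\<close>, \<open>\<epsilon>\<^sup>2 = 0\<close>: a derivation \<open>\<delta>\<close> of the complex numbers is the same as a
  ring homomorphism \<open>x \<mapsto> x + \<delta> x \<epsilon>\<close>.\<close>

datatype dual = Dual (std: complex) (eps: complex)

instantiation dual :: comm_ring_1
begin

definition "0 = Dual 0 0"
definition "1 = Dual 1 0"
definition "x + y = Dual (std x + std y) (eps x + eps y)"
definition "x - y = Dual (std x - std y) (eps x - eps y)"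
definition "- x = Dual (- std x) (- eps x)"
definition "x * y = Dual (std x * std y) (std x * eps y + eps x * std y)"

instance
  by standard (auto simp: zero_dual_def one_dual_def plus_dual_def minus_dual_def uminus_dual_def
      times_dual_def algebra_simps)

end

lemma dual_simps [simp]:
  "std 0 = 0" "eps 0 = 0" "std 1 = 1" "eps 1 = 0"
  "std (x + y) = std x + std y" "eps (x + y) = eps x + eps y"
  "std (x - y) = std x - std y" "eps (x - y) = eps x - eps y"
  "std (- x) = - std x" "eps (- x) = - eps x"
  "std (x * y) = std x * std y" "eps (x * y) = std x * eps y + eps x * std y"
  by (simp_all add: zero_dual_def one_dual_def plus_dual_def minus_dual_def uminus_dual_def times_dual_def)

definition partial_derivation :: "(complex \<times> dual) set \<Rightarrow> bool" where
  "partial_derivation \<Gamma> \<longleftrightarrow> graph_ring \<Gamma> \<and> functional \<Gamma> \<and> (\<forall>(x, y) \<in> \<Gamma>. std y = x)"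

text \<open>The rule for differentiating \<open>p(a)\<close>: \<open>s\<close> is the value at
  \<open>a\<close> of \<open>p\<close> with the derivation applied to its coefficients, and
  \<open>\<beta>\<close> is the derivative of \<open>a\<close>.\<close>

lemma gpoly_dual_value:
  assumes "partial_derivation \<Gamma>" and "gpoly \<Gamma> p r"
  shows "\<exists>s. \<forall>\<beta>. poly r (Dual a \<beta>) = Dual (poly p a) (s + \<beta> * poly (pderiv p) a)"
  using assms(2)
proof (induction p arbitrary: r)
  case 0
  then have "r = 0" using gpoly_0_left assms(1) unfolding partial_derivation_def by blast
  then show ?case by (intro exI[of _ 0]) (simp add: zero_dual_def)
next
  case (pCons x p)
  obtain w q where r: "r = pCons w q" by (metis pCons_cases)
  then have w: "(x, w) \<in> \<Gamma>" and q: "gpoly \<Gamma> p q" using pCons.prems by (auto simp: gpoly_pCons)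
  have sw: "std w = x" using assms(1) w unfolding partial_derivation_def by blast
  obtain s where s: "\<And>\<beta>. poly q (Dual a \<beta>) = Dual (poly p a) (s + \<beta> * poly (pderiv p) a)"
    using pCons.IH[OF q] by blast
  have "poly r (Dual a \<beta>) = Dual (poly (pCons x p) a) (eps w + a * s + \<beta> * poly (pderiv (pCons x p)) a)" for \<beta>
    by (rule dual.expand) (simp add: r s sw pderiv_pCons algebra_simps)
  then show ?case by blast
qed

lemma partial_derivation_adjoin:
  assumes der: "partial_derivation \<Gamma>" and f: "functional (adjoin \<Gamma> a (Dual a \<beta>))"
  shows "partial_derivation (adjoin \<Gamma> a (Dual a \<beta>))"
proof -
  have ring: "graph_ring \<Gamma>" using der unfolding partial_derivation_def by simp
  have "std y = x" if xy: "(x, y) \<in> adjoin \<Gamma> a (Dual a \<beta>)" for x y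
  proof -
    obtain p r where pr: "gpoly \<Gamma> p r" "x = poly p a" "y = poly r (Dual a \<beta>)"
      using xy unfolding adjoin_def by blast
    obtain s where "\<forall>\<beta>. poly r (Dual a \<beta>) = Dual (poly p a) (s + \<beta> * poly (pderiv p) a)"
      using gpoly_dual_value[OF der pr(1)] by blast
    then show ?thesis using pr by simp
  qed
  then show ?thesis unfolding partial_derivation_def using f graph_ring_adjoin[OF ring] by blast
qed

text \<open>If \<open>a\<close> is algebraic, differentiating the equation of its minimal polynomial
  forces \<open>\<beta>\<close> to be \<open>- s / p0'(a)\<close>, and \<open>p0'(a)\<close> is
  nonzero since \<open>p0'\<close> has smaller degree. If \<open>a\<close> is transcendental, there
  is no constraint and 0 is chosen.\<close>

lemma partial_derivation_extend:
  assumes der: "partial_derivation \<Gamma>"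
  shows "\<exists>\<beta>. a \<in> Domain \<Gamma> \<or> partial_derivation (adjoin \<Gamma> a (Dual a \<beta>))"
proof -
  have ring: "graph_ring \<Gamma>" and f: "functional \<Gamma>" and st: "\<And>x y. (x, y) \<in> \<Gamma> \<Longrightarrow> std y = x"
    using der unfolding partial_derivation_def by auto
  have "\<exists>\<beta>. functional (adjoin \<Gamma> a (Dual a \<beta>))"
  proof (cases "\<exists>p r. gpoly \<Gamma> p r \<and> p \<noteq> 0 \<and> poly p a = 0")
    case True
    then obtain p0 r0 where min: "min_gpoly \<Gamma> a p0 r0" using min_gpoly_exists by blast
    have p0: "gpoly \<Gamma> p0 r0" "p0 \<noteq> 0" "poly p0 a = 0" using min unfolding min_gpoly_def by auto
    have deg: "degree p0 > 0" by (rule min_gpoly_degree[OF min])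
    have "coeff (pderiv p0) i \<in> Domain \<Gamma>" for i
    proof -
      have "(of_nat (Suc i) * coeff p0 (Suc i), of_nat (Suc i) * coeff r0 (Suc i)) \<in> \<Gamma>"
        using p0(1) graph_ring_closed(4)[OF ring graph_ring_of_nat[OF ring]] unfolding gpoly_def by blast
      then show ?thesis unfolding coeff_pderiv by blast
    qed
    then obtain r1 where "gpoly \<Gamma> (pderiv p0) r1" using gpoly_exists[OF ring] by blast
    moreover have "pderiv p0 \<noteq> 0" using deg by (simp add: pderiv_eq_0_iff)
    moreover have "degree (pderiv p0) < degree p0" using deg by (simp add: degree_pderiv)
    ultimately have d: "poly (pderiv p0) a \<noteq> 0" using min unfolding min_gpoly_def by fastforce
    obtain s where s: "\<And>\<beta>. poly r0 (Dual a \<beta>) = Dual (poly p0 a) (s + \<beta> * poly (pderiv p0) a)"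
      using gpoly_dual_value[OF der p0(1)] by blast
    have root: "poly r0 (Dual a (- s / poly (pderiv p0) a)) = 0"
      unfolding s using d p0 by (simp add: zero_dual_def)
    have "functional (adjoin \<Gamma> a (Dual a (- s / poly (pderiv p0) a)))"
    proof (rule functional_adjoin_algebraic[OF ring f min root])
      fix l l' z assume l: "(l, l') \<in> \<Gamma>" "l \<noteq> 0" "l' * z = 0"
      then have "std l' = l" using st by blast
      moreover have "std (l' * z) = 0" "eps (l' * z) = 0" using l by simp_all
      ultimately have "std z = 0" "eps z = 0" using l(2) by auto
      then show "z = 0" by (simp add: dual.expand)
    qed
    then show ?thesis by blast
  next
    case False
    have "functional (adjoin \<Gamma> a (Dual a 0))"
    proof (rule functional_adjoin[OF ring])
      fix p r assume pr: "gpoly \<Gamma> p r" "poly p a = 0"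
      then have "p = 0" using False by blast
      then have "r = 0" using gpoly_0_left[OF f] pr by blast
      then show "poly r (Dual a 0) = 0" by simp
    qed
    then show ?thesis by blast
  qed
  then show ?thesis using partial_derivation_adjoin[OF der] by blast
qed

lemma partial_derivation_total:
  assumes der: "partial_derivation \<Gamma>0"
  shows "\<exists>\<Gamma>. \<Gamma>0 \<subseteq> \<Gamma> \<and> partial_derivation \<Gamma> \<and> Domain \<Gamma> = UNIV"
proof -
  let ?A = "{\<Gamma>. \<Gamma>0 \<subseteq> \<Gamma> \<and> partial_derivation \<Gamma>}"
  have "\<exists>\<Gamma>\<in>?A. \<forall>X\<in>?A. \<Gamma> \<subseteq> X \<longrightarrow> X = \<Gamma>"
  proof (rule subset_Zorn_nonempty)
    show "?A \<noteq> {}" using der by blast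
    fix C assume C: "C \<noteq> {}" "subset.chain ?A C"
    then have CA: "\<And>\<Gamma>. \<Gamma> \<in> C \<Longrightarrow> \<Gamma>0 \<subseteq> \<Gamma> \<and> partial_derivation \<Gamma>" and ch: "\<And>X Y. X \<in> C \<Longrightarrow> Y \<in> C \<Longrightarrow> X \<subseteq> Y \<or> Y \<subseteq> X"
      unfolding subset_chain_def by auto
    have rg: "graph_ring X" if "X \<in> C" for X using CA that unfolding partial_derivation_def by simp
    have "graph_ring (\<Union>C)"
      unfolding graph_ring_def
    proof (intro conjI allI impI)
      show "(1, 1) \<in> \<Union>C" using C rg graph_ring_closed(1) by blast
      show "(- a, - b) \<in> \<Union>C" if "(a, b) \<in> \<Union>C" for a b
        using that rg graph_ring_closed(2) by blast
      fix a b c d assume "(a, b) \<in> \<Union>C \<and> (c, d) \<in> \<Union>C"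
      then obtain X Y where "X \<in> C" "Y \<in> C" "(a, b) \<in> X" "(c, d) \<in> Y" by blast
      then obtain Z where Z: "Z \<in> C" "(a, b) \<in> Z" "(c, d) \<in> Z" using ch by blast
      then show "(a + c, b + d) \<in> \<Union>C" "(a * c, b * d) \<in> \<Union>C" using graph_ring_closed(3,4)[OF rg[OF Z(1)] Z(2,3)] by blast+
    qed
    moreover have "functional X" if "X \<in> C" for X
      using CA that unfolding partial_derivation_def by auto
    then have "functional (\<Union>C)"
      unfolding functional_def by blast
    moreover have "std y = x" if "(x, y) \<in> \<Union>C" for x y
      using that CA unfolding partial_derivation_def by blast
    then have "\<forall>(x, y) \<in> \<Union>C. std y = x" by blast
    moreover have "\<Gamma>0 \<subseteq> \<Union>C" using C CA by blast
    ultimately show "\<Union>C \<in> ?A" unfolding partial_derivation_def mem_Collect_eq by (intro conjI)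
  qed
  then obtain \<Gamma> where A: "\<Gamma> \<in> ?A" and max: "\<forall>X\<in>?A. \<Gamma> \<subseteq> X \<longrightarrow> X = \<Gamma>" by (rule bexE)
  have \<Gamma>: "\<Gamma>0 \<subseteq> \<Gamma>" "partial_derivation \<Gamma>" using A by auto
  have ring: "graph_ring \<Gamma>" using \<Gamma> unfolding partial_derivation_def by simp
  have "a \<in> Domain \<Gamma>" for a
  proof -
    obtain \<beta> where \<beta>: "a \<in> Domain \<Gamma> \<or> partial_derivation (adjoin \<Gamma> a (Dual a \<beta>))"
      using partial_derivation_extend[OF \<Gamma>(2)] by blast
    have "(a, Dual a \<beta>) \<in> \<Gamma>" if new: "partial_derivation (adjoin \<Gamma> a (Dual a \<beta>))"
    proof -
      have sup: "\<Gamma> \<subseteq> adjoin \<Gamma> a (Dual a \<beta>)" by (rule adjoin_superset[OF ring])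
      then have "adjoin \<Gamma> a (Dual a \<beta>) \<in> ?A" using \<Gamma> new by simp
      then have "adjoin \<Gamma> a (Dual a \<beta>) = \<Gamma>" using max sup by simp
      then show ?thesis using adjoin_new[OF ring, of a "Dual a \<beta>"] by simp
    qed
    then show ?thesis using \<beta> by blast
  qed
  then have "Domain \<Gamma> = UNIV" by blast
  then show ?thesis using \<Gamma> by (intro exI[of _ \<Gamma>] conjI)
qed

lemma transcendental_exists: "\<exists>t :: complex. \<forall>p. p \<noteq> 0 \<and> (\<forall>i. coeff p i \<in> \<rat>) \<longrightarrow> poly p t \<noteq> 0"
proof (rule ccontr)
  let ?A = "{p :: complex poly. p \<noteq> 0 \<and> (\<forall>i. coeff p i \<in> \<rat>)}"
  assume "\<not> ?thesis"
  then have "UNIV = (\<Union>p\<in>?A. {t. poly p t = 0})" by auto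
  moreover have "countable ?A"
  proof -
    have "coeffs ` ?A \<subseteq> lists \<rat>" by (auto simp: coeffs_def)
    then have "countable (coeffs ` ?A)" using countable_rat countable_lists countable_subset by blast
    moreover have "inj_on coeffs ?A" by (rule inj_onI) (rule iffD2[OF coeffs_eq_iff])
    ultimately show ?thesis using countable_image_inj_on by blast
  qed
  moreover have "countable {t. poly p t = 0}" if "p \<in> ?A" for p
    using that poly_roots_finite countable_finite by blast
  ultimately have "countable (UNIV :: complex set)" by (metis (no_types, lifting) countable_UN)
  then show False using uncountable_UNIV_complex by blast
qed

theorem complex_derivation_exists:
  "\<exists>\<delta> :: complex \<Rightarrow> complex. \<exists>t. \<delta> t = 1 \<and> (\<forall>x y. \<delta> (x + y) = \<delta> x + \<delta> y) \<and>
    (\<forall>x y. \<delta> (x * y) = x * \<delta> y + \<delta> x * y)"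
proof -
  obtain t :: complex where t: "\<And>p. p \<noteq> 0 \<Longrightarrow> (\<forall>i. coeff p i \<in> \<rat>) \<Longrightarrow> poly p t \<noteq> 0"
    using transcendental_exists by blast
  define \<Gamma>0 where "\<Gamma>0 = {(q, Dual q 0) | q. q \<in> \<rat>}"
  have \<Gamma>0: "partial_derivation \<Gamma>0"
    unfolding partial_derivation_def \<Gamma>0_def graph_ring_def functional_def
    by (auto simp: zero_dual_def one_dual_def plus_dual_def uminus_dual_def times_dual_def)
  have ring: "graph_ring \<Gamma>0" and f: "functional \<Gamma>0" using \<Gamma>0 unfolding partial_derivation_def by auto
  have "functional (adjoin \<Gamma>0 t (Dual t 1))"
  proof (rule functional_adjoin[OF ring])
    fix p r assume pr: "gpoly \<Gamma>0 p r" "poly p t = 0"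
    then have "\<forall>i. coeff p i \<in> \<rat>" unfolding gpoly_def \<Gamma>0_def by blast
    then have "p = 0" using t pr by blast
    then have "r = 0" using gpoly_0_left[OF f] pr by blast
    then show "poly r (Dual t 1) = 0" by simp
  qed
  then have "partial_derivation (adjoin \<Gamma>0 t (Dual t 1))" by (rule partial_derivation_adjoin[OF \<Gamma>0])
  from partial_derivation_total[OF this] obtain \<Gamma> where sup: "adjoin \<Gamma>0 t (Dual t 1) \<subseteq> \<Gamma>"
    and \<Gamma>: "partial_derivation \<Gamma>" "Domain \<Gamma> = UNIV" by metis
  have r: "graph_ring \<Gamma>" and g: "functional \<Gamma>" and st: "\<And>x y. (x, y) \<in> \<Gamma> \<Longrightarrow> std y = x"
    using \<Gamma> unfolding partial_derivation_def by auto
  have "\<forall>x. \<exists>y. (x, y) \<in> \<Gamma>" using \<Gamma>(2) by blast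
  then obtain \<phi> where \<phi>: "\<And>x. (x, \<phi> x) \<in> \<Gamma>" by metis
  have u: "y = y'" if "(x, y) \<in> \<Gamma>" "(x, y') \<in> \<Gamma>" for x y y'
    using graph_ring_diff[OF r that] g unfolding functional_def by (metis diff_self eq_iff_diff_eq_0)
  have "\<phi> t = Dual t 1" using u[OF \<phi>] sup adjoin_new[OF ring] by (metis subsetD)
  moreover have "\<phi> (x + y) = \<phi> x + \<phi> y" "\<phi> (x * y) = \<phi> x * \<phi> y" for x y
    using u[OF \<phi>] graph_ring_closed(3,4)[OF r \<phi> \<phi>] by metis+
  moreover have "std (\<phi> x) = x" for x using st[OF \<phi>] .
  ultimately show ?thesis by (intro exI[of _ "\<lambda>x. eps (\<phi> x)"] exI[of _ t]) simp
qed

subsection \<open>Rational functionals\<close>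

lemma rational_functional_exists:
  fixes z :: complex
  assumes "z \<noteq> 0"
  shows "\<exists>l :: complex \<Rightarrow> rat. l z = 1 \<and> (\<forall>x y. l (x + y) = l x + l y) \<and> (\<forall>q x. l (of_rat q * x) = q * l x)"
proof -
  interpret C: vector_space "\<lambda>q x. of_rat q * (x :: complex)"
    by standard (auto simp: algebra_simps of_rat_add of_rat_mult)
  interpret Q: vector_space "(*) :: rat \<Rightarrow> rat \<Rightarrow> rat"
    by standard (auto simp: algebra_simps)
  interpret P: vector_space_pair "\<lambda>q x. of_rat q * (x :: complex)" "(*) :: rat \<Rightarrow> rat \<Rightarrow> rat" ..
  have "C.independent {z}" using assms C.dependent_single by blast
  then obtain l where l: "Vector_Spaces.linear (\<lambda>q x. of_rat q * (x :: complex)) (*) l" "\<forall>x\<in>{z}. l x = (1 :: rat)"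
    using P.linear_independent_extend[of "{z}" "\<lambda>_. 1"] by blast
  then interpret L: Vector_Spaces.linear "\<lambda>q x. of_rat q * (x :: complex)" "(*)" l by simp
  show ?thesis using l(2) L.add L.scale by (intro exI[of _ l]) auto
qed

section \<open>Nilpotent elements of the symplectic Lie algebra\<close>

definition ad_mat :: "'a::ring_1 mat \<Rightarrow> 'a mat \<Rightarrow> 'a mat" where
  "ad_mat A X = A * X - X * A"

lemma ad_mat_carrier [simp]:
  "A \<in> carrier_mat n n \<Longrightarrow> X \<in> carrier_mat n n \<Longrightarrow> ad_mat A X \<in> carrier_mat n n"
  unfolding ad_mat_def by auto

lemma jordan_block_0_mult:
  assumes "X \<in> carrier_mat n n"
  shows "jordan_block n (0 :: 'a::comm_ring_1) * X = mat n n (\<lambda>(i, j). if Suc i < n then X $$ (Suc i, j) else 0)"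
    and "X * jordan_block n 0 = mat n n (\<lambda>(i, j). if j = 0 then 0 else X $$ (i, j - 1))"
proof -
  show "jordan_block n 0 * X = mat n n (\<lambda>(i, j). if Suc i < n then X $$ (Suc i, j) else 0)"
  proof (rule eq_matI)
    fix i j assume "i < dim_row (mat n n (\<lambda>(i, j). if Suc i < n then X $$ (Suc i, j) else 0))"
      "j < dim_col (mat n n (\<lambda>(i, j). if Suc i < n then X $$ (Suc i, j) else 0))"
    then have ij: "i < n" "j < n" by auto
    have "(jordan_block n 0 * X) $$ (i, j) = (\<Sum>k<n. jordan_block n 0 $$ (i, k) * X $$ (k, j))"
      using ij assms by (simp add: scalar_prod_def lessThan_atLeast0)
    also have "\<dots> = (\<Sum>k<n. if k = Suc i then X $$ (k, j) else 0)"
      using ij by (intro sum.cong) auto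
    finally show "(jordan_block n 0 * X) $$ (i, j) = mat n n (\<lambda>(i, j). if Suc i < n then X $$ (Suc i, j) else 0) $$ (i, j)"
      using ij by simp
  qed (use assms in auto)
  show "X * jordan_block n 0 = mat n n (\<lambda>(i, j). if j = 0 then 0 else X $$ (i, j - 1))"
  proof (rule eq_matI)
    fix i j assume "i < dim_row (mat n n (\<lambda>(i, j). if j = 0 then 0 else X $$ (i, j - 1)))"
      "j < dim_col (mat n n (\<lambda>(i, j). if j = 0 then 0 else X $$ (i, j - 1)))"
    then have ij: "i < n" "j < n" by auto
    have "(X * jordan_block n 0) $$ (i, j) = (\<Sum>k<n. X $$ (i, k) * jordan_block n 0 $$ (k, j))"
      using ij assms by (simp add: scalar_prod_def lessThan_atLeast0)
    also have "\<dots> = (\<Sum>k<n. if k = j - 1 then if j = 0 then 0 else X $$ (i, k) else 0)"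
      using ij by (intro sum.cong) auto
    finally show "(X * jordan_block n 0) $$ (i, j) = mat n n (\<lambda>(i, j). if j = 0 then 0 else X $$ (i, j - 1)) $$ (i, j)"
      using ij by simp
  qed (use assms in auto)
qed

lemma jordan_block_0_ad:
  "\<exists>B \<in> carrier_mat n n. ad_mat (jordan_block n 0) (ad_mat (jordan_block n 0) B) = jordan_block n (0 :: complex)"
proof
  let ?J = "jordan_block n (0 :: complex)"
  \<comment> \<open>\<open>B\<close> is minus half the lowering matrix of the irreducible
    sl2-representation of dimension \<open>n\<close>; the factor gives
    \<open>[J, [J, B]] = J\<close>. The differences of the \<open>b i\<close> form the progression
    \<open>c\<close> of step 1, and \<open>b\<close> vanishes at \<open>n - 1\<close>, where the
    matrix has no further entry.\<close>
  define b where "b i = (of_nat i + 1) * (of_nat i + 1 - of_nat n) / (2 :: complex)" for i :: nat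
  define B where "B = mat n n (\<lambda>(i, j). if i = Suc j then b j else 0)"
  show B: "B \<in> carrier_mat n n" unfolding B_def by simp
  define c where "c i = of_nat i - (of_nat n - 1) / (2 :: complex)" for i :: nat
  have JB: "ad_mat ?J B = mat n n (\<lambda>(i, j). if i = j then c i else 0)"
  proof (rule eq_matI)
    fix i j assume "i < dim_row (mat n n (\<lambda>(i, j). if i = j then c i else 0))"
      "j < dim_col (mat n n (\<lambda>(i, j). if i = j then c i else 0))"
    then have ij: "i < n" "j < n" by auto
    have "b i = 0" if "\<not> Suc i < n"
    proof -
      have "n = Suc i" using that ij by simp
      then show ?thesis unfolding b_def by simp
    qed
    moreover have "b i - b (i - 1) = c i" if "i > 0"
      using that by (cases i) (auto simp: b_def c_def field_simps)
    moreover have "b 0 = c 0" by (simp add: b_def c_def field_simps)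
    ultimately show "ad_mat ?J B $$ (i, j) = mat n n (\<lambda>(i, j). if i = j then c i else 0) $$ (i, j)"
      using ij unfolding ad_mat_def jordan_block_0_mult[OF B] by (auto simp: B_def)
  qed (use B in \<open>auto simp: ad_mat_def\<close>)
  have D: "mat n n (\<lambda>(i, j). if i = j then c i else 0) \<in> carrier_mat n n" by simp
  show "ad_mat ?J (ad_mat ?J B) = ?J"
  proof (rule eq_matI)
    fix i j assume "i < dim_row ?J" "j < dim_col ?J"
    then have ij: "i < n" "j < n" by auto
    have "c j - c (j - Suc 0) = 1" if "0 < j" for j using that unfolding c_def by (cases j) auto
    then show "ad_mat ?J (ad_mat ?J B) $$ (i, j) = ?J $$ (i, j)"
      using ij unfolding JB unfolding ad_mat_def jordan_block_0_mult[OF D] by auto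
  qed (use B in \<open>auto simp: ad_mat_def\<close>)
qed

lemma jordan_matrix_0_ad:
  assumes "\<forall>(n, a) \<in> set n_as. a = 0"
  shows "\<exists>B \<in> carrier_mat (sum_list (map fst n_as)) (sum_list (map fst n_as)).
    ad_mat (jordan_matrix n_as) (ad_mat (jordan_matrix n_as) B) = jordan_matrix (n_as :: (nat \<times> complex) list)"
  using assms
proof (induction n_as)
  case Nil
  show ?case by (intro bexI[of _ "0\<^sub>m 0 0"]) (auto simp: ad_mat_def)
next
  case (Cons na n_as)
  obtain n where na: "na = (n, 0)" using Cons.prems by (cases na) auto
  define m where "m = sum_list (map fst n_as)"
  let ?J1 = "jordan_block n (0 :: complex)" and ?J2 = "jordan_matrix n_as"
  have J2: "?J2 \<in> carrier_mat m m" unfolding m_def by simp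
  obtain B2 where B2: "B2 \<in> carrier_mat m m" "ad_mat ?J2 (ad_mat ?J2 B2) = ?J2"
    using Cons unfolding m_def by auto
  obtain B1 where B1: "B1 \<in> carrier_mat n n" "ad_mat ?J1 (ad_mat ?J1 B1) = ?J1"
    using jordan_block_0_ad by blast
  let ?D = "\<lambda>X Y. four_block_mat X (0\<^sub>m n m) (0\<^sub>m m n) Y"
  have J: "jordan_matrix (na # n_as) = ?D ?J1 ?J2" unfolding na jordan_matrix_Cons m_def by simp
  have ad: "ad_mat (?D X Y) (?D X' Y') = ?D (ad_mat X X') (ad_mat Y Y')"
    if "X \<in> carrier_mat n n" "X' \<in> carrier_mat n n" "Y \<in> carrier_mat m m" "Y' \<in> carrier_mat m m"
    for X X' Y Y' :: "complex mat"
  proof -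
    have m1: "?D X Y * ?D X' Y' = ?D (X * X') (Y * Y')" 
      using that by (subst mult_four_block_mat[where ?nr1.0 = n and ?n1.0 = n and ?n2.0 = m and ?nr2.0 = m
        and ?nc1.0 = n and ?nc2.0 = m]) auto
    have m2: "?D X' Y' * ?D X Y = ?D (X' * X) (Y' * Y)" 
      using that by (subst mult_four_block_mat[where ?nr1.0 = n and ?n1.0 = n and ?n2.0 = m and ?nr2.0 = m
        and ?nc1.0 = n and ?nc2.0 = m]) auto
    show ?thesis unfolding ad_mat_def m1 m2
      by (rule eq_matI) (use that in auto)
  qed
  have "ad_mat (?D ?J1 ?J2) (ad_mat (?D ?J1 ?J2) (?D B1 B2)) = ?D ?J1 ?J2"
    using ad B1 B2 J2 by simp
  moreover have "?D B1 B2 \<in> carrier_mat (n + m) (n + m)" using B1 B2 by simp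
  moreover have "sum_list (map fst (na # n_as)) = n + m" unfolding na m_def by simp
  ultimately show ?case unfolding J by (metis (no_types, lifting))
qed

lemma ad_mat_similar:
  fixes D P Q :: "'a::comm_ring_1 mat"
  assumes "P \<in> carrier_mat n n" "Q \<in> carrier_mat n n" "D \<in> carrier_mat n n" "X \<in> carrier_mat n n" and QP: "Q * P = 1\<^sub>m n"
  shows "ad_mat (P * D * Q) (P * X * Q) = P * ad_mat D X * Q"
proof -
  note c = assms(1-4)
  have m: "(P * Y * Q) * (P * Z * Q) = P * (Y * Z) * Q" if "Y \<in> carrier_mat n n" "Z \<in> carrier_mat n n" for Y Z
  proof -
    have "(P * Y * Q) * (P * Z * Q) = P * Y * ((Q * P) * (Z * Q))"
      using that c by (simp add: assoc_mult_mat[of _ n n _ n _ n])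
    then show ?thesis using that c QP by (simp add: assoc_mult_mat[of _ n n _ n _ n])
  qed
  show ?thesis unfolding ad_mat_def m[OF c(3,4)] m[OF c(4,3)]
    using c by (simp add: mult_minus_distrib_mat[of _ n n _ n] minus_mult_distrib_mat[of _ n n _ _ n])
qed

lemma nilpotent_complex_ad:
  fixes A :: "complex mat"
  assumes A: "A \<in> carrier_mat n n" and ev: "\<And>k. eigenvalue A k \<Longrightarrow> k = 0"
  shows "\<exists>B \<in> carrier_mat n n. ad_mat A (ad_mat A B) = A"
proof -
  obtain as where as: "char_poly A = (\<Prod>a\<leftarrow>as. [:- a, 1:])" using char_poly_factorized[OF A] by blast
  then obtain n_as where jnf: "jordan_nf A n_as" using jordan_nf_exists[OF A] by blast
  have 0: "\<forall>(m, a) \<in> set n_as. a = 0"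
  proof clarify
    fix m a assume ma: "(m, a) \<in> set n_as"
    then have "m \<noteq> 0" using jnf unfolding jordan_nf_def by force
    have "poly (char_poly A) a = (\<Prod>(m, b)\<leftarrow>n_as. poly ([:- b, 1:] ^ m) a)"
      unfolding jordan_nf_char_poly[OF jnf] poly_prod_list by (simp add: comp_def case_prod_unfold)
    also have "\<dots> = 0" using ma \<open>m \<noteq> 0\<close> by (auto simp: prod_list_zero_iff intro!: image_eqI[of _ _ "(m, a)"])
    finally show "a = 0" using eigenvalue_root_char_poly[OF A] ev by blast
  qed
  obtain P Q where w: "similar_mat_wit A (jordan_matrix n_as) P Q"
    using jnf unfolding jordan_nf_def similar_mat_def by blast
  have "n = dim_row A" using A by simp
  note w = similar_mat_witD[OF this w]
  have n: "sum_list (map fst n_as) = n" using w(5) by (metis carrier_matD(1) jordan_matrix_dim(1))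
  obtain B where B: "B \<in> carrier_mat n n" "ad_mat (jordan_matrix n_as) (ad_mat (jordan_matrix n_as) B) = jordan_matrix n_as"
    using jordan_matrix_0_ad[OF 0] unfolding n by blast
  have "ad_mat A (ad_mat A (P * B * Q)) = A"
    unfolding w(3) using ad_mat_similar[OF w(6,7,5) _ w(2)] B w(5) by simp
  then show ?thesis using B w(6,7) by (intro bexI[of _ "P * B * Q"]) auto
qed

text \<open>A rational functional \<open>l\<close> carries complex solutions of rational linear equations to rational
  ones.\<close>

context
  fixes l :: "complex \<Rightarrow> rat"
  assumes l_add: "\<And>x y. l (x + y) = l x + l y" and l_scale: "\<And>q x. l (of_rat q * x) = q * l x"
begin

lemma rational_functional_minus: "l (- x) = - l x"
  using l_scale[of "- 1" x] by simp

lemma rational_functional_diff: "l (x - y) = l x - l y"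
  using l_add[of x "- y"] rational_functional_minus[of y] by simp

lemma rational_functional_sum: "l (sum f I) = (\<Sum>i\<in>I. l (f i))"
proof -
  have "l 0 = 0" using l_scale[of 0 0] by simp
  then show ?thesis by (induction I rule: infinite_finite_induct) (auto simp: l_add)
qed

lemma map_functional_mult_left:
  assumes "A \<in> carrier_mat n n" and "X \<in> carrier_mat n n"
  shows "map_mat l (map_mat of_rat A * X) = A * map_mat l X"
  by (rule eq_matI) (use assms in \<open>auto simp: scalar_prod_def rational_functional_sum l_scale\<close>)

lemma map_functional_mult_right:
  assumes "A \<in> carrier_mat n n" and "X \<in> carrier_mat n n"
  shows "map_mat l (X * map_mat of_rat A) = map_mat l X * A"
  by (rule eq_matI)
    (use assms in \<open>auto simp: scalar_prod_def rational_functional_sum l_scale[unfolded mult.commute[of "of_rat _"] mult.commute[of _ "l _"]]\<close>)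

lemma map_functional_ad:
  assumes "A \<in> carrier_mat n n" and "X \<in> carrier_mat n n"
  shows "map_mat l (ad_mat (map_mat of_rat A) X) = ad_mat A (map_mat l X)"
proof -
  have "map_mat l (Y - Z) = map_mat l Y - map_mat l Z"
    if "Y \<in> carrier_mat n n" "Z \<in> carrier_mat n n" for Y Z
    by (rule eq_matI) (use that in \<open>auto simp: rational_functional_diff\<close>)
  then show ?thesis unfolding ad_mat_def map_functional_mult_left[OF assms, symmetric]
      map_functional_mult_right[OF assms, symmetric] using assms by auto
qed

end

section \<open>Passing from complex to rational symplectic matrices\<close>

definition sp_mat :: "nat \<Rightarrow> 'a::comm_ring_1 mat \<Rightarrow> 'a mat set" where
  "sp_mat n J = {X \<in> carrier_mat n n. transpose_mat X * J = - (J * X)}"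

text \<open>An infinitesimal transvection \<open>w \<mapsto> (v^T J w) v\<close>. It is symplectic
  because \<open>V V^T\<close> is symmetric and \<open>J\<close> skew.\<close>

lemma sp_mat_rank_one:
  fixes J :: "'a::comm_ring_1 mat"
  assumes J: "J \<in> carrier_mat n n" "transpose_mat J = - J" and V: "V \<in> carrier_mat n 1"
  shows "V * (transpose_mat V * J) \<in> sp_mat n J"
proof -
  have Vt: "transpose_mat V \<in> carrier_mat 1 n" using V by simp
  have VJ: "transpose_mat V * J \<in> carrier_mat 1 n" using Vt J by simp
  have "transpose_mat (V * (transpose_mat V * J)) = transpose_mat J * V * transpose_mat V"
    using transpose_mult[OF V VJ] transpose_mult[OF Vt J(1)] by simp
  also have "\<dots> = - (J * V * transpose_mat V)" using J V by simp
  also have "\<dots> * J = - (J * V * transpose_mat V * J)" using J V by simp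
  also have "J * V * transpose_mat V * J = J * (V * (transpose_mat V * J))"
    using J V Vt VJ by (simp add: assoc_mult_mat[of _ n "Suc 0" _ n _ n] assoc_mult_mat[of _ n n _ n _ n])
  finally show ?thesis unfolding sp_mat_def using V VJ by simp
qed

text \<open>For an eigenvector \<open>v\<close> the matrix \<open>E = v v^T J\<close> is symplectic
  and satisfies \<open>[A, E] = 2 k E\<close>. Nilpotency of \<open>ad A\<close> is known on
  rational matrices only, so a Q-linear functional is applied to the entries of \<open>E\<close>;
  this commutes with \<open>ad A\<close>, as \<open>A\<close> is rational.\<close>

lemma sp_eigenvalue_zero:
  fixes A J :: "rat mat"
  assumes A: "A \<in> sp_mat n J" and J: "J \<in> carrier_mat n n" "transpose_mat J = - J" "K \<in> carrier_mat n n" "J * K = 1\<^sub>m n"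
    and nil: "\<And>X. X \<in> sp_mat n J \<Longrightarrow> (ad_mat A ^^ s) X = 0\<^sub>m n n"
    and ev: "eigenvalue (map_mat of_rat A :: complex mat) k"
  shows "k = 0"
proof (rule ccontr)
  assume k: "k \<noteq> 0"
  let ?h = "map_mat of_rat :: rat mat \<Rightarrow> complex mat"
  have An: "A \<in> carrier_mat n n" and AJ: "transpose_mat A * J = - (J * A)" using A unfolding sp_mat_def by auto
  have hA: "?h A \<in> carrier_mat n n" and hJ: "?h J \<in> carrier_mat n n" and hK: "?h K \<in> carrier_mat n n"
    using An J by auto
  have hAJ: "transpose_mat (?h A) * ?h J = - (?h J * ?h A)"
  proof -
    have "transpose_mat (?h A) * ?h J = ?h (transpose_mat A * J)"
      using of_rat_hom.mat_hom_mult[of "transpose_mat A" n n J n, where 'a = complex] An J(1)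
      by (simp add: map_mat_transpose)
    also have "\<dots> = - ?h (J * A)" unfolding AJ by (rule eq_matI) (auto simp: of_rat_minus)
    also have "?h (J * A) = ?h J * ?h A" by (rule of_rat_hom.mat_hom_mult[OF J(1) An])
    finally show ?thesis .
  qed
  have hJt: "transpose_mat (?h J) = - ?h J"
  proof -
    have "transpose_mat (?h J) = ?h (transpose_mat J)" by (rule eq_matI) auto
    also have "\<dots> = - ?h J" unfolding J(2) by (rule eq_matI) (auto simp: of_rat_minus)
    finally show ?thesis .
  qed
  have hJK: "?h J * ?h K = 1\<^sub>m n"
    using of_rat_hom.mat_hom_mult[OF J(1,3)] J(4) of_rat_hom.mat_hom_one by metis
  obtain v where v: "v \<in> carrier_vec n" "v \<noteq> 0\<^sub>v n" "?h A *\<^sub>v v = k \<cdot>\<^sub>v v"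
    using ev hA unfolding eigenvalue_def eigenvector_def by auto
  define V where "V = mat n 1 (\<lambda>(i, j). v $ i)"
  have V: "V \<in> carrier_mat n 1" and Vt: "transpose_mat V \<in> carrier_mat 1 n" unfolding V_def by auto
  have AV: "?h A * V = k \<cdot>\<^sub>m V"
  proof (rule eq_matI)
    fix i j assume "i < dim_row (k \<cdot>\<^sub>m V)" "j < dim_col (k \<cdot>\<^sub>m V)"
    then have ij: "i < n" "j = 0" using V by auto
    have "col V 0 = v" unfolding V_def by (rule eq_vecI) (use v in auto)
    then have "(?h A * V) $$ (i, j) = (?h A *\<^sub>v v) $ i" using ij hA V by simp
    also have "\<dots> = (k \<cdot>\<^sub>m V) $$ (i, j)" unfolding v(3) using ij v V by (simp add: V_def)
    finally show "(?h A * V) $$ (i, j) = (k \<cdot>\<^sub>m V) $$ (i, j)" .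
  qed (use hA V in auto)
  define R where "R = transpose_mat V * ?h J"
  define E where "E = V * R"
  have R: "R \<in> carrier_mat 1 n" unfolding R_def using Vt hJ by simp
  have E: "E \<in> carrier_mat n n" unfolding E_def using V R by simp
  have Esp: "E \<in> sp_mat n (?h J)" unfolding E_def R_def by (rule sp_mat_rank_one[OF hJ hJt V])
  have RA: "R * ?h A = - (k \<cdot>\<^sub>m R)"
  proof -
    have "R * ?h A = transpose_mat V * (?h J * ?h A)"
      unfolding R_def using Vt hJ hA by simp
    also have "?h J * ?h A = - (transpose_mat (?h A) * ?h J)" using hAJ by simp
    also have "transpose_mat V * (- (transpose_mat (?h A) * ?h J)) = - (transpose_mat V * transpose_mat (?h A) * ?h J)"
      using Vt hJ hA by simp
    also have "transpose_mat V * transpose_mat (?h A) = transpose_mat (?h A * V)"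
      using transpose_mult[OF hA V] by simp
    also have "\<dots> = k \<cdot>\<^sub>m transpose_mat V" unfolding AV by (rule eq_matI) (use V in auto)
    also have "k \<cdot>\<^sub>m transpose_mat V * ?h J = k \<cdot>\<^sub>m R" unfolding R_def by (rule mult_smult_assoc_mat[OF Vt hJ])
    finally show ?thesis .
  qed
  have adE: "ad_mat (?h A) (c \<cdot>\<^sub>m E) = (2 * k * c) \<cdot>\<^sub>m E" for c
  proof -
    have "?h A * (c \<cdot>\<^sub>m E) = (k * c) \<cdot>\<^sub>m E"
    proof -
      have "?h A * E = (?h A * V) * R" unfolding E_def by (rule assoc_mult_mat[OF hA V R, symmetric])
      also have "\<dots> = k \<cdot>\<^sub>m E" unfolding AV E_def by (rule mult_smult_assoc_mat[OF V R])
      finally have "c \<cdot>\<^sub>m (?h A * E) = c \<cdot>\<^sub>m (k \<cdot>\<^sub>m E)" by simp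
      moreover have "\<dots> = (k * c) \<cdot>\<^sub>m E" by (rule eq_matI) auto
      ultimately show ?thesis unfolding mult_smult_distrib[OF hA E] by simp
    qed
    moreover have "(c \<cdot>\<^sub>m E) * ?h A = - ((k * c) \<cdot>\<^sub>m E)"
    proof -
      have "E * ?h A = V * (R * ?h A)" unfolding E_def by (rule assoc_mult_mat[OF V R hA])
      also have "\<dots> = - (k \<cdot>\<^sub>m E)" unfolding RA E_def mult_smult_distrib[OF V R, symmetric]
        using V R by (intro uminus_mult_right_mat) auto
      finally have "c \<cdot>\<^sub>m (E * ?h A) = c \<cdot>\<^sub>m (- (k \<cdot>\<^sub>m E))" by simp
      moreover have "\<dots> = - ((k * c) \<cdot>\<^sub>m E)" by (rule eq_matI) (use E in auto)
      ultimately show ?thesis unfolding mult_smult_assoc_mat[OF E hA] by simp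
    qed
    ultimately show ?thesis unfolding ad_mat_def by (intro eq_matI) (use E in \<open>auto simp: algebra_simps\<close>)
  qed
  have "\<exists>i < n. \<exists>j < n. E $$ (i, j) \<noteq> 0"
  proof (rule ccontr)
    assume no: "\<not> ?thesis"
    obtain i where i: "i < n" "v $ i \<noteq> 0" using v by (metis carrier_vecD eq_vecI index_zero_vec)
    have "R = 0\<^sub>m 1 n"
    proof (rule eq_matI)
      fix i' j assume "i' < dim_row (0\<^sub>m 1 n :: complex mat)" "j < dim_col (0\<^sub>m 1 n :: complex mat)"
      then have j: "i' = 0" "j < n" by auto
      have "E $$ (i, j) = row V i \<bullet> col R j" unfolding E_def using i j V R by auto
      also have "\<dots> = v $ i * R $$ (0, j)" using i j R by (simp add: scalar_prod_def V_def)
      finally have "E $$ (i, j) = v $ i * R $$ (0, j)" .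
      then show "R $$ (i', j) = 0\<^sub>m 1 n $$ (i', j)" using no i j by auto
    qed (use R in auto)
    then have "R * ?h K = 0\<^sub>m 1 n" using hK by simp
    moreover have "R * ?h K = transpose_mat V * (?h J * ?h K)"
      unfolding R_def by (rule assoc_mult_mat[OF Vt hJ hK])
    ultimately have "transpose_mat V = 0\<^sub>m 1 n" unfolding hJK using Vt by simp
    then have "transpose_mat V $$ (0, i) = 0" using i by simp
    then show False using i by (simp add: V_def)
  qed
  then obtain i j where ij: "i < n" "j < n" "E $$ (i, j) \<noteq> 0" by blast
  \<comment> \<open>\<open>l\<close> is linear over the rationals only, and \<open>k\<close> need
    not be rational; so \<open>l\<close> is normalised on an entry of \<open>(2 k)^s E\<close> and
    not of \<open>E\<close>.\<close>
  obtain l :: "complex \<Rightarrow> rat" where l: "l ((2 * k) ^ s * E $$ (i, j)) = 1"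
    and l_add: "\<And>x y. l (x + y) = l x + l y" and l_scale: "\<And>q x. l (of_rat q * x) = q * l x"
  proof -
    have "(2 * k) ^ s * E $$ (i, j) \<noteq> 0" using ij k by simp
    from rational_functional_exists[OF this] show ?thesis using that by metis
  qed
  let ?X = "map_mat l E"
  have X: "?X \<in> sp_mat n J"
  proof -
    have "transpose_mat ?X * J = map_mat l (transpose_mat E) * J" by (simp add: map_mat_transpose)
    also have "\<dots> = map_mat l (transpose_mat E * ?h J)"
      by (rule map_functional_mult_right[OF l_add l_scale, symmetric]) (use E J in auto)
    also have "\<dots> = map_mat l (- (?h J * E))" using Esp unfolding sp_mat_def by simp
    also have "\<dots> = - map_mat l (?h J * E)"
      by (rule eq_matI) (use rational_functional_minus[OF l_add l_scale] in auto)
    also have "map_mat l (?h J * E) = J * ?X"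
      by (rule map_functional_mult_left[OF l_add l_scale]) (use E J in auto)
    finally show ?thesis unfolding sp_mat_def using E by simp
  qed
  have "(ad_mat A ^^ r) ?X = map_mat l ((2 * k) ^ r \<cdot>\<^sub>m E)" for r
  proof (induction r)
    case 0
    show ?case by (rule eq_matI) auto
  next
    case (Suc r)
    have "(ad_mat A ^^ Suc r) ?X = map_mat l (ad_mat (?h A) ((2 * k) ^ r \<cdot>\<^sub>m E))"
      using Suc map_functional_ad[OF l_add l_scale An, of "(2 * k) ^ r \<cdot>\<^sub>m E"] E by simp
    then show ?case unfolding adE by (simp add: mult.assoc)
  qed
  then have "map_mat l ((2 * k) ^ s \<cdot>\<^sub>m E) = 0\<^sub>m n n" using nil[OF X] by metis
  then have "map_mat l ((2 * k) ^ s \<cdot>\<^sub>m E) $$ (i, j) = 0" using ij by simp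
  then show False using l ij E by simp
qed

text \<open>A solution in all matrices is averaged with its image under the involution
  \<open>X \<mapsto> - J\<^sup>-\<^sup>1 X\<^sup>T J\<close>, whose fixed points form the symplectic Lie algebra.\<close>

theorem sp_nilpotent_ad:
  fixes A J :: "rat mat"
  assumes A: "A \<in> sp_mat n J" and J: "J \<in> carrier_mat n n" "transpose_mat J = - J" "invertible_mat J"
    and nil: "\<And>X. X \<in> sp_mat n J \<Longrightarrow> (ad_mat A ^^ s) X = 0\<^sub>m n n"
  shows "\<exists>B \<in> sp_mat n J. ad_mat A (ad_mat A B) = A"
proof -
  obtain K where K: "J * K = 1\<^sub>m n" "K * J = 1\<^sub>m n" "K \<in> carrier_mat n n"
  proof -
    obtain K where "inverts_mat J K" "inverts_mat K J" using J(3) unfolding invertible_mat_def by blast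
    then have *: "J * K = 1\<^sub>m n" "K * J = 1\<^sub>m (dim_row K)" using J(1) unfolding inverts_mat_def by auto
    have "dim_col K = n" using arg_cong[OF *(1), of dim_col] by simp
    moreover have "dim_row K = n" using arg_cong[OF *(2), of dim_col] J(1) by simp
    ultimately show ?thesis using that * by auto
  qed
  have An: "A \<in> carrier_mat n n" and AJ: "transpose_mat A * J = - (J * A)" using A unfolding sp_mat_def by auto
  obtain B0 :: "complex mat" where B0: "B0 \<in> carrier_mat n n"
    "ad_mat (map_mat of_rat A) (ad_mat (map_mat of_rat A) B0) = map_mat of_rat A"
    using nilpotent_complex_ad[of "map_mat of_rat A" n] sp_eigenvalue_zero[OF A J(1,2) K(3,1) nil] An by auto
  obtain l :: "complex \<Rightarrow> rat" where l1: "l 1 = 1"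
    and l_add: "\<And>x y. l (x + y) = l x + l y" and l_scale: "\<And>q x. l (of_rat q * x) = q * l x"
    using rational_functional_exists[of 1] one_neq_zero by metis
  define B where "B = map_mat l B0"
  have B: "B \<in> carrier_mat n n" unfolding B_def using B0 by simp
  have adB: "ad_mat A (ad_mat A B) = A"
  proof -
    have "ad_mat A (ad_mat A B) = map_mat l (map_mat of_rat A)"
      unfolding B_def using map_functional_ad[OF l_add l_scale An] B0 An by (metis ad_mat_carrier map_carrier_mat)
    also have "\<dots> = A" by (rule eq_matI) (use l_scale[of _ 1] l1 in auto)
    finally show ?thesis .
  qed
  note assoc = assoc_mult_mat[of _ n n _ n _ n]
  have Kt: "transpose_mat K = - K"
  proof -
    have e: "transpose_mat K * J = - 1\<^sub>m n"
      using transpose_mult[OF J(1) K(3)] K(1) J(2) K(3) J(1) by (metis transpose_one uminus_mult_right_mat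
          uminus_uminus_mat transpose_carrier_mat carrier_matD)
    have "transpose_mat K = transpose_mat K * (J * K)" using K by simp
    also have "\<dots> = (transpose_mat K * J) * K" using K(3) J(1) by (simp add: assoc)
    also have "\<dots> = - K" unfolding e using K by simp
    finally show ?thesis .
  qed
  define t where "t X = - (K * transpose_mat X * J)" for X
  have t: "t X \<in> carrier_mat n n" if "X \<in> carrier_mat n n" for X
    unfolding t_def using that K J by simp
  have KA: "K * transpose_mat A = - (A * K)"
  proof -
    have "K * transpose_mat A = K * transpose_mat A * (J * K)" using K An by simp
    also have "\<dots> = K * (transpose_mat A * J) * K" using K(3) An J(1) by (simp add: assoc)
    also have "\<dots> = - (K * (J * A) * K)" unfolding AJ using K(3) An J(1) by simp
    also have "K * (J * A) * K = (K * J) * A * K" using K(3) An J(1) by (simp add: assoc)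
    finally show ?thesis using K An by simp
  qed
  have tA: "t A = A"
  proof -
    have "t A = - (- (A * K) * J)" unfolding t_def KA ..
    also have "\<dots> = A * (K * J)" using An K(3) J(1) by (simp add: assoc)
    finally show ?thesis using K An by simp
  qed
  \<comment> \<open>\<open>t\<close> is minus an anti-automorphism, hence an automorphism of the Lie
    algebra of matrices. It fixes \<open>A\<close>, so it commutes with \<open>ad A\<close> and maps
    solutions to solutions.\<close>
  have t_ad: "ad_mat A (t X) = t (ad_mat A X)" if X: "X \<in> carrier_mat n n" for X
  proof -
    have Xt: "transpose_mat X \<in> carrier_mat n n" "transpose_mat A \<in> carrier_mat n n" using X An by auto
    have AK: "A * K = - (K * transpose_mat A)" using KA by simp
    have "A * t X = - (A * K * transpose_mat X * J)" unfolding t_def using An K(3) Xt J(1) by (simp add: assoc)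
    also have "\<dots> = K * transpose_mat A * transpose_mat X * J" unfolding AK using An K(3) Xt J(1) by simp
    also have "\<dots> = K * transpose_mat (X * A) * J" using transpose_mult[OF X An] An K Xt J by (simp add: assoc)
    finally have 1: "A * t X = - t (X * A)" unfolding t_def by simp
    have JA: "J * A = - (transpose_mat A * J)" using AJ by simp
    have "t X * A = - (K * transpose_mat X * (J * A))" unfolding t_def using An K(3) Xt J(1) by (simp add: assoc)
    also have "\<dots> = K * (transpose_mat X * transpose_mat A) * J" unfolding JA using An K(3) Xt J(1) by (simp add: assoc)
    also have "\<dots> = K * transpose_mat (A * X) * J" using transpose_mult[OF An X] by simp
    finally have 2: "t X * A = - t (A * X)" unfolding t_def by simp
    have "t (ad_mat A X) = - (K * (transpose_mat (A * X) - transpose_mat (X * A)) * J)"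
      unfolding t_def ad_mat_def using transpose_minus[of "A * X" n n "X * A"] An X by simp
    also have "\<dots> = - (K * transpose_mat (A * X) * J - K * transpose_mat (X * A) * J)"
      using K J An X by (simp add: mult_minus_distrib_mat[of _ n n _ n] minus_mult_distrib_mat[of _ n n _ _ n])
    also have "\<dots> = - t (X * A) - (- t (A * X))"
      unfolding t_def by (rule eq_matI) (use K J An X in auto)
    finally show ?thesis unfolding ad_mat_def 1 2 by simp
  qed
  define B' where "B' = (1/2) \<cdot>\<^sub>m (B + t B)"
  have B': "B' \<in> carrier_mat n n" unfolding B'_def using B t by simp
  have ad_lin: "ad_mat A ((1/2) \<cdot>\<^sub>m (X + Y)) = (1/2) \<cdot>\<^sub>m (ad_mat A X + ad_mat A Y)"
    if X: "X \<in> carrier_mat n n" and Y: "Y \<in> carrier_mat n n" for X Y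
  proof -
    have 1: "A * ((1/2) \<cdot>\<^sub>m (X + Y)) = (1/2) \<cdot>\<^sub>m (A * X + A * Y)"
      using An X Y by (simp add: mult_smult_distrib[of _ n n _ n] mult_add_distrib_mat[of _ n n _ n])
    have 2: "((1/2) \<cdot>\<^sub>m (X + Y)) * A = (1/2) \<cdot>\<^sub>m (X * A + Y * A)"
      using An X Y by (simp add: mult_smult_assoc_mat[of _ n n _ n] add_mult_distrib_mat[of _ n n _ _ n])
    show ?thesis unfolding ad_mat_def 1 2 by (rule eq_matI) (use An X Y in \<open>auto simp: algebra_simps\<close>)
  qed
  have "ad_mat A (ad_mat A B') = A"
  proof -
    have "ad_mat A (ad_mat A B') = (1/2) \<cdot>\<^sub>m (ad_mat A (ad_mat A B) + ad_mat A (ad_mat A (t B)))"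
      unfolding B'_def using ad_lin B t An by simp
    also have "\<dots> = (1/2) \<cdot>\<^sub>m (A + A)" using t_ad B An adB tA by simp
    also have "\<dots> = A" by (rule eq_matI) (use An in auto)
    finally show ?thesis .
  qed
  moreover have "B' \<in> sp_mat n J"
  proof -
    have Bt: "transpose_mat B \<in> carrier_mat n n" using B by simp
    have "transpose_mat (t B) = - (transpose_mat J * (B * transpose_mat K))"
      unfolding t_def using transpose_mult[of "K * transpose_mat B" n n J n] transpose_mult[OF K(3) Bt] K J B
      by (simp add: transpose_uminus)
    also have "\<dots> = - (J * (B * K))" unfolding J(2) Kt using J K B by simp
    finally have tt: "transpose_mat (t B) = - (J * (B * K))" .
    have "transpose_mat (t B) * J = - (J * B * (K * J))" unfolding tt using J(1) K(3) B by (simp add: assoc)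
    then have 1: "transpose_mat (t B) * J = - (J * B)" unfolding K(2) using J B by simp
    have "J * t B = - ((J * K) * transpose_mat B * J)" unfolding t_def using J(1) K(3) Bt by (simp add: assoc)
    then have 2: "J * t B = - (transpose_mat B * J)" unfolding K(1) using Bt by simp
    have tBt: "transpose_mat (t B) \<in> carrier_mat n n" using t[OF B] by simp
    have "transpose_mat B' = (1/2) \<cdot>\<^sub>m (transpose_mat B + transpose_mat (t B))"
      unfolding B'_def transpose_add[OF B t[OF B], symmetric] by (rule eq_matI) auto
    then have "transpose_mat B' * J = (1/2) \<cdot>\<^sub>m (transpose_mat B * J + transpose_mat (t B) * J)"
      using mult_smult_assoc_mat[OF add_carrier_mat[OF tBt] J(1), of "1/2" "transpose_mat B"]
        add_mult_distrib_mat[OF Bt tBt J(1)] by simp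
    moreover have "J * B' = (1/2) \<cdot>\<^sub>m (J * B + J * t B)"
      unfolding B'_def mult_smult_distrib[OF J(1) add_carrier_mat[OF t[OF B]]] mult_add_distrib_mat[OF J(1) B t[OF B]] ..
    ultimately have "transpose_mat B' * J = - (J * B')"
      unfolding 1 2 by (intro eq_matI) (use J(1) B Bt in \<open>auto simp: field_simps\<close>)
    then show ?thesis unfolding sp_mat_def using B' by simp
  qed
  ultimately show ?thesis by blast
qed

section \<open>Engel's theorem\<close>

definition comm :: "('b \<Rightarrow> 'b::ab_group_add) \<Rightarrow> ('b \<Rightarrow> 'b) \<Rightarrow> 'b \<Rightarrow> 'b" where
  "comm S T = (\<lambda>v. S (T v) - T (S v))"

locale operator_algebra = vector_space scale
  for scale :: "'a::field \<Rightarrow> 'b::ab_group_add \<Rightarrow> 'b"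
begin

definition act :: "('b \<Rightarrow> 'b) set \<Rightarrow> 'b set \<Rightarrow> 'b set" where
  "act K U = span {k u | k u. k \<in> K \<and> u \<in> U}"

lemma act_mono: "K \<subseteq> K' \<Longrightarrow> U \<subseteq> U' \<Longrightarrow> act K U \<subseteq> act K' U'"
  unfolding act_def by (intro span_mono) blast

lemma act_pow_mono: "K \<subseteq> K' \<Longrightarrow> U \<subseteq> U' \<Longrightarrow> (act K ^^ b) U \<subseteq> (act K' ^^ b) U'"
  by (induction b) (auto dest: act_mono)

lemma actI: "k \<in> K \<Longrightarrow> u \<in> U \<Longrightarrow> k u \<in> act K U"
  unfolding act_def by (intro span_base) blast

lemma act_least: "subspace S \<Longrightarrow> (\<And>k u. k \<in> K \<Longrightarrow> u \<in> U \<Longrightarrow> k u \<in> S) \<Longrightarrow> act K U \<subseteq> S"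
  unfolding act_def by (intro span_minimal) auto

end

text \<open>Following Jacobson, only closure under commutators of the set of nilpotent operators is used,
  so that no linear structure on this set is needed.\<close>

locale nilpotent_operators = operator_algebra scale
  for scale :: "'a::field \<Rightarrow> 'b::ab_group_add \<Rightarrow> 'b" +
  fixes V B :: "'b set" and L :: "('b \<Rightarrow> 'b) set"
  assumes subV: "subspace V" and finB: "finite B" and VB: "V \<subseteq> span B"
    and LV: "\<And>S x. S \<in> L \<Longrightarrow> x \<in> V \<Longrightarrow> S x \<in> V"
    and L_add: "\<And>S x y. S \<in> L \<Longrightarrow> x \<in> V \<Longrightarrow> y \<in> V \<Longrightarrow> S (x + y) = S x + S y"
    and L_scale: "\<And>S c x. S \<in> L \<Longrightarrow> x \<in> V \<Longrightarrow> S (scale c x) = scale c (S x)"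
    and L_out: "\<And>S x. S \<in> L \<Longrightarrow> x \<notin> V \<Longrightarrow> S x = 0"
    and L_comm: "\<And>S T. S \<in> L \<Longrightarrow> T \<in> L \<Longrightarrow> comm S T \<in> L"
    and L_nil: "\<And>S x. S \<in> L \<Longrightarrow> x \<in> V \<Longrightarrow> \<exists>p. (S ^^ p) x = 0"
begin

lemma L_0: "S \<in> L \<Longrightarrow> S 0 = 0"
  using L_scale[of S 0 0] subV subspace_0 by simp

lemma L_span:
  assumes S: "S \<in> L" and X: "X \<subseteq> V" and W: "subspace W" and "\<And>x. x \<in> X \<Longrightarrow> S x \<in> W" and x: "x \<in> span X"
  shows "S x \<in> W"
proof -
  have "span X \<subseteq> {x \<in> V. S x \<in> W}"
  proof (rule span_minimal)
    show "X \<subseteq> {x \<in> V. S x \<in> W}" using assms by blast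
    show "subspace {x \<in> V. S x \<in> W}"
    proof (rule subspaceI)
      show "0 \<in> {x \<in> V. S x \<in> W}" using subspace_0[OF subV] subspace_0[OF W] L_0[OF S] by simp
      show "x + y \<in> {x \<in> V. S x \<in> W}" if "x \<in> {x \<in> V. S x \<in> W}" "y \<in> {x \<in> V. S x \<in> W}" for x y
        using that L_add[OF S] subspace_add[OF subV] subspace_add[OF W] by simp
      show "scale c x \<in> {x \<in> V. S x \<in> W}" if "x \<in> {x \<in> V. S x \<in> W}" for c x
        using that L_scale[OF S] subspace_scale[OF subV] subspace_scale[OF W] by simp
    qed
  qed
  then show ?thesis using x by blast
qed

abbreviation U :: "('b \<Rightarrow> 'b) set \<Rightarrow> nat \<Rightarrow> 'b set" where
  "U K b \<equiv> (act K ^^ b) V"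

lemma act_subspace: "subspace (act K X)"
  unfolding act_def by (rule subspace_span)

lemma U_subspace: "subspace (U K b)"
  using subV act_subspace by (cases b) auto

lemma U_V:
  assumes "K \<subseteq> L"
  shows "U K b \<subseteq> V"
proof (induction b)
  case (Suc b)
  then show ?case using act_least[OF subV, of K "U K b"] LV assms by auto
qed simp

lemma U_decreasing_Suc:
  assumes "K \<subseteq> L"
  shows "U K (Suc b) \<subseteq> U K b"
proof (induction b)
  case 0
  then show ?case using U_V[OF assms, of 1] by simp
next
  case (Suc b)
  then show ?case using act_mono[OF subset_refl] by simp
qed

lemma U_decreasing: "K \<subseteq> L \<Longrightarrow> b \<le> c \<Longrightarrow> U K c \<subseteq> U K b"
  by (rule lift_Suc_antimono_le[of "U K"]) (rule U_decreasing_Suc)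

lemma UI: "k \<in> K \<Longrightarrow> u \<in> U K b \<Longrightarrow> k u \<in> U K (Suc b)"
  using actI by simp

text \<open>A repetition in the chain \<open>U K b\<close> would make it constant from there on, so
  it drops strictly until it is 0, and vectors taken from successive differences are independent.
  The bound does not depend on \<open>K\<close>, which lets the vanishing pass to unions of chains
  in \<open>engel\<close>.\<close>

lemma U_bound:
  assumes K: "K \<subseteq> L" and m: "U K m \<subseteq> {0}"
  shows "U K (card B) \<subseteq> {0}"
proof (rule ccontr)
  let ?n = "card B"
  assume no: "\<not> U K ?n \<subseteq> {0}"
  have "U K b \<noteq> U K (Suc b)" if "b \<le> ?n" for b
  proof
    assume eq: "U K b = U K (Suc b)"
    have "U K (b + j) = U K b" for j
    proof (induction j)
      case (Suc j)
      have "U K (b + Suc j) = act K (U K (b + j))" by simp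
      also have "\<dots> = U K (Suc b)" unfolding Suc by simp
      finally show ?case unfolding eq[symmetric] .
    qed simp
    then have "U K b = U K (b + m)" by metis
    also have "\<dots> \<subseteq> U K m" by (rule U_decreasing[OF K]) simp
    finally have "U K b \<subseteq> {0}" using m by blast
    then show False using no U_decreasing[OF K that] by blast
  qed
  then have "\<exists>w. b \<le> ?n \<longrightarrow> w \<in> U K b \<and> w \<notin> U K (Suc b)" for b
    using U_decreasing_Suc[OF K, of b] by (metis subsetI subset_antisym)
  then have "\<forall>b. \<exists>w. b \<le> ?n \<longrightarrow> w \<in> U K b \<and> w \<notin> U K (Suc b)" by blast
  from choice[OF this] obtain w where
    w: "\<And>b. b \<le> ?n \<Longrightarrow> w b \<in> U K b" "\<And>b. b \<le> ?n \<Longrightarrow> w b \<notin> U K (Suc b)" by blast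
  have "independent (w ` {?n - j..?n}) \<and> card (w ` {?n - j..?n}) = Suc j \<and> w ` {?n - j..?n} \<subseteq> U K (?n - j)"
    if "j \<le> ?n" for j
    using that
  proof (induction j)
    case 0
    have "w ?n \<noteq> 0" using w(2)[of ?n] U_subspace[where K = K and b = "Suc ?n"] subspace_0 by auto
    then show ?case using w by simp
  next
    case (Suc j)
    define b where "b = ?n - Suc j"
    have b: "?n - j = Suc b" "b \<le> ?n" using Suc.prems unfolding b_def by auto
    have IH: "independent (w ` {Suc b..?n})" "card (w ` {Suc b..?n}) = Suc j" "w ` {Suc b..?n} \<subseteq> U K (Suc b)"
      using Suc b by auto
    have ins: "{b..?n} = insert b {Suc b..?n}" using b by auto
    have "w b \<notin> span (w ` {Suc b..?n})" using span_minimal[OF IH(3) U_subspace] w(2)[OF b(2)] by blast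
    then have "independent (insert (w b) (w ` {Suc b..?n}))" using independent_insertI IH by blast
    moreover have "w b \<notin> w ` {Suc b..?n}" using w(2)[OF b(2)] IH(3) by blast
    ultimately show ?case
      using IH w(1)[OF b(2)] U_decreasing_Suc[OF K, of b] unfolding b_def[symmetric] ins by auto
  qed
  from this[of ?n] have "independent (w ` {0..?n})" "card (w ` {0..?n}) = Suc ?n" "w ` {0..?n} \<subseteq> V" by auto
  then show False using independent_span_bound[OF finB, of "w ` {0..?n}"] VB by auto
qed

lemma nilpotent_uniform:
  assumes y: "y \<in> L"
  shows "\<exists>p. \<forall>v \<in> V. (y ^^ p) v = 0"
proof -
  obtain B' where B': "B' \<subseteq> V" "independent B'" "V \<subseteq> span B'" using maximal_independent_subset by blast
  then have "finite B'" using independent_span_bound[OF finB, of B'] VB by blast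
  obtain q where q: "\<And>v. v \<in> V \<Longrightarrow> (y ^^ q v) v = 0" using L_nil[OF y] by metis
  define p where "p = Max (insert 0 (q ` B'))"
  have y0: "(y ^^ j) 0 = 0" for j by (induction j) (auto simp: L_0[OF y])
  have yV: "(y ^^ j) v \<in> V" if "v \<in> V" for j v using that by (induction j) (auto simp: LV[OF y])
  have b0: "(y ^^ p) b = 0" if "b \<in> B'" for b
  proof -
    have "q b \<le> p" unfolding p_def using that \<open>finite B'\<close> by simp
    then have "(y ^^ p) b = (y ^^ (p - q b)) ((y ^^ q b) b)" by (metis comp_apply funpow_add le_add_diff_inverse2)
    then show ?thesis using q that B' y0 by auto
  qed
  have "span B' \<subseteq> {v \<in> V. (y ^^ p) v = 0}"
  proof (rule span_minimal)
    show "B' \<subseteq> {v \<in> V. (y ^^ p) v = 0}" using b0 B' by blast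
    have add: "(y ^^ j) (u + v) = (y ^^ j) u + (y ^^ j) v" if "u \<in> V" "v \<in> V" for j u v
      using that by (induction j) (auto simp: L_add[OF y] yV)
    have sc: "(y ^^ j) (scale c v) = scale c ((y ^^ j) v)" if "v \<in> V" for j c v
      using that by (induction j) (auto simp: L_scale[OF y] yV)
    show "subspace {v \<in> V. (y ^^ p) v = 0}"
      by (rule subspaceI) (use subV subspace_0 subspace_add subspace_scale y0 add sc in auto)
  qed
  then show ?thesis using B' by blast
qed

text \<open>\<open>y\<close> normalizes \<open>K\<close>, hence preserves every
  \<open>U K b\<close>. Modulo \<open>U K (b + 1)\<close> the operators in \<open>K\<close> act on
  it as 0, so among the words of length \<open>p\<close> only \<open>y^p\<close> could survive, and
  it is 0. Words of length \<open>p\<close> thus lower the flag by one step, and \<open>n p\<close>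
  is a possible \<open>m\<close>.\<close>

lemma extend_nilpotent:
  assumes K: "K \<subseteq> L" and n: "U K n \<subseteq> {0}" and y: "y \<in> L" and norm: "\<And>k. k \<in> K \<Longrightarrow> comm y k \<in> K"
  shows "\<exists>m. U (insert y K) m \<subseteq> {0}"
proof -
  have yU: "y u \<in> U K b" if "u \<in> U K b" for u b
    using that
  proof (induction b arbitrary: u)
    case 0
    then show ?case using LV[OF y] by simp
  next
    case (Suc b)
    have "u \<in> span {k u | k u. k \<in> K \<and> u \<in> U K b}"
      using Suc.prems unfolding funpow.simps comp_apply act_def[of K "U K b"] .
    then show ?case
    proof (rule L_span[OF y _ U_subspace, rotated 2])
      show "{k u | k u. k \<in> K \<and> u \<in> U K b} \<subseteq> V" using LV K U_V[OF K, of b] by blast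
      fix x assume "x \<in> {k u | k u. k \<in> K \<and> u \<in> U K b}"
      then obtain k u where x: "x = k u" "k \<in> K" "u \<in> U K b" by blast
      have "y x = k (y u) + comm y k u" unfolding x comm_def by simp
      moreover have "k (y u) \<in> U K (Suc b)" using UI x Suc.IH by blast
      moreover have "comm y k u \<in> U K (Suc b)" using UI x norm by blast
      ultimately show "y x \<in> U K (Suc b)"
        using subspace_add[OF U_subspace[where K = K and b = "Suc b"]] by metis
    qed
  qed
  obtain p where p: "\<forall>v \<in> V. (y ^^ p) v = 0" using nilpotent_uniform[OF y] by blast
  have ypU: "(y ^^ j) u \<in> U K b" if "u \<in> U K b" for j u b using that by (induction j) (auto intro: yU)
  have step: "(act (insert y K) ^^ j) (U K b) \<subseteq> span (U K (Suc b) \<union> (y ^^ j) ` U K b)" for j b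
  proof (induction j)
    case 0
    show ?case by (auto intro: span_base)
  next
    case (Suc j)
    let ?W = "span (U K (Suc b) \<union> (y ^^ Suc j) ` U K b)"
    have X: "U K (Suc b) \<union> (y ^^ j) ` U K b \<subseteq> U K b" using U_decreasing_Suc[OF K] ypU by blast
    have "act (insert y K) ((act (insert y K) ^^ j) (U K b)) \<subseteq> ?W"
    proof (rule act_least)
      fix k x assume k: "k \<in> insert y K" and "x \<in> (act (insert y K) ^^ j) (U K b)"
      then have x: "x \<in> span (U K (Suc b) \<union> (y ^^ j) ` U K b)" using Suc by blast
      have kL: "k \<in> L" using k y K by blast
      show "k x \<in> ?W"
      proof (rule L_span[OF kL _ subspace_span _ x])
        show "U K (Suc b) \<union> (y ^^ j) ` U K b \<subseteq> V" using X U_V[OF K, of b] by blast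
        fix z assume z: "z \<in> U K (Suc b) \<union> (y ^^ j) ` U K b"
        show "k z \<in> ?W"
        proof (cases "k \<in> K")
          case True
          then have "k z \<in> U K (Suc b)" using UI z X by blast
          then show ?thesis by (intro span_base) blast
        next
          case False
          then have ky: "k = y" using k by blast
          from z show ?thesis
          proof
            assume "z \<in> U K (Suc b)"
            then show ?thesis unfolding ky using yU by (intro span_base) blast
          next
            assume "z \<in> (y ^^ j) ` U K b"
            then show ?thesis unfolding ky by (intro span_base) auto
          qed
        qed
      qed
    qed (rule subspace_span)
    then show ?case by simp
  qed
  have "(act (insert y K) ^^ p) (U K b) \<subseteq> U K (Suc b)" for b
  proof -
    have "(y ^^ p) ` U K b \<subseteq> {0}" using p U_V[OF K, of b] by blast
    then have "span (U K (Suc b) \<union> (y ^^ p) ` U K b) \<subseteq> U K (Suc b)"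
      using subspace_0[OF U_subspace[where K = K and b = "Suc b"]]
      by (intro span_minimal[OF _ U_subspace[where K = K and b = "Suc b"]]) auto
    then show ?thesis using step[of p b] by blast
  qed
  then have "U (insert y K) (b * p) \<subseteq> U K b" for b
  proof (induction b)
    case (Suc b)
    have "U (insert y K) (Suc b * p) = (act (insert y K) ^^ p) (U (insert y K) (b * p))"
      by (simp add: funpow_add)
    also have "\<dots> \<subseteq> (act (insert y K) ^^ p) (U K b)" by (rule act_pow_mono) (use Suc in auto)
    finally show ?case using Suc.prems by blast
  qed simp
  then show ?thesis using n by blast
qed

text \<open>Jacobson's argument: otherwise every element of \<open>L\<close> outside
  \<open>K\<close> has a commutator with some element of \<open>K\<close> that is again outside
  \<open>K\<close>. Repeated commutators of \<open>y0\<close> are sums of words with more and more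
  letters from \<open>K\<close> around one \<open>y0\<close>; they end up as 0, which is in
  \<open>K\<close>.\<close>

lemma normalizing_element:
  assumes K: "K \<subseteq> L" and n: "U K n \<subseteq> {0}" and K0: "(\<lambda>_. 0) \<in> K" and y0: "y0 \<in> L" "y0 \<notin> K"
  shows "\<exists>y \<in> L - K. \<forall>k \<in> K. comm k y \<in> K \<and> comm y k \<in> K"
proof (rule ccontr)
  assume no: "\<not> ?thesis"
  \<comment> \<open>\<open>P a c\<close> is spanned by values of words with \<open>a\<close> letters
    of \<open>K\<close> to the left of \<open>y0\<close> and \<open>c\<close> to its right, and
    \<open>T s\<close> by those with at least \<open>s\<close> letters of \<open>K\<close>.\<close>
  define P where "P a c = (act K ^^ a) (span (y0 ` U K c))" for a c
  define T where "T s = span (\<Union> {P a c | a c. s \<le> a + c})" for s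
  have y0V: "span (y0 ` U K c) \<subseteq> V" for c
    using U_V[OF K, of c] LV[OF y0(1)] by (intro span_minimal subV) blast
  have PV: "P a c \<subseteq> U K a" for a c unfolding P_def by (rule act_pow_mono[OF subset_refl y0V])
  have PVV: "\<Union> {P a c | a c. s \<le> a + c} \<subseteq> V" for s using PV U_V[OF K] by blast
  have act0: "act K {0} \<subseteq> {0}" by (rule act_least[OF subspace_single_0]) (use L_0 K in auto)
  \<comment> \<open>Of \<open>2 n\<close> letters at least \<open>n\<close> stand on one side of
    \<open>y0\<close>, and \<open>n\<close> consecutive letters of \<open>K\<close> give 0.\<close>
  have P0: "P a c \<subseteq> {0}" if ac: "2 * n \<le> a + c" for a c
  proof (cases "n \<le> a")
    case True
    then show ?thesis using PV U_decreasing[OF K, of n a] n by blast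
  next
    case False
    then have "U K c \<subseteq> {0}" using U_decreasing[OF K, of n c] n ac by auto
    then have "span (y0 ` U K c) \<subseteq> {0}" using L_0[OF y0(1)] by (intro span_minimal subspace_single_0) auto
    then have "(act K ^^ a) (span (y0 ` U K c)) \<subseteq> (act K ^^ a) {0}" by (rule act_pow_mono[OF subset_refl])
    moreover have "(act K ^^ a) {0} \<subseteq> {0}"
    proof (induction a)
      case (Suc a)
      then show ?case using act_mono[OF subset_refl Suc, of K] act0 by simp
    qed simp
    ultimately show ?thesis unfolding P_def by blast
  qed
  have T0: "T s \<subseteq> {0}" if s: "2 * n \<le> s" for s
    unfolding T_def
  proof (intro span_minimal subspace_single_0 subsetI)
    fix z assume "z \<in> \<Union> {P a c | a c. s \<le> a + c}"
    then obtain a c where "z \<in> P a c" "s \<le> a + c" by blast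
    then show "z \<in> {0}" using P0[of a c] s by auto
  qed
  have kT: "k x \<in> T (Suc s)" if k: "k \<in> K" and x: "x \<in> T s" for k x s
  proof (rule L_span[where S = k and x = x and W = "T (Suc s)" and X = "\<Union> {P a c | a c. s \<le> a + c}"])
    show "k \<in> L" using k K by blast
    show "x \<in> span (\<Union> {P a c | a c. s \<le> a + c})" using x unfolding T_def .
    show "subspace (T (Suc s))" unfolding T_def by (rule subspace_span)
    fix z assume "z \<in> \<Union> {P a c | a c. s \<le> a + c}"
    then obtain a c where ac: "z \<in> P a c" "s \<le> a + c" by blast
    then have "k z \<in> P (Suc a) c" unfolding P_def using actI[OF k] by simp
    moreover have "Suc s \<le> Suc a + c" using ac by simp
    ultimately show "k z \<in> T (Suc s)" unfolding T_def by (intro span_base) blast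
  qed (rule PVV)
  have Tsub: "subspace (T s)" for s unfolding T_def by (rule subspace_span)
  \<comment> \<open>After \<open>i\<close> commutators the operator raises the number of letters by
    \<open>i\<close>: a commutator with \<open>k\<close> either adds a letter on the left or moves
    the argument to \<open>U K (Suc b)\<close>.\<close>
  have "\<exists>y \<in> L - K. \<forall>b. \<forall>u \<in> U K b. y u \<in> T (i + b)" for i
  proof (induction i)
    case 0
    have "y0 u \<in> T (0 + b)" if "u \<in> U K b" for b u
    proof -
      have "y0 u \<in> P 0 b" unfolding P_def using that by (auto intro: span_base)
      then show ?thesis unfolding T_def by (intro span_base) force
    qed
    then show ?case using y0 by blast
  next
    case (Suc i)
    then obtain y where y: "y \<in> L - K" "\<And>b u. u \<in> U K b \<Longrightarrow> y u \<in> T (i + b)" by blast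
    obtain k where k: "k \<in> K" "comm k y \<notin> K \<or> comm y k \<notin> K" using no y(1) by blast
    have T1: "k (y u) \<in> T (Suc i + b)" "y (k u) \<in> T (Suc i + b)" if u: "u \<in> U K b" for u b
      using kT[OF k(1) y(2)[OF u]] y(2)[OF UI[OF k(1) u]] by simp_all
    have "comm k y u \<in> T (Suc i + b)" "comm y k u \<in> T (Suc i + b)" if "u \<in> U K b" for u b
      unfolding comm_def using T1[OF that] subspace_diff[OF Tsub] by blast+
    moreover have "comm k y \<in> L" "comm y k \<in> L" using L_comm y(1) k(1) K by blast+
    ultimately show ?case using k(2) by blast
  qed
  then obtain y where y: "y \<in> L - K" "\<And>b u. u \<in> U K b \<Longrightarrow> y u \<in> T (2 * n + b)" by blast
  \<comment> \<open>The values on \<open>V\<close> lie in \<open>T (2 n)\<close>, which is 0 by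
    \<open>T0\<close>. Outside \<open>V\<close> the operator is 0 by \<open>L_out\<close>.\<close>
  have "y = (\<lambda>_. 0)"
  proof
    fix v
    show "y v = 0"
    proof (cases "v \<in> V")
      case True
      then have "y v \<in> T (2 * n + 0)" using y(2)[of v 0] by simp
      then show ?thesis using T0[of "2 * n + 0"] by auto
    qed (use y L_out in blast)
  qed
  then show False using y(1) K0 by blast
qed

text \<open>Zorn's lemma gives a maximal commutator-closed set \<open>K\<close> containing 0 with
  \<open>U K (card B)\<close> equal to 0. If it were not \<open>L\<close>,
  \<open>normalizing_element\<close> would supply an operator to adjoin,
  \<open>extend_nilpotent\<close> would keep the set nilpotent, and \<open>U_bound\<close> would
  bring the exponent back to \<open>card B\<close>.\<close>

theorem engel: "\<exists>m. U L m \<subseteq> {0}"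
proof (cases "L = {}")
  case True
  have "act {} V \<subseteq> {0}" by (rule act_least[OF subspace_single_0]) auto
  then have "U L 1 \<subseteq> {0}" using True by simp
  then show ?thesis by blast
next
  case False
  let ?n = "card B" and ?z = "\<lambda>_ :: 'b. 0 :: 'b"
  obtain S0 where "S0 \<in> L" using False by blast
  then have z: "?z \<in> L" using L_comm[of S0 S0] by (simp add: comm_def)
  have cz: "comm ?z S = ?z" "comm S ?z = ?z" if "S \<in> L" for S using L_0[OF that] by (auto simp: comm_def)
  let ?F = "{K. K \<subseteq> L \<and> ?z \<in> K \<and> (\<forall>S \<in> K. \<forall>T \<in> K. comm S T \<in> K) \<and> U K ?n \<subseteq> {0}}"
  have "\<exists>K\<in>?F. \<forall>X\<in>?F. K \<subseteq> X \<longrightarrow> X = K"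
  proof (rule subset_Zorn_nonempty)
    have "act {?z} V \<subseteq> {0}" by (rule act_least[OF subspace_single_0]) auto
    then have "U {?z} 1 \<subseteq> {0}" by simp
    then have "U {?z} ?n \<subseteq> {0}" by (rule U_bound[rotated]) (use z in blast)
    then have zF: "{?z} \<in> ?F" using z cz by simp
    show "?F \<noteq> {}"
    proof
      assume "?F = {}"
      then have "{?z} \<notin> ?F" by (rule equals0D)
      then show False using zF by (rule notE)
    qed
  next
    fix C assume C: "C \<noteq> {}" "subset.chain ?F C"
    then have CF: "\<And>K. K \<in> C \<Longrightarrow> K \<in> ?F" and ch: "\<And>X Y. X \<in> C \<Longrightarrow> Y \<in> C \<Longrightarrow> X \<subseteq> Y \<or> Y \<subseteq> X"
      unfolding subset_chain_def by auto
    \<comment> \<open>A sum of words in the union involves finitely many operators, all of which lie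
      in one member of the chain.\<close>
    have "U (\<Union>C) b \<subseteq> (\<Union>K\<in>C. U K b)" for b
    proof (induction b)
      case (Suc b)
      have "act (\<Union>C) (U (\<Union>C) b) \<subseteq> (\<Union>K\<in>C. U K (Suc b))"
      proof (rule act_least)
        fix k u assume "k \<in> \<Union>C" "u \<in> U (\<Union>C) b"
        then obtain K1 K2 where K: "K1 \<in> C" "k \<in> K1" "K2 \<in> C" "u \<in> U K2 b" using Suc by blast
        show "k u \<in> (\<Union>K\<in>C. U K (Suc b))"
        proof (cases "K1 \<subseteq> K2")
          case True
          then show ?thesis using K UI[of k K2 u b] by blast
        next
          case False
          then have "U K2 b \<subseteq> U K1 b" using ch K by (intro act_pow_mono) auto
          then show ?thesis using K UI[of k K1 u b] by blast
        qed
      next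
        show "subspace (\<Union>K\<in>C. U K (Suc b))"
        proof (rule subspaceI)
          show "0 \<in> (\<Union>K\<in>C. U K (Suc b))" using C subspace_0[OF U_subspace[where b = "Suc b"]] by blast
          show "scale c x \<in> (\<Union>K\<in>C. U K (Suc b))" if "x \<in> (\<Union>K\<in>C. U K (Suc b))" for c x
            using that subspace_scale[OF U_subspace[where b = "Suc b"]] by blast
          fix x y assume "x \<in> (\<Union>K\<in>C. U K (Suc b))" "y \<in> (\<Union>K\<in>C. U K (Suc b))"
          then obtain K1 K2 where K: "K1 \<in> C" "x \<in> U K1 (Suc b)" "K2 \<in> C" "y \<in> U K2 (Suc b)" by blast
          then have "U K1 (Suc b) \<subseteq> U K2 (Suc b) \<or> U K2 (Suc b) \<subseteq> U K1 (Suc b)"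
            using ch[OF K(1,3)] act_pow_mono[OF _ subset_refl] by blast
          then show "x + y \<in> (\<Union>K\<in>C. U K (Suc b))" using K subspace_add[OF U_subspace[where b = "Suc b"]] by blast
        qed
      qed
      then show ?case by simp
    qed (use C in auto)
    moreover have "U K ?n \<subseteq> {0}" if "K \<in> C" for K using CF[OF that] by simp
    ultimately have Cn: "U (\<Union>C) ?n \<subseteq> {0}" by (meson UN_least order_trans)
    have Cc: "comm S T \<in> \<Union>C" if ST: "S \<in> \<Union>C" "T \<in> \<Union>C" for S T
    proof -
      obtain K1 where K1: "K1 \<in> C" "S \<in> K1" using ST(1) by (rule UnionE)
      obtain K2 where K2: "K2 \<in> C" "T \<in> K2" using ST(2) by (rule UnionE)
      obtain K where K: "K \<in> C" "S \<in> K" "T \<in> K"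
        using ch[OF K1(1) K2(1)] K1 K2 by (metis subsetD)
      have "K \<in> ?F" by (rule CF[OF K(1)])
      then have "comm S T \<in> K" using K by simp
      then show ?thesis using K(1) by (rule UnionI[rotated])
    qed
    have CL: "\<Union>C \<subseteq> L"
    proof (rule Union_least)
      show "K \<subseteq> L" if "K \<in> C" for K using CF[OF that] by simp
    qed
    obtain K0 where "K0 \<in> C" using C(1) by auto
    then have Cz: "?z \<in> \<Union>C" using CF[of K0] by auto
    show "\<Union>C \<in> ?F" unfolding mem_Collect_eq
      by (intro conjI ballI CL Cz Cn Cc)
  qed
  then obtain K where KF: "K \<in> ?F" and max: "\<forall>X\<in>?F. K \<subseteq> X \<longrightarrow> X = K" by (rule bexE)
  have K: "K \<subseteq> L" "?z \<in> K" "U K ?n \<subseteq> {0}" and Kc: "\<And>S T. S \<in> K \<Longrightarrow> T \<in> K \<Longrightarrow> comm S T \<in> K"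
    using KF by auto
  have "K = L"
  proof (rule ccontr)
    assume "K \<noteq> L"
    then obtain y0 where y0: "y0 \<in> L" "y0 \<notin> K" using K(1) by (metis subsetI subset_antisym)
    obtain y where y: "y \<in> L - K" and yK: "\<forall>k \<in> K. comm k y \<in> K \<and> comm y k \<in> K"
      using normalizing_element[OF K(1,3,2) y0] by (rule bexE)
    have yL: "insert y K \<subseteq> L" using y K(1) by simp
    have "\<exists>m. U (insert y K) m \<subseteq> {0}"
      by (rule extend_nilpotent[OF K(1,3)]) (use y yK in auto)
    then obtain m where "U (insert y K) m \<subseteq> {0}" by (rule exE)
    then have n: "U (insert y K) ?n \<subseteq> {0}" by (rule U_bound[OF yL])
    have "comm y y = ?z" by (simp add: comm_def)
    then have "\<forall>S \<in> insert y K. \<forall>T \<in> insert y K. comm S T \<in> insert y K" 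
      using yK Kc K(2) by auto
    then have "insert y K \<in> ?F" unfolding mem_Collect_eq
      by (intro conjI yL n insertI2 K(2))
    then have "insert y K = K" by (rule mp[OF bspec[OF max] subset_insertI])
    then have "y \<in> K" by (rule subst) (rule insertI1)
    then show False using y by auto
  qed
  then show ?thesis using K(3) by auto
qed

end

section \<open>The Lie algebra of a proalgebraic group\<close>

definition cscale :: "rat \<Rightarrow> ('g \<Rightarrow> complex) \<Rightarrow> 'g \<Rightarrow> complex" where
  "cscale q f = (\<lambda>x. of_rat q * f x)"

global_interpretation rat_functions: vector_space "rscale :: rat \<Rightarrow> ('b \<Rightarrow> rat) \<Rightarrow> 'b \<Rightarrow> rat"
  by standard (auto simp: rscale_def fun_eq_iff algebra_simps)

global_interpretation complex_functions: vector_space "cscale :: rat \<Rightarrow> ('b \<Rightarrow> complex) \<Rightarrow> 'b \<Rightarrow> complex"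
  by standard (auto simp: cscale_def fun_eq_iff algebra_simps of_rat_add of_rat_mult)

lemma sum_fun_apply: "(\<Sum>i\<in>I. F i) x = (\<Sum>i\<in>I. F i x)"
  by (induction I rule: infinite_finite_induct) auto

locale proalgebraic_group =
  fixes G :: "'g qgroup"
  assumes proalg: "proalgebraic G"
begin

abbreviation "\<O> \<equiv> regular G"

lemma group_G: "group G"
  using proalg unfolding proalgebraic_def by blast

sublocale group G by (rule group_G)

lemma
  shows regular_outside: "f \<in> \<O> \<Longrightarrow> zero_outside (carrier G) f = f"
    and regular_const: "zero_outside (carrier G) (\<lambda>x. of_rat q) \<in> \<O>"
    and regular_add: "f \<in> \<O> \<Longrightarrow> g \<in> \<O> \<Longrightarrow> f + g \<in> \<O>"
    and regular_mult: "f \<in> \<O> \<Longrightarrow> g \<in> \<O> \<Longrightarrow> f * g \<in> \<O>"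
    and regular_at_one: "f \<in> \<O> \<Longrightarrow> f \<one>\<^bsub>G\<^esub> \<in> \<rat>"
    and regular_coproduct: "f \<in> \<O> \<Longrightarrow> \<exists>n u v. coproduct G f n u v"
  using proalg unfolding proalgebraic_def by blast+

lemma point_exists:
  assumes "e (zero_outside (carrier G) (\<lambda>x. 1)) = (1 :: complex)"
    and "\<And>f g. f \<in> \<O> \<Longrightarrow> g \<in> \<O> \<Longrightarrow> e (f + g) = e f + e g"
    and "\<And>f g. f \<in> \<O> \<Longrightarrow> g \<in> \<O> \<Longrightarrow> e (f * g) = e f * e g"
  shows "\<exists>x \<in> carrier G. \<forall>f \<in> \<O>. e f = f x"
proof -
  have e: "e (zero_outside (carrier G) (\<lambda>x. 1)) = 1 \<and>
    (\<forall>f \<in> \<O>. \<forall>g \<in> \<O>. e (f + g) = e f + e g \<and> e (f * g) = e f * e g)" using assms by blast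
  have all: "\<forall>e :: ('g \<Rightarrow> complex) \<Rightarrow> complex. e (zero_outside (carrier G) (\<lambda>x. 1)) = 1 \<and>
    (\<forall>f \<in> \<O>. \<forall>g \<in> \<O>. e (f + g) = e f + e g \<and> e (f * g) = e f * e g) \<longrightarrow>
    (\<exists>!x. x \<in> carrier G \<and> (\<forall>f \<in> \<O>. e f = f x))"
    using proalg unfolding proalgebraic_def by (elim conjE)
  have "\<exists>!x. x \<in> carrier G \<and> (\<forall>f \<in> \<O>. e f = f x)" by (rule mp[OF spec[OF all, of e] e])
  from ex1_implies_ex[OF this] show ?thesis unfolding Bex_def .
qed

lemma regular_eq_0:
  assumes "f \<in> \<O>" and "x \<notin> carrier G"
  shows "f x = 0"
proof -
  have "zero_outside (carrier G) f x = 0" using assms by (simp add: zero_outside_def)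
  then show ?thesis unfolding regular_outside[OF assms(1)] .
qed

lemma regular_eqI: "f \<in> \<O> \<Longrightarrow> g \<in> \<O> \<Longrightarrow> (\<And>x. x \<in> carrier G \<Longrightarrow> f x = g x) \<Longrightarrow> f = g"
  by (rule ext) (metis regular_eq_0)

lemma regular_scale: "f \<in> \<O> \<Longrightarrow> cscale q f \<in> \<O>"
proof -
  assume f: "f \<in> \<O>"
  have "cscale q f = zero_outside (carrier G) (\<lambda>x. of_rat q) * f"
    using regular_eq_0[OF f] by (auto simp: cscale_def zero_outside_def fun_eq_iff)
  then show ?thesis using regular_mult[OF regular_const f] by simp
qed

lemma regular_0: "0 \<in> \<O>"
proof -
  have "(0 :: 'g \<Rightarrow> complex) = zero_outside (carrier G) (\<lambda>x. of_rat 0)" by (auto simp: zero_outside_def fun_eq_iff)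
  then show ?thesis using regular_const by metis
qed

lemma regular_subspace: "complex_functions.subspace \<O>"
  by (rule complex_functions.subspaceI) (auto intro: regular_0 regular_add regular_scale)

lemmas regular_sum = complex_functions.subspace_sum[OF regular_subspace]
lemmas regular_diff = complex_functions.subspace_diff[OF regular_subspace]

text \<open>Covers evaluations at complex points as well as rational functionals. Additivity alone
  gives linearity over the rationals, see \<open>additive_scale\<close>.\<close>

definition additive_on_regular :: "(('g \<Rightarrow> complex) \<Rightarrow> complex) \<Rightarrow> bool" where
  "additive_on_regular Y \<longleftrightarrow> (\<forall>f \<in> \<O>. \<forall>g \<in> \<O>. Y (f + g) = Y f + Y g)"

lemma additive_0: "additive_on_regular Y \<Longrightarrow> Y 0 = 0"
  unfolding additive_on_regular_def using regular_0 by (metis add.right_neutral add_left_cancel)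

lemma additive_sum:
  assumes "additive_on_regular Y" and "\<And>i. i \<in> I \<Longrightarrow> f i \<in> \<O>"
  shows "Y (\<Sum>i\<in>I. f i) = (\<Sum>i\<in>I. Y (f i))"
  using assms(2)
proof (induction I rule: infinite_finite_induct)
  case (insert i I)
  then have "sum f I \<in> \<O>" "f i \<in> \<O>" by (auto intro: regular_sum)
  then have "Y (f i + sum f I) = Y (f i) + Y (sum f I)"
    using assms(1) unfolding additive_on_regular_def by blast
  moreover have "Y (sum f I) = (\<Sum>i\<in>I. Y (f i))" using insert by blast
  ultimately show ?case unfolding sum.insert[OF insert(1,2)] by (simp only:)
qed (simp_all add: additive_0[OF assms(1)])

lemma additive_scale:
  assumes Y: "additive_on_regular Y" and f: "f \<in> \<O>"
  shows "Y (cscale q f) = of_rat q * Y f"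
proof -
  have add: "Y (cscale (a + b) f) = Y (cscale a f) + Y (cscale b f)" for a b
    using Y regular_scale[OF f] unfolding additive_on_regular_def
    by (metis complex_functions.scale_left_distrib)
  have n: "Y (cscale (of_nat n * a) f) = of_nat n * Y (cscale a f)" for n a
  proof (induction n)
    case 0
    show ?case unfolding of_nat_0 mult_zero_left complex_functions.scale_zero_left by (rule additive_0[OF Y])
  next
    case (Suc n)
    have "of_nat (Suc n) * a = a + of_nat n * a" by (simp add: distrib_right)
    then show ?case using add[of a "of_nat n * a"] Suc by (simp only:) (simp add: distrib_right)
  qed
  have neg: "Y (cscale (- a) f) = - Y (cscale a f)" for a
    using add[of a "- a"] additive_0[OF Y] unfolding right_minus complex_functions.scale_zero_left
    by (metis add_eq_0_iff)
  have int: "Y (cscale (of_int m) f) = of_int m * Y f" for m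
  proof (cases m rule: int_cases2)
    case (nonneg k)
    then show ?thesis using n[of k 1] by simp
  next
    case (nonpos k)
    then show ?thesis using n[of k 1] neg[of "of_nat k"] by simp
  qed
  obtain a b where ab: "q = of_int a / of_int b" "b > 0" by (metis Fract_of_int_quotient Rat_cases)
  then obtain k where k: "b = int k" by (metis zero_le_imp_eq_int less_imp_le)
  have "of_nat k * q = of_int a" using ab k by simp
  then have e: "of_nat k * Y (cscale q f) = of_int a * Y f" using n[of k q] int by metis
  have nz: "of_nat k \<noteq> (0 :: complex)" using ab k by simp
  have "Y (cscale q f) = (of_int a / of_nat k) * Y f"
    unfolding times_divide_eq_left nonzero_eq_divide_eq[OF nz] mult.commute[of "Y (cscale q f)"] by (rule e)
  moreover have "of_rat q = (of_int a / of_nat k :: complex)" using ab k by (simp add: of_rat_divide)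
  ultimately show ?thesis by (simp only:)
qed

text \<open>The regular functions are linearly disjoint from the complex numbers: otherwise there would be
  a shortest relation with a coefficient 1 and another one which some automorphism moves.\<close>

lemma linear_disjoint:
  assumes Y: "additive_on_regular Y" and "finite I" and v: "\<And>i. i \<in> I \<Longrightarrow> v i \<in> \<O>"
    and rel: "\<And>x. x \<in> carrier G \<Longrightarrow> (\<Sum>i\<in>I. c i * v i x) = 0"
  shows "(\<Sum>i\<in>I. c i * Y (v i)) = 0"
  using rel
proof (induction "card {i \<in> I. c i \<noteq> 0}" arbitrary: c rule: less_induct)
  case less
  show ?case
  proof (cases "\<exists>k \<in> I. c k \<noteq> 0")
    case False
    then show ?thesis by simp
  next
    case True
    then obtain k where k: "k \<in> I" "c k \<noteq> 0" by blast
    define d where "d i = c i / c k" for i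
    have dk: "d k = 1" using k unfolding d_def by simp
    have d: "(\<Sum>i\<in>I. d i * v i x) = 0" if "x \<in> carrier G" for x
      using less.prems[OF that] unfolding d_def by (simp flip: sum_divide_distrib)
    have supp: "{i \<in> I. d i \<noteq> 0} = {i \<in> I. c i \<noteq> 0}" using k unfolding d_def by auto
    have IH: "(\<Sum>i\<in>I. a i * Y (v i)) = 0"
      if a: "\<And>x. x \<in> carrier G \<Longrightarrow> (\<Sum>i\<in>I. a i * v i x) = 0" "\<And>i. i \<in> I \<Longrightarrow> d i = 0 \<Longrightarrow> a i = 0"
        and j: "j \<in> I" "d j \<noteq> 0" "a j = 0" for a j
    proof (rule less.hyps)
      have "{i \<in> I. a i \<noteq> 0} \<subset> {i \<in> I. d i \<noteq> 0}" using a(2) j by blast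
      then show "card {i \<in> I. a i \<noteq> 0} < card {i \<in> I. c i \<noteq> 0}"
        unfolding supp using \<open>finite I\<close> by (intro psubset_card_mono) auto
    qed (rule a(1))
    have "(\<Sum>i\<in>I. d i * Y (v i)) = 0"
    proof (cases "\<forall>i \<in> I. d i \<in> \<rat>")
      case True
      then have "\<forall>i \<in> I. \<exists>r. d i = of_rat r" by (auto elim: Rats_cases)
      then obtain q where q: "\<And>i. i \<in> I \<Longrightarrow> d i = of_rat (q i)" using bchoice[of I] by metis
      have "(\<Sum>i\<in>I. cscale (q i) (v i)) = 0"
      proof (rule regular_eqI)
        show "(\<Sum>i\<in>I. cscale (q i) (v i)) \<in> \<O>" using v by (intro regular_sum regular_scale)
        show "(\<Sum>i\<in>I. cscale (q i) (v i)) x = 0 x" if "x \<in> carrier G" for x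
          using d[OF that] q by (simp add: sum_fun_apply cscale_def)
      qed (rule regular_0)
      then have "Y (\<Sum>i\<in>I. cscale (q i) (v i)) = 0" using additive_0[OF Y] by metis
      moreover have "Y (\<Sum>i\<in>I. cscale (q i) (v i)) = (\<Sum>i\<in>I. Y (cscale (q i) (v i)))"
        by (rule additive_sum[OF Y]) (intro regular_scale v)
      moreover have "\<dots> = (\<Sum>i\<in>I. d i * Y (v i))"
        by (rule sum.cong) (use additive_scale[OF Y v] q in auto)
      ultimately show ?thesis by metis
    next
      case False
      then obtain j where j: "j \<in> I" "d j \<notin> \<rat>" by blast
      obtain \<sigma> where \<sigma>: "bij \<sigma>" "\<And>x y. \<sigma> (x + y) = \<sigma> x + \<sigma> y" "\<And>x y. \<sigma> (x * y) = \<sigma> x * \<sigma> y" "\<sigma> 1 = 1"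
        and \<sigma>j: "\<sigma> (d j) \<noteq> d j" using complex_automorphism_moves[OF j(2)] by metis
      have \<sigma>0: "\<sigma> 0 = 0" using \<sigma>(2)[of 0 0] by simp
      have \<sigma>sum: "\<sigma> (sum f I) = (\<Sum>i\<in>I. \<sigma> (f i))" for f
        using \<open>finite I\<close> by induction (auto simp: \<sigma>0 \<sigma>(2))
      \<comment> \<open>Evaluation at \<open>x\<close> followed by the inverse of
        \<open>\<sigma>\<close> is again a ring homomorphism, hence evaluation at a point
        \<open>x'\<close>. The relation at \<open>x'\<close> is carried by \<open>\<sigma>\<close>
        to the one with transformed coefficients at \<open>x\<close>.\<close>
      have \<sigma>rel: "(\<Sum>i\<in>I. \<sigma> (d i) * v i x) = 0" if x: "x \<in> carrier G" for x
      proof -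
        define \<tau> where "\<tau> = inv_into UNIV \<sigma>"
        have st: "\<sigma> (\<tau> z) = z" "\<tau> (\<sigma> z) = z" for z
          unfolding \<tau>_def using \<sigma>(1) by (auto simp: bij_is_surj surj_f_inv_f bij_is_inj)
        have "\<tau> (y + z) = \<tau> y + \<tau> z" "\<tau> (y * z) = \<tau> y * \<tau> z" "\<tau> 1 = 1" for y z
          using st \<sigma>(2-4) by metis+
        then have "\<exists>x' \<in> carrier G. \<forall>f \<in> \<O>. \<tau> (f x) = f x'"
          using x by (intro point_exists) (simp_all add: zero_outside_def)
        then obtain x' where x': "x' \<in> carrier G" "\<And>f. f \<in> \<O> \<Longrightarrow> \<sigma> (f x') = f x" using st by metis
        have "(\<Sum>i\<in>I. \<sigma> (d i) * v i x) = \<sigma> (\<Sum>i\<in>I. d i * v i x')"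
          unfolding \<sigma>sum \<sigma>(3) using x'(2) v by simp
        then show ?thesis using d[OF x'(1)] \<sigma>0 by simp
      qed
      \<comment> \<open>\<open>a\<close> vanishes at \<open>k\<close> because
        \<open>\<sigma> 1 = 1\<close>, and \<open>b\<close>, which eliminates the coefficient of
        \<open>d\<close> at \<open>j\<close>, vanishes at \<open>j\<close>. Both are shorter
        relations, and \<open>d\<close> is a combination of them.\<close>
      define a where "a i = d i - \<sigma> (d i)" for i
      have arel: "(\<Sum>i\<in>I. a i * v i x) = 0" if "x \<in> carrier G" for x
        using d[OF that] \<sigma>rel[OF that] unfolding a_def by (simp add: left_diff_distrib sum_subtractf)
      have a0: "a i = 0" if "d i = 0" for i using that \<sigma>0 unfolding a_def by simp
      have 1: "(\<Sum>i\<in>I. a i * Y (v i)) = 0"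
        by (rule IH[OF arel _ k(1)]) (use a0 dk \<sigma>(4) in \<open>auto simp: a_def\<close>)
      have aj: "a j \<noteq> 0" using \<sigma>j unfolding a_def by simp
      define b where "b i = d i - d j / a j * a i" for i
      have "(\<Sum>i\<in>I. b i * z i) = (\<Sum>i\<in>I. d i * z i) - d j / a j * (\<Sum>i\<in>I. a i * z i)" for z
        unfolding b_def by (simp add: left_diff_distrib sum_subtractf sum_distrib_left mult.assoc)
      note b = this
      have "d j \<noteq> 0" using j by auto
      have "(\<Sum>i\<in>I. b i * Y (v i)) = 0"
      proof (rule IH[OF _ _ j(1) \<open>d j \<noteq> 0\<close>])
        show "(\<Sum>i\<in>I. b i * v i x) = 0" if "x \<in> carrier G" for x
          unfolding b using d[OF that] arel[OF that] by simp
        show "b i = 0" if "d i = 0" for i using a0[OF that] that unfolding b_def by simp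
        show "b j = 0" using aj unfolding b_def by simp
      qed
      then show ?thesis using 1 unfolding b by simp
    qed
    moreover have "(\<Sum>i\<in>I. c i * Y (v i)) = c k * (\<Sum>i\<in>I. d i * Y (v i))"
      unfolding d_def using k by (simp add: sum_distrib_left)
    ultimately show ?thesis by simp
  qed
qed

lemma linear_disjoint2:
  assumes Y: "additive_on_regular Y" and "finite I" "finite J"
    and "\<And>i. i \<in> I \<Longrightarrow> v i \<in> \<O>" "\<And>j. j \<in> J \<Longrightarrow> w j \<in> \<O>"
    and rel: "\<And>x. x \<in> carrier G \<Longrightarrow> (\<Sum>i\<in>I. c i * v i x) = (\<Sum>j\<in>J. d j * w j x)"
  shows "(\<Sum>i\<in>I. c i * Y (v i)) = (\<Sum>j\<in>J. d j * Y (w j))"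
proof -
  let ?c = "case_sum c (\<lambda>j. - d j)" and ?v = "case_sum v w"
  have split: "(\<Sum>k\<in>I <+> J. ?c k * F (?v k)) = (\<Sum>i\<in>I. c i * F (v i)) - (\<Sum>j\<in>J. d j * F (w j))"
    for F :: "('g \<Rightarrow> complex) \<Rightarrow> complex"
    using assms(2,3) by (simp add: sum.Plus sum_negf)
  have "(\<Sum>k\<in>I <+> J. ?c k * Y (?v k)) = 0"
  proof (rule linear_disjoint[OF Y])
    show "(\<Sum>k\<in>I <+> J. ?c k * ?v k x) = 0" if "x \<in> carrier G" for x
      using split[of "\<lambda>f. f x"] rel[OF that] by simp
  qed (use assms in auto)
  then show ?thesis unfolding split by simp
qed

text \<open>Index sets are arbitrary finite sets, so that sums and products of functions are
  presented over disjoint sums and products of index sets.\<close>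

definition presents :: "('g \<Rightarrow> complex) \<Rightarrow> 'i set \<Rightarrow> ('i \<Rightarrow> 'g \<Rightarrow> complex) \<Rightarrow> ('i \<Rightarrow> 'g \<Rightarrow> complex) \<Rightarrow> bool" where
  "presents f I u v \<longleftrightarrow> finite I \<and> (\<forall>i \<in> I. u i \<in> \<O> \<and> v i \<in> \<O>) \<and>
     (\<forall>x \<in> carrier G. \<forall>y \<in> carrier G. f (x \<otimes>\<^bsub>G\<^esub> y) = (\<Sum>i\<in>I. u i x * v i y))"

lemma coproduct_presents: "coproduct G f n u v \<longleftrightarrow> presents f {..<n} u v"
  unfolding coproduct_def presents_def by auto

text \<open>Convolution with complex values, which can mix evaluation at a point with a rational
  functional. It makes the same choice of a presentation as \<open>convolution\<close>.\<close>

definition cconv :: "(('g \<Rightarrow> complex) \<Rightarrow> complex) \<Rightarrow> (('g \<Rightarrow> complex) \<Rightarrow> complex) \<Rightarrow> ('g \<Rightarrow> complex) \<Rightarrow> complex" where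
  "cconv A B f = (case (SOME (n, u, v). coproduct G f n u v) of (n, u, v) \<Rightarrow> \<Sum>i<n. A (u i) * B (v i))"

text \<open>A presentation is an identity between functions of two points. With the first point
  fixed, \<open>linear_disjoint2\<close> replaces evaluation at the second by \<open>B\<close>; a
  second application replaces evaluation at the first by \<open>A\<close>.\<close>

lemma presents_unique:
  assumes A: "additive_on_regular A" and B: "additive_on_regular B"
    and p: "presents f I u v" and q: "presents f J u' v'"
  shows "(\<Sum>i\<in>I. A (u i) * B (v i)) = (\<Sum>j\<in>J. A (u' j) * B (v' j))"
proof -
  have x: "(\<Sum>i\<in>I. u i x * B (v i)) = (\<Sum>j\<in>J. u' j x * B (v' j))" if "x \<in> carrier G" for x
    by (rule linear_disjoint2[OF B]) (use p q that in \<open>auto simp: presents_def\<close>)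
  have "(\<Sum>i\<in>I. B (v i) * A (u i)) = (\<Sum>j\<in>J. B (v' j) * A (u' j))"
    by (rule linear_disjoint2[OF A]) (use p q x in \<open>auto simp: presents_def mult.commute\<close>)
  then show ?thesis by (simp add: mult.commute)
qed

lemma some_coproduct:
  assumes "f \<in> \<O>"
  shows "\<exists>n u v. (SOME (n, u, v). coproduct G f n u v) = (n, u, v) \<and> presents f {..<n} u v"
proof -
  obtain n u v where "coproduct G f n u v" using regular_coproduct assms by blast
  then have "\<exists>t. case t of (n, u, v) \<Rightarrow> coproduct G f n u v" by (intro exI[of _ "(n, u, v)"]) simp
  then have some: "case (SOME (n, u, v). coproduct G f n u v) of (n, u, v) \<Rightarrow> coproduct G f n u v"
    by (rule someI_ex)
  obtain n u v where t: "(SOME (n, u, v). coproduct G f n u v) = (n, u, v)" using prod_cases3 by blast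
  show ?thesis using some unfolding t case_prod_conv coproduct_presents by blast
qed

lemma cconv_eq:
  assumes "f \<in> \<O>" and "additive_on_regular A" "additive_on_regular B" and "presents f I u v"
  shows "cconv A B f = (\<Sum>i\<in>I. A (u i) * B (v i))"
proof -
  obtain n u' v' where s: "(SOME (n, u, v). coproduct G f n u v) = (n, u', v')" "presents f {..<n} u' v'"
    using some_coproduct[OF assms(1)] by blast
  show ?thesis unfolding cconv_def s(1) case_prod_conv
    by (rule presents_unique[OF assms(2,3) s(2) assms(4)])
qed

lemma obtain_presents:
  assumes "f \<in> \<O>"
  obtains n u v where "presents f {..<n :: nat} u v"
  using some_coproduct[OF assms] by blast

lemma additive_eval: "additive_on_regular (\<lambda>f. f x)"
  unfolding additive_on_regular_def by simp

definition linear_functionals :: "'g lie set" where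
  "linear_functionals = {X. \<forall>f \<in> \<O>. \<forall>g \<in> \<O>. X (f + g) = X f + X g}"

lemma additive_rat: "X \<in> linear_functionals \<Longrightarrow> additive_on_regular (\<lambda>f. of_rat (X f))"
  unfolding linear_functionals_def additive_on_regular_def by (simp add: of_rat_add)

text \<open>The left invariant operator whose value at the identity is \<open>X\<close>.\<close>

definition D :: "'g lie \<Rightarrow> ('g \<Rightarrow> complex) \<Rightarrow> 'g \<Rightarrow> complex" where
  "D X f = zero_outside (carrier G) (\<lambda>x. cconv (\<lambda>g. g x) (\<lambda>g. of_rat (X g)) f)"

lemma D_eq:
  assumes f: "f \<in> \<O>" and X: "X \<in> linear_functionals" and p: "presents f I u v"
  shows "D X f = (\<Sum>i\<in>I. cscale (X (v i)) (u i))"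
proof
  fix x
  have u: "u i x = 0" if "i \<in> I" "x \<notin> carrier G" for i
    using that p regular_eq_0 unfolding presents_def by blast
  show "D X f x = (\<Sum>i\<in>I. cscale (X (v i)) (u i)) x"
    unfolding D_def zero_outside_def cconv_eq[OF f additive_eval additive_rat[OF X] p]
    using u by (auto simp: sum_fun_apply cscale_def mult.commute)
qed

lemma D_regular:
  assumes f: "f \<in> \<O>" and X: "X \<in> linear_functionals"
  shows "D X f \<in> \<O>"
proof -
  obtain n u v where p: "presents f {..<n :: nat} u v" using obtain_presents[OF f] .
  show ?thesis unfolding D_eq[OF f X p] using p
    by (intro regular_sum regular_scale) (auto simp: presents_def)
qed

lemma cconv_D:
  assumes f: "f \<in> \<O>" and A: "additive_on_regular A" and X: "X \<in> linear_functionals"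
  shows "cconv A (\<lambda>g. of_rat (X g)) f = A (D X f)"
proof -
  obtain n u v where p: "presents f {..<n :: nat} u v" using obtain_presents[OF f] .
  then have u: "u i \<in> \<O>" if "i < n" for i using that unfolding presents_def by auto
  show ?thesis
    unfolding cconv_eq[OF f A additive_rat[OF X] p] D_eq[OF f X p]
    using additive_sum[OF A, of "{..<n}" "\<lambda>i. cscale (X (v i)) (u i)"] additive_scale[OF A] regular_scale u
    by (simp add: mult.commute)
qed

text \<open>Left invariance: the operator touches the right tensor factor only. Associativity gives
  an identity of functions of a third point \<open>z\<close>, in which linear disjointness replaces
  evaluation at \<open>z\<close> by \<open>X\<close>.\<close>

lemma presents_D:
  assumes f: "f \<in> \<O>" and X: "X \<in> linear_functionals" and p: "presents f I u v"
  shows "presents (D X f) I u (\<lambda>i. D X (v i))"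
  unfolding presents_def
proof (intro conjI ballI)
  show "finite I" using p unfolding presents_def by simp
  show "u i \<in> \<O>" "D X (v i) \<in> \<O>" if "i \<in> I" for i
    using that p D_regular[OF _ X] unfolding presents_def by blast+
  fix x y assume x: "x \<in> carrier G" and y: "y \<in> carrier G"
  have u: "u i \<in> \<O>" and v: "v i \<in> \<O>" if "i \<in> I" for i using that p unfolding presents_def by blast+
  have "\<forall>i \<in> I. \<exists>n a b. presents (v i) {..<n :: nat} a b" using obtain_presents[OF v] by metis
  then obtain n a b where ab: "\<And>i. i \<in> I \<Longrightarrow> presents (v i) {..<n i :: nat} (a i) (b i)" by metis
  have "D X f (x \<otimes>\<^bsub>G\<^esub> y) = (\<Sum>i\<in>I. u i (x \<otimes>\<^bsub>G\<^esub> y) * of_rat (X (v i)))"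
    unfolding D_eq[OF f X p] by (simp add: sum_fun_apply cscale_def mult.commute)
  also have "\<dots> = (\<Sum>k\<in>Sigma I (\<lambda>i. {..<n i}). (u (fst k) x * a (fst k) (snd k) y) * of_rat (X (b (fst k) (snd k))))"
  proof (rule linear_disjoint2[OF additive_rat[OF X]])
    show "finite I" using p unfolding presents_def by simp
    then show "finite (Sigma I (\<lambda>i. {..<n i}))" by simp
    show "v i \<in> \<O>" if "i \<in> I" for i using v that .
    show "b (fst k) (snd k) \<in> \<O>" if "k \<in> Sigma I (\<lambda>i. {..<n i})" for k
      using that ab unfolding presents_def by auto
    fix z assume z: "z \<in> carrier G"
    have "(\<Sum>i\<in>I. u i (x \<otimes>\<^bsub>G\<^esub> y) * v i z) = f ((x \<otimes>\<^bsub>G\<^esub> y) \<otimes>\<^bsub>G\<^esub> z)"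
      using p x y z unfolding presents_def by simp
    also have "\<dots> = f (x \<otimes>\<^bsub>G\<^esub> (y \<otimes>\<^bsub>G\<^esub> z))" using x y z by (simp add: m_assoc)
    also have "\<dots> = (\<Sum>i\<in>I. u i x * v i (y \<otimes>\<^bsub>G\<^esub> z))" using p x y z unfolding presents_def by simp
    also have "\<dots> = (\<Sum>i\<in>I. \<Sum>j<n i. u i x * a i j y * b i j z)"
      using ab y z by (intro sum.cong) (auto simp: presents_def sum_distrib_left mult.assoc)
    also have "\<dots> = (\<Sum>k\<in>Sigma I (\<lambda>i. {..<n i}). (u (fst k) x * a (fst k) (snd k) y) * b (fst k) (snd k) z)"
      using \<open>finite I\<close> by (subst sum.Sigma) (auto simp: case_prod_beta)
    finally show "(\<Sum>i\<in>I. u i (x \<otimes>\<^bsub>G\<^esub> y) * v i z) =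
      (\<Sum>k\<in>Sigma I (\<lambda>i. {..<n i}). (u (fst k) x * a (fst k) (snd k) y) * b (fst k) (snd k) z)" .
  qed
  also have "\<dots> = (\<Sum>i\<in>I. \<Sum>j<n i. u i x * a i j y * of_rat (X (b i j)))"
    using p by (subst sum.Sigma) (auto simp: case_prod_beta presents_def)
  also have "\<dots> = (\<Sum>i\<in>I. u i x * D X (v i) y)"
    using D_eq[OF v X ab] by (intro sum.cong) (auto simp: sum_fun_apply cscale_def sum_distrib_left mult_ac)
  finally show "D X f (x \<otimes>\<^bsub>G\<^esub> y) = (\<Sum>i\<in>I. u i x * D X (v i) y)" .
qed

lemma D_at_one:
  assumes f: "f \<in> \<O>" and X: "X \<in> linear_functionals"
  shows "D X f \<one>\<^bsub>G\<^esub> = of_rat (X f)"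
proof -
  obtain n u v where p: "presents f {..<n :: nat} u v" using obtain_presents[OF f] .
  have "D X f \<one>\<^bsub>G\<^esub> = (\<Sum>i<n. u i \<one>\<^bsub>G\<^esub> * of_rat (X (v i)))"
    unfolding D_eq[OF f X p] by (simp add: sum_fun_apply cscale_def mult.commute)
  also have "\<dots> = (\<Sum>j\<in>{()}. 1 * of_rat (X f))"
  proof (rule linear_disjoint2[OF additive_rat[OF X]])
    show "(\<Sum>i<n. u i \<one>\<^bsub>G\<^esub> * v i x) = (\<Sum>j\<in>{()}. 1 * f x)" if "x \<in> carrier G" for x
    proof -
      have "f (\<one>\<^bsub>G\<^esub> \<otimes>\<^bsub>G\<^esub> x) = (\<Sum>i<n. u i \<one>\<^bsub>G\<^esub> * v i x)"
        using p that unfolding presents_def by blast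
      then show ?thesis using that by simp
    qed
  qed (use p f in \<open>auto simp: presents_def\<close>)
  finally show ?thesis by simp
qed

lemma presents_add:
  assumes "presents f I u v" "presents g J u' v'"
  shows "presents (f + g) (I <+> J) (case_sum u u') (case_sum v v')"
  using assms unfolding presents_def by (auto simp: sum.Plus)

lemma presents_mult:
  assumes "presents f I u v" "presents g J u' v'"
  shows "presents (f * g) (I \<times> J) (\<lambda>(i, j). u i * u' j) (\<lambda>(i, j). v i * v' j)"
  using assms unfolding presents_def
  by (auto simp: regular_mult sum_product sum.cartesian_product intro!: sum.cong)

lemma D_add:
  assumes f: "f \<in> \<O>" and g: "g \<in> \<O>" and X: "X \<in> linear_functionals"
  shows "D X (f + g) = D X f + D X g"
proof -
  obtain n u v where p: "presents f {..<n :: nat} u v" using obtain_presents[OF f] .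
  obtain m u' v' where q: "presents g {..<m :: nat} u' v'" using obtain_presents[OF g] .
  show ?thesis
    unfolding D_eq[OF f X p] D_eq[OF g X q] D_eq[OF regular_add[OF f g] X presents_add[OF p q]]
    by (simp add: sum.Plus)
qed

lemma D_scale:
  assumes f: "f \<in> \<O>" and X: "X \<in> linear_functionals"
  shows "D X (cscale q f) = cscale q (D X f)"
proof
  fix x
  have A: "additive_on_regular (\<lambda>f. D X f x)"
    unfolding additive_on_regular_def using D_add[OF _ _ X] by simp
  show "D X (cscale q f) x = cscale q (D X f) x"
    using additive_scale[OF A f] by (simp add: cscale_def)
qed

subsection \<open>The bracket\<close>

abbreviation "\<g> \<equiv> lie_algebra G"

lemma lie_linear: "X \<in> \<g> \<Longrightarrow> X \<in> linear_functionals"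
  unfolding lie_algebra_def linear_functionals_def by blast

lemma lie_mult:
  "X \<in> \<g> \<Longrightarrow> f \<in> \<O> \<Longrightarrow> g \<in> \<O> \<Longrightarrow> of_rat (X (f * g)) = of_rat (X f) * g \<one>\<^bsub>G\<^esub> + f \<one>\<^bsub>G\<^esub> * of_rat (X g)"
  unfolding lie_algebra_def by blast

lemma lie_outside:
  assumes "X \<in> \<g>" and "f \<notin> \<O>"
  shows "X f = 0"
proof -
  have "zero_outside \<O> X f = 0" using assms(2) by (simp add: zero_outside_def)
  moreover have "zero_outside \<O> X = X" using assms(1) unfolding lie_algebra_def by blast
  ultimately show ?thesis by (simp only:)
qed

lemma lieI:
  assumes "\<And>f. f \<notin> \<O> \<Longrightarrow> X f = 0" and "X \<in> linear_functionals"
    and "\<And>f g. f \<in> \<O> \<Longrightarrow> g \<in> \<O> \<Longrightarrow> of_rat (X (f * g)) = of_rat (X f) * g \<one>\<^bsub>G\<^esub> + f \<one>\<^bsub>G\<^esub> * of_rat (X g)"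
  shows "X \<in> \<g>"
proof -
  have "zero_outside \<O> X = X" by (rule ext) (simp add: zero_outside_def assms(1))
  then show ?thesis using assms(2,3) unfolding lie_algebra_def linear_functionals_def by blast
qed

lemma lie_subspace: "rat_functions.subspace \<g>"
proof (rule rat_functions.subspaceI)
  show "0 \<in> \<g>" by (rule lieI) (auto simp: linear_functionals_def)
  show "X + Y \<in> \<g>" if X: "X \<in> \<g>" and Y: "Y \<in> \<g>" for X Y
  proof (rule lieI)
    show "X + Y \<in> linear_functionals"
      using lie_linear[OF X] lie_linear[OF Y] unfolding linear_functionals_def by auto
  qed (simp_all add: lie_outside[OF X] lie_outside[OF Y] lie_mult[OF X] lie_mult[OF Y] of_rat_add algebra_simps)
  show "rscale q X \<in> \<g>" if X: "X \<in> \<g>" for q X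
  proof (rule lieI)
    show "rscale q X \<in> linear_functionals"
      using lie_linear[OF X] unfolding linear_functionals_def by (auto simp: rscale_def distrib_left)
  qed (simp_all add: rscale_def lie_outside[OF X] lie_mult[OF X] of_rat_mult algebra_simps)
qed

lemma D_mult:
  assumes f: "f \<in> \<O>" and g: "g \<in> \<O>" and X: "X \<in> \<g>"
  shows "D X (f * g) = D X f * g + f * D X g"
proof
  fix x
  note XL = lie_linear[OF X]
  obtain n u v where p: "presents f {..<n :: nat} u v" using obtain_presents[OF f] .
  obtain m u' v' where q: "presents g {..<m :: nat} u' v'" using obtain_presents[OF g] .
  have reg: "v i \<in> \<O>" "v' j \<in> \<O>" if "i < n" "j < m" for i j using p q that unfolding presents_def by auto
  show "D X (f * g) x = (D X f * g + f * D X g) x"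
  proof (cases "x \<in> carrier G")
    case False
    then show ?thesis
      using regular_eq_0[OF D_regular[OF regular_mult[OF f g] XL] False] regular_eq_0[OF f False]
        regular_eq_0[OF g False] by simp
  next
    case True
    have fx: "f x = (\<Sum>i<n. u i x * v i \<one>\<^bsub>G\<^esub>)" and gx: "g x = (\<Sum>j<m. u' j x * v' j \<one>\<^bsub>G\<^esub>)"
      using p q True unfolding presents_def by (metis one_closed r_one)+
    have "D X (f * g) x = (\<Sum>i<n. \<Sum>j<m. of_rat (X (v i * v' j)) * (u i x * u' j x))"
      unfolding D_eq[OF regular_mult[OF f g] XL presents_mult[OF p q]]
      by (simp add: sum_fun_apply cscale_def sum.cartesian_product case_prod_beta)
    also have "\<dots> = (\<Sum>i<n. \<Sum>j<m. (of_rat (X (v i)) * u i x) * (u' j x * v' j \<one>\<^bsub>G\<^esub>)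
        + (u i x * v i \<one>\<^bsub>G\<^esub>) * (of_rat (X (v' j)) * u' j x))"
      using lie_mult[OF X reg] by (intro sum.cong refl) (auto simp: algebra_simps)
    also have "\<dots> = D X f x * g x + f x * D X g x"
      unfolding D_eq[OF f XL p] D_eq[OF g XL q] fx gx
      by (simp add: sum_fun_apply cscale_def sum_product sum.distrib)
    finally show ?thesis by simp
  qed
qed

lemma convolution_eq:
  assumes f: "f \<in> \<O>" and X: "X \<in> linear_functionals" and Y: "Y \<in> linear_functionals"
  shows "convolution G X Y f = X (D Y f)"
proof -
  have "of_rat (convolution G X Y f) = cconv (\<lambda>g. of_rat (X g)) (\<lambda>g. of_rat (Y g)) f"
    unfolding convolution_def cconv_def zero_outside_def using f
    by (auto simp: of_rat_sum of_rat_mult split: prod.splits)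
  also have "\<dots> = of_rat (X (D Y f))" by (rule cconv_D[OF f additive_rat[OF X] Y])
  finally show ?thesis by simp
qed

lemma bracket_eq:
  assumes f: "f \<in> \<O>" and X: "X \<in> \<g>" and Y: "Y \<in> \<g>"
  shows "bracket G X Y f = X (D Y f) - Y (D X f)"
  unfolding bracket_def using convolution_eq[OF f] lie_linear X Y by simp

lemma bracket_outside: "f \<notin> \<O> \<Longrightarrow> bracket G X Y f = 0"
  unfolding bracket_def convolution_def zero_outside_def by simp

lemma linear_diff:
  assumes "X \<in> linear_functionals" "f \<in> \<O>" "g \<in> \<O>"
  shows "X (f - g) = X f - X g"
proof -
  have "X (f - g + g) = X (f - g) + X g"
    using assms regular_diff unfolding linear_functionals_def by blast
  then show ?thesis by simp
qed

lemma linear_add: "X \<in> linear_functionals \<Longrightarrow> f \<in> \<O> \<Longrightarrow> g \<in> \<O> \<Longrightarrow> X (f + g) = X f + X g"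
  unfolding linear_functionals_def by blast

lemma bracket_linear:
  assumes X: "X \<in> \<g>" and Y: "Y \<in> \<g>"
  shows "bracket G X Y \<in> linear_functionals"
  unfolding linear_functionals_def
proof (intro CollectI ballI)
  fix f g assume f: "f \<in> \<O>" and g: "g \<in> \<O>"
  note XL = lie_linear[OF X] and YL = lie_linear[OF Y]
  show "bracket G X Y (f + g) = bracket G X Y f + bracket G X Y g"
    unfolding bracket_eq[OF f X Y] bracket_eq[OF g X Y] bracket_eq[OF regular_add[OF f g] X Y]
      D_add[OF f g XL] D_add[OF f g YL] linear_add[OF XL D_regular[OF f YL] D_regular[OF g YL]]
      linear_add[OF YL D_regular[OF f XL] D_regular[OF g XL]] by simp
qed

lemma bracket_lie:
  assumes X: "X \<in> \<g>" and Y: "Y \<in> \<g>"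
  shows "bracket G X Y \<in> \<g>"
proof (rule lieI)
  fix f g assume f: "f \<in> \<O>" and g: "g \<in> \<O>"
  note XL = lie_linear[OF X] and YL = lie_linear[OF Y]
  have reg: "D Z f \<in> \<O>" "D Z g \<in> \<O>" if "Z \<in> \<g>" for Z using D_regular f g lie_linear that by auto
  have XY: "of_rat (A (D B (f * g))) = of_rat (A (D B f)) * g \<one>\<^bsub>G\<^esub> + of_rat (B f) * of_rat (A g)
      + of_rat (A f) * of_rat (B g) + f \<one>\<^bsub>G\<^esub> * of_rat (A (D B g))"
    if A: "A \<in> \<g>" and B: "B \<in> \<g>" for A B
  proof -
    have "A (D B (f * g)) = A (D B f * g) + A (f * D B g)"
      unfolding D_mult[OF f g B] using lie_linear[OF A] reg[OF B] f g regular_mult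
      unfolding linear_functionals_def by blast
    then show ?thesis
      using lie_mult[OF A reg(1)[OF B] g] lie_mult[OF A f reg(2)[OF B]] D_at_one[OF f lie_linear[OF B]]
        D_at_one[OF g lie_linear[OF B]] by (simp add: of_rat_add)
  qed
  show "of_rat (bracket G X Y (f * g)) = of_rat (bracket G X Y f) * g \<one>\<^bsub>G\<^esub> + f \<one>\<^bsub>G\<^esub> * of_rat (bracket G X Y g)"
    unfolding bracket_eq[OF regular_mult[OF f g] X Y] bracket_eq[OF f X Y] bracket_eq[OF g X Y]
      of_rat_diff XY[OF X Y] XY[OF Y X] by (simp add: algebra_simps)
qed (use bracket_outside bracket_linear X Y in auto)

lemma D_bracket:
  assumes f: "f \<in> \<O>" and X: "X \<in> \<g>" and Y: "Y \<in> \<g>"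
  shows "D (bracket G X Y) f = D X (D Y f) - D Y (D X f)"
proof -
  note XL = lie_linear[OF X] and YL = lie_linear[OF Y]
  obtain n u v where p: "presents f {..<n :: nat} u v" using obtain_presents[OF f] .
  have v: "v i \<in> \<O>" if "i < n" for i using p that unfolding presents_def by auto
  show ?thesis
    unfolding D_eq[OF f bracket_linear[OF X Y] p] D_eq[OF D_regular[OF f YL] XL presents_D[OF f YL p]]
      D_eq[OF D_regular[OF f XL] YL presents_D[OF f XL p]] sum_subtractf[symmetric]
    using bracket_eq[OF v X Y] by (intro sum.cong refl) (simp add: complex_functions.scale_left_diff_distrib)
qed

lemma bracket_skew: "bracket G X Y = - bracket G Y X"
  unfolding bracket_def by simp

text \<open>The chosen presentation depends on the function alone, so these identities hold for
  arbitrary functionals.\<close>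

lemma convolution_bilinear:
  "convolution G X (Y + Z) = convolution G X Y + convolution G X Z"
  "convolution G (Y + Z) X = convolution G Y X + convolution G Z X"
  "convolution G X (rscale q Y) = rscale q (convolution G X Y)"
  "convolution G (rscale q Y) X = rscale q (convolution G Y X)"
  unfolding convolution_def zero_outside_def rscale_def
  by (auto simp: fun_eq_iff algebra_simps sum.distrib sum_distrib_left split: prod.splits)

lemma bracket_linear_right: "Vector_Spaces.linear rscale rscale (bracket G X)"
  unfolding Vector_Spaces.linear_iff
proof (intro conjI allI rat_functions.vector_space_axioms)
  show "bracket G X (Y + Z) = bracket G X Y + bracket G X Z" for Y Z
    unfolding bracket_def convolution_bilinear by simp
  show "bracket G X (rscale q Y) = rscale q (bracket G X Y)" for q Y
    unfolding bracket_def convolution_bilinear by (simp add: rat_functions.scale_right_diff_distrib)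
qed

lemma bracket_jacobi:
  assumes X: "X \<in> \<g>" and Y: "Y \<in> \<g>" and Z: "Z \<in> \<g>"
  shows "bracket G X (bracket G Y Z) = bracket G (bracket G X Y) Z + bracket G Y (bracket G X Z)"
proof
  fix f
  show "bracket G X (bracket G Y Z) f = (bracket G (bracket G X Y) Z + bracket G Y (bracket G X Z)) f"
  proof (cases "f \<in> \<O>")
    case False
    then show ?thesis using bracket_outside by simp
  next
    case f: True
    note L = lie_linear[OF X] lie_linear[OF Y] lie_linear[OF Z]
    note R = D_regular[OF f L(1)] D_regular[OF f L(2)] D_regular[OF f L(3)]
    note RR = D_regular[OF R(1) L(2)] D_regular[OF R(1) L(3)] D_regular[OF R(2) L(1)]
      D_regular[OF R(2) L(3)] D_regular[OF R(3) L(1)] D_regular[OF R(3) L(2)]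
    show ?thesis
      unfolding plus_fun_apply bracket_eq[OF f X bracket_lie[OF Y Z]] bracket_eq[OF f bracket_lie[OF X Y] Z]
        bracket_eq[OF f Y bracket_lie[OF X Z]] bracket_eq[OF R(1) Y Z] bracket_eq[OF R(3) X Y]
        bracket_eq[OF R(2) X Z] D_bracket[OF f Y Z] D_bracket[OF f X Y] D_bracket[OF f X Z]
        linear_diff[OF L(1) RR(6,4)] linear_diff[OF L(3) RR(3,1)] linear_diff[OF L(2) RR(5,2)]
      by simp
  qed
qed

end

subsection \<open>One-parameter subgroups\<close>

context vector_space
begin

lemma span_lessThan: "x \<in> span (w ` {..<m :: nat}) \<Longrightarrow> \<exists>q. x = (\<Sum>j<m. scale (q j) (w j))"
proof (induction m arbitrary: x)
  case (Suc m)
  then obtain k where "x - scale k (w m) \<in> span (w ` {..<m})"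
    by (auto simp: lessThan_Suc span_insert)
  then obtain q where q: "x - scale k (w m) = (\<Sum>j<m. scale (q j) (w j))" using Suc.IH by blast
  have "(\<Sum>j<Suc m. scale ((q(m := k)) j) (w j)) = (\<Sum>j<m. scale (q j) (w j)) + scale k (w m)"
    by (simp add: lessThan_Suc add.commute)
  then have "x = (\<Sum>j<Suc m. scale ((q(m := k)) j) (w j))" unfolding q[symmetric] by simp
  then show ?case by blast
qed simp

lemma linear_recurrence_exists:
  assumes "finite B" and w: "\<And>j :: nat. w j \<in> span B"
  shows "\<exists>m q. w m = (\<Sum>j<m. scale (q j) (w j))"
proof (rule ccontr)
  assume no: "\<not> ?thesis"
  have "independent (w ` {..<m}) \<and> card (w ` {..<m}) = m" for m
  proof (induction m)
    case (Suc m)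
    have new: "w m \<notin> span (w ` {..<m})" using no span_lessThan[of "w m" w m] by metis
    then have "w m \<notin> w ` {..<m}" using span_superset[of "w ` {..<m}"] by (metis subsetD)
    moreover have "independent (insert (w m) (w ` {..<m}))" using independent_insertI[OF new] Suc by simp
    ultimately show ?case using Suc by (simp add: lessThan_Suc)
  qed (simp add: independent_empty)
  note this[of "Suc (card B)"]
  moreover have "w ` {..<Suc (card B)} \<subseteq> span B" using w by auto
  ultimately show False using independent_span_bound[OF \<open>finite B\<close>, of "w ` {..<Suc (card B)}"]
    by (metis Suc_n_not_le_n)
qed

end

text \<open>Used in \<open>coef_summable\<close>, where the factorials dominate this geometric
  growth. \<open>B\<close> is at least 1, so that its powers increase, and at least the sum of the
  norms of the coefficients, so that one use of the recurrence costs a factor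
  \<open>B\<close>.\<close>

lemma recurrence_bound:
  fixes a :: "nat \<Rightarrow> 'a::real_normed_field"
  assumes rec: "\<And>k. a (k + m) = (\<Sum>j<m. q j * a (k + j))"
  shows "\<exists>C B. \<forall>k. norm (a k) \<le> C * B ^ k"
proof -
  define B where "B = 1 + (\<Sum>j<m. norm (q j))"
  define C where "C = (\<Sum>j<m. norm (a j))"
  have B: "B \<ge> 1" and C: "C \<ge> 0" unfolding B_def C_def by (auto intro: sum_nonneg)
  have "norm (a k) \<le> C * B ^ k" for k
  proof (induction k rule: less_induct)
    case (less k)
    show ?case
    proof (cases "k < m")
      case True
      then have "norm (a k) \<le> C" unfolding C_def by (intro member_le_sum) auto
      also have "C * 1 \<le> C * B ^ k" using B C by (intro mult_left_mono one_le_power)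
      finally show ?thesis by simp
    next
      case False
      define l where "l = k - m"
      have k: "k = l + m" using False unfolding l_def by simp
      show ?thesis
      proof (cases "m = 0")
        case True
        then show ?thesis using rec[of l] C B k by simp
      next
        case m: False
        then have "k > 0" using False by simp
        have "norm (a k) \<le> (\<Sum>j<m. norm (q j) * norm (a (l + j)))"
          unfolding k rec by (rule order_trans[OF norm_sum]) (simp add: norm_mult)
        also have "\<dots> \<le> (\<Sum>j<m. norm (q j) * (C * B ^ (k - 1)))"
        proof (intro sum_mono mult_left_mono)
          fix j assume "j \<in> {..<m}"
          then have "l + j < k" "l + j \<le> k - 1" unfolding k by auto
          then have "norm (a (l + j)) \<le> C * B ^ (l + j)" "B ^ (l + j) \<le> B ^ (k - 1)"
            using less B power_increasing[of "l + j" "k - 1" B] by auto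
          then show "norm (a (l + j)) \<le> C * B ^ (k - 1)" using C by (meson mult_left_mono order_trans)
        qed simp
        also have "\<dots> = (\<Sum>j<m. norm (q j)) * (C * B ^ (k - 1))" by (simp add: sum_distrib_right)
        also have "\<dots> \<le> B * (C * B ^ (k - 1))"
          using C B by (intro mult_right_mono mult_nonneg_nonneg) (auto simp: B_def)
        also have "\<dots> = C * B ^ k" using \<open>k > 0\<close> by (simp add: power_eq_if)
        finally show ?thesis .
      qed
    qed
  qed
  then show ?thesis by blast
qed

text \<open>Up to the factor \<open>k!\<close>, these are Stirling numbers of the second kind.\<close>

lemma finite_difference_pos:
  assumes "0 < k" and "k \<le> m"
  shows "(\<Sum>j\<le>k. (- 1) ^ (k - j) * int (k choose j) * int j ^ m) > 0"
proof -
  define \<Delta> where "\<Delta> k m = (\<Sum>j\<le>k. (- 1) ^ (k - j) * int (k choose j) * int j ^ m)" for k m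
  have rec: "\<Delta> (Suc k) (Suc m) = int (Suc k) * (\<Delta> (Suc k) m + \<Delta> k m)" for k m
  proof -
    have "\<Delta> (Suc k) (Suc m) = (\<Sum>j\<le>k. (- 1) ^ (k - j) * int (Suc k choose Suc j) * int (Suc j) ^ Suc m)"
      unfolding \<Delta>_def by (subst sum.atMost_Suc_shift) simp
    also have "\<dots> = (\<Sum>j\<le>k. int (Suc k) * ((- 1) ^ (k - j) * int (k choose j) * int (Suc j) ^ m))"
    proof (rule sum.cong)
      fix j
      have "int (Suc j) * int (Suc k choose Suc j) = int (Suc k) * int (k choose j)"
        using Suc_times_binomial_eq[of k j] by (metis mult.commute of_nat_mult)
      then show "(- 1) ^ (k - j) * int (Suc k choose Suc j) * int (Suc j) ^ Suc m =
          int (Suc k) * ((- 1) ^ (k - j) * int (k choose j) * int (Suc j) ^ m)"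
        by (simp only: power_Suc) (metis (no_types, opaque_lifting) mult.assoc mult.left_commute)
    qed simp
    also have "\<dots> = int (Suc k) * (\<Sum>j\<le>k. (- 1) ^ (k - j) * int (k choose j) * int (Suc j) ^ m)"
      by (simp only: sum_distrib_left)
    also have "(\<Sum>j\<le>k. (- 1) ^ (k - j) * int (k choose j) * int (Suc j) ^ m) = \<Delta> (Suc k) m + \<Delta> k m"
    proof -
      have "\<Delta> (Suc k) m = (- 1) ^ Suc k * int 0 ^ m
          + (\<Sum>j\<le>k. (- 1) ^ (k - j) * int (Suc k choose Suc j) * int (Suc j) ^ m)"
        unfolding \<Delta>_def by (subst sum.atMost_Suc_shift) simp
      also have "(\<Sum>j\<le>k. (- 1) ^ (k - j) * int (Suc k choose Suc j) * int (Suc j) ^ m)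
        = (\<Sum>j\<le>k. (- 1) ^ (k - j) * int (k choose j) * int (Suc j) ^ m)
          + (\<Sum>j\<le>k. (- 1) ^ (k - j) * int (k choose Suc j) * int (Suc j) ^ m)"
        by (simp only: binomial_Suc_Suc of_nat_add distrib_left distrib_right sum.distrib)
      also have "(\<Sum>j\<le>k. (- 1) ^ (k - j) * int (k choose Suc j) * int (Suc j) ^ m)
        = (\<Sum>j<k. (- 1) ^ (k - j) * int (k choose Suc j) * int (Suc j) ^ m)"
        by (simp add: lessThan_Suc_atMost[symmetric] lessThan_Suc)
      also have "\<dots> = - (\<Sum>j<k. (- 1) ^ (k - Suc j) * int (k choose Suc j) * int (Suc j) ^ m)"
        unfolding sum_negf[symmetric]
      proof (rule sum.cong)
        fix j assume "j \<in> {..<k}"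
        then have "k - j = Suc (k - Suc j)" by auto
        then show "(- 1) ^ (k - j) * int (k choose Suc j) * int (Suc j) ^ m =
            - ((- 1) ^ (k - Suc j) * int (k choose Suc j) * int (Suc j) ^ m)" by simp
      qed simp
      also have "(\<Sum>j<k. (- 1) ^ (k - Suc j) * int (k choose Suc j) * int (Suc j) ^ m) = \<Delta> k m - (- 1) ^ k * int 0 ^ m"
        unfolding \<Delta>_def by (simp add: lessThan_Suc_atMost[symmetric] sum.lessThan_Suc_shift del: sum.lessThan_Suc)
      finally show ?thesis by simp
    qed
    finally show ?thesis .
  qed
  have nonneg: "\<Delta> k m \<ge> 0" for k m
  proof (induction m arbitrary: k)
    case 0
    show ?case
    proof (cases k)
      case (Suc l)
      have "\<Delta> k 0 = (\<Sum>j\<le>k. of_nat (k choose j) * 1 ^ j * (- 1) ^ (k - j))"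
        unfolding \<Delta>_def by (simp add: mult.commute)
      also have "\<dots> = (1 + - 1) ^ k" by (rule binomial_ring[symmetric])
      finally show ?thesis using Suc by simp
    qed (simp add: \<Delta>_def)
  next
    case (Suc m)
    show ?case
    proof (cases k)
      case (Suc l)
      then show ?thesis using rec[of l m] Suc.IH by simp
    qed (simp add: \<Delta>_def)
  qed
  have "\<Delta> (Suc k) (Suc (k + d)) > 0" for k d
  proof (induction k arbitrary: d)
    case 0
    show ?case by (simp add: \<Delta>_def)
  next
    case (Suc k)
    have "\<Delta> (Suc k) (Suc (k + d)) > 0" by (rule Suc)
    then have "\<Delta> (Suc (Suc k)) (Suc k + d) + \<Delta> (Suc k) (Suc k + d) > 0"
      using nonneg[of "Suc (Suc k)" "Suc k + d"] by simp
    then show ?case unfolding rec by simp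
  qed
  from this[of "k - 1" "m - k"] show ?thesis using assms unfolding \<Delta>_def by simp
qed

section \<open>The exponential of an element of the Lie algebra\<close>

context proalgebraic_group
begin

lemma Dpow_regular: "f \<in> \<O> \<Longrightarrow> X \<in> linear_functionals \<Longrightarrow> (D X ^^ k) f \<in> \<O>"
  by (induction k) (auto intro: D_regular)

lemma Dpow_add:
  assumes "f \<in> \<O>" "g \<in> \<O>" "X \<in> linear_functionals"
  shows "(D X ^^ k) (f + g) = (D X ^^ k) f + (D X ^^ k) g"
proof (induction k)
  case (Suc k)
  then show ?case
    using D_add[OF Dpow_regular[OF assms(1,3), of k] Dpow_regular[OF assms(2,3), of k] assms(3)]
    by (simp only: funpow.simps comp_apply)
qed simp

lemma Dpow_0:
  assumes "X \<in> linear_functionals"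
  shows "(D X ^^ k) 0 = 0"
proof -
  have "(D X ^^ k) 0 = (D X ^^ k) 0 + (D X ^^ k) 0"
    using Dpow_add[OF regular_0 regular_0 assms, of k] unfolding add_0_right .
  then show ?thesis unfolding add_cancel_right_right .
qed

lemma Dpow_scale:
  assumes "f \<in> \<O>" "X \<in> linear_functionals"
  shows "(D X ^^ k) (cscale q f) = cscale q ((D X ^^ k) f)"
proof (induction k)
  case (Suc k)
  then show ?case
    using D_scale[OF Dpow_regular[OF assms, of k] assms(2)] by (simp only: funpow.simps comp_apply)
qed simp

lemma Dpow_sum:
  assumes X: "X \<in> linear_functionals" and v: "\<And>i. i \<in> I \<Longrightarrow> v i \<in> \<O>"
  shows "(D X ^^ k) (\<Sum>i\<in>I. cscale (q i) (v i)) = (\<Sum>i\<in>I. cscale (q i) ((D X ^^ k) (v i)))"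
  using v
proof (induction I rule: infinite_finite_induct)
  case (insert i I)
  have r: "cscale (q i) (v i) \<in> \<O>" "(\<Sum>i\<in>I. cscale (q i) (v i)) \<in> \<O>"
    using insert by (auto intro!: regular_scale regular_sum)
  have "(D X ^^ k) (cscale (q i) (v i) + (\<Sum>i\<in>I. cscale (q i) (v i)))
      = cscale (q i) ((D X ^^ k) (v i)) + (\<Sum>i\<in>I. cscale (q i) ((D X ^^ k) (v i)))"
    unfolding Dpow_add[OF r X] using insert Dpow_scale[OF _ X] by simp
  then show ?case unfolding sum.insert[OF insert(1,2)] .
qed (simp_all add: Dpow_0[OF X])

lemma presents_Dpow:
  "f \<in> \<O> \<Longrightarrow> X \<in> linear_functionals \<Longrightarrow> presents f I u v \<Longrightarrow> presents ((D X ^^ k) f) I u (\<lambda>i. (D X ^^ k) (v i))"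
proof (induction k)
  case (Suc k)
  then show ?case using presents_D[OF Dpow_regular[of f X k]] by simp
qed simp

text \<open>The value at the identity of \<open>X\<^sup>k\<close> in the universal enveloping algebra.\<close>

definition moment :: "'g lie \<Rightarrow> ('g \<Rightarrow> complex) \<Rightarrow> nat \<Rightarrow> rat" where
  "moment X f k = (THE q. of_rat q = (D X ^^ k) f \<one>\<^bsub>G\<^esub>)"

lemma of_rat_moment:
  assumes "f \<in> \<O>" "X \<in> linear_functionals"
  shows "of_rat (moment X f k) = (D X ^^ k) f \<one>\<^bsub>G\<^esub>"
proof -
  have "(D X ^^ k) f \<one>\<^bsub>G\<^esub> \<in> \<rat>" using Dpow_regular[OF assms] by (rule regular_at_one)
  then obtain q where q: "(D X ^^ k) f \<one>\<^bsub>G\<^esub> = of_rat q" by (elim Rats_cases)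
  have "moment X f k = q" unfolding moment_def q by (rule the_equality) auto
  then show ?thesis using q by simp
qed

lemma Dpow_eq:
  assumes f: "f \<in> \<O>" and X: "X \<in> linear_functionals" and p: "presents f I u v"
  shows "(D X ^^ k) f = (\<Sum>i\<in>I. cscale (moment X (v i) k) (u i))"
proof (rule regular_eqI)
  have v: "v i \<in> \<O>" and u: "u i \<in> \<O>" if "i \<in> I" for i using p that unfolding presents_def by blast+
  show "(D X ^^ k) f \<in> \<O>" by (rule Dpow_regular[OF f X])
  show "(\<Sum>i\<in>I. cscale (moment X (v i) k) (u i)) \<in> \<O>" by (intro regular_sum regular_scale u)
  fix x assume x: "x \<in> carrier G"
  have "(D X ^^ k) f (x \<otimes>\<^bsub>G\<^esub> \<one>\<^bsub>G\<^esub>) = (\<Sum>i\<in>I. u i x * (D X ^^ k) (v i) \<one>\<^bsub>G\<^esub>)"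
    using presents_Dpow[OF f X p, of k] x unfolding presents_def by blast
  then show "(D X ^^ k) f x = (\<Sum>i\<in>I. cscale (moment X (v i) k) (u i)) x"
    using x v by (simp add: sum_fun_apply cscale_def of_rat_moment[OF _ X] mult.commute)
qed

text \<open>All iterates lie in the span of the finitely many left factors of one presentation of
  \<open>f\<close>, by \<open>Dpow_eq\<close>.\<close>

lemma Dpow_recurrence:
  assumes f: "f \<in> \<O>" and X: "X \<in> linear_functionals"
  shows "\<exists>m q. (D X ^^ m) f = (\<Sum>j<m. cscale (q j) ((D X ^^ j) f))"
proof -
  obtain n u v where p: "presents f {..<n :: nat} u v" using obtain_presents[OF f] .
  have "(D X ^^ k) f \<in> complex_functions.span (u ` {..<n})" for k
    unfolding Dpow_eq[OF f X p]
    by (intro complex_functions.span_sum complex_functions.span_scale complex_functions.span_base) simp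
  then show ?thesis using complex_functions.linear_recurrence_exists[of "u ` {..<n}" "\<lambda>k. (D X ^^ k) f"] by simp
qed

text \<open>Taylor coefficients at 0 of the function whose value at \<open>t\<close> is
  \<open>f (exp (t X))\<close>, given before the point \<open>exp (t X)\<close> is
  constructed.\<close>

definition coef :: "'g lie \<Rightarrow> ('g \<Rightarrow> complex) \<Rightarrow> nat \<Rightarrow> complex" where
  "coef X f k = (D X ^^ k) f \<one>\<^bsub>G\<^esub> / fact k"

definition exp_value :: "'g lie \<Rightarrow> ('g \<Rightarrow> complex) \<Rightarrow> complex \<Rightarrow> complex" where
  "exp_value X f t = suminf (\<lambda>k. coef X f k * t ^ k)"

lemma coef_summable:
  assumes f: "f \<in> \<O>" and X: "X \<in> linear_functionals"
  shows "summable (\<lambda>k. norm (coef X f k * t ^ k))"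
proof -
  obtain m q where mq: "(D X ^^ m) f = (\<Sum>j<m. cscale (q j) ((D X ^^ j) f))"
    using Dpow_recurrence[OF assms] by blast
  have "(D X ^^ (k + m)) f \<one>\<^bsub>G\<^esub> = (\<Sum>j<m. of_rat (q j) * (D X ^^ (k + j)) f \<one>\<^bsub>G\<^esub>)" for k
  proof -
    have "(D X ^^ (k + m)) f = (\<Sum>j<m. cscale (q j) ((D X ^^ k) ((D X ^^ j) f)))"
      unfolding funpow_add comp_apply mq by (rule Dpow_sum[OF X]) (rule Dpow_regular[OF f X])
    then show ?thesis by (simp add: sum_fun_apply cscale_def funpow_add)
  qed
  then obtain C B where CB: "\<And>k. norm ((D X ^^ k) f \<one>\<^bsub>G\<^esub>) \<le> C * B ^ k"
    using recurrence_bound[of "\<lambda>k. (D X ^^ k) f \<one>\<^bsub>G\<^esub>" m "\<lambda>j. of_rat (q j)"] by blast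
  have "norm (norm (coef X f k * t ^ k)) \<le> C * (inverse (fact k) * (B * norm t) ^ k)" for k
  proof -
    have "norm (coef X f k * t ^ k) = norm ((D X ^^ k) f \<one>\<^bsub>G\<^esub>) * (norm t ^ k / fact k)"
      unfolding coef_def by (simp add: norm_mult norm_divide norm_power)
    also have "\<dots> \<le> C * B ^ k * (norm t ^ k / fact k)" using CB by (intro mult_right_mono) auto
    finally show ?thesis by (simp add: power_mult_distrib field_simps)
  qed
  then show ?thesis
    by (intro summable_comparison_test'[OF summable_mult[OF summable_exp[of "B * norm t"], of C]])
qed

lemma exp_value_sums:
  "f \<in> \<O> \<Longrightarrow> X \<in> linear_functionals \<Longrightarrow> (\<lambda>k. coef X f k * t ^ k) sums exp_value X f t"
  unfolding exp_value_def by (rule summable_sums[OF summable_norm_cancel[OF coef_summable]])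

lemma Dpow_mult:
  assumes X: "X \<in> \<g>" and "f \<in> \<O>" "g \<in> \<O>"
  shows "(D X ^^ k) (f * g) x = (\<Sum>i\<le>k. of_nat (k choose i) * (D X ^^ i) f x * (D X ^^ (k - i)) g x)"
  using assms(2,3)
proof (induction k arbitrary: f g)
  case (Suc k)
  note XL = lie_linear[OF X] and f = Suc.prems(1) and g = Suc.prems(2)
  note Df = D_regular[OF f XL] and Dg = D_regular[OF g XL]
  have "(D X ^^ Suc k) (f * g) = (D X ^^ k) (D X f * g) + (D X ^^ k) (f * D X g)"
    unfolding funpow_Suc_right comp_apply D_mult[OF f g X]
    by (rule Dpow_add[OF regular_mult[OF Df g] regular_mult[OF f Dg] XL])
  then have "(D X ^^ Suc k) (f * g) x =
      (\<Sum>i\<le>k. of_nat (k choose i) * (D X ^^ Suc i) f x * (D X ^^ (k - i)) g x)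
      + (\<Sum>i\<le>k. of_nat (k choose i) * (D X ^^ i) f x * (D X ^^ (Suc k - i)) g x)"
  proof -
    have "(D X ^^ (k - i)) (D X g) = (D X ^^ (Suc k - i)) g" if "i \<le> k" for i
      using that by (simp only: Suc_diff_le funpow_Suc_right comp_apply)
    then have "(D X ^^ k) (f * D X g) x = (\<Sum>i\<le>k. of_nat (k choose i) * (D X ^^ i) f x * (D X ^^ (Suc k - i)) g x)"
      unfolding Suc.IH[OF f Dg] by (intro sum.cong refl) (simp only: atMost_iff)
    moreover have "(D X ^^ k) (D X f * g) x = (\<Sum>i\<le>k. of_nat (k choose i) * (D X ^^ Suc i) f x * (D X ^^ (k - i)) g x)"
      unfolding Suc.IH[OF Df g] by (simp only: funpow_Suc_right comp_apply)
    ultimately show "(D X ^^ Suc k) (f * g) = (D X ^^ k) (D X f * g) + (D X ^^ k) (f * D X g) \<Longrightarrow> ?thesis"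
      by (simp only: plus_fun_apply)
  qed
  also have "(\<Sum>i\<le>k. of_nat (k choose i) * (D X ^^ i) f x * (D X ^^ (Suc k - i)) g x)
      = f x * (D X ^^ Suc k) g x + (\<Sum>i\<le>k. of_nat (k choose Suc i) * (D X ^^ Suc i) f x * (D X ^^ (k - i)) g x)"
  proof -
    have "(\<Sum>i\<le>k. of_nat (k choose i) * (D X ^^ i) f x * (D X ^^ (Suc k - i)) g x)
      = (\<Sum>i\<le>Suc k. of_nat (k choose i) * (D X ^^ i) f x * (D X ^^ (Suc k - i)) g x)"
      by (simp add: binomial_eq_0)
    then show ?thesis by (simp only: sum.atMost_Suc_shift) (simp del: funpow.simps(2))
  qed
  also have "(\<Sum>i\<le>k. of_nat (k choose i) * (D X ^^ Suc i) f x * (D X ^^ (k - i)) g x)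
      + (f x * (D X ^^ Suc k) g x + (\<Sum>i\<le>k. of_nat (k choose Suc i) * (D X ^^ Suc i) f x * (D X ^^ (k - i)) g x))
      = f x * (D X ^^ Suc k) g x + (\<Sum>i\<le>k. of_nat (Suc k choose Suc i) * (D X ^^ Suc i) f x * (D X ^^ (k - i)) g x)"
    by (simp add: sum.distrib distrib_right del: funpow.simps(2))
  also have "\<dots> = (\<Sum>i\<le>Suc k. of_nat (Suc k choose i) * (D X ^^ i) f x * (D X ^^ (Suc k - i)) g x)"
    by (simp only: sum.atMost_Suc_shift) (simp del: funpow.simps(2))
  finally show ?case .
qed simp

lemma exp_value_mult:
  assumes X: "X \<in> \<g>" and f: "f \<in> \<O>" and g: "g \<in> \<O>"
  shows "exp_value X (f * g) t = exp_value X f t * exp_value X g t"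
proof -
  note XL = lie_linear[OF X]
  have "coef X (f * g) k * t ^ k = (\<Sum>i\<le>k. (coef X f i * t ^ i) * (coef X g (k - i) * t ^ (k - i)))" for k
    unfolding coef_def Dpow_mult[OF X f g] sum_divide_distrib sum_distrib_right
    by (rule sum.cong) (auto simp: binomial_fact field_simps power_add[symmetric])
  then show ?thesis
    unfolding exp_value_def Cauchy_product[OF coef_summable[OF f XL] coef_summable[OF g XL]] by simp
qed

lemma exp_value_add:
  assumes X: "X \<in> linear_functionals" and f: "f \<in> \<O>" and g: "g \<in> \<O>"
  shows "exp_value X (f + g) t = exp_value X f t + exp_value X g t"
proof -
  have "coef X (f + g) k * t ^ k = coef X f k * t ^ k + coef X g k * t ^ k" for k
    unfolding coef_def Dpow_add[OF f g X] by (simp add: add_divide_distrib distrib_right)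
  then show ?thesis
    using sums_unique2[OF exp_value_sums[OF regular_add[OF f g] X, of t]
        sums_add[OF exp_value_sums[OF f X, of t] exp_value_sums[OF g X, of t], THEN sums_cong[THEN iffD1, rotated]]]
    by simp
qed

lemma exp_value_killed:
  assumes "D X f = 0" and X: "X \<in> linear_functionals"
  shows "exp_value X f t = f \<one>\<^bsub>G\<^esub>"
proof -
  have "coef X f k * t ^ k = (if k = 0 then f \<one>\<^bsub>G\<^esub> else 0)" for k
  proof (cases k)
    case (Suc l)
    then have "(D X ^^ k) f = 0" using assms Dpow_0[OF X, of l] by (simp only: funpow_Suc_right comp_apply)
    then show ?thesis using Suc unfolding coef_def by simp
  qed (simp add: coef_def)
  then show ?thesis
    unfolding exp_value_def using sums_unique[OF sums_single[of 0 "\<lambda>_. f \<one>\<^bsub>G\<^esub>"]] by simp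
qed

lemma D_const:
  assumes X: "X \<in> \<g>"
  shows "D X (zero_outside (carrier G) (\<lambda>x. 1)) = 0"
proof -
  let ?e = "zero_outside (carrier G) (\<lambda>x. 1 :: complex)"
  note XL = lie_linear[OF X]
  have e: "?e \<in> \<O>" using regular_const[of 1] by simp
  have mult: "?e * f = f" if "f \<in> \<O>" for f
    using regular_eq_0[OF that] by (auto simp: zero_outside_def fun_eq_iff)
  have "D X ?e = D X ?e * ?e + ?e * D X ?e" using D_mult[OF e e X] mult[OF e] by simp
  also have "\<dots> = D X ?e + D X ?e" using mult[OF D_regular[OF e XL]] by (simp add: mult.commute)
  finally show ?thesis by (metis add_cancel_left_right)
qed

text \<open>The series respects sums and products, the latter by the Leibniz rule and the Cauchy
  product. It is thus a ring homomorphism on the coordinate ring, and such a homomorphism is a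
  point.\<close>

lemma exp_point_exists:
  assumes X: "X \<in> \<g>"
  shows "\<exists>x \<in> carrier G. \<forall>f \<in> \<O>. exp_value X f t = f x"
proof (rule point_exists)
  show "exp_value X (zero_outside (carrier G) (\<lambda>x. 1)) t = 1"
    unfolding exp_value_killed[OF D_const[OF X] lie_linear[OF X]] by (simp add: zero_outside_def)
qed (use exp_value_add[OF lie_linear[OF X]] exp_value_mult[OF X] in auto)

definition exp_point :: "'g lie \<Rightarrow> complex \<Rightarrow> 'g" where
  "exp_point X t = (SOME x. x \<in> carrier G \<and> (\<forall>f \<in> \<O>. exp_value X f t = f x))"

lemma exp_point:
  assumes X: "X \<in> \<g>"
  shows "exp_point X t \<in> carrier G" and "f \<in> \<O> \<Longrightarrow> f (exp_point X t) = exp_value X f t"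
proof -
  have "\<exists>x. x \<in> carrier G \<and> (\<forall>f \<in> \<O>. exp_value X f t = f x)" using exp_point_exists[OF X] by blast
  from someI_ex[OF this] show "exp_point X t \<in> carrier G" "f \<in> \<O> \<Longrightarrow> f (exp_point X t) = exp_value X f t"
    unfolding exp_point_def by auto
qed

text \<open>The law \<open>exp ((s + t) X) = exp (s X) exp (t X)\<close> on coordinates:
  \<open>Dpow_eq\<close> splits the derivatives of order \<open>j + l\<close> over the presentation,
  and the binomial expansion becomes a Cauchy product.\<close>

lemma exp_value_plus:
  assumes f: "f \<in> \<O>" and X: "X \<in> linear_functionals" and p: "presents f I u v"
  shows "exp_value X f (s + t) = (\<Sum>i\<in>I. exp_value X (u i) s * exp_value X (v i) t)"
proof -
  have v: "v i \<in> \<O>" and u: "u i \<in> \<O>" if "i \<in> I" for i using p that unfolding presents_def by blast+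
  have add: "(D X ^^ (j + l)) f \<one>\<^bsub>G\<^esub> = (\<Sum>i\<in>I. (D X ^^ j) (u i) \<one>\<^bsub>G\<^esub> * (D X ^^ l) (v i) \<one>\<^bsub>G\<^esub>)" for j l
  proof -
    have "(D X ^^ (j + l)) f = (\<Sum>i\<in>I. cscale (moment X (v i) l) ((D X ^^ j) (u i)))"
      unfolding funpow_add comp_apply Dpow_eq[OF f X p] by (rule Dpow_sum[OF X u])
    then show ?thesis
      using v by (simp add: sum_fun_apply cscale_def of_rat_moment[OF _ X] mult.commute)
  qed
  have k: "coef X f k * (s + t) ^ k =
      (\<Sum>i\<in>I. \<Sum>j\<le>k. (coef X (u i) j * s ^ j) * (coef X (v i) (k - j) * t ^ (k - j)))" for k
  proof -
    have "coef X f k * (s + t) ^ k = (\<Sum>j\<le>k. (D X ^^ (j + (k - j))) f \<one>\<^bsub>G\<^esub> * (s ^ j / fact j) * (t ^ (k - j) / fact (k - j)))"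
      unfolding coef_def binomial_ring sum_distrib_left
      by (rule sum.cong) (auto simp: binomial_fact field_simps)
    also have "\<dots> = (\<Sum>j\<le>k. \<Sum>i\<in>I. (coef X (u i) j * s ^ j) * (coef X (v i) (k - j) * t ^ (k - j)))"
      unfolding add coef_def sum_distrib_right by (intro sum.cong) (auto simp: field_simps)
    finally show ?thesis by (subst sum.swap)
  qed
  have "(\<lambda>k. \<Sum>i\<in>I. \<Sum>j\<le>k. (coef X (u i) j * s ^ j) * (coef X (v i) (k - j) * t ^ (k - j)))
      sums (\<Sum>i\<in>I. exp_value X (u i) s * exp_value X (v i) t)"
    unfolding exp_value_def by (intro sums_sum Cauchy_product_sums coef_summable u v X)
  then show ?thesis unfolding k[symmetric] using sums_unique2[OF exp_value_sums[OF f X]] by blast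
qed

lemma exp_point_pow:
  assumes X: "X \<in> \<g>" and f: "f \<in> \<O>"
  shows "f (exp_point X t [^]\<^bsub>G\<^esub> (j :: nat)) = exp_value X f (of_nat j * t)"
  using f
proof (induction j arbitrary: f)
  case 0
  have "exp_value X f 0 = f \<one>\<^bsub>G\<^esub>"
  proof -
    have "(\<lambda>k. coef X f k * 0 ^ k) = (\<lambda>k. if k = 0 then f \<one>\<^bsub>G\<^esub> else 0)"
      by (auto simp: coef_def fun_eq_iff)
    then show ?thesis
    unfolding exp_value_def using sums_unique[OF sums_single[of 0 "\<lambda>_. f \<one>\<^bsub>G\<^esub>"]] by simp
  qed
  then show ?case by simp
next
  case (Suc j)
  note XL = lie_linear[OF X] and x = exp_point(1)[OF X, of t]
  obtain n u v where p: "presents f {..<n :: nat} u v" using obtain_presents[OF Suc.prems] .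
  have uv: "u i \<in> \<O>" "v i \<in> \<O>" if "i < n" for i using p that unfolding presents_def by auto
  have "f (exp_point X t [^]\<^bsub>G\<^esub> Suc j) = (\<Sum>i<n. u i (exp_point X t [^]\<^bsub>G\<^esub> j) * v i (exp_point X t))"
    using p x unfolding presents_def by (simp add: nat_pow_closed)
  also have "\<dots> = (\<Sum>i<n. exp_value X (u i) (of_nat j * t) * exp_value X (v i) t)"
    by (rule sum.cong) (auto simp: Suc.IH uv exp_point(2)[OF X])
  also have "\<dots> = exp_value X f (of_nat j * t + t)" by (rule exp_value_plus[OF Suc.prems XL p, symmetric])
  finally show ?case by (simp add: distrib_right add.commute)
qed

text \<open>Comparison of coefficients: the relation holds for all \<open>t\<close>, so it is an
  identity of power series in \<open>t\<close>.\<close>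

lemma coef_zero:
  assumes f: "f \<in> \<O>" and X: "X \<in> linear_functionals"
    and zero: "\<And>t. (\<Sum>j\<in>J. c j * exp_value X f (of_nat j * t)) = 0" and "m > 0"
  shows "coef X f m * (\<Sum>j\<in>J. c j * of_nat j ^ m) = 0"
proof (rule ccontr)
  assume nz: "\<not> ?thesis"
  have sums: "(\<lambda>m. (coef X f m * (\<Sum>j\<in>J. c j * of_nat j ^ m)) * t ^ m) sums 0" for t
  proof -
    have "(\<lambda>m. \<Sum>j\<in>J. c j * (coef X f m * (of_nat j * t) ^ m)) sums (\<Sum>j\<in>J. c j * exp_value X f (of_nat j * t))"
      by (intro sums_sum sums_mult exp_value_sums f X)
    then show ?thesis unfolding zero
      by (simp add: power_mult_distrib sum_distrib_left sum_distrib_right mult_ac)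
  qed
  show False
  proof (rule powser_0_nonzero[of 1 "0 :: complex" "\<lambda>m. coef X f m * (\<Sum>j\<in>J. c j * of_nat j ^ m)" "\<lambda>_. 0" m])
    show "(\<lambda>n. (coef X f n * (\<Sum>j\<in>J. c j * of_nat j ^ n)) * (t - 0) ^ n) sums 0" for t
      using sums[of t] by simp
    show "coef X f m * (\<Sum>j\<in>J. c j * of_nat j ^ m) \<noteq> 0" by (rule nz)
    show False if "0 < s" "\<And>z. z \<in> cball (0 :: complex) s - {0} \<Longrightarrow> (0 :: complex) \<noteq> 0" for s
      using that(1) that(2)[of "of_real s"] by simp
  qed (use \<open>m > 0\<close> in simp_all)
qed

lemma exp_vanishing:
  assumes X: "X \<in> \<g>" and f: "f \<in> \<O>" and zero: "\<And>t. f (exp_point X t) = 0"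
  shows "X f = 0"
proof -
  have "coef X f 1 * (\<Sum>j\<in>{1}. 1 * of_nat j ^ 1) = 0"
    by (rule coef_zero[OF f lie_linear[OF X]]) (use zero exp_point(2)[OF X f] in auto)
  then show ?thesis unfolding coef_def using D_at_one[OF f lie_linear[OF X]] by simp
qed

lemma exp_value_holomorphic:
  assumes "f \<in> \<O>" "X \<in> linear_functionals"
  shows "exp_value X f holomorphic_on UNIV"
proof -
  have "exp_value X f holomorphic_on ball 0 r" for r
    by (rule power_series_holomorphic[where a = "coef X f"]) (use exp_value_sums[OF assms] in simp)
  then have "exp_value X f field_differentiable at z" for z
    using holomorphic_on_imp_differentiable_at[of "exp_value X f" "ball 0 (norm z + 1)" z] by simp
  then show ?thesis unfolding holomorphic_on_def by (simp add: field_differentiable_at_within)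
qed

text \<open>The exponents of unipotency of the points of a one-parameter subgroup are bounded on an
  uncountable set of parameters, hence, by analytic continuation, on all of it.\<close>

lemma unipotent_moment_zero:
  assumes X: "X \<in> \<g>" and f: "f \<in> \<O>"
    and unip: "\<And>t. \<exists>k>0. (\<Sum>j\<le>k. (- 1) ^ (k - j) * of_nat (k choose j) * f (exp_point X t [^]\<^bsub>G\<^esub> j)) = 0"
  shows "\<exists>K. \<forall>m\<ge>K. (D X ^^ m) f \<one>\<^bsub>G\<^esub> = 0"
proof -
  note XL = lie_linear[OF X]
  define F where "F k t = (\<Sum>j\<le>k. ((- 1) ^ (k - j) * of_nat (k choose j)) * exp_value X f (of_nat j * t))" for k :: nat and t
  have "\<exists>k>0. F k t = 0" for t using unip[of t] exp_point_pow[OF X f] unfolding F_def by simp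
  then have U: "of_real ` {0..1 :: real} = (\<Union>k\<in>{0<..}. {t \<in> of_real ` {0..1}. F k t = 0})" by auto
  have "uncountable (of_real ` {0..1 :: real} :: complex set)"
    using uncountable_closed_interval[of 0 "1 :: real"] by (simp add: countable_image_inj_eq inj_on_def)
  then have unc: "uncountable (\<Union>k\<in>{0<..}. {t \<in> of_real ` {0..1 :: real}. F k t = 0})" using U by simp
  have "\<exists>k. k > 0 \<and> infinite {t \<in> of_real ` {0..1 :: real}. F k t = 0}"
  proof (rule ccontr)
    assume no: "\<not> ?thesis"
    have "countable {t \<in> of_real ` {0..1 :: real}. F k t = 0}" if "k \<in> {0<..}" for k
    proof (rule countable_finite)
      have "k > 0" using that by simp
      then show "finite {t \<in> of_real ` {0..1 :: real}. F k t = 0}" using no by blast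
    qed
    then show False using unc countable_UN[of "{0<..}"] by blast
  qed
  then obtain k where k: "k > 0" "infinite {t \<in> of_real ` {0..1 :: real}. F k t = 0}" by blast
  have "compact (of_real ` {0..1 :: real} :: complex set)"
    by (intro compact_continuous_image continuous_intros compact_Icc)
  then obtain \<xi> where \<xi>: "\<xi> islimpt {t \<in> of_real ` {0..1 :: real}. F k t = 0}"
    using Heine_Borel_imp_Bolzano_Weierstrass[OF _ k(2)] by blast
  have hol: "F k holomorphic_on UNIV"
    unfolding F_def
    by (intro holomorphic_intros holomorphic_on_compose_gen[OF _ exp_value_holomorphic[OF f XL], unfolded comp_def]) auto
  have F0: "F k t = 0" for t
    by (rule analytic_continuation[OF hol _ _ _ _ \<xi>]) auto
  have "(D X ^^ m) f \<one>\<^bsub>G\<^esub> = 0" if "m \<ge> k" for m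
  proof -
    \<comment> \<open>The coefficients are those of a \<open>k\<close>-th finite difference, so the
      \<open>m\<close>-th Taylor coefficient gets multiplied by a number that is positive for
      \<open>m \<ge> k\<close>.\<close>
    have "coef X f m * (\<Sum>j\<le>k. ((- 1) ^ (k - j) * of_nat (k choose j)) * of_nat j ^ m) = 0"
      by (rule coef_zero[OF f XL]) (use F0 k that in \<open>auto simp: F_def\<close>)
    moreover have "(\<Sum>j\<le>k. ((- 1) ^ (k - j) * of_nat (k choose j)) * of_nat j ^ m) =
        (of_int (\<Sum>j\<le>k. (- 1) ^ (k - j) * int (k choose j) * int j ^ m) :: complex)"
      by simp
    moreover have "(of_int (\<Sum>j\<le>k. (- 1) ^ (k - j) * int (k choose j) * int j ^ m) :: complex) \<noteq> 0"
      using finite_difference_pos[OF k(1) that] by (simp only: of_int_eq_0_iff)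
    ultimately have "coef X f m = 0" by (metis mult_eq_0_iff)
    then show ?thesis unfolding coef_def by simp
  qed
  then show ?thesis by blast
qed

text \<open>Vanishing at the identity, applied to the finitely many right factors of a presentation
  of \<open>f\<close>, makes all coefficients in \<open>Dpow_eq\<close> vanish for one common
  exponent.\<close>

lemma D_locally_nilpotent:
  assumes X: "X \<in> linear_functionals" and zero: "\<And>f. f \<in> \<O> \<Longrightarrow> \<exists>K. \<forall>m\<ge>K. (D X ^^ m) f \<one>\<^bsub>G\<^esub> = 0"
    and f: "f \<in> \<O>"
  shows "\<exists>K. (D X ^^ K) f = 0"
proof -
  obtain n u v where p: "presents f {..<n :: nat} u v" using obtain_presents[OF f] .
  have v: "v i \<in> \<O>" if "i < n" for i using p that unfolding presents_def by auto
  have "\<forall>i. \<exists>K. i < n \<longrightarrow> (\<forall>m\<ge>K. (D X ^^ m) (v i) \<one>\<^bsub>G\<^esub> = 0)" using zero v by blast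
  then obtain K where K: "\<And>i m. i < n \<Longrightarrow> m \<ge> K i \<Longrightarrow> (D X ^^ m) (v i) \<one>\<^bsub>G\<^esub> = 0" by metis
  define L where "L = Max (insert 0 (K ` {..<n}))"
  have "moment X (v i) L = 0" if "i < n" for i
  proof -
    have "K i \<le> L" unfolding L_def using that by simp
    then have "of_rat (moment X (v i) L) = (0 :: complex)" using K that of_rat_moment[OF v X] by metis
    then show ?thesis by simp
  qed
  then have "(D X ^^ L) f = 0" unfolding Dpow_eq[OF f X p] by simp
  then show ?thesis by blast
qed

end

section \<open>Extensions of the symplectic group\<close>

lemma derivation_of_rat:
  fixes \<delta> :: "complex \<Rightarrow> complex"
  assumes add: "\<And>x y. \<delta> (x + y) = \<delta> x + \<delta> y" and mult: "\<And>x y. \<delta> (x * y) = x * \<delta> y + \<delta> x * y"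
  shows "\<delta> (of_rat q) = 0"
proof -
  have 0: "\<delta> 0 = 0" using add[of 0 0] by simp
  have 1: "\<delta> 1 = 0" using mult[of 1 1] by simp
  have minus: "\<delta> (- x) = - \<delta> x" for x using add[of x "- x"] 0 by (simp add: eq_neg_iff_add_eq_0 add.commute)
  have nat: "\<delta> (of_nat m) = 0" for m by (induction m) (auto simp: 0 1 add)
  have int: "\<delta> (of_int a) = 0" for a by (cases a rule: int_diff_cases) (simp add: diff_conv_add_uminus add minus nat del: add_uminus_conv_diff)
  obtain a b where q: "q = Rat.Fract a b" "b > 0" by (cases q) auto
  then have "of_rat q * (of_int b :: complex) = of_int a" by (simp add: of_rat_rat)
  then show ?thesis using mult[of "of_rat q" "of_int b"] int q by simp
qed

text \<open>\<open>v^T J v = 0\<close> because \<open>J\<close> is skew and the characteristic is 0,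
  whence \<open>E E = 0\<close>, and \<open>1 + t E\<close> is the exponential of the
  infinitesimally symplectic matrix \<open>t E\<close>.\<close>

lemma transvection:
  fixes J :: "'a::field_char_0 mat"
  assumes J: "J \<in> carrier_mat n n" "transpose_mat J = - J" and V: "V \<in> carrier_mat n 1"
  defines "E \<equiv> V * (transpose_mat V * J)"
  shows "E \<in> carrier_mat n n" and "E * E = 0\<^sub>m n n"
    and "transpose_mat (1\<^sub>m n + t \<cdot>\<^sub>m E) * J * (1\<^sub>m n + t \<cdot>\<^sub>m E) = J"
    and "(1\<^sub>m n + t \<cdot>\<^sub>m E) * (1\<^sub>m n - t \<cdot>\<^sub>m E) = 1\<^sub>m n"
proof -
  have Vt: "transpose_mat V \<in> carrier_mat 1 n" using V by simp
  have VJ: "transpose_mat V * J \<in> carrier_mat 1 n" using Vt J by simp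
  show E: "E \<in> carrier_mat n n" unfolding E_def using V VJ by simp
  have sp: "transpose_mat E * J = - (J * E)" using sp_mat_rank_one[OF J V] unfolding sp_mat_def E_def by blast
  define M where "M = transpose_mat V * J * V"
  have M: "M \<in> carrier_mat 1 1" unfolding M_def using V VJ by simp
  have "transpose_mat M = transpose_mat V * (transpose_mat J * V)"
    unfolding M_def using transpose_mult[OF VJ V] transpose_mult[OF Vt J(1)] by simp
  also have "\<dots> = - M" unfolding M_def using J V Vt by (simp add: assoc_mult_mat[of _ "Suc 0" n _ n _ "Suc 0"])
  finally have Mt: "transpose_mat M = - M" .
  have "M $$ (0, 0) = transpose_mat M $$ (0, 0)" using M by simp
  also have "\<dots> = - M $$ (0, 0)" unfolding Mt using M by simp
  finally have "M $$ (0, 0) = - M $$ (0, 0)" .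
  then have "M $$ (0, 0) = 0" by simp
  then have M0: "M = 0\<^sub>m 1 1" using M by (intro eq_matI) auto
  have "E * E = V * ((transpose_mat V * J) * (V * (transpose_mat V * J)))"
    unfolding E_def using V VJ by (intro assoc_mult_mat[of _ n 1 _ n _ n]) auto
  also have "(transpose_mat V * J) * (V * (transpose_mat V * J)) = M * (transpose_mat V * J)"
    unfolding M_def using V VJ by (intro assoc_mult_mat[symmetric, of _ 1 n _ 1 _ n]) auto
  also have "V * (M * (transpose_mat V * J)) = 0\<^sub>m n n"
    unfolding M0 using V VJ J by simp
  finally show EE: "E * E = 0\<^sub>m n n" .
  let ?g = "1\<^sub>m n + t \<cdot>\<^sub>m E"
  have tE: "t \<cdot>\<^sub>m E \<in> carrier_mat n n" using E by simp
  have Et: "transpose_mat E \<in> carrier_mat n n" using E by simp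
  have tr: "transpose_mat ?g = 1\<^sub>m n + t \<cdot>\<^sub>m transpose_mat E"
    using E by (intro eq_matI) auto
  have "transpose_mat ?g * J = 1\<^sub>m n * J + (t \<cdot>\<^sub>m transpose_mat E) * J"
    unfolding tr using Et J by (intro add_mult_distrib_mat[of _ n n]) auto
  also have "(t \<cdot>\<^sub>m transpose_mat E) * J = t \<cdot>\<^sub>m (transpose_mat E * J)"
    using Et J by (intro mult_smult_assoc_mat[of _ n n _ n]) auto
  also have "1\<^sub>m n * J + t \<cdot>\<^sub>m (transpose_mat E * J) = J - t \<cdot>\<^sub>m (J * E)"
    unfolding sp using E J by (intro eq_matI) (auto simp: algebra_simps)
  finally have L: "transpose_mat ?g * J = J - t \<cdot>\<^sub>m (J * E)" .
  have "transpose_mat ?g * J * ?g = (J - t \<cdot>\<^sub>m (J * E)) * 1\<^sub>m n + (J - t \<cdot>\<^sub>m (J * E)) * (t \<cdot>\<^sub>m E)"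
    unfolding L using J E tE by (intro mult_add_distrib_mat[of _ n n]) auto
  also have "(J - t \<cdot>\<^sub>m (J * E)) * (t \<cdot>\<^sub>m E) = J * (t \<cdot>\<^sub>m E) - (t \<cdot>\<^sub>m (J * E)) * (t \<cdot>\<^sub>m E)"
    using J E tE by (intro minus_mult_distrib_mat[of _ n n]) auto
  also have "(t \<cdot>\<^sub>m (J * E)) * (t \<cdot>\<^sub>m E) = t \<cdot>\<^sub>m (t \<cdot>\<^sub>m (J * (E * E)))"
    using J E by (simp add: assoc_mult_mat[of _ n n _ n _ n] mult_smult_assoc_mat[of _ n n _ n] mult_smult_distrib[of _ n n _ n])
  also have "J * (t \<cdot>\<^sub>m E) = t \<cdot>\<^sub>m (J * E)" using J E by (simp add: mult_smult_distrib[of _ n n _ n])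
  also have "(J - t \<cdot>\<^sub>m (J * E)) * 1\<^sub>m n + (t \<cdot>\<^sub>m (J * E) - t \<cdot>\<^sub>m (t \<cdot>\<^sub>m (J * (E * E)))) = J"
    unfolding EE using J E by (intro eq_matI) auto
  finally show "transpose_mat ?g * J * ?g = J" .
  have "?g * (1\<^sub>m n - t \<cdot>\<^sub>m E) = ?g * 1\<^sub>m n - ?g * (t \<cdot>\<^sub>m E)"
    using E by (intro mult_minus_distrib_mat[of _ n n]) auto
  also have "?g * (t \<cdot>\<^sub>m E) = 1\<^sub>m n * (t \<cdot>\<^sub>m E) + (t \<cdot>\<^sub>m E) * (t \<cdot>\<^sub>m E)"
    using E by (intro add_mult_distrib_mat[of _ n n]) auto
  also have "(t \<cdot>\<^sub>m E) * (t \<cdot>\<^sub>m E) = t \<cdot>\<^sub>m (t \<cdot>\<^sub>m (E * E))"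
    using E by (simp add: mult_smult_assoc_mat[of _ n n _ n] mult_smult_distrib[of _ n n _ n])
  also have "?g * 1\<^sub>m n - (1\<^sub>m n * (t \<cdot>\<^sub>m E) + t \<cdot>\<^sub>m (t \<cdot>\<^sub>m (E * E))) = 1\<^sub>m n"
    unfolding EE using E by (intro eq_matI) auto
  finally show "?g * (1\<^sub>m n - t \<cdot>\<^sub>m E) = 1\<^sub>m n" .
qed

lemma sum_pairs: "(\<Sum>p\<in>A \<times> B. f p) = (\<Sum>k\<in>A. \<Sum>l\<in>B. f (k, l))"
  by (simp add: sum.cartesian_product)

locale symplectic_extension = proalgebraic_group G
  for G :: "'g qgroup" +
  fixes \<pi> :: "'g \<Rightarrow> complex mat" and n :: nat and J :: "rat mat"
  assumes extension: "prounipotent_extension G (Sp n J) \<pi>"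
    and J: "J \<in> carrier_mat n n" "transpose_mat J = - J" "invertible_mat J"
begin

lemma proj_hom: "\<pi> \<in> proalgebraic_hom G (Sp n J)" and proj_surj: "\<pi> ` carrier G = Sp_carrier n J"
  and kernel_prounipotent: "prounipotent (closed_subgroup G (kernel G (Sp n J) \<pi>))"
  using extension unfolding prounipotent_extension_def by (auto simp: Sp_def)

lemma proj_Sp: "x \<in> carrier G \<Longrightarrow> \<pi> x \<in> Sp_carrier n J"
  using proj_surj by blast

lemma proj_carrier: "x \<in> carrier G \<Longrightarrow> \<pi> x \<in> carrier_mat n n"
  using proj_Sp unfolding Sp_carrier_def by blast

lemma proj_mult: "x \<in> carrier G \<Longrightarrow> y \<in> carrier G \<Longrightarrow> \<pi> (x \<otimes>\<^bsub>G\<^esub> y) = \<pi> x * \<pi> y"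
  using proj_hom unfolding proalgebraic_hom_def hom_def by (auto simp: Sp_def)

lemma J_inverse: obtains K where "K \<in> carrier_mat n n" "J * K = 1\<^sub>m n" "K * J = 1\<^sub>m n"
  using J unfolding invertible_mat_def inverts_mat_def
  by (metis carrier_matD carrier_matI index_mult_mat(2,3) index_one_mat(2,3))

text \<open>The image of the identity is idempotent, and it is invertible because it preserves the
  nondegenerate form \<open>J\<close>.\<close>

lemma proj_one: "\<pi> \<one>\<^bsub>G\<^esub> = 1\<^sub>m n"
proof -
  obtain K where K: "K \<in> carrier_mat n n" "K * J = 1\<^sub>m n" using J_inverse by blast
  let ?h = "map_mat of_rat :: rat mat \<Rightarrow> complex mat" and ?A = "\<pi> \<one>\<^bsub>G\<^esub>"
  have A: "?A \<in> carrier_mat n n" by (rule proj_carrier) simp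
  have sp: "transpose_mat ?A * ?h J * ?A = ?h J" using proj_Sp[of "\<one>\<^bsub>G\<^esub>"] unfolding Sp_carrier_def by simp
  have KJ: "?h K * ?h J = 1\<^sub>m n" 
    using of_rat_hom.mat_hom_mult[OF K(1) J(1), symmetric] K(2) by (simp add: of_rat_hom.mat_hom_one)
  let ?B = "?h K * (transpose_mat ?A * ?h J)"
  have B: "?B \<in> carrier_mat n n" using A J K by simp
  have BA: "?B * ?A = 1\<^sub>m n"
    using A J K sp KJ by (simp add: assoc_mult_mat[of _ n n _ n _ n])
  have "?A * ?A = ?A" using proj_mult[of "\<one>\<^bsub>G\<^esub>" "\<one>\<^bsub>G\<^esub>"] by simp
  then have "?B * ?A * ?A = ?B * ?A" using A B by (simp add: assoc_mult_mat[of _ n n _ n _ n])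
  then show ?thesis unfolding BA using A by simp
qed

definition \<xi> :: "nat \<Rightarrow> nat \<Rightarrow> 'g \<Rightarrow> complex" where
  "\<xi> i j = zero_outside (carrier G) (\<lambda>x. \<pi> x $$ (i, j))"

lemma coordinate_eq: "x \<in> carrier G \<Longrightarrow> \<xi> i j x = \<pi> x $$ (i, j)"
  unfolding \<xi>_def zero_outside_def by simp

lemma coordinate_regular:
  assumes "i < n" "j < n"
  shows "\<xi> i j \<in> \<O>"
proof -
  have "zero_outside (Sp_carrier n J) (\<lambda>A. A $$ (i, j)) \<in> regular (Sp n J)"
    unfolding Sp_def using matrix_polynomials.entry[OF assms] by simp
  then have "zero_outside (carrier G) (zero_outside (Sp_carrier n J) (\<lambda>A. A $$ (i, j)) \<circ> \<pi>) \<in> \<O>"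
    using proj_hom unfolding proalgebraic_hom_def by blast
  also have "zero_outside (carrier G) (zero_outside (Sp_carrier n J) (\<lambda>A. A $$ (i, j)) \<circ> \<pi>) = \<xi> i j"
    unfolding \<xi>_def zero_outside_def using proj_Sp by auto
  finally show ?thesis .
qed

lemma coordinate_at_one: "i < n \<Longrightarrow> j < n \<Longrightarrow> \<xi> i j \<one>\<^bsub>G\<^esub> = (if i = j then 1 else 0)"
  by (simp add: coordinate_eq proj_one)

lemma coordinate_presents:
  assumes "i < n" "j < n"
  shows "presents (\<xi> i j) {..<n} (\<xi> i) (\<lambda>k. \<xi> k j)"
  unfolding presents_def
proof (intro conjI ballI)
  fix x y assume xy: "x \<in> carrier G" "y \<in> carrier G"
  then show "\<xi> i j (x \<otimes>\<^bsub>G\<^esub> y) = (\<Sum>k<n. \<xi> i k x * \<xi> k j y)"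
    using proj_carrier[OF xy(1)] proj_carrier[OF xy(2)] assms
    by (simp add: coordinate_eq proj_mult scalar_prod_def lessThan_atLeast0)
qed (use assms coordinate_regular in auto)

text \<open>The differential of \<open>\<pi>\<close>.\<close>

definition lie_mat :: "'g lie \<Rightarrow> rat mat" where
  "lie_mat X = mat n n (\<lambda>(i, j). X (\<xi> i j))"

lemma lie_mat_carrier [simp]: "lie_mat X \<in> carrier_mat n n" "dim_row (lie_mat X) = n" "dim_col (lie_mat X) = n"
  unfolding lie_mat_def by simp_all

lemma lie_mat_index [simp]: "i < n \<Longrightarrow> j < n \<Longrightarrow> lie_mat X $$ (i, j) = X (\<xi> i j)"
  unfolding lie_mat_def by simp

lemma D_coordinate:
  assumes "i < n" "j < n" and X: "X \<in> \<g>"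
  shows "D X (\<xi> i j) = (\<Sum>k<n. cscale (X (\<xi> k j)) (\<xi> i k))"
  by (rule D_eq[OF coordinate_regular[OF assms(1,2)] lie_linear[OF X] coordinate_presents[OF assms(1,2)]])

lemma lie_apply_sum:
  assumes X: "X \<in> linear_functionals" and f: "\<And>i. i \<in> I \<Longrightarrow> f i \<in> \<O>"
  shows "X (\<Sum>i\<in>I. cscale (q i) (f i)) = (\<Sum>i\<in>I. q i * X (f i))"
proof -
  have "(of_rat (X (\<Sum>i\<in>I. cscale (q i) (f i))) :: complex) = (\<Sum>i\<in>I. of_rat (X (cscale (q i) (f i))))"
    by (rule additive_sum[OF additive_rat[OF X]]) (use f regular_scale in auto)
  also have "\<dots> = (\<Sum>i\<in>I. of_rat (q i * X (f i)))"
    by (rule sum.cong) (use additive_scale[OF additive_rat[OF X] f] in \<open>auto simp: of_rat_mult\<close>)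
  finally show ?thesis by (simp flip: of_rat_sum)
qed

lemma lie_mat_bracket:
  assumes X: "X \<in> \<g>" and Y: "Y \<in> \<g>"
  shows "lie_mat (bracket G X Y) = ad_mat (lie_mat X) (lie_mat Y)"
proof (rule eq_matI)
  fix i j assume "i < dim_row (ad_mat (lie_mat X) (lie_mat Y))" "j < dim_col (ad_mat (lie_mat X) (lie_mat Y))"
  then have ij: "i < n" "j < n" by (auto simp: ad_mat_def lie_mat_def)
  have "X (D Y (\<xi> i j)) = (\<Sum>k<n. X (\<xi> i k) * Y (\<xi> k j))" if "X \<in> \<g>" "Y \<in> \<g>" for X Y
    unfolding D_coordinate[OF ij that(2)]
    using lie_apply_sum[OF lie_linear[OF that(1)], of "{..<n}" "\<xi> i" "\<lambda>k. Y (\<xi> k j)"] ij coordinate_regular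
    by (simp add: mult.commute)
  then show "lie_mat (bracket G X Y) $$ (i, j) = ad_mat (lie_mat X) (lie_mat Y) $$ (i, j)"
    using ij X Y bracket_eq[OF coordinate_regular[OF ij] X Y]
    by (simp add: ad_mat_def scalar_prod_def lessThan_atLeast0)
qed (auto simp: ad_mat_def lie_mat_def)

lemma lie_const:
  assumes X: "X \<in> \<g>"
  shows "X (zero_outside (carrier G) (\<lambda>x. of_rat q)) = 0"
proof -
  let ?c = "zero_outside (carrier G) (\<lambda>x. 1)"
  have c: "?c \<in> \<O>" using regular_const[of 1] by simp
  have "of_rat (X ?c) = (0 :: complex)" using D_at_one[OF c lie_linear[OF X]] D_const[OF X] by simp
  then have "X (\<Sum>i\<in>{()}. cscale q ?c) = 0" using lie_apply_sum[OF lie_linear[OF X], of "{()}" "\<lambda>_. ?c" "\<lambda>_. q"] c by simp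
  moreover have "cscale q ?c = zero_outside (carrier G) (\<lambda>x. of_rat q)"
    by (auto simp: cscale_def zero_outside_def)
  ultimately show ?thesis by simp
qed

lemma lie_mult_rat:
  assumes X: "X \<in> \<g>" and "f \<in> \<O>" "g \<in> \<O>" and "f \<one>\<^bsub>G\<^esub> = of_rat a" "g \<one>\<^bsub>G\<^esub> = of_rat b"
  shows "X (f * g) = X f * b + a * X g"
proof -
  have "(of_rat (X (f * g)) :: complex) = of_rat (X f * b + a * X g)"
    using lie_mult[OF assms(1-3)] assms(4,5) by (simp add: of_rat_add of_rat_mult)
  then show ?thesis by simp
qed

text \<open>The entries of \<open>\<pi>^T J \<pi>\<close> are constant functions on the group, so
  \<open>X\<close> kills them. The Leibniz rule at the identity, where \<open>\<xi> i j\<close> is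
  the Kronecker symbol, turns this into the equation of the symplectic Lie algebra.\<close>

lemma lie_mat_sp:
  assumes X: "X \<in> \<g>"
  shows "lie_mat X \<in> sp_mat n J"
  unfolding sp_mat_def mem_Collect_eq
proof (intro conjI eq_matI lie_mat_carrier)
  fix i j assume "i < dim_row (- (J * lie_mat X))" "j < dim_col (- (J * lie_mat X))"
  then have ij: "i < n" "j < n" using J by (auto simp: lie_mat_def)
  let ?I = "{..<n} \<times> {..<n}" and ?f = "\<lambda>(k, l). \<xi> k i * \<xi> l j" and ?q = "\<lambda>(k, l). J $$ (k, l)"
  have f: "?f p \<in> \<O>" if "p \<in> ?I" for p using that ij coordinate_regular regular_mult by auto
  have "(\<Sum>p\<in>?I. cscale (?q p) (?f p)) = zero_outside (carrier G) (\<lambda>x. of_rat (J $$ (i, j)))"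
  proof (rule regular_eqI)
    show "(\<Sum>p\<in>?I. cscale (?q p) (?f p)) \<in> \<O>" using f regular_scale by (intro regular_sum) blast
    show "zero_outside (carrier G) (\<lambda>x. of_rat (J $$ (i, j))) \<in> \<O>" by (rule regular_const)
    fix x assume x: "x \<in> carrier G"
    have "transpose_mat (\<pi> x) * map_mat of_rat J * \<pi> x = map_mat of_rat J" and px: "\<pi> x \<in> carrier_mat n n"
      using proj_Sp[OF x] unfolding Sp_carrier_def by auto
    then have "transpose_mat (\<pi> x) * (map_mat of_rat J * \<pi> x) = map_mat of_rat J"
      using J by (simp add: assoc_mult_mat[of _ n n _ n _ n])
    then have "(transpose_mat (\<pi> x) * (map_mat of_rat J * \<pi> x)) $$ (i, j) = of_rat (J $$ (i, j))"
      using J ij by simp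
    then have "(\<Sum>k<n. \<pi> x $$ (k, i) * (\<Sum>l<n. of_rat (J $$ (k, l)) * \<pi> x $$ (l, j))) = of_rat (J $$ (i, j))"
      using px J ij by (simp add: scalar_prod_def lessThan_atLeast0)
    then show "(\<Sum>p\<in>?I. cscale (?q p) (?f p)) x = zero_outside (carrier G) (\<lambda>x. of_rat (J $$ (i, j))) x"
      using x by (simp add: sum_fun_apply zero_outside_def sum_pairs cscale_def
          coordinate_eq sum_distrib_left mult_ac)
  qed
  then have "0 = X (\<Sum>p\<in>?I. cscale (?q p) (?f p))" using lie_const[OF X] by simp
  also have "\<dots> = (\<Sum>p\<in>?I. ?q p * X (?f p))" using f by (intro lie_apply_sum lie_linear X) 
  also have "\<dots> = (\<Sum>k<n. \<Sum>l<n. J $$ (k, l) * (X (\<xi> k i) * (if l = j then 1 else 0) + (if k = i then 1 else 0) * X (\<xi> l j)))"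
    unfolding sum_pairs case_prod_conv
  proof (intro sum.cong refl)
    fix k l assume "k \<in> {..<n}" "l \<in> {..<n}"
    then have "X (\<xi> k i * \<xi> l j) = X (\<xi> k i) * (if l = j then 1 else 0) + (if k = i then 1 else 0) * X (\<xi> l j)"
      using ij coordinate_at_one coordinate_regular by (intro lie_mult_rat X) auto
    then show "J $$ (k, l) * X (\<xi> k i * \<xi> l j) = J $$ (k, l) * (X (\<xi> k i) * (if l = j then 1 else 0) + (if k = i then 1 else 0) * X (\<xi> l j))"
      by simp
  qed
  also have "\<dots> = (\<Sum>k<n. X (\<xi> k i) * J $$ (k, j)) + (\<Sum>l<n. J $$ (i, l) * X (\<xi> l j))"
  proof -
    have "(\<Sum>l<n. J $$ (k, l) * (X (\<xi> k i) * (if l = j then 1 else 0) + (if k = i then 1 else 0) * X (\<xi> l j)))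
        = X (\<xi> k i) * J $$ (k, j) + (if k = i then (\<Sum>l<n. J $$ (i, l) * X (\<xi> l j)) else 0)" for k
    proof -
      have "(\<Sum>l<n. J $$ (k, l) * (X (\<xi> k i) * (if l = j then 1 else 0) + (if k = i then 1 else 0) * X (\<xi> l j)))
        = (\<Sum>l<n. (if l = j then X (\<xi> k i) * J $$ (k, j) else 0) + (if k = i then J $$ (i, l) * X (\<xi> l j) else 0))"
        by (rule sum.cong) (auto simp: algebra_simps)
      also have "\<dots> = (\<Sum>l<n. if l = j then X (\<xi> k i) * J $$ (k, j) else 0) + (\<Sum>l<n. if k = i then J $$ (i, l) * X (\<xi> l j) else 0)"
        by (rule sum.distrib)
      also have "(\<Sum>l<n. if l = j then X (\<xi> k i) * J $$ (k, j) else 0) = X (\<xi> k i) * J $$ (k, j)"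
        using ij by simp
      also have "(\<Sum>l<n. if k = i then J $$ (i, l) * X (\<xi> l j) else 0) = (if k = i then (\<Sum>l<n. J $$ (i, l) * X (\<xi> l j)) else 0)"
        by simp
      finally show ?thesis .
    qed
    then show ?thesis using ij by (simp add: sum.distrib)
  qed
  finally show "(transpose_mat (lie_mat X) * J) $$ (i, j) = (- (J * lie_mat X)) $$ (i, j)"
    using ij J by (simp add: scalar_prod_def lessThan_atLeast0 eq_neg_iff_add_eq_0)
qed (use J in \<open>auto simp: lie_mat_def\<close>)

end

section \<open>Surjectivity onto the symplectic Lie algebra\<close>

context symplectic_extension
begin

text \<open>Let \<open>\<delta>\<close> be a derivation of the complex numbers with \<open>\<delta> t = 1\<close>, and \<open>x\<close> a point over the
  transvection \<open>1 + t v v\<^sup>T J\<close>. Applying \<open>\<delta>\<close> to the coordinates of \<open>x\<close> and translating back to the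
  identity gives a complex valued derivation over \<open>v v\<^sup>T J\<close>, which a rational functional makes
  rational.\<close>

lemma rank_one_lie: "\<exists>X \<in> \<g>. \<forall>i<n. \<forall>j<n. X (\<xi> i j) = v i * (\<Sum>r<n. v r * J $$ (r, j))"
proof -
  obtain \<delta> :: "complex \<Rightarrow> complex" and t where \<delta>: "\<delta> t = 1" "\<And>x y. \<delta> (x + y) = \<delta> x + \<delta> y" "\<And>x y. \<delta> (x * y) = x * \<delta> y + \<delta> x * y"
    using complex_derivation_exists by blast
  obtain l :: "complex \<Rightarrow> rat" where l: "l 1 = 1" "\<And>x y. l (x + y) = l x + l y" "\<And>q x. l (of_rat q * x) = q * l x"
    using rational_functional_exists[of 1] by force
  have \<delta>0: "\<delta> 0 = 0" using \<delta>(2)[of 0 0] by simp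
  have \<delta>sum: "\<delta> (sum f I) = (\<Sum>i\<in>I. \<delta> (f i))" for f :: "'i \<Rightarrow> complex" and I
    by (induction I rule: infinite_finite_induct) (auto simp: \<delta>0 \<delta>(2))
  define e where "e i j = v i * (\<Sum>r<n. v r * J $$ (r, j))" for i j
  let ?h = "map_mat of_rat :: rat mat \<Rightarrow> complex mat"
  define V where "V = mat n 1 (\<lambda>(i, _). of_rat (v i) :: complex)"
  define E where "E = V * (transpose_mat V * ?h J)"
  have V: "V \<in> carrier_mat n 1" unfolding V_def by simp
  have hJ: "?h J \<in> carrier_mat n n" "transpose_mat (?h J) = - ?h J"
  proof -
    show "?h J \<in> carrier_mat n n" using J by simp
    have skew: "J $$ (j, i) = - J $$ (i, j)" if "i < n" "j < n" for i j
    proof -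
      have "transpose_mat J $$ (i, j) = - J $$ (i, j)" unfolding J(2) using J(1) that by simp
      then show ?thesis using J(1) that by simp
    qed
    show "transpose_mat (?h J) = - ?h J"
    proof (rule eq_matI)
      fix i j assume "i < dim_row (- ?h J)" "j < dim_col (- ?h J)"
      then have ij: "i < n" "j < n" using J(1) by auto
      then show "transpose_mat (?h J) $$ (i, j) = (- ?h J) $$ (i, j)"
        using J(1) by (simp only: index_transpose_mat index_uminus_mat index_map_mat carrier_matD skew[OF ij] of_rat_minus)
    qed (use J(1) in auto)
  qed
  note tv = transvection[OF hJ V, folded E_def]
  have Eij: "E $$ (i, j) = of_rat (e i j)" if "i < n" "j < n" for i j
    using that J by (simp add: E_def V_def e_def scalar_prod_def lessThan_atLeast0 of_rat_mult of_rat_sum)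
  have "1\<^sub>m n + t \<cdot>\<^sub>m E \<in> Sp_carrier n J"
    unfolding Sp_carrier_def using tv(1) tv(3)[of t] by simp
  then obtain x where x: "x \<in> carrier G" "\<pi> x = 1\<^sub>m n + t \<cdot>\<^sub>m E"
    using proj_surj by (metis imageE)
  have invx: "\<pi> (inv\<^bsub>G\<^esub> x) = 1\<^sub>m n - t \<cdot>\<^sub>m E"
  proof -
    have ix: "\<pi> (inv\<^bsub>G\<^esub> x) \<in> carrier_mat n n" using x by (intro proj_carrier) simp
    have "\<pi> (inv\<^bsub>G\<^esub> x) * \<pi> x = 1\<^sub>m n" using proj_mult[of "inv\<^bsub>G\<^esub> x" x] x(1) proj_one by simp
    then have a: "\<pi> (inv\<^bsub>G\<^esub> x) * \<pi> x = 1\<^sub>m n" .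
    have R: "1\<^sub>m n - t \<cdot>\<^sub>m E \<in> carrier_mat n n" using tv(1) by auto
    have "\<pi> (inv\<^bsub>G\<^esub> x) * \<pi> x * (1\<^sub>m n - t \<cdot>\<^sub>m E) = \<pi> (inv\<^bsub>G\<^esub> x) * (\<pi> x * (1\<^sub>m n - t \<cdot>\<^sub>m E))"
      by (rule assoc_mult_mat[OF ix proj_carrier[OF x(1)] R])
    then have "\<pi> (inv\<^bsub>G\<^esub> x) * (\<pi> x * (1\<^sub>m n - t \<cdot>\<^sub>m E)) = 1\<^sub>m n - t \<cdot>\<^sub>m E"
      unfolding a left_mult_one_mat[OF R] by (rule sym)
    then show ?thesis unfolding x(2) tv(4)[of t] using ix by simp
  qed
  let ?A = "\<lambda>f :: 'g \<Rightarrow> complex. \<delta> (f x)" and ?B = "\<lambda>f :: 'g \<Rightarrow> complex. f (inv\<^bsub>G\<^esub> x)"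
  have A: "additive_on_regular ?A" unfolding additive_on_regular_def using \<delta>(2) by simp
  have B: "additive_on_regular ?B" by (rule additive_eval)
  \<comment> \<open>On the matrix coordinates \<open>Y\<close> is the logarithmic derivative:
    \<open>\<delta>\<close> applied to the entries of \<open>\<pi> x\<close>, times the inverse of
    \<open>\<pi> x\<close>.\<close>
  define Y where "Y = cconv ?A ?B"
  have Y: "Y f = (\<Sum>i\<in>I. \<delta> (u i x) * w i (inv\<^bsub>G\<^esub> x))" if "f \<in> \<O>" "presents f I u w"
    for f I and u w :: "'i \<Rightarrow> 'g \<Rightarrow> complex"
    unfolding Y_def by (rule cconv_eq[OF that(1) A B that(2)])
  have f1: "f \<one>\<^bsub>G\<^esub> = (\<Sum>i\<in>I. u i x * w i (inv\<^bsub>G\<^esub> x))" if "presents f I u w"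
    for f I and u w :: "'i \<Rightarrow> 'g \<Rightarrow> complex"
  proof -
    have "f (x \<otimes>\<^bsub>G\<^esub> inv\<^bsub>G\<^esub> x) = (\<Sum>i\<in>I. u i x * w i (inv\<^bsub>G\<^esub> x))"
      using that x(1) unfolding presents_def by blast
    then show ?thesis using x(1) by simp
  qed
  have Yadd: "Y (f + g) = Y f + Y g" if fg: "f \<in> \<O>" "g \<in> \<O>" for f g
  proof -
    obtain I u w where p: "presents f {..<I :: nat} u w" using obtain_presents[OF fg(1)] by blast
    obtain I' u' w' where q: "presents g {..<I' :: nat} u' w'" using obtain_presents[OF fg(2)] by blast
    show ?thesis unfolding Y[OF regular_add[OF fg] presents_add[OF p q]] Y[OF fg(1) p] Y[OF fg(2) q]
      by (simp add: sum.Plus)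
  qed
  have Ymult: "Y (f * g) = Y f * g \<one>\<^bsub>G\<^esub> + f \<one>\<^bsub>G\<^esub> * Y g" if fg: "f \<in> \<O>" "g \<in> \<O>" for f g
  proof -
    obtain I u w where p: "presents f {..<I :: nat} u w" using obtain_presents[OF fg(1)] by blast
    obtain I' u' w' where q: "presents g {..<I' :: nat} u' w'" using obtain_presents[OF fg(2)] by blast
    show ?thesis
      unfolding Y[OF regular_mult[OF fg] presents_mult[OF p q]] Y[OF fg(1) p] Y[OF fg(2) q] f1[OF p] f1[OF q] sum_pairs sum_product
        sum.distrib[symmetric]
      by (intro sum.cong refl) (simp add: \<delta>(3) algebra_simps)
  qed
  define X where "X f = (if f \<in> \<O> then l (Y f) else 0)" for f
  have Xg: "X \<in> \<g>"
  proof (rule lieI)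
    show "X f = 0" if "f \<notin> \<O>" for f using that by (simp add: X_def)
    show "X \<in> linear_functionals"
      unfolding linear_functionals_def mem_Collect_eq using Yadd regular_add by (intro ballI) (simp add: X_def l(2))
    fix f g assume fg: "f \<in> \<O>" "g \<in> \<O>"
    obtain a b where ab: "f \<one>\<^bsub>G\<^esub> = of_rat a" "g \<one>\<^bsub>G\<^esub> = of_rat b"
      using regular_at_one[OF fg(1)] regular_at_one[OF fg(2)] by (auto elim!: Rats_cases)
    have "Y (f * g) = of_rat b * Y f + of_rat a * Y g" unfolding Ymult[OF fg] ab by (simp add: mult.commute)
    then have "l (Y (f * g)) = b * l (Y f) + a * l (Y g)" by (simp add: l(2,3))
    then have "X (f * g) = b * X f + a * X g" using fg regular_mult[OF fg] by (simp add: X_def)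
    then show "of_rat (X (f * g)) = of_rat (X f) * g \<one>\<^bsub>G\<^esub> + f \<one>\<^bsub>G\<^esub> * of_rat (X g)"
      unfolding ab by (simp add: of_rat_add of_rat_mult mult.commute)
  qed
  moreover have "X (\<xi> i j) = e i j" if ij: "i < n" "j < n" for i j
  proof -
    \<comment> \<open>\<open>\<delta>\<close> kills rational numbers and
      \<open>\<delta> t = 1\<close>, so it sends \<open>1 + t E\<close> to \<open>E\<close>. As
      \<open>E E = 0\<close>, multiplication by the inverse \<open>1 - t E\<close> leaves
      \<open>E\<close> unchanged.\<close>
    have dx: "\<delta> (\<xi> i k x) = E $$ (i, k)" if "k < n" for k
    proof -
      have "\<xi> i k x = of_rat (if i = k then 1 else 0) + t * of_rat (e i k)"
        using x ij that tv(1) by (simp add: coordinate_eq Eij)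
      then show ?thesis
        using ij that by (simp add: \<delta> derivation_of_rat[OF \<delta>(2,3)] Eij)
    qed
    have "Y (\<xi> i j) = (\<Sum>k<n. \<delta> (\<xi> i k x) * \<xi> k j (inv\<^bsub>G\<^esub> x))"
      by (rule Y[OF coordinate_regular[OF ij] coordinate_presents[OF ij]])
    also have "\<dots> = (\<Sum>k<n. E $$ (i, k) * (1\<^sub>m n - t \<cdot>\<^sub>m E) $$ (k, j))"
      using x(1) by (intro sum.cong refl) (simp add: dx coordinate_eq[OF inv_closed] invx)
    also have "\<dots> = (E * (1\<^sub>m n - t \<cdot>\<^sub>m E)) $$ (i, j)"
      using ij tv(1) by (simp add: scalar_prod_def lessThan_atLeast0)
    also have "E * (1\<^sub>m n - t \<cdot>\<^sub>m E) = E * 1\<^sub>m n - E * (t \<cdot>\<^sub>m E)"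
      using tv(1) by (intro mult_minus_distrib_mat[of _ n n]) auto
    also have "E * (t \<cdot>\<^sub>m E) = t \<cdot>\<^sub>m (E * E)"
      using tv(1) by (intro mult_smult_distrib[of _ n n _ n]) auto
    also have "(E * 1\<^sub>m n - t \<cdot>\<^sub>m (E * E)) $$ (i, j) = of_rat (e i j)"
      unfolding tv(2) using tv(1) ij Eij by simp
    finally have "Y (\<xi> i j) = of_rat (e i j) * 1" by simp
    then have "l (Y (\<xi> i j)) = e i j * l 1" using l(3) by metis
    then show ?thesis using coordinate_regular[OF ij] l(1) by (simp add: X_def)
  qed
  ultimately show ?thesis unfolding e_def by (intro bexI[of _ X]) auto
qed

text \<open>Polarisation: the symmetric matrices are spanned by the matrices \<open>v v\<^sup>T\<close>.\<close>

lemma lie_mat_surj: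
  assumes S: "S \<in> sp_mat n J"
  shows "\<exists>X \<in> \<g>. lie_mat X = S"
proof -
  obtain K where K: "K \<in> carrier_mat n n" "J * K = 1\<^sub>m n" "K * J = 1\<^sub>m n" using J_inverse by blast
  have Sn: "S \<in> carrier_mat n n" and SJ: "transpose_mat S * J = - (J * S)" using S unfolding sp_mat_def by auto
  \<comment> \<open>For symplectic \<open>S\<close> the factor \<open>T\<close> in
    \<open>S = T J\<close> is symmetric, so it can be assembled from rank one matrices.\<close>
  define T where "T = S * K"
  have T: "T \<in> carrier_mat n n" unfolding T_def using Sn K by simp
  have TJ: "T * J = S" unfolding T_def using Sn K J by (simp add: assoc_mult_mat[of _ n n _ n _ n])
  have Tt: "transpose_mat T \<in> carrier_mat n n" using T by simp
  have "transpose_mat S = transpose_mat J * transpose_mat T" using transpose_mult[OF T J(1)] TJ by simp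
  then have "transpose_mat S * J = - (J * (transpose_mat T * J))"
    using J Tt by (simp add: assoc_mult_mat[of _ n n _ n _ n])
  then have "- (- (J * (transpose_mat T * J))) = - (- (J * S))" using SJ by simp
  then have "J * (transpose_mat T * J) = J * S" by (simp only: uminus_uminus_mat)
  then have "K * (J * (transpose_mat T * J)) = K * (J * S)" by (rule arg_cong)
  moreover have KJ: "K * (J * A) = A" if A: "A \<in> carrier_mat n n" for A
    unfolding assoc_mult_mat[OF K(1) J(1) A, symmetric] K(3) by (rule left_mult_one_mat[OF A])
  moreover have TtJ: "transpose_mat T * J \<in> carrier_mat n n" using Tt J by simp
  ultimately have "transpose_mat T * J = S" using Sn by metis
  then have "transpose_mat T * J * K = T" unfolding T_def by (rule arg_cong)
  moreover have "transpose_mat T * J * K = transpose_mat T"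
    unfolding assoc_mult_mat[OF Tt J(1) K(1)] K(2) by (rule right_mult_one_mat[OF Tt])
  ultimately have "transpose_mat T = T" by simp
  then have sym: "T $$ (j, i) = T $$ (i, j)" if "i < n" "j < n" for i j
    using that T index_transpose_mat(1)[of i T j] by simp
  have "\<exists>R. \<forall>v. R v \<in> \<g> \<and> (\<forall>i<n. \<forall>j<n. R v (\<xi> i j) = v i * (\<Sum>r<n. v r * J $$ (r, j)))"
    using rank_one_lie by (intro choice) blast
  then obtain R where R: "\<And>v. R v \<in> \<g>" "\<And>v i j. i < n \<Longrightarrow> j < n \<Longrightarrow> R v (\<xi> i j) = v i * (\<Sum>r<n. v r * J $$ (r, j))"
    by blast
  let ?b = "\<lambda>a i. if i = a then 1 else 0 :: rat"
  \<comment> \<open>The polarisation of \<open>R\<close> at two basis vectors; its matrix is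
    \<open>(E_ab + E_ba) J\<close> with elementary matrices \<open>E_ab\<close> and
    \<open>E_ba\<close>.\<close>
  define Q where "Q a b = R (\<lambda>i. ?b a i + ?b b i) - R (?b a) - R (?b b)" for a b
  have Q: "Q a b \<in> \<g>" for a b unfolding Q_def
    by (intro rat_functions.subspace_diff[OF lie_subspace] R)
  have Qij: "Q a b (\<xi> i j) = ?b a i * J $$ (b, j) + ?b b i * J $$ (a, j)" if "a < n" "b < n" "i < n" "j < n" for a b i j
  proof -
    have d: "(\<Sum>r<n. ?b a r * J $$ (r, j)) = J $$ (a, j)" if "a < n" for a
    proof -
      have "(\<Sum>r<n. ?b a r * J $$ (r, j)) = (\<Sum>r<n. if r = a then J $$ (r, j) else 0)" by (rule sum.cong) auto
      then show ?thesis using that by simp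
    qed
    have "(\<Sum>r<n. (?b a r + ?b b r) * J $$ (r, j)) = J $$ (a, j) + J $$ (b, j)"
      using d[OF that(1)] d[OF that(2)] by (simp only: distrib_right sum.distrib)
    then show ?thesis unfolding Q_def minus_apply R(2)[OF that(3,4)] d[OF that(1)] d[OF that(2)]
      by (simp only: distrib_left distrib_right)
  qed
  \<comment> \<open>The factor 1/2 compensates for \<open>Q a b\<close> and \<open>Q b a\<close>
    having the same matrix.\<close>
  define X where "X = (\<Sum>a<n. \<Sum>b<n. rscale (T $$ (a, b) / 2) (Q a b))"
  have "X \<in> \<g>" unfolding X_def
    by (intro rat_functions.subspace_sum[OF lie_subspace] rat_functions.subspace_scale[OF lie_subspace] Q)
  moreover have "lie_mat X = S"
  proof (rule eq_matI)
    fix i j assume "i < dim_row S" "j < dim_col S"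
    then have ij: "i < n" "j < n" using Sn by auto
    have "X (\<xi> i j) = (\<Sum>a<n. \<Sum>b<n. T $$ (a, b) / 2 * (?b a i * J $$ (b, j) + ?b b i * J $$ (a, j)))"
      unfolding X_def sum_fun_apply rscale_def
      using ij Qij by (intro sum.cong refl) simp
    also have "\<dots> = (\<Sum>a<n. \<Sum>b<n. if a = i then T $$ (i, b) / 2 * J $$ (b, j) else 0) + (\<Sum>a<n. \<Sum>b<n. if b = i then T $$ (a, i) / 2 * J $$ (a, j) else 0)"
      unfolding sum.distrib[symmetric] by (intro sum.cong refl) auto
    also have "(\<Sum>a<n. \<Sum>b<n. if a = i then T $$ (i, b) / 2 * J $$ (b, j) else 0) = (\<Sum>b<n. T $$ (i, b) / 2 * J $$ (b, j))"
      using ij by (subst sum.swap) simp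
    also have "(\<Sum>a<n. \<Sum>b<n. if b = i then T $$ (a, i) / 2 * J $$ (a, j) else 0) = (\<Sum>b<n. T $$ (i, b) / 2 * J $$ (b, j))"
      using ij by (simp add: sym)
    also have "(\<Sum>b<n. T $$ (i, b) / 2 * J $$ (b, j)) + (\<Sum>b<n. T $$ (i, b) / 2 * J $$ (b, j)) = (T * J) $$ (i, j)"
      using ij T J by (simp add: sum.distrib[symmetric] scalar_prod_def lessThan_atLeast0 field_simps)
    finally show "lie_mat X $$ (i, j) = S $$ (i, j)" using ij TJ by simp
  qed (use Sn in auto)
  ultimately show ?thesis by blast
qed

end

subsection \<open>The prounipotent radical\<close>

context proalgebraic_group
begin

lemma D_linear_in_lie:
  assumes f: "f \<in> \<O>" and X: "X \<in> linear_functionals" and Y: "Y \<in> linear_functionals"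
  shows "D (X + Y) f = D X f + D Y f" and "D (rscale q X) f = cscale q (D X f)"
proof -
  obtain I u v where p: "presents f {..<I :: nat} u v" using obtain_presents[OF f] by blast
  have "X + Y \<in> linear_functionals" "rscale q X \<in> linear_functionals"
    using X Y unfolding linear_functionals_def by (auto simp: rscale_def algebra_simps)
  note eqs = D_eq[OF f this(1) p] D_eq[OF f this(2) p] D_eq[OF f X p] D_eq[OF f Y p]
  have a: "(X + Y) (v i) = X (v i) + Y (v i)" for i by simp
  show "D (X + Y) f = D X f + D Y f"
    unfolding eqs a complex_functions.scale_left_distrib by (rule sum.distrib)
  show "D (rscale q X) f = cscale q (D X f)"
    unfolding eqs complex_functions.scale_sum_right by (simp add: rscale_def)
qed

text \<open>\<open>D X f\<close> sees \<open>X\<close> on finitely many functions only, which turns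
  approximation in \<open>lie_closure\<close> into equality.\<close>

lemma D_cong:
  assumes f: "f \<in> \<O>" and X: "X \<in> linear_functionals" and Y: "Y \<in> linear_functionals"
    and p: "presents f I u v" and eq: "\<And>i. i \<in> I \<Longrightarrow> X (v i) = Y (v i)"
  shows "D X f = D Y f"
  unfolding D_eq[OF f X p] D_eq[OF f Y p] using eq by (intro sum.cong) auto

lemma closed_subgroup_simps [simp]:
  "carrier (closed_subgroup G U) = U" "regular (closed_subgroup G U) = zero_outside U ` \<O>"
  "\<one>\<^bsub>closed_subgroup G U\<^esub> = \<one>\<^bsub>G\<^esub>" "mult (closed_subgroup G U) = mult G"
  by (auto simp: closed_subgroup_def)

lemma closed_subgroup_pow: "x [^]\<^bsub>closed_subgroup G U\<^esub> (k :: nat) = x [^]\<^bsub>G\<^esub> k"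
  unfolding nat_pow_def by simp

lemma zero_outside_ring:
  "zero_outside U (f + g) = zero_outside U f + zero_outside U (g :: 'g \<Rightarrow> complex)"
  "zero_outside U (f * g) = zero_outside U f * zero_outside U g"
  by (auto simp: zero_outside_def)

text \<open>The coordinate ring of the closed subgroup is the quotient of \<open>\<O>\<close> by the
  functions vanishing on \<open>U\<close>, so its derivations are the derivations of
  \<open>\<O>\<close> that kill these functions.\<close>

lemma lie_subalgebra_iff:
  assumes U: "U \<subseteq> carrier G" "\<one>\<^bsub>G\<^esub> \<in> U"
  shows "X \<in> lie_subalgebra G U \<longleftrightarrow> X \<in> \<g> \<and> (\<forall>f \<in> \<O>. (\<forall>x \<in> U. f x = 0) \<longrightarrow> X f = 0)"
proof
  let ?r = "\<lambda>f :: 'g \<Rightarrow> complex. zero_outside U f"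
  have r1: "?r f \<one>\<^bsub>G\<^esub> = f \<one>\<^bsub>G\<^esub>" for f using U by (simp add: zero_outside_def)
  have rr: "?r f \<in> regular (closed_subgroup G U)" if "f \<in> \<O>" for f using that by simp
  assume "X \<in> lie_subalgebra G U"
  then obtain Y where Y: "Y \<in> lie_algebra (closed_subgroup G U)"
    and X: "X = zero_outside \<O> (\<lambda>f. Y (?r f))"
    unfolding lie_subalgebra_def lie_differential_def by auto
  have Xf: "X f = Y (?r f)" if "f \<in> \<O>" for f using that unfolding X zero_outside_def by simp
  have Yadd: "Y (f + g) = Y f + Y g" and Ymult: "of_rat (Y (f * g)) = of_rat (Y f) * g \<one>\<^bsub>G\<^esub> + f \<one>\<^bsub>G\<^esub> * of_rat (Y g)"
    if "f \<in> ?r ` \<O>" "g \<in> ?r ` \<O>" for f g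
    using Y that unfolding lie_algebra_def by auto
  have "X \<in> \<g>"
  proof (rule lieI)
    show "X f = 0" if "f \<notin> \<O>" for f using that unfolding X zero_outside_def by simp
    show "X \<in> linear_functionals" unfolding linear_functionals_def mem_Collect_eq
    proof (intro ballI)
      fix f g assume fg: "f \<in> \<O>" "g \<in> \<O>"
      show "X (f + g) = X f + X g"
        unfolding Xf[OF regular_add[OF fg]] Xf[OF fg(1)] Xf[OF fg(2)] zero_outside_ring by (rule Yadd) (use fg in auto)
    qed
    fix f g assume fg: "f \<in> \<O>" "g \<in> \<O>"
    show "of_rat (X (f * g)) = of_rat (X f) * g \<one>\<^bsub>G\<^esub> + f \<one>\<^bsub>G\<^esub> * of_rat (X g)"
      unfolding Xf[OF regular_mult[OF fg]] Xf[OF fg(1)] Xf[OF fg(2)] zero_outside_ring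
      using Ymult[of "?r f" "?r g"] fg by (simp add: r1)
  qed
  moreover have "X f = 0" if f: "f \<in> \<O>" "\<forall>x \<in> U. f x = 0" for f
  proof -
    have "?r f = ?r 0" using f(2) by (auto simp: zero_outside_def)
    moreover have "?r 0 + ?r 0 = ?r 0" by (auto simp: zero_outside_def)
    ultimately have "Y (?r f) = Y (?r f) + Y (?r f)" using Yadd[of "?r 0" "?r 0"] regular_0 by auto
    then show ?thesis using Xf[OF f(1)] by simp
  qed
  ultimately show "X \<in> \<g> \<and> (\<forall>f \<in> \<O>. (\<forall>x \<in> U. f x = 0) \<longrightarrow> X f = 0)" by blast
next
  let ?r = "\<lambda>f :: 'g \<Rightarrow> complex. zero_outside U f"
  have r1: "?r f \<one>\<^bsub>G\<^esub> = f \<one>\<^bsub>G\<^esub>" for f using U by (simp add: zero_outside_def)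
  assume "X \<in> \<g> \<and> (\<forall>f \<in> \<O>. (\<forall>x \<in> U. f x = 0) \<longrightarrow> X f = 0)"
  then have X: "X \<in> \<g>" and van: "\<And>f. f \<in> \<O> \<Longrightarrow> (\<forall>x \<in> U. f x = 0) \<Longrightarrow> X f = 0" by auto
  have wd: "X f = X g" if "f \<in> \<O>" "g \<in> \<O>" "?r f = ?r g" for f g
  proof -
    have "f x = g x" if "x \<in> U" for x using that \<open>?r f = ?r g\<close> unfolding zero_outside_def by meson
    then have "X (f - g) = 0" using that(1,2) by (intro van regular_diff) auto
    then show ?thesis using linear_diff[OF lie_linear[OF X] that(1,2)] by simp
  qed
  define Y where "Y = zero_outside (?r ` \<O>) (\<lambda>h. X (SOME f. f \<in> \<O> \<and> ?r f = h))"
  have Yr: "Y (?r f) = X f" if f: "f \<in> \<O>" for f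
  proof -
    have "(SOME g. g \<in> \<O> \<and> ?r g = ?r f) \<in> \<O> \<and> ?r (SOME g. g \<in> \<O> \<and> ?r g = ?r f) = ?r f"
      by (rule someI[of _ f]) (use f in simp)
    then have "X (SOME g. g \<in> \<O> \<and> ?r g = ?r f) = X f" using f by (intro wd) auto
    then show ?thesis using f unfolding Y_def zero_outside_def[of "?r ` \<O>"] by auto
  qed
  have "Y \<in> lie_algebra (closed_subgroup G U)"
    unfolding lie_algebra_def mem_Collect_eq closed_subgroup_simps
  proof (intro conjI ballI)
    show "zero_outside (?r ` \<O>) Y = Y" unfolding Y_def zero_outside_def[of "?r ` \<O>"] by auto
    fix f g assume "f \<in> ?r ` \<O>" "g \<in> ?r ` \<O>"
    then obtain f' g' where fg: "f = ?r f'" "g = ?r g'" "f' \<in> \<O>" "g' \<in> \<O>" by auto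
    show "Y (f + g) = Y f + Y g"
      unfolding fg(1,2) zero_outside_ring[symmetric] Yr[OF regular_add[OF fg(3,4)]] Yr[OF fg(3)] Yr[OF fg(4)]
      by (rule linear_add[OF lie_linear[OF X] fg(3,4)])
    show "of_rat (Y (f * g)) = of_rat (Y f) * g \<one>\<^bsub>G\<^esub> + f \<one>\<^bsub>G\<^esub> * of_rat (Y g)"
      unfolding fg(1,2) zero_outside_ring[symmetric] Yr[OF regular_mult[OF fg(3,4)]] Yr[OF fg(3)] Yr[OF fg(4)] r1
      by (rule lie_mult[OF X fg(3,4)])
  qed
  moreover have "X = zero_outside \<O> (\<lambda>f. Y (?r f))"
    using Yr lie_outside[OF X] by (auto simp: zero_outside_def[of \<O>])
  ultimately show "X \<in> lie_subalgebra G U"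
    unfolding lie_subalgebra_def lie_differential_def by auto
qed

lemma unipotent_lie_nilpotent:
  assumes U: "subgroup U G" and unip: "\<And>x. x \<in> U \<Longrightarrow> unipotent_element (closed_subgroup G U) x"
    and X: "X \<in> \<g>" and exp: "\<And>t. exp_point X t \<in> U" and f: "f \<in> \<O>"
  shows "\<exists>K. (D X ^^ K) f = 0"
proof (rule D_locally_nilpotent[OF lie_linear[OF X] _ f])
  fix f assume f: "f \<in> \<O>"
  show "\<exists>K. \<forall>m\<ge>K. (D X ^^ m) f \<one>\<^bsub>G\<^esub> = 0"
  proof (rule unipotent_moment_zero[OF X f])
    fix t
    let ?x = "exp_point X t" and ?h = "zero_outside U f"
    let ?s = "\<lambda>k h. \<Sum>j\<le>k. (- 1) ^ (k - j) * of_nat (k choose j) * (h (?x [^]\<^bsub>G\<^esub> j) :: complex)"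
    have U1: "\<one>\<^bsub>G\<^esub> \<in> U" by (rule subgroup.one_closed[OF U])
    have pow: "?x [^]\<^bsub>G\<^esub> j \<in> U" for j :: nat
    proof (induction j)
      case (Suc j)
      then show ?case unfolding nat_pow_Suc by (rule subgroup.m_closed[OF U _ exp])
    qed (simp add: U1)
    have "\<exists>k. \<forall>y \<in> U. (\<Sum>j\<le>k. (- 1) ^ (k - j) * of_nat (k choose j) * ?h (y \<otimes>\<^bsub>G\<^esub> ?x [^]\<^bsub>G\<^esub> j)) = 0"
      using unip[OF exp[of t]] f unfolding unipotent_element_def closed_subgroup_simps closed_subgroup_pow by auto
    then obtain k where k: "\<And>y. y \<in> U \<Longrightarrow> (\<Sum>j\<le>k. (- 1) ^ (k - j) * of_nat (k choose j) * ?h (y \<otimes>\<^bsub>G\<^esub> ?x [^]\<^bsub>G\<^esub> j)) = 0"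
      by (elim exE) (rule that, blast)
    \<comment> \<open>With exponent 0 unipotency says that \<open>f\<close> vanishes on
      \<open>U\<close>, and then exponent 1 works as well. A positive exponent is what
      \<open>finite_difference_pos\<close> can handle.\<close>
    show "\<exists>k>0. ?s k f = 0"
    proof (cases k)
      case 0
      have "f y = 0" if y: "y \<in> U" for y
        using k[OF y] y subgroup.mem_carrier[OF U y] unfolding 0 by (simp add: zero_outside_def)
      then have "?s 1 f = 0" using pow by simp
      then show ?thesis by (intro exI[of _ 1] conjI) simp_all
    next
      case (Suc m)
      have "?s k f = (\<Sum>j\<le>k. (- 1) ^ (k - j) * of_nat (k choose j) * ?h (\<one>\<^bsub>G\<^esub> \<otimes>\<^bsub>G\<^esub> ?x [^]\<^bsub>G\<^esub> j))"
      proof (rule sum.cong[OF refl])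
        fix j :: nat
        have "\<one>\<^bsub>G\<^esub> \<otimes>\<^bsub>G\<^esub> ?x [^]\<^bsub>G\<^esub> j = ?x [^]\<^bsub>G\<^esub> j"
          by (rule l_one[OF nat_pow_closed[OF exp_point(1)[OF X]]])
        then show "(- 1) ^ (k - j) * of_nat (k choose j) * f (?x [^]\<^bsub>G\<^esub> j)
            = (- 1) ^ (k - j) * of_nat (k choose j) * ?h (\<one>\<^bsub>G\<^esub> \<otimes>\<^bsub>G\<^esub> ?x [^]\<^bsub>G\<^esub> j)"
          using pow[of j] by (simp add: zero_outside_def)
      qed
      also have "\<dots> = 0" by (rule k[OF U1])
      finally have "?s k f = 0" .
      then show ?thesis using Suc by (intro exI[of _ k] conjI) simp_all
    qed
  qed
qed

section \<open>Closure in the topology of pointwise convergence\<close>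

lemma lie_closure_subset: "lie_closure G A \<subseteq> \<g>"
  unfolding lie_closure_def by blast

lemma lie_closure_approx:
  assumes Z: "Z \<in> lie_closure G A" and F: "finite F" "F \<subseteq> \<O>"
  obtains Z' where "Z' \<in> A" "\<And>f. f \<in> F \<Longrightarrow> Z f = Z' f"
proof -
  have "\<forall>F. finite F \<and> F \<subseteq> \<O> \<longrightarrow> (\<exists>Y \<in> A. \<forall>f \<in> F. Z f = Y f)"
    using Z unfolding lie_closure_def by simp
  then have "\<exists>Y \<in> A. \<forall>f \<in> F. Z f = Y f" using F by simp
  then show ?thesis using that by auto
qed

lemma lie_closure_subspace:
  assumes A: "rat_functions.subspace A"
  shows "rat_functions.subspace (lie_closure G A)"
proof (rule rat_functions.subspaceI)
  show "0 \<in> lie_closure G A"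
    unfolding lie_closure_def mem_Collect_eq
    by (intro conjI rat_functions.subspace_0[OF lie_subspace] allI impI bexI[OF _ rat_functions.subspace_0[OF A]] ballI refl)
  show "x + y \<in> lie_closure G A" if xy: "x \<in> lie_closure G A" "y \<in> lie_closure G A" for x y
    unfolding lie_closure_def mem_Collect_eq
  proof (intro conjI allI impI)
    show "x + y \<in> \<g>" using xy lie_closure_subset by (intro rat_functions.subspace_add[OF lie_subspace]) auto
    fix F assume F: "finite F \<and> F \<subseteq> \<O>"
    obtain x' where x': "x' \<in> A" "\<And>f. f \<in> F \<Longrightarrow> x f = x' f" 
      by (rule lie_closure_approx[OF xy(1) conjunct1[OF F] conjunct2[OF F]]) blast
    obtain y' where y': "y' \<in> A" "\<And>f. f \<in> F \<Longrightarrow> y f = y' f" 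
      by (rule lie_closure_approx[OF xy(2) conjunct1[OF F] conjunct2[OF F]]) blast
    show "\<exists>Y\<in>A. \<forall>f\<in>F. (x + y) f = Y f"
      by (rule bexI[OF _ rat_functions.subspace_add[OF A x'(1) y'(1)]]) (simp add: x' y')
  qed
  show "rscale c x \<in> lie_closure G A" if x: "x \<in> lie_closure G A" for c x
    unfolding lie_closure_def mem_Collect_eq
  proof (intro conjI allI impI)
    show "rscale c x \<in> \<g>" using x lie_closure_subset by (intro rat_functions.subspace_scale[OF lie_subspace]) auto
    fix F assume F: "finite F \<and> F \<subseteq> \<O>"
    obtain x' where x': "x' \<in> A" "\<And>f. f \<in> F \<Longrightarrow> x f = x' f" 
      by (rule lie_closure_approx[OF x conjunct1[OF F] conjunct2[OF F]]) blast
    show "\<exists>Y\<in>A. \<forall>f\<in>F. (rscale c x) f = Y f"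
      by (rule bexI[OF _ rat_functions.subspace_scale[OF A x'(1), of c]]) (simp add: x' rscale_def)
  qed
qed

lemma lie_closure_D:
  assumes Z: "Z \<in> lie_closure G A" and A: "A \<subseteq> linear_functionals" and f: "f \<in> \<O>"
  shows "\<exists>Z' \<in> A. D Z f = D Z' f"
proof -
  obtain I u v where p: "presents f {..<I :: nat} u v" using obtain_presents[OF f] by blast
  have "v ` {..<I} \<subseteq> \<O>" using p unfolding presents_def by auto
  then obtain Z' where Z': "Z' \<in> A" "\<And>f. f \<in> v ` {..<I} \<Longrightarrow> Z f = Z' f"
    using lie_closure_approx[OF Z, of "v ` {..<I}"] by blast
  have "D Z f = D Z' f"
    by (rule D_cong[OF f lie_linear[OF subsetD[OF lie_closure_subset Z]] subsetD[OF A Z'(1)] p])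
      (use Z'(2) in simp)
  then show ?thesis using Z'(1) by blast
qed

lemma lie_closureI:
  assumes "Z \<in> \<g>" and "\<And>F. finite F \<Longrightarrow> F \<subseteq> \<O> \<Longrightarrow> \<exists>Y \<in> A. \<forall>f \<in> F. Z f = Y f"
  shows "Z \<in> lie_closure G A"
  using assms unfolding lie_closure_def by simp

lemma lie_closure_mono:
  assumes AB: "A \<subseteq> B"
  shows "lie_closure G A \<subseteq> lie_closure G B"
proof
  fix Z assume Z: "Z \<in> lie_closure G A"
  show "Z \<in> lie_closure G B"
  proof (rule lie_closureI)
    show "Z \<in> \<g>" using Z lie_closure_subset by blast
    fix F assume "finite F" "F \<subseteq> \<O>"
    then obtain Z' where "Z' \<in> A" "\<And>f. f \<in> F \<Longrightarrow> Z f = Z' f" using lie_closure_approx[OF Z] by metis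
    then show "\<exists>Y \<in> B. \<forall>f \<in> F. Z f = Y f" using AB by (intro bexI[of _ Z']) auto
  qed
qed

lemma lie_closure_extensive:
  assumes A: "A \<subseteq> \<g>"
  shows "A \<subseteq> lie_closure G A"
proof
  fix Z assume Z: "Z \<in> A"
  show "Z \<in> lie_closure G A"
    by (rule lie_closureI) (use Z A in auto)
qed

lemma bracket_add_right: "bracket G X (Y + Z) = bracket G X Y + bracket G X Z"
  and bracket_scale_right: "bracket G X (rscale q Y) = rscale q (bracket G X Y)"
  using bracket_linear_right unfolding Vector_Spaces.linear_iff by auto

lemma lie_closure_bracket:
  assumes X: "X \<in> \<g>" and Z: "Z \<in> lie_closure G A" and A: "A \<subseteq> \<g>" and AB: "\<And>Y. Y \<in> A \<Longrightarrow> bracket G X Y \<in> B"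
  shows "bracket G X Z \<in> lie_closure G B"
proof (rule lie_closureI)
  have Zg: "Z \<in> \<g>" using Z lie_closure_subset by blast
  then show "bracket G X Z \<in> \<g>" by (rule bracket_lie[OF X])
  fix F assume F: "finite F" "F \<subseteq> \<O>"
  have "\<exists>v. \<exists>I :: nat. \<exists>u. presents f {..<I} u v" if "f \<in> F" for f
    using obtain_presents[of f] that F by blast
  then obtain v where "\<And>f. f \<in> F \<Longrightarrow> \<exists>I :: nat. \<exists>u. presents f {..<I} u (v f)" by metis
  then obtain I :: "('g \<Rightarrow> complex) \<Rightarrow> nat" where "\<And>f. f \<in> F \<Longrightarrow> \<exists>u. presents f {..<I f} u (v f)" by metis
  then obtain u where p: "\<And>f. f \<in> F \<Longrightarrow> presents f {..<I f} (u f) (v f)" by metis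
  \<comment> \<open>The values of \<open>[X, Z]\<close> on \<open>F\<close> depend on
    \<open>Z\<close> through \<open>D Z f\<close>, that is through the right factors of a
    presentation, and through \<open>Z (D X f)\<close>. So approximation of \<open>Z\<close> on
    these finitely many functions suffices.\<close>
  let ?E = "(\<Union>f\<in>F. v f ` {..<I f}) \<union> D X ` F"
  have E: "finite ?E" "?E \<subseteq> \<O>"
    using F p D_regular[OF _ lie_linear[OF X]] unfolding presents_def by auto
  obtain Y where Y: "Y \<in> A" "\<And>f. f \<in> ?E \<Longrightarrow> Z f = Y f" by (rule lie_closure_approx[OF Z E]) blast
  have Yg: "Y \<in> \<g>" using Y(1) A by blast
  have "bracket G X Z f = bracket G X Y f" if f: "f \<in> F" for f
  proof -
    have fO: "f \<in> \<O>" using F f by blast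
    have "D Z f = D Y f"
      by (rule D_cong[OF fO lie_linear[OF Zg] lie_linear[OF Yg] p[OF f]], rule Y(2)) (use f in auto)
    moreover have "Z (D X f) = Y (D X f)" by (rule Y(2)) (use f in auto)
    ultimately show ?thesis unfolding bracket_eq[OF fO X Zg] bracket_eq[OF fO X Yg] by simp
  qed
  then show "\<exists>Y \<in> B. \<forall>f \<in> F. bracket G X Z f = Y f" using AB[OF Y(1)] by (intro bexI[of _ "bracket G X Y"]) auto
qed

lemma lie_closure_idem: "lie_closure G (lie_closure G A) = lie_closure G A"
proof
  show "lie_closure G A \<subseteq> lie_closure G (lie_closure G A)"
    by (rule lie_closure_extensive[OF lie_closure_subset])
  show "lie_closure G (lie_closure G A) \<subseteq> lie_closure G A"
  proof
    fix Z assume Z: "Z \<in> lie_closure G (lie_closure G A)"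
    show "Z \<in> lie_closure G A"
    proof (rule lie_closureI)
      show "Z \<in> \<g>" using Z lie_closure_subset by blast
      fix F assume F: "finite F" "F \<subseteq> \<O>"
      obtain Z' where Z': "Z' \<in> lie_closure G A" "\<And>f. f \<in> F \<Longrightarrow> Z f = Z' f"
        by (rule lie_closure_approx[OF Z F]) blast
      obtain Y where "Y \<in> A" "\<And>f. f \<in> F \<Longrightarrow> Z' f = Y f"
        by (rule lie_closure_approx[OF Z'(1) F]) blast
      then show "\<exists>Y \<in> A. \<forall>f \<in> F. Z f = Y f" using Z'(2) by (intro bexI[of _ Y]) auto
    qed
  qed
qed

end

section \<open>The kernel of the projection and its Lie algebra\<close>

context symplectic_extension
begin

definition \<U> :: "'g set" where "\<U> = kernel G (Sp n J) \<pi>"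

lemma kernel_iff: "x \<in> \<U> \<longleftrightarrow> x \<in> carrier G \<and> \<pi> x = 1\<^sub>m n"
  unfolding \<U>_def kernel_def Sp_def by simp

lemma kernel_subgroup: "subgroup \<U> G"
proof (rule subgroupI)
  show "\<U> \<subseteq> carrier G" using kernel_iff by blast
  have "\<one>\<^bsub>G\<^esub> \<in> \<U>" unfolding kernel_iff using proj_one by simp
  then show "\<U> \<noteq> {}" by blast
  show "inv\<^bsub>G\<^esub> x \<in> \<U>" if x: "x \<in> \<U>" for x
  proof -
    have xc: "x \<in> carrier G" "\<pi> x = 1\<^sub>m n" using x unfolding kernel_iff by auto
    have "\<pi> (inv\<^bsub>G\<^esub> x) * \<pi> x = 1\<^sub>m n" using proj_mult[of "inv\<^bsub>G\<^esub> x" x] xc(1) proj_one by simp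
    then show ?thesis unfolding kernel_iff using xc proj_carrier[of "inv\<^bsub>G\<^esub> x"] by simp
  qed
  show "x \<otimes>\<^bsub>G\<^esub> y \<in> \<U>" if "x \<in> \<U>" "y \<in> \<U>" for x y
    using that unfolding kernel_iff by (simp add: proj_mult)
qed

definition \<uu> :: "'g lie set" where "\<uu> = lie_subalgebra G \<U>"

lemma radical_iff_vanishing: "X \<in> \<uu> \<longleftrightarrow> X \<in> \<g> \<and> (\<forall>f \<in> \<O>. (\<forall>x \<in> \<U>. f x = 0) \<longrightarrow> X f = 0)"
  unfolding \<uu>_def
  by (rule lie_subalgebra_iff[OF subgroup.subset[OF kernel_subgroup] subgroup.one_closed[OF kernel_subgroup]])

lemma exp_point_in_kernel:
  assumes X: "X \<in> \<g>" and 0: "lie_mat X = 0\<^sub>m n n"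
  shows "exp_point X t \<in> \<U>"
proof -
  have z: "X (\<xi> i j) = 0" if "i < n" "j < n" for i j
    using lie_mat_index[OF that, of X] that unfolding 0 by simp
  have "\<xi> i j (exp_point X t) = (if i = j then 1 else 0)" if ij: "i < n" "j < n" for i j
  proof -
    have "D X (\<xi> i j) = 0"
      unfolding D_coordinate[OF ij X] using z ij(2) by (auto simp: fun_eq_iff sum_fun_apply cscale_def)
    then show ?thesis
      using exp_point(2)[OF X coordinate_regular[OF ij]] exp_value_killed[OF _ lie_linear[OF X]] coordinate_at_one[OF ij] by metis
  qed
  then have "\<pi> (exp_point X t) = 1\<^sub>m n"
    using proj_carrier[OF exp_point(1)[OF X]] coordinate_eq[OF exp_point(1)[OF X]] by (intro eq_matI) auto
  then show ?thesis unfolding kernel_iff using exp_point(1)[OF X] by blast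
qed

text \<open>If \<open>lie_mat X\<close> is 0, all points \<open>exp (t X)\<close> lie in the kernel,
  so a function vanishing there has derivative 0 along \<open>X\<close>. Conversely, the differences
  of the \<open>\<xi> i j\<close> and their values at the identity vanish on the kernel.\<close>

lemma radical_iff: "X \<in> \<uu> \<longleftrightarrow> X \<in> \<g> \<and> lie_mat X = 0\<^sub>m n n"
proof
  assume "X \<in> \<uu>"
  then have X: "X \<in> \<g>" and van: "\<And>f. f \<in> \<O> \<Longrightarrow> (\<And>x. x \<in> \<U> \<Longrightarrow> f x = 0) \<Longrightarrow> X f = 0"
    unfolding radical_iff_vanishing by auto
  have "X (\<xi> i j) = 0" if ij: "i < n" "j < n" for i j
  proof -
    let ?c = "zero_outside (carrier G) (\<lambda>x. of_rat (if i = j then 1 else 0))"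
    have c: "?c \<in> \<O>" by (rule regular_const)
    have "X (\<xi> i j - ?c) = 0"
    proof (rule van)
      show "\<xi> i j - ?c \<in> \<O>" by (rule regular_diff[OF coordinate_regular[OF ij] c])
      show "(\<xi> i j - ?c) x = 0" if "x \<in> \<U>" for x
        using that ij unfolding kernel_iff by (simp add: coordinate_eq zero_outside_def)
    qed
    then show ?thesis using linear_diff[OF lie_linear[OF X] coordinate_regular[OF ij] c] lie_const[OF X, of "if i = j then 1 else 0"] by simp
  qed
  then show "X \<in> \<g> \<and> lie_mat X = 0\<^sub>m n n" using X by (intro conjI eq_matI) auto
next
  assume X: "X \<in> \<g> \<and> lie_mat X = 0\<^sub>m n n"
  show "X \<in> \<uu>" unfolding radical_iff_vanishing
  proof (intro conjI ballI impI)
    show Xg: "X \<in> \<g>" using X by blast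
    fix f assume f: "f \<in> \<O>" "\<forall>x \<in> \<U>. f x = 0"
    show "X f = 0"
      by (rule exp_vanishing[OF Xg f(1)]) (use f(2) X exp_point_in_kernel in blast)
  qed
qed

lemma radical_nilpotent:
  assumes X: "X \<in> \<uu>" and f: "f \<in> \<O>"
  shows "\<exists>K. (D X ^^ K) f = 0"
proof (rule unipotent_lie_nilpotent[OF kernel_subgroup])
  show "unipotent_element (closed_subgroup G \<U>) x" if "x \<in> \<U>" for x
    using kernel_prounipotent that unfolding prounipotent_def \<U>_def by (simp add: closed_subgroup_def)
  show "X \<in> \<g>" using X radical_iff by blast
  show "exp_point X t \<in> \<U>" for t using X exp_point_in_kernel unfolding radical_iff by blast
qed (rule f)

end

context symplectic_extension
begin

lemma radical_subset: "\<uu> \<subseteq> \<g>"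
  using radical_iff by blast

lemma radical_linear: "X \<in> \<uu> \<Longrightarrow> X \<in> linear_functionals"
  using radical_subset lie_linear by blast

lemma radical_bracket:
  assumes "X \<in> \<g>" "Y \<in> \<uu>"
  shows "bracket G X Y \<in> \<uu>" and "bracket G Y X \<in> \<uu>"
  using assms bracket_lie lie_mat_bracket unfolding radical_iff
  by (auto simp: ad_mat_def)

lemma radical_subspace: "rat_functions.subspace \<uu>"
proof (rule rat_functions.subspaceI)
  show "0 \<in> \<uu>" unfolding radical_iff_vanishing using rat_functions.subspace_0[OF lie_subspace] by simp
  show "x + y \<in> \<uu>" if "x \<in> \<uu>" "y \<in> \<uu>" for x y
    using that rat_functions.subspace_add[OF lie_subspace] unfolding radical_iff_vanishing by simp
  show "rscale c x \<in> \<uu>" if "x \<in> \<uu>" for c x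
    using that rat_functions.subspace_scale[OF lie_subspace] unfolding radical_iff_vanishing by (simp add: rscale_def)
qed

lemma radical_closed: "lie_closure G \<uu> = \<uu>"
proof
  show "\<uu> \<subseteq> lie_closure G \<uu>" by (rule lie_closure_extensive[OF radical_subset])
  show "lie_closure G \<uu> \<subseteq> \<uu>"
  proof
    fix Z assume Z: "Z \<in> lie_closure G \<uu>"
    have "Z f = 0" if f: "f \<in> \<O>" "\<forall>x \<in> \<U>. f x = 0" for f
    proof -
      obtain Z' where "Z' \<in> \<uu>" "Z f = Z' f" using lie_closure_approx[OF Z, of "{f}"] f(1) by auto
      then show ?thesis using f unfolding radical_iff_vanishing by simp
    qed
    then show "Z \<in> \<uu>" unfolding radical_iff_vanishing using Z lie_closure_subset by blast
  qed
qed

section \<open>The lower central series and its convergence to 0\<close>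

abbreviation "\<L> \<equiv> lower_central G \<uu>"

lemma lower_central_subset: "\<L> m \<subseteq> \<uu>"
proof (induction m)
  case (Suc m)
  have "rat_functions.span {bracket G X Y | X Y. X \<in> \<uu> \<and> Y \<in> \<L> m} \<subseteq> \<uu>"
    using radical_bracket(1) radical_subset Suc by (intro rat_functions.span_minimal radical_subspace) blast
  then have "\<L> (Suc m) \<subseteq> lie_closure G \<uu>"
    unfolding lower_central.simps by (rule lie_closure_mono)
  then show ?case unfolding radical_closed .
qed simp

lemma lower_central_subspace: "rat_functions.subspace (\<L> m)"
proof (cases m)
  case 0
  then show ?thesis using radical_subspace by simp
next
  case (Suc k)
  then show ?thesis using lie_closure_subspace[OF rat_functions.subspace_span] by simp
qed

text \<open>The operators \<open>D X\<close> with \<open>X\<close> in \<open>\<uu>\<close> act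
  nilpotently on a finite-dimensional space containing \<open>f\<close>, so by Engel's theorem all
  sufficiently long products of them vanish there. On this space elements of \<open>\<L> m\<close>
  act as sums of such products, and the value at the identity recovers \<open>Z f\<close>.\<close>

lemma lower_central_kills:
  assumes f: "f \<in> \<O>"
  shows "\<exists>m. \<forall>Z \<in> \<L> m. Z f = 0"
proof -
  obtain I u v where p: "presents f {..<I :: nat} u v" using obtain_presents[OF f] by blast
  \<comment> \<open>a finite-dimensional space containing \<open>f\<close> and stable under all left invariant operators\<close>
  define V where "V = {g \<in> \<O>. \<exists>v. presents g {..<I} u v}"
  define L where "L = (\<lambda>X. zero_outside V (D X)) ` \<uu>"
  have VO: "g \<in> \<O>" if "g \<in> V" for g using that unfolding V_def by blast
  have DV: "D X g \<in> V" if X: "X \<in> \<uu>" and g: "g \<in> V" for X g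
  proof -
    obtain v where "presents g {..<I} u v" using g unfolding V_def by blast
    then show ?thesis unfolding V_def
      using D_regular[OF VO[OF g] radical_linear[OF X]] presents_D[OF VO[OF g] radical_linear[OF X]] by blast
  qed
  have zo: "zero_outside V h x = h x" if "x \<in> V" for h :: "('g \<Rightarrow> complex) \<Rightarrow> 'g \<Rightarrow> complex" and x
    using that unfolding zero_outside_def by simp
  have uO: "u i \<in> \<O>" if "i < I" for i using p that unfolding presents_def by blast
  have subV: "complex_functions.subspace V"
  proof (rule complex_functions.subspaceI)
    show "0 \<in> V" unfolding V_def using regular_0 uO by (auto simp: presents_def intro!: exI[of _ "\<lambda>_. 0"])
    show "x + y \<in> V" if xy: "x \<in> V" "y \<in> V" for x y
    proof -
      obtain v w where vw: "presents x {..<I} u v" "presents y {..<I} u w" using xy unfolding V_def by blast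
      have "presents (x + y) {..<I} u (\<lambda>i. v i + w i)"
        unfolding presents_def
      proof (intro conjI ballI)
        show "v i + w i \<in> \<O>" if "i \<in> {..<I}" for i using vw that regular_add unfolding presents_def by blast
        fix a b assume "a \<in> carrier G" "b \<in> carrier G"
        then have "x (a \<otimes>\<^bsub>G\<^esub> b) = (\<Sum>i<I. u i a * v i b)" "y (a \<otimes>\<^bsub>G\<^esub> b) = (\<Sum>i<I. u i a * w i b)"
          using vw unfolding presents_def by blast+
        then show "(x + y) (a \<otimes>\<^bsub>G\<^esub> b) = (\<Sum>i<I. u i a * (v i + w i) b)"
          by (simp add: distrib_left sum.distrib)
      qed (use uO in auto)
      then show ?thesis using regular_add[OF VO[OF xy(1)] VO[OF xy(2)]] unfolding V_def by blast
    qed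
    show "cscale c x \<in> V" if x: "x \<in> V" for c x
    proof -
      obtain v where v: "presents x {..<I} u v" using x unfolding V_def by blast
      have "presents (cscale c x) {..<I} u (\<lambda>i. cscale c (v i))"
        unfolding presents_def
      proof (intro conjI ballI)
        show "cscale c (v i) \<in> \<O>" if "i \<in> {..<I}" for i using v that regular_scale unfolding presents_def by blast
        fix a b assume "a \<in> carrier G" "b \<in> carrier G"
        then have "x (a \<otimes>\<^bsub>G\<^esub> b) = (\<Sum>i<I. u i a * v i b)" using v unfolding presents_def by blast
        then show "cscale c x (a \<otimes>\<^bsub>G\<^esub> b) = (\<Sum>i<I. u i a * cscale c (v i) b)"
          by (simp add: cscale_def sum_distrib_left mult_ac)
      qed (use uO in auto)
      then show ?thesis using regular_scale[OF VO[OF x]] unfolding V_def by blast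
    qed
  qed
  have V0: "0 \<in> V" by (rule complex_functions.subspace_0[OF subV])
  have V_span: "V \<subseteq> complex_functions.span (u ` {..<I})"
  proof
    fix g assume g: "g \<in> V"
    then obtain v where v: "presents g {..<I} u v" unfolding V_def by blast
    have "\<exists>q. v i \<one>\<^bsub>G\<^esub> = of_rat q" if "i < I" for i
      using v that regular_at_one unfolding presents_def by (metis Rats_cases lessThan_iff)
    then obtain q where q: "\<And>i. i < I \<Longrightarrow> v i \<one>\<^bsub>G\<^esub> = of_rat (q i)" by metis
    have geq: "g = (\<Sum>i<I. cscale (q i) (u i))"
    proof (rule regular_eqI)
      show "g \<in> \<O>" by (rule VO[OF g])
      show "(\<Sum>i<I. cscale (q i) (u i)) \<in> \<O>" using uO regular_scale by (intro regular_sum) auto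
      fix x assume x: "x \<in> carrier G"
      then have "g (x \<otimes>\<^bsub>G\<^esub> \<one>\<^bsub>G\<^esub>) = (\<Sum>i<I. u i x * v i \<one>\<^bsub>G\<^esub>)" using v one_closed unfolding presents_def by blast
      then show "g x = (\<Sum>i<I. cscale (q i) (u i)) x"
        using x by (simp add: q sum_fun_apply cscale_def mult.commute)
    qed
    show "g \<in> complex_functions.span (u ` {..<I})"
      unfolding geq by (intro complex_functions.span_sum complex_functions.span_scale complex_functions.span_base imageI)
  qed
  interpret E: nilpotent_operators cscale V "u ` {..<I}" L
  proof unfold_locales
    show "complex_functions.subspace V" by (rule subV)
    show "finite (u ` {..<I})" by simp
    show "V \<subseteq> complex_functions.span (u ` {..<I})" by (rule V_span)
    fix S assume "S \<in> L"
    then obtain X where X: "X \<in> \<uu>" "S = zero_outside V (D X)" unfolding L_def by blast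
    show "S x \<in> V" if "x \<in> V" for x unfolding X(2) zo[OF that] by (rule DV[OF X(1) that])
    show "S (x + y) = S x + S y" if "x \<in> V" "y \<in> V" for x y
      unfolding X(2) zo[OF that(1)] zo[OF that(2)] zo[OF complex_functions.subspace_add[OF subV that]]
      by (rule D_add[OF VO[OF that(1)] VO[OF that(2)] radical_linear[OF X(1)]])
    show "S (cscale c x) = cscale c (S x)" if "x \<in> V" for c x
      unfolding X(2) zo[OF that] zo[OF complex_functions.subspace_scale[OF subV that]]
      by (rule D_scale[OF VO[OF that] radical_linear[OF X(1)]])
    show "S x = 0" if "x \<notin> V" for x using that unfolding X(2) zero_outside_def by simp
    show "\<exists>p. (S ^^ p) x = 0" if x: "x \<in> V" for x
    proof -
      have "(S ^^ p) x = (D X ^^ p) x \<and> (D X ^^ p) x \<in> V" for p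
      proof (induction p)
        case (Suc p)
        then have "S ((S ^^ p) x) = D X ((D X ^^ p) x)" unfolding X(2) using zo by simp
        then show ?case using DV[OF X(1)] Suc by simp
      qed (simp add: x)
      then show ?thesis using radical_nilpotent[OF X(1) VO[OF x]] by simp
    qed
    fix T assume "T \<in> L"
    then obtain Y where Y: "Y \<in> \<uu>" "T = zero_outside V (D Y)" unfolding L_def by blast
    have XY: "X \<in> \<g>" "Y \<in> \<g>" using X Y radical_subset by auto
    have "comm S T = zero_outside V (D (bracket G X Y))"
    proof
      fix g
      show "comm S T g = zero_outside V (D (bracket G X Y)) g"
      proof (cases "g \<in> V")
        case True
        show ?thesis
          unfolding comm_def X(2) Y(2) zo[OF True] zo[OF DV[OF X(1) True]] zo[OF DV[OF Y(1) True]]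
          by (rule D_bracket[OF VO[OF True] XY, symmetric])
      next
        case False
        have "D X 0 = 0" "D Y 0 = 0"
          using Dpow_0[OF lie_linear[OF XY(1)], of 1] Dpow_0[OF lie_linear[OF XY(2)], of 1] by simp_all
        then show ?thesis using False V0 unfolding comm_def X(2) Y(2) by (simp add: zero_outside_def)
      qed
    qed
    then show "comm S T \<in> L" unfolding L_def using radical_bracket(1)[OF XY(1) Y(1)] by blast
  qed
  obtain m where m: "E.U L m \<subseteq> {0}" using E.engel by blast
  have UV: "E.U L b \<subseteq> V" for b
  proof (induction b)
    case (Suc b)
    have "E.act L (E.U L b) \<subseteq> V" by (rule E.act_least[OF subV]) (use Suc E.LV in blast)
    then show ?case by simp
  qed simp
  \<comment> \<open>\<open>\<L> k\<close> is the term of index \<open>k + 1\<close>, so its elements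
    lower the flag by \<open>k + 1\<close> steps and not by \<open>k\<close>.\<close>
  have "D Z g \<in> E.U L (Suc (k + b))" if "Z \<in> \<L> k" "g \<in> E.U L b" for Z g k b
    using that
  proof (induction k arbitrary: Z g b)
    case 0
    have gV: "g \<in> V" using UV 0 by blast
    have "zero_outside V (D Z) g \<in> E.act L (E.U L b)"
      using 0 by (intro E.actI) (auto simp: L_def)
    then show ?case using zo[OF gV] by simp
  next
    case (Suc k)
    have gV: "g \<in> V" using UV Suc.prems by blast
    define T where "T = E.U L (Suc (Suc k + b))"
    have T: "complex_functions.subspace T" unfolding T_def by (rule E.U_subspace)
    let ?R = "{Z \<in> \<g>. D Z g \<in> T}"
    have "rat_functions.span {bracket G X Y | X Y. X \<in> \<uu> \<and> Y \<in> \<L> k} \<subseteq> ?R"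
    proof (rule rat_functions.span_minimal)
      show "rat_functions.subspace ?R"
      proof (rule rat_functions.subspaceI)
        have "D 0 g = 0"
        proof -
          have 0: "0 \<in> linear_functionals" by (rule lie_linear[OF rat_functions.subspace_0[OF lie_subspace]])
          show ?thesis using D_linear_in_lie(2)[OF VO[OF gV] 0 0, where q = 0] by simp
        qed
        then show "0 \<in> ?R" using rat_functions.subspace_0[OF lie_subspace] complex_functions.subspace_0[OF T] by auto
        show "x + y \<in> ?R" if "x \<in> ?R" "y \<in> ?R" for x y
          using that D_linear_in_lie(1)[OF VO[OF gV] lie_linear lie_linear] rat_functions.subspace_add[OF lie_subspace]
            complex_functions.subspace_add[OF T] by auto
        show "rscale c x \<in> ?R" if "x \<in> ?R" for c x
          using that D_linear_in_lie(2)[OF VO[OF gV] lie_linear lie_linear] rat_functions.subspace_scale[OF lie_subspace]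
            complex_functions.subspace_scale[OF T] by auto
      qed
      show "{bracket G X Y | X Y. X \<in> \<uu> \<and> Y \<in> \<L> k} \<subseteq> ?R"
      proof clarify
        fix X Y assume X: "X \<in> \<uu>" and Y: "Y \<in> \<L> k"
        have Yu: "Y \<in> \<uu>" using lower_central_subset Y by blast
        have XY: "X \<in> \<g>" "Y \<in> \<g>" using X Yu radical_subset by auto
        have step: "D X h \<in> E.U L (Suc c)" if h: "h \<in> E.U L c" for h c
        proof -
          have hV: "h \<in> V" using UV h by blast
          have "zero_outside V (D X) h \<in> E.act L (E.U L c)"
            using h X by (intro E.actI) (auto simp: L_def)
          then show ?thesis using zo[OF hV] by simp
        qed
        have "D X (D Y g) \<in> E.U L (Suc (Suc (k + b)))" by (intro step Suc.IH[OF Y] Suc.prems)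
        moreover have "D Y (D X g) \<in> E.U L (Suc (k + Suc b))" by (intro Suc.IH[OF Y] step Suc.prems)
        ultimately have "D X (D Y g) - D Y (D X g) \<in> T"
          unfolding T_def add_Suc add_Suc_right by (rule complex_functions.subspace_diff[OF E.U_subspace])
        then show "bracket G X Y \<in> \<g> \<and> D (bracket G X Y) g \<in> T"
          unfolding D_bracket[OF VO[OF gV] XY] using bracket_lie[OF XY] by blast
      qed
    qed
    \<comment> \<open>On the single function \<open>g\<close> the operator of a limit agrees with
      that of an element of the span, by \<open>lie_closure_D\<close>.\<close>
    moreover obtain Z' where "Z' \<in> rat_functions.span {bracket G X Y | X Y. X \<in> \<uu> \<and> Y \<in> \<L> k}" "D Z g = D Z' g"
    proof -
      have "rat_functions.span {bracket G X Y | X Y. X \<in> \<uu> \<and> Y \<in> \<L> k} \<subseteq> linear_functionals"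
        using calculation lie_linear by blast
      then show ?thesis using lie_closure_D[OF _ _ VO[OF gV]] Suc.prems(1) that by auto
    qed
    ultimately have "D Z g \<in> T" by auto
    then show ?case unfolding T_def .
  qed
  moreover have "f \<in> E.U L 0" using f p unfolding V_def by auto
  ultimately have "D Z f \<in> E.U L (Suc m)" if "Z \<in> \<L> m" for Z using that by (metis add.right_neutral)
  moreover have "E.U L (Suc m) \<subseteq> {0}"
  proof -
    have "E.act L (E.U L m) \<subseteq> {0}"
      by (rule E.act_least[OF complex_functions.subspace_single_0]) (use m E.L_0 in auto)
    then show ?thesis by simp
  qed
  ultimately have "D Z f = 0" if "Z \<in> \<L> m" for Z using that by blast
  then have "Z f = 0" if Z: "Z \<in> \<L> m" for Z
    using D_at_one[OF f radical_linear, of Z] lower_central_subset Z by auto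
  then show ?thesis by blast
qed

end

subsection \<open>The weight filtration\<close>

context symplectic_extension
begin

lemma lower_central_lie: "X \<in> \<L> m \<Longrightarrow> X \<in> \<g>"
  using lower_central_subset radical_subset by blast

abbreviation "gens m \<equiv> {bracket G X Y | X Y. X \<in> \<uu> \<and> Y \<in> \<L> m}"

lemma gens_span_lie: "rat_functions.span (gens m) \<subseteq> \<g>"
proof (rule rat_functions.span_minimal[OF _ lie_subspace])
  show "gens m \<subseteq> \<g>"
  proof clarify
    fix X Y assume "X \<in> \<uu>" "Y \<in> \<L> m"
    then show "bracket G X Y \<in> \<g>" by (intro bracket_lie subsetD[OF radical_subset] lower_central_lie)
  qed
qed

lemma lower_central_bracketI:
  assumes "X \<in> \<uu>" and "Y \<in> \<L> m"
  shows "bracket G X Y \<in> \<L> (Suc m)"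
proof -
  have "bracket G X Y \<in> gens m" using assms by auto
  then show ?thesis
    unfolding lower_central.simps by (intro subsetD[OF lie_closure_extensive[OF gens_span_lie]] rat_functions.span_base)
qed

lemma lower_central_closed: "lie_closure G (\<L> m) = \<L> m"
  by (cases m) (simp_all add: radical_closed lie_closure_idem)

lemma lower_central_Suc: "\<L> (Suc m) \<subseteq> \<L> m"
proof (induction m)
  case 0
  then show ?case using lower_central_subset[of "Suc 0"] by (simp del: lower_central.simps(2))
next
  case (Suc m)
  then have "gens (Suc m) \<subseteq> gens m" by blast
  then show ?case
    unfolding lower_central.simps(2)[of _ _ "Suc m"] lower_central.simps(2)[of _ _ m]
    by (intro lie_closure_mono rat_functions.span_mono)
qed

lemma lower_central_antimono: "i \<le> j \<Longrightarrow> \<L> j \<subseteq> \<L> i"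
  by (rule lift_Suc_antimono_le[where f = \<L>]) (rule lower_central_Suc)

text \<open>\<open>\<L> (Suc m)\<close> is the closure of the span of brackets; as
  \<open>bracket G X\<close> is continuous and \<open>\<L> k\<close> a closed subspace, the brackets
  alone have to be tested.\<close>

lemma lower_central_step:
  assumes X: "X \<in> \<g>" and gens: "\<And>A B. A \<in> \<uu> \<Longrightarrow> B \<in> \<L> m \<Longrightarrow> bracket G X (bracket G A B) \<in> \<L> k"
    and Z: "Z \<in> \<L> (Suc m)"
  shows "bracket G X Z \<in> \<L> k"
proof -
  have "rat_functions.span (gens m) \<subseteq> {Y. bracket G X Y \<in> \<L> k}"
  proof (rule rat_functions.span_minimal)
    show "gens m \<subseteq> {Y. bracket G X Y \<in> \<L> k}" using gens by blast
    show "rat_functions.subspace {Y. bracket G X Y \<in> \<L> k}"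
    proof (rule rat_functions.subspaceI)
      have "bracket G X 0 = 0" using bracket_scale_right[of X 0 0] by simp
      then show "0 \<in> {Y. bracket G X Y \<in> \<L> k}"
        using rat_functions.subspace_0[OF lower_central_subspace] by simp
    qed (simp_all add: bracket_add_right bracket_scale_right
        rat_functions.subspace_add[OF lower_central_subspace] rat_functions.subspace_scale[OF lower_central_subspace])
  qed
  then have "bracket G X Z \<in> lie_closure G (\<L> k)"
    using Z gens_span_lie by (intro lie_closure_bracket[OF X, of Z "rat_functions.span (gens m)"]) auto
  then show ?thesis unfolding lower_central_closed .
qed

lemma lower_central_ideal: "X \<in> \<g> \<Longrightarrow> Y \<in> \<L> m \<Longrightarrow> bracket G X Y \<in> \<L> m"
proof (induction m arbitrary: Y)
  case 0
  then show ?case using radical_bracket(1) by simp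
next
  case (Suc m)
  show ?case
  proof (rule lower_central_step[OF Suc.prems(1) _ Suc.prems(2)])
    fix A B assume AB: "A \<in> \<uu>" "B \<in> \<L> m"
    have g: "A \<in> \<g>" "B \<in> \<g>" using AB radical_subset lower_central_lie by auto
    have "bracket G (bracket G X A) B \<in> \<L> (Suc m)"
      by (rule lower_central_bracketI[OF radical_bracket(1)[OF Suc.prems(1) AB(1)] AB(2)])
    moreover have "bracket G A (bracket G X B) \<in> \<L> (Suc m)"
      by (rule lower_central_bracketI[OF AB(1) Suc.IH[OF Suc.prems(1) AB(2)]])
    ultimately show "bracket G X (bracket G A B) \<in> \<L> (Suc m)"
      unfolding bracket_jacobi[OF Suc.prems(1) g] by (rule rat_functions.subspace_add[OF lower_central_subspace])
  qed
qed

lemma lower_central_neg: "- X \<in> \<L> m \<longleftrightarrow> X \<in> \<L> m"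
  using rat_functions.subspace_neg[OF lower_central_subspace, of X m] rat_functions.subspace_neg[OF lower_central_subspace, of "- X" m]
  by auto

text \<open>The indices \<open>i + 1\<close> and \<open>j + 1\<close> of the two terms add up to
  that of \<open>\<L> (Suc (i + j))\<close>. In the Jacobi identity for \<open>[Y, [A, B]]\<close>
  both summands are reached through the induction hypothesis for \<open>B\<close>, once against
  \<open>[Y, A]\<close> and once against \<open>Y\<close>.\<close>

lemma lower_central_bracket: "X \<in> \<L> i \<Longrightarrow> Y \<in> \<L> j \<Longrightarrow> bracket G X Y \<in> \<L> (Suc (i + j))"
proof (induction i arbitrary: X Y j)
  case 0
  then show ?case using lower_central_bracketI by simp
next
  case (Suc i)
  have Yg: "Y \<in> \<g>" by (rule lower_central_lie[OF Suc.prems(2)])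
  have "bracket G Y X \<in> \<L> (Suc (Suc i + j))"
  proof (rule lower_central_step[OF Yg _ Suc.prems(1)])
    fix A B assume AB: "A \<in> \<uu>" "B \<in> \<L> i"
    have g: "A \<in> \<g>" "B \<in> \<g>" using AB radical_subset lower_central_lie by auto
    have "bracket G A Y \<in> \<L> (Suc j)" by (rule lower_central_bracketI[OF AB(1) Suc.prems(2)])
    then have "bracket G Y A \<in> \<L> (Suc j)" unfolding bracket_skew[of Y A] lower_central_neg .
    then have "bracket G B (bracket G Y A) \<in> \<L> (Suc (i + Suc j))" by (rule Suc.IH[OF AB(2)])
    then have "bracket G (bracket G Y A) B \<in> \<L> (Suc (Suc i + j))"
      unfolding bracket_skew[of "bracket G Y A" B] lower_central_neg add_Suc add_Suc_right .
    moreover have "bracket G B Y \<in> \<L> (Suc (i + j))" by (rule Suc.IH[OF AB(2) Suc.prems(2)])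
    then have "bracket G Y B \<in> \<L> (Suc (i + j))" unfolding bracket_skew[of Y B] lower_central_neg .
    then have "bracket G A (bracket G Y B) \<in> \<L> (Suc (Suc i + j))"
      unfolding add_Suc by (rule lower_central_bracketI[OF AB(1)])
    ultimately show "bracket G Y (bracket G A B) \<in> \<L> (Suc (Suc i + j))"
      unfolding bracket_jacobi[OF Yg g] by (rule rat_functions.subspace_add[OF lower_central_subspace])
  qed
  then show ?case unfolding bracket_skew[of X Y] lower_central_neg .
qed

abbreviation "\<W> \<equiv> weight_filtration G \<pi> (Sp n J)"

lemma weight_nonneg: "i \<ge> 0 \<Longrightarrow> \<W> i = \<g>"
  and weight_neg: "i < 0 \<Longrightarrow> \<W> i = \<L> (nat (- i - 1))"
  unfolding weight_filtration_def \<uu>_def \<U>_def by simp_all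

lemma weight_subspace: "rat_functions.subspace (\<W> i)"
  by (cases "i \<ge> 0") (simp_all add: weight_nonneg weight_neg lie_subspace lower_central_subspace)

lemma weight_lie: "\<W> i \<subseteq> \<g>"
proof (cases "i \<ge> 0")
  case False
  then show ?thesis using lower_central_lie weight_neg[of i] by auto
qed (simp add: weight_nonneg)

lemma weight_mono: "i \<le> j \<Longrightarrow> \<W> i \<subseteq> \<W> j"
proof (cases "j \<ge> 0")
  case True
  then show ?thesis using weight_lie weight_nonneg[of j] by simp
next
  case False
  assume "i \<le> j"
  then have "\<L> (nat (- i - 1)) \<subseteq> \<L> (nat (- j - 1))" by (intro lower_central_antimono) simp
  then show ?thesis using False \<open>i \<le> j\<close> weight_neg[of i] weight_neg[of j] by simp
qed

lemma weight_ideal: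
  assumes X: "X \<in> \<g>" and Y: "Y \<in> \<W> i"
  shows "bracket G X Y \<in> \<W> i"
proof (cases "i \<ge> 0")
  case True
  then show ?thesis using X Y bracket_lie weight_nonneg[of i] by simp
next
  case False
  then show ?thesis using lower_central_ideal[OF X] Y weight_neg[of i] by simp
qed

lemma weight_bracket:
  assumes X: "X \<in> \<W> i" and Y: "Y \<in> \<W> j"
  shows "bracket G X Y \<in> \<W> (i + j)"
proof -
  have g: "X \<in> \<g>" "Y \<in> \<g>" using X Y weight_lie by auto
  consider "i \<ge> 0" | "j \<ge> 0" | "i < 0" "j < 0" by linarith
  then show ?thesis
  proof cases
    case 1
    then show ?thesis using weight_ideal[OF g(1) Y] weight_mono[of j "i + j"] by auto
  next
    case 2
    have "bracket G Y X \<in> \<W> (i + j)" using weight_ideal[OF g(2) X] weight_mono[of i "i + j"] 2 by auto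
    then show ?thesis using rat_functions.subspace_neg[OF weight_subspace] bracket_skew[of X Y] by simp
  next
    case 3
    then have "Suc (nat (- i - 1) + nat (- j - 1)) = nat (- (i + j) - 1)" by simp
    then show ?thesis
      using lower_central_bracket[of X "nat (- i - 1)" Y "nat (- j - 1)"] X Y 3
        weight_neg[of i] weight_neg[of j] weight_neg[of "i + j"] by simp
  qed
qed

text \<open>A finite set of functions defines a neighbourhood of 0 in the inverse limit topology; by
  \<open>lower_central_kills\<close> every such neighbourhood contains a term of the weight
  filtration.\<close>

lemma weight_kills:
  assumes "finite F" "F \<subseteq> \<O>"
  shows "\<exists>l. \<forall>Z \<in> \<W> l. \<forall>f \<in> F. Z f = 0"
  using assms
proof (induction F rule: finite_induct)
  case (insert f F)
  then obtain l where l: "\<And>Z f. Z \<in> \<W> l \<Longrightarrow> f \<in> F \<Longrightarrow> Z f = 0" by auto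
  obtain m where m: "\<And>Z. Z \<in> \<L> m \<Longrightarrow> Z f = 0" using lower_central_kills[of f] insert.prems by auto
  have Wm: "\<W> (- int m - 1) = \<L> m" using weight_neg[of "- int m - 1"] by simp
  have "\<forall>Z \<in> \<W> (min l (- int m - 1)). \<forall>h \<in> insert f F. Z h = 0"
  proof (intro ballI)
    fix Z h assume Z: "Z \<in> \<W> (min l (- int m - 1))" and h: "h \<in> insert f F"
    have "Z \<in> \<W> l" "Z \<in> \<L> m" 
      using subsetD[OF weight_mono[OF min.cobounded1] Z] subsetD[OF weight_mono[OF min.cobounded2] Z] unfolding Wm by auto
    then show "Z h = 0" using l m h by auto
  qed
  then show ?case by blast
qed auto

end

subsection \<open>The normalizer\<close>

context symplectic_extension
begin

lemma lie_mat_diff: "lie_mat (X - Y) = lie_mat X - lie_mat Y"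
  by (intro eq_matI) auto

lemma radical_operator_nilpotent:
  assumes N: "N \<in> \<g>" and rel: "relative_weight_filtration \<g> \<W> (bracket G N) M"
  shows "\<exists>s. \<forall>X \<in> \<g>. (bracket G N ^^ s) X \<in> \<uu>"
proof -
  let ?F = "gr_filtration \<W> M 0"
  have W: "\<W> 0 = \<g>" "\<W> (- 1) = \<uu>" by (simp_all add: weight_nonneg weight_neg)
  have "mono M" and NM: "\<And>k. bracket G N ` M k \<subseteq> M (k - 2)"
    using rel unfolding relative_weight_filtration_def by auto
  obtain a b where a: "?F a = \<uu>" and b: "?F b = \<g>"
    using rel W unfolding relative_weight_filtration_def Let_def by (metis diff_0)
  have step: "bracket G N x \<in> ?F (k - 2)" if x: "x \<in> ?F k" for x k
  proof -
    obtain y z where yz: "x = y + z" "y \<in> M k" "y \<in> \<g>" "z \<in> \<uu>"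
      using x W unfolding gr_filtration_def by auto
    have "bracket G N y \<in> M (k - 2) \<inter> \<W> 0" "bracket G N z \<in> \<W> (0 - 1)"
      using NM[of k] yz(2) bracket_lie[OF N yz(3)] radical_bracket(1)[OF N yz(4)] W by auto
    then show ?thesis unfolding gr_filtration_def yz(1) bracket_add_right by blast
  qed
  have "(bracket G N ^^ s) x \<in> ?F (b - 2 * int s)" if "x \<in> \<g>" for x s
    using that
  proof (induction s)
    case (Suc s)
    have eq: "b - 2 * int (Suc s) = b - 2 * int s - 2" by simp
    show ?case unfolding funpow.simps(2) o_apply eq by (rule step[OF Suc.IH[OF Suc.prems]])
  qed (use b in simp)
  moreover have "?F i \<subseteq> ?F j" if "i \<le> j" for i j
    using monoD[OF \<open>mono M\<close> that] unfolding gr_filtration_def by blast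
  \<comment> \<open>The index \<open>b - 2 s\<close> with \<open>s = nat (b - a)\<close> is at most
    \<open>a\<close>, whichever of \<open>a\<close> and \<open>b\<close> is larger.\<close>
  then have "?F (b - 2 * int (nat (b - a))) \<subseteq> \<uu>" unfolding a[symmetric] by simp
  ultimately show ?thesis by blast
qed

text \<open>\<open>lie_mat\<close> respects brackets and maps onto the symplectic matrices with
  kernel \<open>\<uu>\<close>. So nilpotency modulo \<open>\<uu>\<close> descends to matrices, and
  the solution found there by \<open>sp_nilpotent_ad\<close> lifts.\<close>

lemma sl2_element_exists:
  assumes N: "N \<in> \<g>" and nil: "\<forall>X \<in> \<g>. (bracket G N ^^ s) X \<in> \<uu>"
  shows "\<exists>e \<in> \<g>. bracket G N (bracket G N e) - rscale 2 N \<in> \<uu>"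
proof -
  have pow: "(bracket G N ^^ k) X \<in> \<g> \<and> lie_mat ((bracket G N ^^ k) X) = (ad_mat (lie_mat N) ^^ k) (lie_mat X)"
    if "X \<in> \<g>" for X k
    by (induction k) (use that bracket_lie[OF N] lie_mat_bracket[OF N] in auto)
  have "\<exists>B \<in> sp_mat n J. ad_mat (lie_mat N) (ad_mat (lie_mat N) B) = lie_mat N"
  proof (rule sp_nilpotent_ad[OF lie_mat_sp[OF N] J])
    fix S assume "S \<in> sp_mat n J"
    then obtain X where X: "X \<in> \<g>" "lie_mat X = S" using lie_mat_surj by blast
    then show "(ad_mat (lie_mat N) ^^ s) S = 0\<^sub>m n n" using pow[OF X(1), of s] nil radical_iff by auto
  qed
  then obtain B where B: "B \<in> sp_mat n J" "ad_mat (lie_mat N) (ad_mat (lie_mat N) B) = lie_mat N" by blast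
  obtain e where e: "e \<in> \<g>" "lie_mat e = B" using lie_mat_surj[OF B(1)] by blast
  let ?d = "bracket G N (bracket G N e) - N"
  have NNe: "bracket G N (bracket G N e) \<in> \<g>" by (intro bracket_lie N e)
  have "lie_mat ?d = lie_mat N - lie_mat N"
    unfolding lie_mat_diff lie_mat_bracket[OF N bracket_lie[OF N e(1)]] lie_mat_bracket[OF N e(1)] e(2) B(2) ..
  then have "?d \<in> \<uu>"
    unfolding radical_iff using rat_functions.subspace_diff[OF lie_subspace NNe N] by simp
  then have "rscale 2 ?d \<in> \<uu>" by (rule rat_functions.subspace_scale[OF radical_subspace])
  \<comment> \<open>The matrix equation was solved with right hand side \<open>A\<close>; doubling
    the solution produces the factor 2 of the sl2-relations.\<close>
  moreover have "bracket G N (bracket G N (rscale 2 e)) - rscale 2 N = rscale 2 ?d"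
    unfolding bracket_scale_right by (rule rat_functions.scale_right_diff_distrib[symmetric])
  ultimately show ?thesis
    using rat_functions.subspace_scale[OF lie_subspace e(1), of 2] by (intro bexI[of _ "rscale 2 e"]) simp_all
qed

lemma relative_monodromy_filtration:
  assumes N: "N \<in> \<g>" and rel: "relative_weight_filtration \<g> \<W> (bracket G N) M"
  shows "monodromy_filtration rscale (bracket G N) (\<W> m) (\<W> (m - 1))
    (\<lambda>k. {x + y | x y. x \<in> M (m + k) \<inter> \<W> m \<and> y \<in> \<W> (m - 1)})"
proof -
  let ?F = "gr_filtration \<W> M m"
  have F: "(\<lambda>k. {x + y | x y. x \<in> M (m + k) \<inter> \<W> m \<and> y \<in> \<W> (m - 1)}) = (\<lambda>k. ?F (m + k))"
    unfolding gr_filtration_def ..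
  have subM: "\<And>k. rat_functions.subspace (M k)" and mono: "mono M" and NM: "\<And>k. bracket G N ` M k \<subseteq> M (k - 2)"
    and bot: "\<exists>k. ?F k = \<W> (m - 1)" and top: "\<exists>k. ?F k = \<W> m"
    and inj: "\<And>k :: nat. \<forall>x \<in> ?F (m + int k). (bracket G N ^^ k) x \<in> ?F (m - int k - 1) \<longrightarrow> x \<in> ?F (m + int k - 1)"
    and surj: "\<And>k :: nat. \<forall>y \<in> ?F (m - int k). \<exists>x \<in> ?F (m + int k). y - (bracket G N ^^ k) x \<in> ?F (m - int k - 1)"
    using rel unfolding relative_weight_filtration_def Let_def by blast+
  have shift: "\<exists>k. ?F (m + k) = S" if "\<exists>k. ?F k = S" for S
    using that by (metis add_diff_cancel_left' diff_add_cancel add.commute)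
  show ?thesis unfolding F
  proof unfold_locales
    show "bracket G N (x + y) = bracket G N x + bracket G N y" for x y by (rule bracket_add_right)
    show "bracket G N (rscale q x) = rscale q (bracket G N x)" for q x by (rule bracket_scale_right)
    show "rat_functions.subspace (\<W> m)" "rat_functions.subspace (\<W> (m - 1))" by (rule weight_subspace)+
    show "rat_functions.subspace (?F (m + k))" for k
      unfolding gr_filtration_def
      by (intro rat_functions.subspace_sums rat_functions.subspace_inter subM weight_subspace)
    have 0: "0 \<in> M (m + k) \<inter> \<W> m" for k
      using rat_functions.subspace_0[OF subM] rat_functions.subspace_0[OF weight_subspace] by blast
    show "\<W> (m - 1) \<subseteq> ?F (m + k)" for k
      unfolding gr_filtration_def using 0[of k] by force
    show "?F (m + k) \<subseteq> \<W> m" for k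
      unfolding gr_filtration_def
      using weight_mono[of "m - 1" m] rat_functions.subspace_add[OF weight_subspace] by auto
    show "?F (m + i) \<subseteq> ?F (m + j)" if "i \<le> j" for i j
      using monoD[OF mono, of "m + i" "m + j"] that unfolding gr_filtration_def by auto
    show "bracket G N x \<in> ?F (m + (k - 2))" if x: "x \<in> ?F (m + k)" for k x
    proof -
      obtain y z where yz: "x = y + z" "y \<in> M (m + k)" "y \<in> \<W> m" "z \<in> \<W> (m - 1)"
        using x unfolding gr_filtration_def by auto
      have "bracket G N y \<in> M (m + (k - 2))" using NM[of "m + k"] yz(2) by (auto simp: algebra_simps)
      then have "bracket G N y \<in> M (m + (k - 2)) \<inter> \<W> m" using weight_ideal[OF N yz(3)] by blast
      then show ?thesis unfolding gr_filtration_def yz(1) bracket_add_right using weight_ideal[OF N yz(4)] by blast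
    qed
    show "bracket G N x \<in> \<W> (m - 1)" if "x \<in> \<W> (m - 1)" for x by (rule weight_ideal[OF N that])
    show "bracket G N x \<in> \<W> m" if "x \<in> \<W> m" for x by (rule weight_ideal[OF N that])
    show "\<exists>k. ?F (m + k) = \<W> (m - 1)" by (rule shift[OF bot])
    show "\<exists>k. ?F (m + k) = \<W> m" by (rule shift[OF top])
    show "x \<in> ?F (m + (int k - 1))" if "x \<in> ?F (m + int k)" "(bracket G N ^^ k) x \<in> ?F (m + (- int k - 1))" for k x
    proof -
      have eqs: "m + (- int k - 1) = m - int k - 1" "m + (int k - 1) = m + int k - 1" by simp_all
      show ?thesis using inj[of k] that unfolding eqs by blast
    qed
    show "\<exists>x \<in> ?F (m + int k). y - (bracket G N ^^ k) x \<in> ?F (m + (- int k - 1))" if "y \<in> ?F (m + - int k)" for k y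
    proof -
      have eqs: "m + (- int k - 1) = m - int k - 1" "m + - int k = m - int k" by simp_all
      show ?thesis using surj[of k] that unfolding eqs by blast
    qed
  qed
qed

theorem normalizer_relative_weight_filtration:
  assumes N: "N \<in> \<g>" and pro: "pro_relative_weight_filtration G \<W> (bracket G N) M"
  shows "{X \<in> \<g>. \<forall>Y \<in> M 0. bracket G X Y \<in> M 0} = M 0"
proof -
  have rel: "relative_weight_filtration \<g> \<W> (bracket G N) M" and closed: "\<And>k. lie_closure G (M k) = M k"
    using pro unfolding pro_relative_weight_filtration_def by auto
  have subM: "\<And>k. rat_functions.subspace (M k)" and Mg: "\<And>k. M k \<subseteq> \<g>" and mono: "mono M"
    and NM: "\<And>k. bracket G N ` M k \<subseteq> M (k - 2)"
    using rel unfolding relative_weight_filtration_def by blast+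
  interpret filtered_lie rscale \<g> "bracket G" \<W> N M
  proof (intro filtered_lie.intro filtered_lie_axioms.intro rat_functions.vector_space_axioms)
    show "Vector_Spaces.linear rscale rscale (bracket G X)" for X by (rule bracket_linear_right)
    show "bracket G X Y = - bracket G Y X" for X Y by (rule bracket_skew)
    show "bracket G X (bracket G Y Z) = bracket G (bracket G X Y) Z + bracket G Y (bracket G X Z)"
      if "X \<in> \<g>" "Y \<in> \<g>" "Z \<in> \<g>" for X Y Z by (rule bracket_jacobi[OF that])
    show "rat_functions.subspace (\<W> i)" for i by (rule weight_subspace)
    show "\<W> i = \<g>" if "i \<ge> 0" for i by (rule weight_nonneg[OF that])
    show "\<W> i \<subseteq> \<W> j" if "i \<le> j" for i j by (rule weight_mono[OF that])
    show "bracket G x y \<in> \<W> (i + j)" if "x \<in> \<W> i" "y \<in> \<W> j" for i j x y by (rule weight_bracket[OF that])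
    show "N \<in> \<g>" by (rule N)
    show "rat_functions.subspace (M k)" "M k \<subseteq> \<g>" for k by (rule subM, rule Mg)
    show "M i \<subseteq> M j" if "i \<le> j" for i j by (rule monoD[OF mono that])
    show "bracket G N x \<in> M (k - 2)" if "x \<in> M k" for k x using NM that by blast
    show "monodromy_filtration rscale (bracket G N) (\<W> m) (\<W> (m - 1))
      (\<lambda>k. {x + y | x y. x \<in> M (m + k) \<inter> \<W> m \<and> y \<in> \<W> (m - 1)})" for m
      by (rule relative_monodromy_filtration[OF N rel])
  qed
  obtain s where "\<forall>X \<in> \<g>. (bracket G N ^^ s) X \<in> \<uu>" using radical_operator_nilpotent[OF N rel] by blast
  then obtain e where e: "e \<in> \<g>" "bracket G N (bracket G N e) - rscale 2 N \<in> \<uu>"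
    using sl2_element_exists[OF N] by blast
  show ?thesis
  proof (rule normalizer_M0[OF e(1)])
    show "bracket G N (bracket G N e) - rscale 2 N \<in> \<W> (- 1)" using e(2) by (simp add: weight_neg)
    fix x assume x: "x \<in> \<g>" "\<And>l. x \<in> MW 0 l"
    have "x \<in> lie_closure G (M 0)"
    proof (rule lie_closureI[OF x(1)])
      fix F assume "finite F" "F \<subseteq> \<O>"
      then have "\<exists>l. \<forall>Z \<in> \<W> l. \<forall>f \<in> F. Z f = 0" by (rule weight_kills)
      then obtain l where l: "\<forall>Z \<in> \<W> l. \<forall>f \<in> F. Z f = 0" by (rule exE)
      \<comment> \<open>With this \<open>l\<close> the component of \<open>x\<close> in
        \<open>W l\<close> is invisible to \<open>F\<close>, so \<open>y\<close> in
        \<open>M 0\<close> approximates \<open>x\<close> there.\<close>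
      obtain y z where yz: "x = y + z" "y \<in> M 0" "z \<in> \<W> l" using x(2)[of l] unfolding MW_def by auto
      have "x f = y f" if "f \<in> F" for f using l yz(1,3) that by simp
      then show "\<exists>Y \<in> M 0. \<forall>f \<in> F. x f = Y f" using yz(2) by (intro bexI[of _ y] ballI)
    qed
    then show "x \<in> M 0" unfolding closed .
  qed
qed

end

lemma open_cone_lie:
  assumes "proalgebraic G" and N: "N \<in> open_cone S P V G \<rho> \<gamma>"
  shows "N \<in> lie_algebra G"
proof -
  interpret proalgebraic_group G by unfold_locales (rule assms(1))
  obtain r N' where "N = (\<Sum>c\<in>\<gamma>. rscale (r c) (N' c))" "\<And>c. c \<in> \<gamma> \<Longrightarrow> \<exists>\<tau>. canonical_log G (\<rho> \<tau>) (N' c)"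
    using N unfolding open_cone_def by blast
  then show ?thesis
    unfolding canonical_log_def
    by (auto intro!: rat_functions.subspace_sum[OF lie_subspace] rat_functions.subspace_scale[OF lie_subspace])
qed

theorem proposition8p5:
  fixes S :: "'a surface" and P :: "'a set" and V :: "'a tangent set"
    and \<gamma> :: "'a set set"
    and n :: nat and \<kappa> :: "'a chain set \<Rightarrow> rat vec" and J :: "rat mat"
    and G :: "'g qgroup" and \<pi> :: "'g \<Rightarrow> complex mat" and \<rho> :: "('a \<Rightarrow> 'a) set \<Rightarrow> 'g"
    and N :: "'g lie" and M :: "int \<Rightarrow> 'g lie set"
  assumes "decorated_surface S P V" and "stable_decoration S P V" and "genus S \<ge> 3"
    and "curve_system S P V \<gamma>"
    and "homology_basis S n \<kappa> J"
    and "relative_completion S P V n \<kappa> J G \<pi> \<rho>"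
    and "N \<in> open_cone S P V G \<rho> \<gamma>"
    and "pro_relative_weight_filtration G (weight_filtration G \<pi> (Sp n J)) (bracket G N) M"
  shows "{X \<in> lie_algebra G. \<forall>Y \<in> M 0. bracket G X Y \<in> M 0} = M 0"
proof -
  have ext: "prounipotent_extension G (Sp n J) \<pi>"
    using assms(6) unfolding relative_completion_def lifting_def by blast
  have G: "proalgebraic G" using ext unfolding prounipotent_extension_def by blast
  interpret symplectic_extension G \<pi> n J
    by unfold_locales (use G ext assms(5) in \<open>auto simp: homology_basis_def intersection_matrix_def\<close>)
  show ?thesis
    by (rule normalizer_relative_weight_filtration[OF open_cone_lie[OF G assms(7)] assms(8)])
qed

end
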